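(* Let $R$ be a ring and let $A_\bullet^*,B_\bullet^*$ be simplicial differential graded $R$-algebras satisfying the following axioms, stated for $A_\bullet^*$: (a) (homology axiom) for each $p\ge0$ the natural morphism $R\to A_p^*$ is a homotopy equivalence of cochain complexes; (b) (homotopy axiom) for each $q\ge0$ the simplicial set $A_\bullet^q$ is simplicially contractible, i.e. its homotopy groups are zero; (c) (freeness axiom) $R$ is a principal ideal domain and for all $p,q$ the $R$-module $A_p^q$ is free. Then the contravariant monoidal functors $A^*,B^*:(\Delta^o\mathbf{Sets})^o\to\mathbf C^*(R)$ are weakly quasi-isomorphic in the category $\mathbf{Mon}((\Delta^o\mathbf{Sets})^o,\mathbf C^*(R))$. In particular, any such cohomology theory is weakly quasi-isomorphic to the singular cochain complex functor $S^*(\ ;R)$.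
   Context: $\Delta^o\mathbf{Sets}$ is the category of simplicial sets, monoidal under cartesian product. $\mathbf C^*(R)$ is the monoidal category of bounded below cochain complexes of $R$-modules with $\otimes_R$. A simplicial differential graded $R$-algebra $A_\bullet^*$ is a simplicial object in differential graded $R$-algebras (cochain algebras, graded in degrees $q\ge0$); $p$ is the simplicial degree and $q$ the differential degree. The associated cohomology theory is the contravariant functor $A^*(X)=\mathrm{Hom}_\Delta(X_\bullet,A_\bullet^* )$, the cochain complex which in degree $q$ is the set (an $R$-module) of simplicial maps $X_\bullet\to A_\bullet^q$. It is a contravariant monoidal functor via the algebra structure: $\kappa:A^*(X)\otimes A^*(Y)\to A^*(X\times Y)$ sends $\alpha\otimes\beta$ to $\mathrm{pr}_X^*(\alpha)\cdot\mathrm{pr}_Y^*(\beta)$. $\mathbf{Mon}((\Delta^o\mathbf{Sets})^o,\mathbf C^*(R))$ is the category of contravariant lax monoidal functors (with natural $\kappa_{X,Y}:F(X)\otimes F(Y)\to F(X\times Y)$ and unit $\eta:R\to F(\mathrm{pt})$ satisfying associativity and unit constraints) and monoidal natural transformations (compatible with $\kappa,\eta$). Two objects are weakly quasi-isomorphic if they are connected by a finite zigzag of morphisms of this category whose components at every simplicial set $X$ are quasi-isomorphisms. $S^*(X;R)$ is the cochain complex of the simplicial set $X$ with coefficients in $R$ ($S^q(X;R)$ is the module of functions $X_q\to R$), with the Alexander–Whitney product; it is the cohomology theory associated to the simplicial dg $R$-algebra whose component in simplicial degree $p$ is the cochain algebra $S^*(\Delta[p];R)$ of the standard simplicial simplex.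 *)

theory Defs
  imports "HOL-Algebra.Module" "HOL-Algebra.AbelCoset" "HOL-Algebra.Ring_Divisibility"
begin

section \<open>Simplicial sets\<close>

text \<open>The arrows [m] \<rightarrow> [n] of the simplex category, as extensional functions.\<close>

definition simplex_hom :: "nat \<Rightarrow> nat \<Rightarrow> (nat \<Rightarrow> nat) set" where
  "simplex_hom m n = {\<theta> \<in> {..m} \<rightarrow>\<^sub>E {..n}. mono_on {..m} \<theta>}"

text \<open>For an arrow \<open>\<theta>\<close> from [m] to [n], \<open>act X m n \<theta>\<close> is the induced map from
  \<open>simp X n\<close> to \<open>simp X m\<close>; its values elsewhere are irrelevant.\<close>

record 'u sset =
  simp :: "nat \<Rightarrow> 'u set"
  act :: "nat \<Rightarrow> nat \<Rightarrow> (nat \<Rightarrow> nat) \<Rightarrow> 'u \<Rightarrow> 'u"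

definition simplicial_set :: "'u sset \<Rightarrow> bool" where
  "simplicial_set X \<longleftrightarrow>
     (\<forall>m n. \<forall>\<theta>\<in>simplex_hom m n. act X m n \<theta> \<in> simp X n \<rightarrow> simp X m) \<and>
     (\<forall>n. \<forall>x\<in>simp X n. act X n n (\<lambda>j\<in>{..n}. j) x = x) \<and>
     (\<forall>k m n. \<forall>\<phi>\<in>simplex_hom k m. \<forall>\<theta>\<in>simplex_hom m n. \<forall>x\<in>simp X n.
        act X k m \<phi> (act X m n \<theta> x) = act X k n (compose {..k} \<theta> \<phi>) x)"

definition simplicial_maps :: "'u sset \<Rightarrow> 'v sset \<Rightarrow> (nat \<Rightarrow> 'u \<Rightarrow> 'v) set" where
  "simplicial_maps X Y =
     {f. (\<forall>n. f n \<in> simp X n \<rightarrow>\<^sub>E simp Y n) \<and>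
         (\<forall>m n. \<forall>\<theta>\<in>simplex_hom m n. \<forall>x\<in>simp X n.
            f m (act X m n \<theta> x) = act Y m n \<theta> (f n x))}"

definition sset_id :: "'u sset \<Rightarrow> nat \<Rightarrow> 'u \<Rightarrow> 'u" where
  "sset_id X = (\<lambda>n. \<lambda>x\<in>simp X n. x)"

definition sset_comp ::
  "'u sset \<Rightarrow> (nat \<Rightarrow> 'v \<Rightarrow> 'w) \<Rightarrow> (nat \<Rightarrow> 'u \<Rightarrow> 'v) \<Rightarrow> nat \<Rightarrow> 'u \<Rightarrow> 'w" where
  "sset_comp X g f = (\<lambda>n. compose (simp X n) (g n) (f n))"

text \<open>The face operator \<open>d\<^sub>i\<close> from (n+1)-simplices to n-simplices.\<close>

definition face :: "'u sset \<Rightarrow> nat \<Rightarrow> nat \<Rightarrow> 'u \<Rightarrow> 'u" where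
  "face X n i = act X n (Suc n) (\<lambda>j\<in>{..n}. if j < i then j else Suc j)"

subsection \<open>Cartesian products inside a universe\<close>

text \<open>The simplicial sets under consideration have their simplices in a type \<open>'u\<close>, which acts
  as the universe.  To have products in the same category, \<open>'u\<close> comes with an injective
  pairing function \<open>pr\<close>; the pair of \<open>x\<close> and \<open>y\<close> is the element \<open>pr (x, y)\<close>.\<close>

definition pfst :: "('u \<times> 'u \<Rightarrow> 'u) \<Rightarrow> 'u \<Rightarrow> 'u" where
  "pfst pr z = fst (inv_into UNIV pr z)"

definition psnd :: "('u \<times> 'u \<Rightarrow> 'u) \<Rightarrow> 'u \<Rightarrow> 'u" where
  "psnd pr z = snd (inv_into UNIV pr z)"

definition sset_prod :: "('u \<times> 'u \<Rightarrow> 'u) \<Rightarrow> 'u sset \<Rightarrow> 'u sset \<Rightarrow> 'u sset" where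
  "sset_prod pr X Y =
     \<lparr> simp = (\<lambda>n. pr ` (simp X n \<times> simp Y n)),
       act = (\<lambda>m n \<theta> z. pr (act X m n \<theta> (pfst pr z), act Y m n \<theta> (psnd pr z))) \<rparr>"

definition sset_fst :: "('u \<times> 'u \<Rightarrow> 'u) \<Rightarrow> 'u sset \<Rightarrow> 'u sset \<Rightarrow> nat \<Rightarrow> 'u \<Rightarrow> 'u" where
  "sset_fst pr X Y = (\<lambda>n. \<lambda>z\<in>simp (sset_prod pr X Y) n. pfst pr z)"

definition sset_snd :: "('u \<times> 'u \<Rightarrow> 'u) \<Rightarrow> 'u sset \<Rightarrow> 'u sset \<Rightarrow> nat \<Rightarrow> 'u \<Rightarrow> 'u" where
  "sset_snd pr X Y = (\<lambda>n. \<lambda>z\<in>simp (sset_prod pr X Y) n. psnd pr z)"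

definition sset_prod_map ::
  "('u \<times> 'u \<Rightarrow> 'u) \<Rightarrow> 'u sset \<Rightarrow> 'u sset \<Rightarrow> (nat \<Rightarrow> 'u \<Rightarrow> 'u) \<Rightarrow> (nat \<Rightarrow> 'u \<Rightarrow> 'u)
     \<Rightarrow> nat \<Rightarrow> 'u \<Rightarrow> 'u" where
  "sset_prod_map pr X Y f g =
     (\<lambda>n. \<lambda>z\<in>simp (sset_prod pr X Y) n. pr (f n (pfst pr z), g n (psnd pr z)))"

text \<open>The associator from \<open>(X \<times> Y) \<times> Z\<close> to \<open>X \<times> (Y \<times> Z)\<close>.\<close>

definition sset_assoc ::
  "('u \<times> 'u \<Rightarrow> 'u) \<Rightarrow> 'u sset \<Rightarrow> 'u sset \<Rightarrow> 'u sset \<Rightarrow> nat \<Rightarrow> 'u \<Rightarrow> 'u" where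
  "sset_assoc pr X Y Z =
     (\<lambda>n. \<lambda>w\<in>simp (sset_prod pr (sset_prod pr X Y) Z) n.
        pr (pfst pr (pfst pr w), pr (psnd pr (pfst pr w), psnd pr w)))"

text \<open>The terminal simplicial set; \<open>undefined\<close> is just some fixed element of the universe.\<close>

definition sset_pt :: "'u sset" where
  "sset_pt = \<lparr> simp = (\<lambda>n. {undefined}), act = (\<lambda>m n \<theta> x. x) \<rparr>"

subsection \<open>Homotopy groups\<close>

text \<open>The combinatorial definition for Kan complexes.  It is applied below to the simplicial
  sets underlying simplicial modules, which are Kan complexes.\<close>

definition const_simplex :: "'u sset \<Rightarrow> 'u \<Rightarrow> nat \<Rightarrow> 'u" where
  "const_simplex X v n = act X n 0 (\<lambda>j\<in>{..n}. 0) v"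

definition spheres :: "'u sset \<Rightarrow> 'u \<Rightarrow> nat \<Rightarrow> 'u set" where
  "spheres X v n =
     {x \<in> simp X n. 0 < n \<longrightarrow> (\<forall>i\<le>n. face X (n - 1) i x = const_simplex X v (n - 1))}"

definition sphere_homotopy :: "'u sset \<Rightarrow> 'u \<Rightarrow> nat \<Rightarrow> ('u \<times> 'u) set" where
  "sphere_homotopy X v n =
     {(x, y). x \<in> spheres X v n \<and> y \<in> spheres X v n \<and>
        (\<exists>z\<in>simp X (Suc n). (\<forall>i<n. face X n i z = const_simplex X v n) \<and>
           face X n n z = x \<and> face X n (Suc n) z = y)}"

definition homotopy_set :: "'u sset \<Rightarrow> 'u \<Rightarrow> nat \<Rightarrow> 'u set set" where
  "homotopy_set X v n = spheres X v n // sphere_homotopy X v n"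

definition simplicially_contractible :: "'u sset \<Rightarrow> bool" where
  "simplicially_contractible X \<longleftrightarrow>
     simp X 0 \<noteq> {} \<and> (\<forall>v\<in>simp X 0. \<forall>n. is_singleton (homotopy_set X v n))"

section \<open>Modules\<close>

definition linear_maps ::
  "('r, 'k) ring_scheme \<Rightarrow> ('r, 'm) module \<Rightarrow> ('r, 'n) module \<Rightarrow> ('m \<Rightarrow> 'n) set" where
  "linear_maps R M N =
     {f \<in> carrier M \<rightarrow> carrier N.
        (\<forall>x\<in>carrier M. \<forall>y\<in>carrier M. f (x \<oplus>\<^bsub>M\<^esub> y) = f x \<oplus>\<^bsub>N\<^esub> f y) \<and>
        (\<forall>r\<in>carrier R. \<forall>x\<in>carrier M. f (r \<odot>\<^bsub>M\<^esub> x) = r \<odot>\<^bsub>N\<^esub> f x)}"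

definition basis :: "('r, 'k) ring_scheme \<Rightarrow> ('r, 'm) module \<Rightarrow> 'm set \<Rightarrow> bool" where
  "basis R M E \<longleftrightarrow> E \<subseteq> carrier M \<and>
     (\<forall>x\<in>carrier M. \<exists>!c. c \<in> E \<rightarrow>\<^sub>E carrier R \<and> finite {e \<in> E. c e \<noteq> \<zero>\<^bsub>R\<^esub>} \<and>
        x = (\<Oplus>\<^bsub>M\<^esub>e\<in>{e \<in> E. c e \<noteq> \<zero>\<^bsub>R\<^esub>}. c e \<odot>\<^bsub>M\<^esub> e))"

definition free_module :: "('r, 'k) ring_scheme \<Rightarrow> ('r, 'm) module \<Rightarrow> bool" where
  "free_module R M \<longleftrightarrow> module R M \<and> (\<exists>E. basis R M E)"

text \<open>\<open>(-1)\<^sup>k\<close> times \<open>x\<close>.\<close>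

definition signed :: "('m, 'k) ring_scheme \<Rightarrow> int \<Rightarrow> 'm \<Rightarrow> 'm" where
  "signed M k x = (if even k then x else \<ominus>\<^bsub>M\<^esub> x)"

text \<open>The record of modules extends that of rings, so that every module carries two fields
  \<open>mult\<close> and \<open>one\<close> that have no meaning for a module.\<close>

definition ring_module :: "('r, 'k) ring_scheme \<Rightarrow> ('r, 'r) module" where
  "ring_module R =
     \<lparr> carrier = carrier R, mult = mult R, one = one R, zero = zero R, add = add R,
       smult = mult R \<rparr>"

section \<open>Cochain complexes\<close>

record ('r, 'm) cochains =
  deg :: "int \<Rightarrow> ('r, 'm) module"
  dif :: "int \<Rightarrow> 'm \<Rightarrow> 'm"

definition cochain_complex :: "('r, 'k) ring_scheme \<Rightarrow> ('r, 'm, 'l) cochains_scheme \<Rightarrow> bool" where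
  "cochain_complex R C \<longleftrightarrow>
     (\<forall>q. module R (deg C q)) \<and>
     (\<forall>q. dif C q \<in> linear_maps R (deg C q) (deg C (q + 1))) \<and>
     (\<forall>q. \<forall>x\<in>carrier (deg C q). dif C (q + 1) (dif C q x) = \<zero>\<^bsub>deg C (q + 2)\<^esub>)"

definition bounded_below :: "('r, 'm, 'l) cochains_scheme \<Rightarrow> bool" where
  "bounded_below C \<longleftrightarrow> (\<exists>N. \<forall>q<N. carrier (deg C q) = {\<zero>\<^bsub>deg C q\<^esub>})"

definition cochain_maps ::
  "('r, 'k) ring_scheme \<Rightarrow> ('r, 'm, 'l) cochains_scheme \<Rightarrow> ('r, 'n, 'l2) cochains_scheme
     \<Rightarrow> (int \<Rightarrow> 'm \<Rightarrow> 'n) set" where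
  "cochain_maps R C D =
     {f. (\<forall>q. f q \<in> linear_maps R (deg C q) (deg D q)) \<and>
         (\<forall>q. \<forall>x\<in>carrier (deg C q). f (q + 1) (dif C q x) = dif D q (f q x))}"

text \<open>A cochain map out of a tensor product of complexes, given by its values
  \<open>b p q x y\<close> on the tensors \<open>x \<otimes> y\<close> with \<open>x\<close> of degree \<open>p\<close> and \<open>y\<close> of degree \<open>q\<close>:
  by the universal property such a map is a family of bilinear maps satisfying the Leibniz
  rule that comes from the differential of the tensor product.\<close>

definition tensor_cochain_maps ::
  "('r, 'k) ring_scheme \<Rightarrow> ('r, 'm, 'l) cochains_scheme \<Rightarrow> ('r, 'n, 'l2) cochains_scheme
     \<Rightarrow> ('r, 'o, 'l3) cochains_scheme \<Rightarrow> (int \<Rightarrow> int \<Rightarrow> 'm \<Rightarrow> 'n \<Rightarrow> 'o) set" where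
  "tensor_cochain_maps R C D E =
     {b. (\<forall>p q. \<forall>x\<in>carrier (deg C p). b p q x \<in> linear_maps R (deg D q) (deg E (p + q))) \<and>
         (\<forall>p q. \<forall>y\<in>carrier (deg D q).
            (\<lambda>x. b p q x y) \<in> linear_maps R (deg C p) (deg E (p + q))) \<and>
         (\<forall>p q. \<forall>x\<in>carrier (deg C p). \<forall>y\<in>carrier (deg D q).
            dif E (p + q) (b p q x y) =
              b (p + 1) q (dif C p x) y
                \<oplus>\<^bsub>deg E (p + q + 1)\<^esub> signed (deg E (p + q + 1)) p (b p (q + 1) x (dif D q y)))}"

text \<open>The unit object: the ring, concentrated in degree 0.\<close>

definition unit_complex :: "('r, 'k) ring_scheme \<Rightarrow> ('r, 'r) cochains" where
  "unit_complex R =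
     \<lparr> deg = (\<lambda>q. if q = 0 then ring_module R else ring_module R \<lparr> carrier := {\<zero>\<^bsub>R\<^esub>} \<rparr>),
       dif = (\<lambda>q x. \<zero>\<^bsub>R\<^esub>) \<rparr>"

definition homotopy_equivalence ::
  "('r, 'k) ring_scheme \<Rightarrow> ('r, 'm, 'l) cochains_scheme \<Rightarrow> ('r, 'n, 'l2) cochains_scheme
     \<Rightarrow> (int \<Rightarrow> 'm \<Rightarrow> 'n) \<Rightarrow> bool" where
  "homotopy_equivalence R C D f \<longleftrightarrow> f \<in> cochain_maps R C D \<and>
     (\<exists>g\<in>cochain_maps R D C. \<exists>h k.
        (\<forall>q. h q \<in> linear_maps R (deg C q) (deg C (q - 1))) \<and>
        (\<forall>q. k q \<in> linear_maps R (deg D q) (deg D (q - 1))) \<and>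
        (\<forall>q. \<forall>x\<in>carrier (deg C q).
           g q (f q x) \<ominus>\<^bsub>deg C q\<^esub> x = dif C (q - 1) (h q x) \<oplus>\<^bsub>deg C q\<^esub> h (q + 1) (dif C q x)) \<and>
        (\<forall>q. \<forall>y\<in>carrier (deg D q).
           f q (g q y) \<ominus>\<^bsub>deg D q\<^esub> y = dif D (q - 1) (k q y) \<oplus>\<^bsub>deg D q\<^esub> k (q + 1) (dif D q y)))"

definition cocycles :: "('r, 'm, 'l) cochains_scheme \<Rightarrow> int \<Rightarrow> 'm set" where
  "cocycles C q = {x \<in> carrier (deg C q). dif C q x = \<zero>\<^bsub>deg C (q + 1)\<^esub>}"

definition coboundaries :: "('r, 'm, 'l) cochains_scheme \<Rightarrow> int \<Rightarrow> 'm set" where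
  "coboundaries C q = dif C (q - 1) ` carrier (deg C (q - 1))"

definition cohomology :: "('r, 'm, 'l) cochains_scheme \<Rightarrow> int \<Rightarrow> 'm set monoid" where
  "cohomology C q = (deg C q \<lparr> carrier := cocycles C q \<rparr>) A_Mod coboundaries C q"

definition quasi_isomorphism ::
  "('r, 'k) ring_scheme \<Rightarrow> ('r, 'm, 'l) cochains_scheme \<Rightarrow> ('r, 'n, 'l2) cochains_scheme
     \<Rightarrow> (int \<Rightarrow> 'm \<Rightarrow> 'n) \<Rightarrow> bool" where
  "quasi_isomorphism R C D f \<longleftrightarrow> f \<in> cochain_maps R C D \<and>
     (\<forall>q. \<exists>\<phi>\<in>iso (cohomology C q) (cohomology D q). \<forall>x\<in>cocycles C q.
        \<phi> (coboundaries C q +>\<^bsub>deg C q\<^esub> x) = coboundaries D q +>\<^bsub>deg D q\<^esub> f q x)"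

section \<open>Simplicial differential graded algebras\<close>

record ('r, 'a) dga = "('r, 'a) cochains" +
  dmul :: "int \<Rightarrow> int \<Rightarrow> 'a \<Rightarrow> 'a \<Rightarrow> 'a"
  dunit :: 'a

definition dg_algebra :: "('r, 'k) ring_scheme \<Rightarrow> ('r, 'a) dga \<Rightarrow> bool" where
  "dg_algebra R A \<longleftrightarrow>
     cochain_complex R A \<and>
     (\<forall>q<0. carrier (deg A q) = {\<zero>\<^bsub>deg A q\<^esub>}) \<and>
     dmul A \<in> tensor_cochain_maps R A A A \<and>
     dunit A \<in> carrier (deg A 0) \<and>
     (\<forall>p q r. \<forall>x\<in>carrier (deg A p). \<forall>y\<in>carrier (deg A q). \<forall>z\<in>carrier (deg A r).
        dmul A (p + q) r (dmul A p q x y) z = dmul A p (q + r) x (dmul A q r y z)) \<and>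
     (\<forall>q. \<forall>x\<in>carrier (deg A q). dmul A 0 q (dunit A) x = x \<and> dmul A q 0 x (dunit A) = x)"

definition dga_maps ::
  "('r, 'k) ring_scheme \<Rightarrow> ('r, 'a) dga \<Rightarrow> ('r, 'b) dga \<Rightarrow> (int \<Rightarrow> 'a \<Rightarrow> 'b) set" where
  "dga_maps R A B =
     {f \<in> cochain_maps R A B.
        (\<forall>p q. \<forall>x\<in>carrier (deg A p). \<forall>y\<in>carrier (deg A q).
           f (p + q) (dmul A p q x y) = dmul B p q (f p x) (f q y)) \<and>
        f 0 (dunit A) = dunit B}"

text \<open>The natural morphism from the ring to a dg algebra.\<close>

definition unit_map :: "('r, 'a) dga \<Rightarrow> int \<Rightarrow> 'r \<Rightarrow> 'a" where
  "unit_map A = (\<lambda>q r. if q = 0 then r \<odot>\<^bsub>deg A 0\<^esub> dunit A else \<zero>\<^bsub>deg A q\<^esub>)"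

record ('r, 'a) sdga =
  level :: "nat \<Rightarrow> ('r, 'a) dga"
  sact :: "nat \<Rightarrow> nat \<Rightarrow> (nat \<Rightarrow> nat) \<Rightarrow> int \<Rightarrow> 'a \<Rightarrow> 'a"

definition simplicial_dga :: "('r, 'k) ring_scheme \<Rightarrow> ('r, 'a) sdga \<Rightarrow> bool" where
  "simplicial_dga R A \<longleftrightarrow>
     (\<forall>p. dg_algebra R (level A p)) \<and>
     (\<forall>m n. \<forall>\<theta>\<in>simplex_hom m n. sact A m n \<theta> \<in> dga_maps R (level A n) (level A m)) \<and>
     (\<forall>n q. \<forall>x\<in>carrier (deg (level A n) q). sact A n n (\<lambda>j\<in>{..n}. j) q x = x) \<and>
     (\<forall>k m n q. \<forall>\<phi>\<in>simplex_hom k m. \<forall>\<theta>\<in>simplex_hom m n. \<forall>x\<in>carrier (deg (level A n) q).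
        sact A k m \<phi> q (sact A m n \<theta> q x) = sact A k n (compose {..k} \<theta> \<phi>) q x)"

text \<open>The simplicial set underlying the simplicial module in a fixed differential degree.\<close>

definition sdga_sset :: "('r, 'a) sdga \<Rightarrow> int \<Rightarrow> 'a sset" where
  "sdga_sset A q =
     \<lparr> simp = (\<lambda>p. carrier (deg (level A p) q)), act = (\<lambda>m n \<theta>. sact A m n \<theta> q) \<rparr>"

definition homology_axiom :: "('r, 'k) ring_scheme \<Rightarrow> ('r, 'a) sdga \<Rightarrow> bool" where
  "homology_axiom R A \<longleftrightarrow>
     (\<forall>p. homotopy_equivalence R (unit_complex R) (level A p) (unit_map (level A p)))"

definition homotopy_axiom :: "('r, 'a) sdga \<Rightarrow> bool" where
  "homotopy_axiom A \<longleftrightarrow> (\<forall>q\<ge>0. simplicially_contractible (sdga_sset A q))"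

definition freeness_axiom :: "('r, 'k) ring_scheme \<Rightarrow> ('r, 'a) sdga \<Rightarrow> bool" where
  "freeness_axiom R A \<longleftrightarrow>
     principal_domain R \<and> (\<forall>p. \<forall>q\<ge>0. free_module R (deg (level A p) q))"

section \<open>Contravariant monoidal functors and weak quasi-isomorphism\<close>

text \<open>A contravariant functor from simplicial sets (in the universe \<open>'u\<close>) to complexes, together
  with the structure maps \<open>\<kappa>\<close> and \<open>\<eta>\<close>.  A map \<open>f\<close> from \<open>X\<close> to \<open>Y\<close> induces
  \<open>fmap F X Y f\<close> from \<open>fobj F Y\<close> to \<open>fobj F X\<close>.\<close>

record ('r, 'u, 'm) mfunctor =
  fobj :: "'u sset \<Rightarrow> ('r, 'm) cochains"
  fmap :: "'u sset \<Rightarrow> 'u sset \<Rightarrow> (nat \<Rightarrow> 'u \<Rightarrow> 'u) \<Rightarrow> int \<Rightarrow> 'm \<Rightarrow> 'm"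
  kappa :: "'u sset \<Rightarrow> 'u sset \<Rightarrow> int \<Rightarrow> int \<Rightarrow> 'm \<Rightarrow> 'm \<Rightarrow> 'm"
  eta :: "int \<Rightarrow> 'r \<Rightarrow> 'm"

definition contravariant_functor ::
  "('r, 'k) ring_scheme \<Rightarrow> ('r, 'u, 'm) mfunctor \<Rightarrow> bool" where
  "contravariant_functor R F \<longleftrightarrow>
     (\<forall>X. simplicial_set X \<longrightarrow> cochain_complex R (fobj F X) \<and> bounded_below (fobj F X)) \<and>
     (\<forall>X Y. simplicial_set X \<longrightarrow> simplicial_set Y \<longrightarrow>
        (\<forall>f\<in>simplicial_maps X Y. fmap F X Y f \<in> cochain_maps R (fobj F Y) (fobj F X))) \<and>
     (\<forall>X q. simplicial_set X \<longrightarrow>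
        (\<forall>a\<in>carrier (deg (fobj F X) q). fmap F X X (sset_id X) q a = a)) \<and>
     (\<forall>X Y Z q. simplicial_set X \<longrightarrow> simplicial_set Y \<longrightarrow> simplicial_set Z \<longrightarrow>
        (\<forall>f\<in>simplicial_maps X Y. \<forall>g\<in>simplicial_maps Y Z. \<forall>a\<in>carrier (deg (fobj F Z) q).
           fmap F X Z (sset_comp X g f) q a = fmap F X Y f q (fmap F Y Z g q a)))"

definition lax_monoidal_functor ::
  "('r, 'k) ring_scheme \<Rightarrow> ('u \<times> 'u \<Rightarrow> 'u) \<Rightarrow> ('r, 'u, 'm) mfunctor \<Rightarrow> bool" where
  "lax_monoidal_functor R pr F \<longleftrightarrow>
     contravariant_functor R F \<and>
     (\<forall>X Y. simplicial_set X \<longrightarrow> simplicial_set Y \<longrightarrow>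
        kappa F X Y \<in> tensor_cochain_maps R (fobj F X) (fobj F Y) (fobj F (sset_prod pr X Y))) \<and>
     (\<forall>X X' Y Y' p q. simplicial_set X \<longrightarrow> simplicial_set X' \<longrightarrow>
        simplicial_set Y \<longrightarrow> simplicial_set Y' \<longrightarrow>
        (\<forall>f\<in>simplicial_maps X X'. \<forall>g\<in>simplicial_maps Y Y'.
         \<forall>a\<in>carrier (deg (fobj F X') p). \<forall>b\<in>carrier (deg (fobj F Y') q).
           fmap F (sset_prod pr X Y) (sset_prod pr X' Y') (sset_prod_map pr X Y f g) (p + q)
               (kappa F X' Y' p q a b)
             = kappa F X Y p q (fmap F X X' f p a) (fmap F Y Y' g q b))) \<and>
     eta F \<in> cochain_maps R (unit_complex R) (fobj F sset_pt) \<and>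
     (\<forall>X Y Z p q r. simplicial_set X \<longrightarrow> simplicial_set Y \<longrightarrow> simplicial_set Z \<longrightarrow>
        (\<forall>a\<in>carrier (deg (fobj F X) p). \<forall>b\<in>carrier (deg (fobj F Y) q).
         \<forall>c\<in>carrier (deg (fobj F Z) r).
           kappa F (sset_prod pr X Y) Z (p + q) r (kappa F X Y p q a b) c
             = fmap F (sset_prod pr (sset_prod pr X Y) Z) (sset_prod pr X (sset_prod pr Y Z))
                 (sset_assoc pr X Y Z) (p + q + r)
                 (kappa F X (sset_prod pr Y Z) p (q + r) a (kappa F Y Z q r b c)))) \<and>
     (\<forall>X q. simplicial_set X \<longrightarrow>
        (\<forall>s\<in>carrier R. \<forall>a\<in>carrier (deg (fobj F X) q).
           kappa F sset_pt X 0 q (eta F 0 s) a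
             = fmap F (sset_prod pr sset_pt X) X (sset_snd pr sset_pt X) q
                 (s \<odot>\<^bsub>deg (fobj F X) q\<^esub> a) \<and>
           kappa F X sset_pt q 0 a (eta F 0 s)
             = fmap F (sset_prod pr X sset_pt) X (sset_fst pr X sset_pt) q
                 (s \<odot>\<^bsub>deg (fobj F X) q\<^esub> a)))"

definition monoidal_transformations ::
  "('r, 'k) ring_scheme \<Rightarrow> ('u \<times> 'u \<Rightarrow> 'u) \<Rightarrow> ('r, 'u, 'm) mfunctor \<Rightarrow> ('r, 'u, 'n) mfunctor
     \<Rightarrow> ('u sset \<Rightarrow> int \<Rightarrow> 'm \<Rightarrow> 'n) set" where
  "monoidal_transformations R pr F G =
     {T. (\<forall>X. simplicial_set X \<longrightarrow> T X \<in> cochain_maps R (fobj F X) (fobj G X)) \<and>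
         (\<forall>X Y q. simplicial_set X \<longrightarrow> simplicial_set Y \<longrightarrow>
            (\<forall>f\<in>simplicial_maps X Y. \<forall>a\<in>carrier (deg (fobj F Y) q).
               T X q (fmap F X Y f q a) = fmap G X Y f q (T Y q a))) \<and>
         (\<forall>X Y p q. simplicial_set X \<longrightarrow> simplicial_set Y \<longrightarrow>
            (\<forall>a\<in>carrier (deg (fobj F X) p). \<forall>b\<in>carrier (deg (fobj F Y) q).
               T (sset_prod pr X Y) (p + q) (kappa F X Y p q a b)
                 = kappa G X Y p q (T X p a) (T Y q b))) \<and>
         (\<forall>q. \<forall>s\<in>carrier (deg (unit_complex R) q). T sset_pt q (eta F q s) = eta G q s)}"

text \<open>\<open>F\<close> and \<open>G\<close> are objects of the category of monoidal functors and there is a morphism from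
  \<open>F\<close> to \<open>G\<close> that is a quasi-isomorphism at every simplicial set.\<close>

definition quasi_iso_step ::
  "('r, 'k) ring_scheme \<Rightarrow> ('u \<times> 'u \<Rightarrow> 'u) \<Rightarrow> ('r, 'u, 'm) mfunctor \<Rightarrow> ('r, 'u, 'n) mfunctor
     \<Rightarrow> bool" where
  "quasi_iso_step R pr F G \<longleftrightarrow>
     lax_monoidal_functor R pr F \<and> lax_monoidal_functor R pr G \<and>
     (\<exists>T\<in>monoidal_transformations R pr F G.
        \<forall>X. simplicial_set X \<longrightarrow> quasi_isomorphism R (fobj F X) (fobj G X) (T X))"

definition quasi_iso_linked ::
  "('r, 'k) ring_scheme \<Rightarrow> ('u \<times> 'u \<Rightarrow> 'u) \<Rightarrow> ('r, 'u, 'm) mfunctor \<Rightarrow> ('r, 'u, 'n) mfunctor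
     \<Rightarrow> bool" where
  "quasi_iso_linked R pr F G \<longleftrightarrow> quasi_iso_step R pr F G \<or> quasi_iso_step R pr G F"

text \<open>A finite zigzag from \<open>F\<close> to \<open>G\<close>.  The modules in the values of \<open>F\<close>, of \<open>G\<close> and of the
  functors between them are carried by possibly different types; since HOL has no quantifier
  over types, the type \<open>'c\<close> carrying the intermediate values is an explicit argument.\<close>

definition weakly_quasi_isomorphic ::
  "'c itself \<Rightarrow> ('r, 'k) ring_scheme \<Rightarrow> ('u \<times> 'u \<Rightarrow> 'u)
     \<Rightarrow> ('r, 'u, 'm) mfunctor \<Rightarrow> ('r, 'u, 'n) mfunctor \<Rightarrow> bool" where
  "weakly_quasi_isomorphic _ R pr F G \<longleftrightarrow>
     (\<exists>H H' :: ('r, 'u, 'c) mfunctor.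
        quasi_iso_linked R pr F H \<and> equivclp (quasi_iso_step R pr) H H' \<and>
        quasi_iso_linked R pr H' G)"

section \<open>The cohomology theory of a simplicial dg algebra\<close>

definition theory_complex :: "('r, 'a) sdga \<Rightarrow> 'u sset \<Rightarrow> ('r, nat \<Rightarrow> 'u \<Rightarrow> 'a) cochains" where
  "theory_complex A X =
     \<lparr> deg = (\<lambda>q.
         \<lparr> carrier = simplicial_maps X (sdga_sset A q), mult = undefined, one = undefined,
           zero = (\<lambda>n. \<lambda>x\<in>simp X n. \<zero>\<^bsub>deg (level A n) q\<^esub>),
           add = (\<lambda>f g n. \<lambda>x\<in>simp X n. f n x \<oplus>\<^bsub>deg (level A n) q\<^esub> g n x),
           smult = (\<lambda>r f n. \<lambda>x\<in>simp X n. r \<odot>\<^bsub>deg (level A n) q\<^esub> f n x) \<rparr>),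
       dif = (\<lambda>q f n. \<lambda>x\<in>simp X n. dif (level A n) q (f n x)) \<rparr>"

definition theory_cup ::
  "('r, 'a) sdga \<Rightarrow> 'u sset \<Rightarrow> int \<Rightarrow> int \<Rightarrow> (nat \<Rightarrow> 'u \<Rightarrow> 'a) \<Rightarrow> (nat \<Rightarrow> 'u \<Rightarrow> 'a)
     \<Rightarrow> nat \<Rightarrow> 'u \<Rightarrow> 'a" where
  "theory_cup A X p q \<alpha> \<beta> = (\<lambda>n. \<lambda>x\<in>simp X n. dmul (level A n) p q (\<alpha> n x) (\<beta> n x))"

definition cohomology_theory ::
  "('u \<times> 'u \<Rightarrow> 'u) \<Rightarrow> ('r, 'a) sdga \<Rightarrow> ('r, 'u, nat \<Rightarrow> 'u \<Rightarrow> 'a) mfunctor" where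
  "cohomology_theory pr A =
     \<lparr> fobj = theory_complex A,
       fmap = (\<lambda>X Y f q \<alpha>. sset_comp X \<alpha> f),
       kappa = (\<lambda>X Y p q \<alpha> \<beta>.
         theory_cup A (sset_prod pr X Y) p q
           (sset_comp (sset_prod pr X Y) \<alpha> (sset_fst pr X Y))
           (sset_comp (sset_prod pr X Y) \<beta> (sset_snd pr X Y))),
       eta = (\<lambda>q r n. \<lambda>x\<in>simp sset_pt n. unit_map (level A n) q r) \<rparr>"

section \<open>Singular cochains\<close>

text \<open>Simplices in integral degree; there are none in negative degrees, so that the modules of
  cochains below are zero there.\<close>

definition simp_int :: "'u sset \<Rightarrow> int \<Rightarrow> 'u set" where
  "simp_int X q = (if q < 0 then {} else simp X (nat q))"

definition singular_complex ::
  "('r, 'k) ring_scheme \<Rightarrow> 'u sset \<Rightarrow> ('r, 'u \<Rightarrow> 'r) cochains" where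
  "singular_complex R X =
     \<lparr> deg = (\<lambda>q.
         \<lparr> carrier = simp_int X q \<rightarrow>\<^sub>E carrier R, mult = undefined, one = undefined,
           zero = (\<lambda>x\<in>simp_int X q. \<zero>\<^bsub>R\<^esub>),
           add = (\<lambda>\<alpha> \<beta>. \<lambda>x\<in>simp_int X q. \<alpha> x \<oplus>\<^bsub>R\<^esub> \<beta> x),
           smult = (\<lambda>r \<alpha>. \<lambda>x\<in>simp_int X q. r \<otimes>\<^bsub>R\<^esub> \<alpha> x) \<rparr>),
       dif = (\<lambda>q \<alpha>. \<lambda>x\<in>simp_int X (q + 1).
         if q < 0 then \<zero>\<^bsub>R\<^esub>
         else (\<Oplus>\<^bsub>R\<^esub>i\<in>{..Suc (nat q)}. signed R (int i) (\<alpha> (face X (nat q) i x)))) \<rparr>"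

text \<open>The Alexander--Whitney product: the first factor is evaluated on the front face, the second
  one on the back face.\<close>

definition singular_cup ::
  "('r, 'k) ring_scheme \<Rightarrow> 'u sset \<Rightarrow> int \<Rightarrow> int \<Rightarrow> ('u \<Rightarrow> 'r) \<Rightarrow> ('u \<Rightarrow> 'r) \<Rightarrow> 'u \<Rightarrow> 'r" where
  "singular_cup R X p q \<alpha> \<beta> = (\<lambda>x\<in>simp_int X (p + q).
     if p < 0 \<or> q < 0 then \<zero>\<^bsub>R\<^esub>
     else \<alpha> (act X (nat p) (nat (p + q)) (\<lambda>j\<in>{..nat p}. j) x)
       \<otimes>\<^bsub>R\<^esub> \<beta> (act X (nat q) (nat (p + q)) (\<lambda>j\<in>{..nat q}. nat p + j) x))"

definition singular_pullback ::
  "'u sset \<Rightarrow> (nat \<Rightarrow> 'u \<Rightarrow> 'v) \<Rightarrow> int \<Rightarrow> ('v \<Rightarrow> 'r) \<Rightarrow> 'u \<Rightarrow> 'r" where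
  "singular_pullback X f q \<alpha> = (\<lambda>x\<in>simp_int X q. \<alpha> (f (nat q) x))"

definition singular_cochains ::
  "('r, 'k) ring_scheme \<Rightarrow> ('u \<times> 'u \<Rightarrow> 'u) \<Rightarrow> ('r, 'u, 'u \<Rightarrow> 'r) mfunctor" where
  "singular_cochains R pr =
     \<lparr> fobj = singular_complex R,
       fmap = (\<lambda>X Y f q \<alpha>. singular_pullback X f q \<alpha>),
       kappa = (\<lambda>X Y p q \<alpha> \<beta>.
         singular_cup R (sset_prod pr X Y) p q
           (singular_pullback (sset_prod pr X Y) (sset_fst pr X Y) p \<alpha>)
           (singular_pullback (sset_prod pr X Y) (sset_snd pr X Y) q \<beta>)),
       eta = (\<lambda>q r. \<lambda>x\<in>simp_int sset_pt q. if q = 0 then r else \<zero>\<^bsub>R\<^esub>) \<rparr>"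

section \<open>Types for the intermediate functors\<close>

text \<open>Elements of a tensor product of two graded modules carried by \<open>'a\<close> and \<open>'b\<close> are
  represented by formal sums of triples (i, a, b) where i is the degree of a.  Thus
  \<open>('u, 'a, 'b) tensor_theory\<close> is large enough to carry the cohomology theory
  associated to the tensor product of two simplicial dg algebras carried by \<open>'a\<close> and \<open>'b\<close>.
  The type \<open>'r simplex_cochain\<close> carries the singular cochains of the standard simplices, a
  simplex of which is an arrow of the simplex category.\<close>

type_synonym ('u, 'a, 'b) tensor_theory = "nat \<Rightarrow> 'u \<Rightarrow> (int \<times> 'a \<times> 'b) list"

type_synonym 'r simplex_cochain = "(nat \<Rightarrow> nat) \<Rightarrow> 'r"

end

theory Submission
  imports Defs "HOL-Library.Sublist"
begin

text \<open>Let \<open>C(A)\<close> be the simplicial dg algebra of cochains of the standard simplices with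
  coefficients in \<open>A\<close>; it takes the role of the tensor product of \<open>A\<close> with the singular
  cochains.  Constant cochains give a levelwise quasi-isomorphism from \<open>A\<close> to \<open>C(A)\<close>, because
  every standard simplex is a cone.  The unit of \<open>A\<close> induces a map from \<open>C(R)\<close> to \<open>C(A)\<close>, a
  levelwise quasi-isomorphism by the homology axiom.  Hence there is a zigzag
  \<open>A \<rightarrow> C(A) \<leftarrow> C(R) \<rightarrow> C(B) \<leftarrow> B\<close>, and the theory of \<open>C(R)\<close> is isomorphic to singular
  cochains.

  A levelwise quasi-isomorphism out of \<open>A\<close> induces quasi-isomorphisms of the theories as soon as the
  simplicial ring \<open>A\<^sup>0\<close> contains a path from 1 to 0, which the homotopy axiom provides: such a path
  makes the simplicial modules over \<open>A\<^sup>0\<close> contractible, so that boundaries of simplices can be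
  filled in them, and the simplicial maps from \<open>X\<close> into a levelwise acyclic complex of such modules
  form an acyclic complex by induction over the skeleta.  This is applied to the mapping cone.\<close>

section \<open>Lifting against boundaries of simplices\<close>

definition coface :: "nat \<Rightarrow> nat \<Rightarrow> nat \<Rightarrow> nat" where
  "coface n j = (\<lambda>i\<in>{..n}. if i < j then i else Suc i)"

definition codegeneracy :: "nat \<Rightarrow> nat \<Rightarrow> nat \<Rightarrow> nat" where
  "codegeneracy n j = (\<lambda>i\<in>{..Suc n}. if i \<le> j then i else i - 1)"

lemma simplex_homI:
  assumes "\<And>i. i \<le> m \<Longrightarrow> \<theta> i \<le> n" "\<And>i. m < i \<Longrightarrow> \<theta> i = undefined"
    "\<And>i j. i \<le> j \<Longrightarrow> j \<le> m \<Longrightarrow> \<theta> i \<le> \<theta> j"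
  shows "\<theta> \<in> simplex_hom m n"
  unfolding simplex_hom_def using assms by (auto simp: PiE_iff extensional_def mono_on_def)

lemma simplex_hom_le: "\<theta> \<in> simplex_hom m n \<Longrightarrow> i \<le> m \<Longrightarrow> \<theta> i \<le> n"
  by (auto simp: simplex_hom_def)

lemma simplex_hom_mono: "\<theta> \<in> simplex_hom m n \<Longrightarrow> i \<le> j \<Longrightarrow> j \<le> m \<Longrightarrow> \<theta> i \<le> \<theta> j"
  by (auto simp: simplex_hom_def mono_on_def)

lemma simplex_hom_eqI:
  assumes "\<theta> \<in> simplex_hom m n" "\<phi> \<in> simplex_hom m n'" "\<And>i. i \<le> m \<Longrightarrow> \<theta> i = \<phi> i"
  shows "\<theta> = \<phi>"
  using assms by (auto simp: simplex_hom_def PiE_def intro!: extensionalityI[of _ "{..m}"])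

lemma simplex_hom_compose [simp, intro]:
  assumes "\<phi> \<in> simplex_hom k m" "\<theta> \<in> simplex_hom m n"
  shows "compose {..k} \<theta> \<phi> \<in> simplex_hom k n"
proof (rule simplex_homI)
  fix i j assume "i \<le> j" "j \<le> k"
  moreover have "\<phi> i \<le> \<phi> j" "\<phi> j \<le> m" using calculation assms simplex_hom_mono simplex_hom_le by metis+
  ultimately show "compose {..k} \<theta> \<phi> i \<le> compose {..k} \<theta> \<phi> j"
    using simplex_hom_mono[OF assms(2)] by (simp add: compose_def)
qed (use assms simplex_hom_le in \<open>fastforce simp: compose_def\<close>)+

lemma simplex_hom_id [simp, intro]: "(\<lambda>j\<in>{..n}. j) \<in> simplex_hom n n"
  by (rule simplex_homI) auto

lemma simplex_hom_const [simp, intro]: "c \<le> n \<Longrightarrow> (\<lambda>j\<in>{..m}. c) \<in> simplex_hom m n"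
  by (rule simplex_homI) auto

lemma coface_hom [simp, intro]: "coface n j \<in> simplex_hom n (Suc n)"
  by (rule simplex_homI) (auto simp: coface_def)

lemma codegeneracy_hom [simp, intro]: "j \<le> n \<Longrightarrow> codegeneracy n j \<in> simplex_hom (Suc n) n"
  by (rule simplex_homI) (auto simp: codegeneracy_def)

lemma face_eq: "face X n j = act X n (Suc n) (coface n j)"
  by (simp add: face_def coface_def)

lemma factor_coface:
  assumes "\<theta> \<in> simplex_hom m (Suc n)" "j \<le> Suc n" "\<And>i. i \<le> m \<Longrightarrow> \<theta> i \<noteq> j"
  obtains \<rho> where "\<rho> \<in> simplex_hom m n" "\<theta> = compose {..m} (coface n j) \<rho>"
    "\<And>i. i \<le> m \<Longrightarrow> \<rho> i = (if \<theta> i < j then \<theta> i else \<theta> i - 1)"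
proof -
  let ?\<rho> = "\<lambda>i\<in>{..m}. if \<theta> i < j then \<theta> i else \<theta> i - 1"
  have le: "?\<rho> i \<le> n" if "i \<le> m" for i
    using assms(2) assms(3)[OF that] simplex_hom_le[OF assms(1) that] that by auto
  have \<rho>: "?\<rho> \<in> simplex_hom m n"
  proof (rule simplex_homI)
    fix i i' assume "i \<le> i'" "i' \<le> m"
    then show "?\<rho> i \<le> ?\<rho> i'"
      using simplex_hom_mono[OF assms(1), of i i'] assms(3)[of i] assms(3)[of i'] by auto
  qed (use le in auto)
  have "\<theta> = compose {..m} (coface n j) ?\<rho>"
  proof (rule simplex_hom_eqI[OF assms(1)])
    show "compose {..m} (coface n j) ?\<rho> \<in> simplex_hom m (Suc n)" using \<rho> by blast
    fix i assume i: "i \<le> m"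
    show "\<theta> i = compose {..m} (coface n j) ?\<rho> i"
      using assms(3)[OF i] le[OF i] i by (auto simp: compose_def coface_def)
  qed
  then show thesis using that[of ?\<rho>] \<rho> by simp
qed

lemma endo_misses:
  assumes "\<theta> \<in> simplex_hom n n" "\<theta> \<noteq> (\<lambda>j\<in>{..n}. j)"
  shows "\<exists>j\<le>n. \<forall>i\<le>n. \<theta> i \<noteq> j"
proof (rule ccontr)
  assume "\<not> ?thesis"
  then have "\<theta> ` {..n} = {..n}" using assms(1) by (fastforce simp: simplex_hom_le image_iff)
  then have inj: "inj_on \<theta> {..n}" by (simp add: eq_card_imp_inj_on)
  have smono: "\<theta> i < \<theta> j" if "i < j" "j \<le> n" for i j
    using simplex_hom_mono[OF assms(1), of i j] inj_onD[OF inj, of i j] that by fastforce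
  have ge: "i \<le> \<theta> i" if "i \<le> n" for i
    using that
  proof (induction i)
    case (Suc i)
    then show ?case using smono[of i "Suc i"] by simp
  qed simp
  have le: "\<theta> (n - i) \<le> n - i" if "i \<le> n" for i
    using that
  proof (induction i)
    case 0 then show ?case using simplex_hom_le[OF assms(1), of n] by simp
  next
    case (Suc i)
    then have "\<theta> (n - Suc i) < \<theta> (n - i)" by (intro smono) auto
    then show ?case using Suc by simp
  qed
  have "\<theta> = (\<lambda>j\<in>{..n}. j)"
  proof (rule simplex_hom_eqI[OF assms(1) simplex_hom_id])
    fix i assume "i \<le> n"
    then show "\<theta> i = (\<lambda>j\<in>{..n}. j) i" using ge[of i] le[of "n - i"] by simp
  qed
  with assms(2) show False by simp
qed

lemma collapse_step:
  assumes "\<sigma> \<in> simplex_hom n k" "k < n"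
  obtains i where "i < n" "\<sigma> (Suc i) = \<sigma> i"
proof -
  have "\<not> (\<forall>i<n. \<sigma> i < \<sigma> (Suc i))"
  proof
    assume A: "\<forall>i<n. \<sigma> i < \<sigma> (Suc i)"
    have "i \<le> \<sigma> i" if "i \<le> n" for i
      using that
    proof (induction i)
      case (Suc i)
      then have "i \<le> \<sigma> i" "\<sigma> i < \<sigma> (Suc i)" using A by auto
      then show ?case by linarith
    qed simp
    from this[of n] show False using simplex_hom_le[OF assms(1), of n] assms(2) by simp
  qed
  then obtain i where "i < n" "\<not> \<sigma> i < \<sigma> (Suc i)" by blast
  moreover have "\<sigma> i \<le> \<sigma> (Suc i)" using simplex_hom_mono[OF assms(1), of i "Suc i"] calculation by simp
  ultimately show thesis using that by fastforce
qed

lemma act_closed: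
  "simplicial_set X \<Longrightarrow> \<theta> \<in> simplex_hom m n \<Longrightarrow> x \<in> simp X n \<Longrightarrow> act X m n \<theta> x \<in> simp X m"
  unfolding simplicial_set_def by blast

lemma act_id:
  "simplicial_set X \<Longrightarrow> x \<in> simp X n \<Longrightarrow> act X n n (\<lambda>j\<in>{..n}. j) x = x"
  unfolding simplicial_set_def by blast

lemma act_act:
  "simplicial_set X \<Longrightarrow> \<phi> \<in> simplex_hom k m \<Longrightarrow> \<theta> \<in> simplex_hom m n \<Longrightarrow> x \<in> simp X n \<Longrightarrow>
     act X k m \<phi> (act X m n \<theta> x) = act X k n (compose {..k} \<theta> \<phi>) x"
  unfolding simplicial_set_def by blast

text \<open>A simplex in the image of \<open>\<sigma>\<close> is fixed by the idempotent that collapses two vertices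
  identified by \<open>\<sigma>\<close>; suitable idempotents for two degenerate simplices commute.\<close>

lemma degenerate_eqI:
  assumes E: "simplicial_set E"
    and \<sigma>: "\<sigma> \<in> simplex_hom n k" "k < n" "e \<in> simp E k" "u = act E n k \<sigma> e"
    and \<sigma>': "\<sigma>' \<in> simplex_hom n k'" "k' < n" "e' \<in> simp E k'" "u' = act E n k' \<sigma>' e'"
    and faces: "\<And>j \<theta>. j < n \<Longrightarrow> \<theta> \<in> simplex_hom j n \<Longrightarrow> act E j n \<theta> u = act E j n \<theta> u'"
  shows "u = u'"
proof -
  obtain n' where n: "n = Suc n'" using \<sigma>(2) by (cases n) auto
  have u: "u \<in> simp E n" and u': "u' \<in> simp E n" using \<sigma> \<sigma>' act_closed[OF E] by auto
  define up where "up i = (\<lambda>x\<in>{..n}. if x = i then Suc i else x)" for i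
  define down where "down i = (\<lambda>x\<in>{..n}. if x = Suc i then i else x)" for i
  have up: "up i \<in> simplex_hom n n" and down: "down i \<in> simplex_hom n n" if "i < n" for i
    by (rule simplex_homI; use that in \<open>auto simp: up_def down_def\<close>)+
  have same: "act E n n \<epsilon> u = act E n n \<epsilon> u'"
    if \<epsilon>: "\<epsilon> \<in> simplex_hom n n" "j \<le> n" "\<And>i. i \<le> n \<Longrightarrow> \<epsilon> i \<noteq> j" for \<epsilon> j
  proof -
    obtain \<rho> where \<rho>: "\<rho> \<in> simplex_hom n n'" "\<epsilon> = compose {..n} (coface n' j) \<rho>"
      using factor_coface[of \<epsilon> n n' j] \<epsilon> n by metis
    then show ?thesis
      using act_act[OF E \<rho>(1) coface_hom, of u j] act_act[OF E \<rho>(1) coface_hom, of u' j] u u'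
        faces[of n' "coface n' j"] n by simp
  qed
  have fix_aux: "act E n n \<epsilon> (act E n l \<tau> w) = act E n l \<tau> w"
    if "\<epsilon> \<in> simplex_hom n n" "\<tau> \<in> simplex_hom n l" "w \<in> simp E l" "\<And>x. x \<le> n \<Longrightarrow> \<tau> (\<epsilon> x) = \<tau> x"
    for \<epsilon> \<tau> l w
  proof -
    have "compose {..n} \<tau> \<epsilon> = \<tau>"
      by (rule simplex_hom_eqI[OF simplex_hom_compose[OF that(1,2)] that(2)])
        (use that in \<open>simp add: compose_def\<close>)
    then show ?thesis using act_act[OF E that(1,2,3)] by simp
  qed
  obtain i where i: "i < n" "\<sigma> (Suc i) = \<sigma> i" using collapse_step[OF \<sigma>(1,2)] by blast
  obtain i' where i': "i' < n" "\<sigma>' (Suc i') = \<sigma>' i'" using collapse_step[OF \<sigma>'(1,2)] by blast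
  have commute: "v = w"
    if "a < b" "b < n" and vw: "v \<in> simp E n" "w \<in> simp E n"
      and v: "act E n n (up a) v = v" and w: "act E n n (down b) w = w"
      and "act E n n (up a) v = act E n n (up a) w" "act E n n (down b) v = act E n n (down b) w"
    for a b v w
  proof -
    have ab: "up a \<in> simplex_hom n n" "down b \<in> simplex_hom n n" using up down that by auto
    have c: "compose {..n} (up a) (down b) = compose {..n} (down b) (up a)"
      using that(1,2) by (auto simp: compose_def up_def down_def fun_eq_iff)
    have "w = act E n n (down b) (act E n n (up a) v)" using that by simp
    also have "\<dots> = act E n n (up a) (act E n n (down b) v)"
      using act_act[OF E ab(1,2) vw(1)] act_act[OF E ab(2,1) vw(1)] c by simp
    also have "\<dots> = v" using that by simp
    finally show ?thesis by simp
  qed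
  have fixes_u: "act E n n (up i) u = u" "act E n n (down i) u = u"
    unfolding \<sigma>(4) using \<sigma> i up down by (auto intro!: fix_aux simp: up_def down_def)
  have fixes_u': "act E n n (up i') u' = u'" "act E n n (down i') u' = u'"
    unfolding \<sigma>'(4) using \<sigma>' i' up down by (auto intro!: fix_aux simp: up_def down_def)
  have same': "act E n n (up a) u = act E n n (up a) u'"
      "act E n n (down a) u = act E n n (down a) u'" if "a < n" for a
    using same[OF up[OF that], of a] same[OF down[OF that], of "Suc a"] that
    by (auto simp: up_def down_def)
  consider "i = i'" | "i < i'" | "i' < i" by linarith
  then show ?thesis
  proof cases
    case 1 then show ?thesis using fixes_u fixes_u' same' i by metis
  next
    case 2 then show ?thesis using commute[OF 2 i'(1) u u'] fixes_u fixes_u' same' i i' by auto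
  next
    case 3 then show ?thesis using commute[OF 3 i(1) u' u] fixes_u fixes_u' same' i i' by metis
  qed
qed

text \<open>The right lifting property against the inclusions of boundaries of simplices: a map from
  the boundary of the standard \<open>p\<close>-simplex is given by its values on the simplices of
  dimension less than \<open>p\<close>.\<close>

definition boundary_family :: "'u sset \<Rightarrow> nat \<Rightarrow> (nat \<Rightarrow> (nat \<Rightarrow> nat) \<Rightarrow> 'u) \<Rightarrow> bool" where
  "boundary_family E p y \<longleftrightarrow>
     (\<forall>k<p. \<forall>\<theta>\<in>simplex_hom k p. y k \<theta> \<in> simp E k) \<and>
     (\<forall>j<p. \<forall>k<p. \<forall>\<phi>\<in>simplex_hom j k. \<forall>\<theta>\<in>simplex_hom k p.
        act E j k \<phi> (y k \<theta>) = y j (compose {..j} \<theta> \<phi>))"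

definition trivial_fibration :: "'u sset \<Rightarrow> 'v sset \<Rightarrow> (nat \<Rightarrow> 'u \<Rightarrow> 'v) \<Rightarrow> bool" where
  "trivial_fibration E B f \<longleftrightarrow>
     (\<forall>p y. \<forall>b\<in>simp B p. boundary_family E p y \<longrightarrow>
        (\<forall>k<p. \<forall>\<theta>\<in>simplex_hom k p. f k (y k \<theta>) = act B k p \<theta> b) \<longrightarrow>
        (\<exists>z\<in>simp E p. f p z = b \<and> (\<forall>k<p. \<forall>\<theta>\<in>simplex_hom k p. act E k p \<theta> z = y k \<theta>)))"

definition fillable :: "'u sset \<Rightarrow> bool" where
  "fillable E \<longleftrightarrow>
     (\<forall>p y. boundary_family E p y \<longrightarrow>
        (\<exists>z\<in>simp E p. \<forall>k<p. \<forall>\<theta>\<in>simplex_hom k p. act E k p \<theta> z = y k \<theta>))"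

definition natural_on :: "nat set \<Rightarrow> 'u sset \<Rightarrow> 'v sset \<Rightarrow> (nat \<Rightarrow> 'u \<Rightarrow> 'v) \<Rightarrow> bool" where
  "natural_on D X E w \<longleftrightarrow>
     (\<forall>n\<in>D. \<forall>x\<in>simp X n. w n x \<in> simp E n) \<and>
     (\<forall>m\<in>D. \<forall>n\<in>D. \<forall>\<theta>\<in>simplex_hom m n. \<forall>x\<in>simp X n. w m (act X m n \<theta> x) = act E m n \<theta> (w n x))"

lemma natural_onD:
  assumes "natural_on D X E w"
  shows "n \<in> D \<Longrightarrow> x \<in> simp X n \<Longrightarrow> w n x \<in> simp E n"
    "m \<in> D \<Longrightarrow> n \<in> D \<Longrightarrow> \<theta> \<in> simplex_hom m n \<Longrightarrow> x \<in> simp X n \<Longrightarrow>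
       w m (act X m n \<theta> x) = act E m n \<theta> (w n x)"
  using assms unfolding natural_on_def by blast+

lemma lift_simplex:
  assumes X: "simplicial_set X" and E: "simplicial_set E" and B: "simplicial_set B"
    and f: "natural_on UNIV E B f"
    and tf: "trivial_fibration E B f"
    and y: "natural_on {..n} X B y"
    and w: "natural_on {..<n} X E w"
    and fw: "\<And>k x. k < n \<Longrightarrow> x \<in> simp X k \<Longrightarrow> f k (w k x) = y k x"
    and x: "x \<in> simp X n"
  shows "\<exists>u\<in>simp E n. f n u = y n x \<and>
    (\<forall>k<n. \<forall>\<theta>\<in>simplex_hom k n. act E k n \<theta> u = w k (act X k n \<theta> x)) \<and>
    (\<forall>k<n. \<forall>\<sigma>\<in>simplex_hom n k. \<forall>x'\<in>simp X k. x = act X n k \<sigma> x' \<longrightarrow> u = act E n k \<sigma> (w k x'))"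
proof (cases "\<exists>k<n. \<exists>\<sigma>\<in>simplex_hom n k. \<exists>x'\<in>simp X k. x = act X n k \<sigma> x'")
  case True
  have faces: "act E j n \<theta> (act E n k \<sigma> (w k x')) = w j (act X j n \<theta> x)"
    if "k < n" "\<sigma> \<in> simplex_hom n k" "x' \<in> simp X k" "x = act X n k \<sigma> x'" "j < n" "\<theta> \<in> simplex_hom j n"
    for j \<theta> k \<sigma> x'
  proof -
    have "act E j n \<theta> (act E n k \<sigma> (w k x')) = act E j k (compose {..j} \<sigma> \<theta>) (w k x')"
      using that natural_onD(1)[OF w] by (intro act_act[OF E]) auto
    also have "\<dots> = w j (act X j k (compose {..j} \<sigma> \<theta>) x')"
      using that by (subst natural_onD(2)[OF w]) auto
    also have "act X j k (compose {..j} \<sigma> \<theta>) x' = act X j n \<theta> x"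
      using that by (simp add: act_act[OF X])
    finally show ?thesis .
  qed
  from True obtain k \<sigma> x' where k: "k < n" "\<sigma> \<in> simplex_hom n k" "x' \<in> simp X k" "x = act X n k \<sigma> x'"
    by blast
  have wx': "w k x' \<in> simp E k" using natural_onD(1)[OF w] k by auto
  show ?thesis
  proof (intro bexI[of _ "act E n k \<sigma> (w k x')"] conjI allI impI ballI)
    show "f n (act E n k \<sigma> (w k x')) = y n x"
      using natural_onD(2)[OF f] natural_onD(2)[OF y] k wx' fw by auto
    show "act E j n \<theta> (act E n k \<sigma> (w k x')) = w j (act X j n \<theta> x)"
      if "j < n" "\<theta> \<in> simplex_hom j n" for j \<theta> using faces k that by blast
    show "act E n k \<sigma> (w k x') = act E n k' \<sigma>' (w k' x'')"
      if "k' < n" "\<sigma>' \<in> simplex_hom n k'" "x'' \<in> simp X k'" "x = act X n k' \<sigma>' x''" for k' \<sigma>' x''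
    proof (rule degenerate_eqI[OF E k(2,1) wx' refl that(2,1) _ refl])
      show "w k' x'' \<in> simp E k'" using natural_onD(1)[OF w] that by auto
      fix j \<theta> assume "j < n" "\<theta> \<in> simplex_hom j n"
      then show "act E j n \<theta> (act E n k \<sigma> (w k x')) = act E j n \<theta> (act E n k' \<sigma>' (w k' x''))"
        using faces[OF k] faces[OF that] by simp
    qed
    show "act E n k \<sigma> (w k x') \<in> simp E n" using act_closed[OF E] k wx' by blast
  qed
next
  case False
  have "boundary_family E n (\<lambda>k \<theta>. w k (act X k n \<theta> x))"
    unfolding boundary_family_def
  proof (intro conjI allI impI ballI)
    fix k \<theta> assume "k < n" "\<theta> \<in> simplex_hom k n"
    then show "w k (act X k n \<theta> x) \<in> simp E k" using natural_onD(1)[OF w] act_closed[OF X] x by auto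
  next
    fix j k \<phi> \<theta> assume "j < n" "k < n" "\<phi> \<in> simplex_hom j k" "\<theta> \<in> simplex_hom k n"
    then show "act E j k \<phi> (w k (act X k n \<theta> x)) = w j (act X j n (compose {..j} \<theta> \<phi>) x)"
      using natural_onD(2)[OF w, of j k \<phi>, symmetric] act_closed[OF X] act_act[OF X] x by auto
  qed
  moreover have "f k (w k (act X k n \<theta> x)) = act B k n \<theta> (y n x)"
    if "k < n" "\<theta> \<in> simplex_hom k n" for k \<theta>
    using fw[OF that(1) act_closed[OF X that(2) x]] natural_onD(2)[OF y, of k n \<theta> x] that x by auto
  moreover have "y n x \<in> simp B n" using natural_onD(1)[OF y] x by auto
  ultimately obtain u where "u \<in> simp E n" "f n u = y n x"
    "\<forall>k<n. \<forall>\<theta>\<in>simplex_hom k n. act E k n \<theta> u = w k (act X k n \<theta> x)"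
    using tf unfolding trivial_fibration_def by blast
  with False show ?thesis by blast
qed

lemma lift_level:
  assumes X: "simplicial_set X" and E: "simplicial_set E" and B: "simplicial_set B"
    and f: "natural_on UNIV E B f"
    and tf: "trivial_fibration E B f"
    and y: "natural_on {..n} X B y"
    and w: "natural_on {..<n} X E w"
    and fw: "\<And>k x. k < n \<Longrightarrow> x \<in> simp X k \<Longrightarrow> f k (w k x) = y k x"
  shows "\<exists>w'. natural_on {..n} X E w' \<and> (\<forall>k\<le>n. \<forall>x\<in>simp X k. f k (w' k x) = y k x) \<and>
    (\<forall>k<n. w' k = w k)"
proof -
  define P where "P x u \<longleftrightarrow> u \<in> simp E n \<and> f n u = y n x \<and>
    (\<forall>k<n. \<forall>\<theta>\<in>simplex_hom k n. act E k n \<theta> u = w k (act X k n \<theta> x)) \<and>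
    (\<forall>k<n. \<forall>\<sigma>\<in>simplex_hom n k. \<forall>x'\<in>simp X k. x = act X n k \<sigma> x' \<longrightarrow> u = act E n k \<sigma> (w k x'))" for x u
  define g where "g x = (SOME u. P x u)" for x
  have g: "P x (g x)" if "x \<in> simp X n" for x
    unfolding g_def
  proof (rule someI_ex)
    show "\<exists>u. P x u" using lift_simplex[OF assms that] unfolding P_def Bex_def .
  qed
  have gE: "g x \<in> simp E n" and gf: "f n (g x) = y n x" if "x \<in> simp X n" for x
    using g[OF that] unfolding P_def by blast+
  have ga: "act E k n \<theta> (g x) = w k (act X k n \<theta> x)"
    if "k < n" "\<theta> \<in> simplex_hom k n" "x \<in> simp X n" for k \<theta> x
    using g[OF that(3)] that unfolding P_def by blast
  have gb: "g (act X n k \<sigma> x) = act E n k \<sigma> (w k x)"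
    if "k < n" "\<sigma> \<in> simplex_hom n k" "x \<in> simp X k" for k \<sigma> x
    using g[OF act_closed[OF X that(2,3)]] that unfolding P_def by blast
  define w' where "w' = w(n := g)"
  have "natural_on {..n} X E w'"
    unfolding natural_on_def
  proof (intro conjI ballI)
    fix k x assume "k \<in> {..n}" "x \<in> simp X k"
    then show "w' k x \<in> simp E k"
      using gE[of x] natural_onD(1)[OF w, of k x] by (cases "k = n") (auto simp: w'_def)
  next
    fix k m \<theta> x assume km: "k \<in> {..n}" "m \<in> {..n}" "\<theta> \<in> simplex_hom k m" "x \<in> simp X m"
    consider "k < n" "m < n" | "k < n" "m = n" | "k = n" "m < n" | "k = n" "m = n"
      using km by fastforce
    then show "w' k (act X k m \<theta> x) = act E k m \<theta> (w' m x)"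
    proof cases
      case 1 then show ?thesis using natural_onD(2)[OF w, of k m] km by (simp add: w'_def)
    next
      case 2 then show ?thesis using ga km by (simp add: w'_def)
    next
      case 3 then show ?thesis using gb km by (simp add: w'_def)
    next
      case 4
      show ?thesis
      proof (cases "\<theta> = (\<lambda>j\<in>{..n}. j)")
        case True
        then show ?thesis using 4 km gE[of x] act_id[OF X] act_id[OF E] by (simp add: w'_def)
      next
        case False
        then obtain j where j: "j \<le> n" "\<forall>i\<le>n. \<theta> i \<noteq> j" using endo_misses[of \<theta> n] km 4 by auto
        then obtain n' where n: "n = Suc n'"
          using simplex_hom_le[of \<theta> n n 0] km 4 by (cases n) auto
        obtain \<rho> where \<rho>: "\<rho> \<in> simplex_hom n n'" "\<theta> = compose {..n} (coface n' j) \<rho>"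
          using factor_coface[of \<theta> n n' j] j km 4 n by metis
        have x: "x \<in> simp X n" using km 4 by simp
        have c: "coface n' j \<in> simplex_hom n' n" using n by simp
        have d: "act X n' n (coface n' j) x \<in> simp X n'" using act_closed[OF X c x] .
        have e: "act X n n \<theta> x = act X n n' \<rho> (act X n' n (coface n' j) x)"
          using act_act[OF X \<rho>(1) c x] \<rho>(2) by simp
        have "g (act X n n \<theta> x) = act E n n' \<rho> (w n' (act X n' n (coface n' j) x))"
          using gb[OF _ \<rho>(1) d] n unfolding e by simp
        also have "w n' (act X n' n (coface n' j) x) = act E n' n (coface n' j) (g x)"
          using ga[OF _ c x] n by simp
        also have "act E n n' \<rho> (act E n' n (coface n' j) (g x)) = act E n n \<theta> (g x)"
          using act_act[OF E \<rho>(1) c] gE[OF x] \<rho>(2) by simp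
        finally show ?thesis using 4 by (simp add: w'_def)
      qed
    qed
  qed
  moreover have "\<forall>k\<le>n. \<forall>x\<in>simp X k. f k (w' k x) = y k x"
    using gf fw by (auto simp: w'_def)
  ultimately show ?thesis by (intro exI[of _ w']) (simp add: w'_def)
qed

lemma trivial_fibration_lift:
  assumes X: "simplicial_set X" and E: "simplicial_set E" and B: "simplicial_set B"
    and f: "natural_on UNIV E B f"
    and tf: "trivial_fibration E B f"
    and D: "\<And>m n. n \<in> D \<Longrightarrow> m \<le> n \<Longrightarrow> m \<in> D"
    and y: "natural_on D X B y"
  obtains w where "natural_on D X E w" "\<And>n x. n \<in> D \<Longrightarrow> x \<in> simp X n \<Longrightarrow> f n (w n x) = y n x"
proof -
  define P where "P n w \<longleftrightarrow> natural_on (D \<inter> {..<n}) X E w \<and>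
    (\<forall>k\<in>D \<inter> {..<n}. \<forall>x\<in>simp X k. f k (w k x) = y k x)" for n w
  have "\<exists>F. \<forall>n. P n (F n) \<and> (\<forall>k<n. F (Suc n) k = F n k)"
  proof (rule dependent_nat_choice)
    show "\<exists>w. P 0 w" by (auto simp: P_def natural_on_def)
    fix w n assume w: "P n w"
    show "\<exists>w'. P (Suc n) w' \<and> (\<forall>k<n. w' k = w k)"
    proof (cases "n \<in> D")
      case True
      then have D1: "D \<inter> {..<n} = {..<n}" "D \<inter> {..<Suc n} = {..n}" using D by fastforce+
      have "natural_on {..n} X B y" using y D[OF True] unfolding natural_on_def by auto
      with w show ?thesis
        unfolding P_def D1 using lift_level[OF X E B f tf, of n y w] by auto
    next
      case False
      then have "D \<inter> {..<Suc n} = D \<inter> {..<n}" by (auto simp: less_Suc_eq)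
      with w show ?thesis by (auto simp: P_def)
    qed
  qed
  then obtain F where F: "\<And>n. P n (F n)" "\<And>n k. k < n \<Longrightarrow> F (Suc n) k = F n k" by blast
  have stable: "F n k = F (Suc k) k" if "k < n" for n k
  proof -
    have "Suc k \<le> n" using that by simp
    then show ?thesis by (induction n rule: dec_induct) (use F(2) in auto)
  qed
  define w where "w k = F (Suc k) k" for k
  show thesis
  proof
    show "natural_on D X E w"
      unfolding natural_on_def
    proof (intro conjI ballI)
      fix n x assume "n \<in> D" "x \<in> simp X n"
      then show "w n x \<in> simp E n"
        using F(1)[of "Suc n"] natural_onD(1)[of "D \<inter> {..<Suc n}" X E "F (Suc n)" n x]
        by (auto simp: w_def P_def)
    next
      fix m n \<theta> x assume mn: "m \<in> D" "n \<in> D" "\<theta> \<in> simplex_hom m n" "x \<in> simp X n"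
      define N where "N = Suc (max m n)"
      have "w m = F N m" "w n = F N n" 
        using stable[of m N] stable[of n N] by (simp_all add: w_def N_def)
      then show "w m (act X m n \<theta> x) = act E m n \<theta> (w n x)"
        using F(1)[of N] natural_onD(2)[of "D \<inter> {..<N}" X E "F N" m n \<theta> x] mn
        by (auto simp: P_def N_def)
    qed
    fix n x assume "n \<in> D" "x \<in> simp X n"
    then show "f n (w n x) = y n x" using F(1)[of "Suc n"] by (auto simp: w_def P_def)
  qed
qed

lemma linear_mapsD:
  assumes "f \<in> linear_maps R M N"
  shows "x \<in> carrier M \<Longrightarrow> f x \<in> carrier N"
    "x \<in> carrier M \<Longrightarrow> y \<in> carrier M \<Longrightarrow> f (x \<oplus>\<^bsub>M\<^esub> y) = f x \<oplus>\<^bsub>N\<^esub> f y"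
    "r \<in> carrier R \<Longrightarrow> x \<in> carrier M \<Longrightarrow> f (r \<odot>\<^bsub>M\<^esub> x) = r \<odot>\<^bsub>N\<^esub> f x"
  using assms unfolding linear_maps_def by auto

lemma linear_mapsI:
  assumes "\<And>x. x \<in> carrier M \<Longrightarrow> f x \<in> carrier N"
    "\<And>x y. x \<in> carrier M \<Longrightarrow> y \<in> carrier M \<Longrightarrow> f (x \<oplus>\<^bsub>M\<^esub> y) = f x \<oplus>\<^bsub>N\<^esub> f y"
    "\<And>r x. r \<in> carrier R \<Longrightarrow> x \<in> carrier M \<Longrightarrow> f (r \<odot>\<^bsub>M\<^esub> x) = r \<odot>\<^bsub>N\<^esub> f x"
  shows "f \<in> linear_maps R M N"
  using assms unfolding linear_maps_def by auto

lemma module_abelian_group: "module R M \<Longrightarrow> abelian_group M"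
  by (simp add: module_def)

lemma additive_zero:
  assumes "abelian_group M" "abelian_group N" "\<And>x. x \<in> carrier M \<Longrightarrow> f x \<in> carrier N"
    "\<And>x y. x \<in> carrier M \<Longrightarrow> y \<in> carrier M \<Longrightarrow> f (x \<oplus>\<^bsub>M\<^esub> y) = f x \<oplus>\<^bsub>N\<^esub> f y"
  shows "f \<zero>\<^bsub>M\<^esub> = \<zero>\<^bsub>N\<^esub>"
proof -
  interpret M: abelian_group M by fact
  interpret N: abelian_group N by fact
  have "f \<zero>\<^bsub>M\<^esub> \<oplus>\<^bsub>N\<^esub> f \<zero>\<^bsub>M\<^esub> = f \<zero>\<^bsub>M\<^esub>" using assms(4)[of "\<zero>\<^bsub>M\<^esub>" "\<zero>\<^bsub>M\<^esub>"] by simp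
  then show ?thesis using assms(3)[OF M.zero_closed] by (metis N.add.r_cancel_one)
qed

lemma additive_minus:
  assumes "abelian_group M" "abelian_group N" "\<And>x. x \<in> carrier M \<Longrightarrow> f x \<in> carrier N"
    "\<And>x y. x \<in> carrier M \<Longrightarrow> y \<in> carrier M \<Longrightarrow> f (x \<oplus>\<^bsub>M\<^esub> y) = f x \<oplus>\<^bsub>N\<^esub> f y"
    "x \<in> carrier M"
  shows "f (\<ominus>\<^bsub>M\<^esub> x) = \<ominus>\<^bsub>N\<^esub> f x"
proof -
  interpret M: abelian_group M by fact
  interpret N: abelian_group N by fact
  have "f (\<ominus>\<^bsub>M\<^esub> x) \<oplus>\<^bsub>N\<^esub> f x = \<zero>\<^bsub>N\<^esub>"
    using assms(4)[of "\<ominus>\<^bsub>M\<^esub> x" x] assms(5) additive_zero[OF assms(1-4)] by (simp add: M.l_neg)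
  then show ?thesis using assms by (metis N.minus_equality M.a_inv_closed)
qed

lemma linear_zero:
  assumes "module R M" "module R N" "f \<in> linear_maps R M N"
  shows "f \<zero>\<^bsub>M\<^esub> = \<zero>\<^bsub>N\<^esub>"
  using assms by (intro additive_zero[of M N f]) (auto simp: module_abelian_group linear_mapsD)

lemma linear_minus:
  assumes "module R M" "module R N" "f \<in> linear_maps R M N" "x \<in> carrier M"
  shows "f (\<ominus>\<^bsub>M\<^esub> x) = \<ominus>\<^bsub>N\<^esub> f x"
  using assms by (intro additive_minus[of M N f]) (auto simp: module_abelian_group linear_mapsD)

lemma linear_signed:
  assumes "module R M" "module R N" "f \<in> linear_maps R M N" "x \<in> carrier M"
  shows "f (signed M k x) = signed N k (f x)"
  using linear_minus[OF assms] by (simp add: signed_def)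

lemma (in abelian_group) signed_closed [simp, intro]:
  "x \<in> carrier G \<Longrightarrow> signed G k x \<in> carrier G"
  by (simp add: signed_def)

lemma (in abelian_group) minus_eq_zero_iff:
  assumes "x \<in> carrier G" "y \<in> carrier G"
  shows "x \<ominus> y = \<zero> \<longleftrightarrow> x = y"
  using assms by (metis a_minus_def add.inv_solve_right' add.inv_closed l_zero zero_closed)

section \<open>Filling boundaries\<close>

lemma fillable_if_sphere_fillers:
  fixes G :: "nat \<Rightarrow> ('g, 'x) ring_scheme"
  assumes G: "\<And>p. abelian_group (G p)"
    and E: "E = \<lparr>simp = \<lambda>p. carrier (G p), act = a\<rparr>" "simplicial_set E"
    and add: "\<And>m n \<theta> x y. \<theta> \<in> simplex_hom m n \<Longrightarrow> x \<in> carrier (G n) \<Longrightarrow> y \<in> carrier (G n) \<Longrightarrow>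
      a m n \<theta> (x \<oplus>\<^bsub>G n\<^esub> y) = a m n \<theta> x \<oplus>\<^bsub>G m\<^esub> a m n \<theta> y"
    and fill: "\<And>n v. v \<in> carrier (G n) \<Longrightarrow>
      (\<And>k \<theta> i. \<theta> \<in> simplex_hom k n \<Longrightarrow> i \<le> n \<Longrightarrow> (\<And>l. l \<le> k \<Longrightarrow> \<theta> l \<noteq> i) \<Longrightarrow> a k n \<theta> v = \<zero>\<^bsub>G k\<^esub>) \<Longrightarrow>
      \<exists>f\<in>carrier (G (Suc n)). (\<forall>i\<le>n. a n (Suc n) (coface n i) f = \<zero>\<^bsub>G n\<^esub>) \<and>
         a n (Suc n) (coface n (Suc n)) f = v"
  shows "fillable E"
  unfolding fillable_def
proof (intro allI impI)
  fix p y assume y: "boundary_family E p y"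
  interpret G: abelian_group "G k" for k by (rule G)
  have closed: "a m n \<theta> x \<in> carrier (G m)" if "\<theta> \<in> simplex_hom m n" "x \<in> carrier (G n)" for m n \<theta> x
    using act_closed[OF E(2) that(1)] that E(1) by simp
  have comp: "a k m \<phi> (a m n \<theta> x) = a k n (compose {..k} \<theta> \<phi>) x"
    if "\<phi> \<in> simplex_hom k m" "\<theta> \<in> simplex_hom m n" "x \<in> carrier (G n)" for k m n \<phi> \<theta> x
    using act_act[OF E(2) that(1,2)] that E(1) by simp
  have zero: "a m n \<theta> \<zero>\<^bsub>G n\<^esub> = \<zero>\<^bsub>G m\<^esub>" if "\<theta> \<in> simplex_hom m n" for m n \<theta>
    using additive_zero[OF G G, of n "a m n \<theta>" m] closed add that by auto
  have minus: "a m n \<theta> (\<ominus>\<^bsub>G n\<^esub> x) = \<ominus>\<^bsub>G m\<^esub> a m n \<theta> x"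
    if "\<theta> \<in> simplex_hom m n" "x \<in> carrier (G n)" for m n \<theta> x
    using additive_minus[OF G G, of n "a m n \<theta>" m x] closed add that by auto
  have diff: "a m n \<theta> (x \<ominus>\<^bsub>G n\<^esub> x') = a m n \<theta> x \<ominus>\<^bsub>G m\<^esub> a m n \<theta> x'"
    if "\<theta> \<in> simplex_hom m n" "x \<in> carrier (G n)" "x' \<in> carrier (G n)" for m n \<theta> x x'
    using that by (simp add: a_minus_def add minus)
  have y_closed: "y k \<theta> \<in> carrier (G k)" if "k < p" "\<theta> \<in> simplex_hom k p" for k \<theta>
    using y that E(1) unfolding boundary_family_def by simp
  have y_comp: "a j k \<phi> (y k \<theta>) = y j (compose {..j} \<theta> \<phi>)"
    if "j < p" "k < p" "\<phi> \<in> simplex_hom j k" "\<theta> \<in> simplex_hom k p" for j k \<phi> \<theta>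
    using y that E(1) unfolding boundary_family_def by simp
  have "\<exists>z\<in>carrier (G p). \<forall>k<p. \<forall>\<theta>\<in>simplex_hom k p. a k p \<theta> z = y k \<theta>"
  proof (cases p)
    case 0
    then show ?thesis by (auto intro!: bexI[of _ "\<zero>\<^bsub>G p\<^esub>"])
  next
    case (Suc n)
    define Q where "Q j z \<longleftrightarrow> z \<in> carrier (G p) \<and> (\<forall>k<p. \<forall>\<theta>\<in>simplex_hom k p.
      (\<exists>i<j. \<forall>l\<le>k. \<theta> l \<noteq> i) \<longrightarrow> a k p \<theta> z = y k \<theta>)" for j z
    have rest: "a k n \<theta> (y n (coface n j) \<ominus>\<^bsub>G n\<^esub> a n p (coface n j) z) = \<zero>\<^bsub>G k\<^esub>"
      if z: "Q j z" and j: "j \<le> p" and \<theta>: "k < p" "\<theta> \<in> simplex_hom k n" "i < j" "\<forall>l\<le>k. \<theta> l \<noteq> i"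
      for j z k \<theta> i
    proof -
      have c: "coface n j \<in> simplex_hom n p" using Suc by simp
      have zc: "z \<in> carrier (G p)" using z by (simp add: Q_def)
      have miss: "compose {..k} (coface n j) \<theta> l \<noteq> i" if "l \<le> k" for l
        using \<theta>(3,4) simplex_hom_le[OF \<theta>(2) that] that by (auto simp: compose_def coface_def)
      have "a k n \<theta> (y n (coface n j) \<ominus>\<^bsub>G n\<^esub> a n p (coface n j) z)
          = a k n \<theta> (y n (coface n j)) \<ominus>\<^bsub>G k\<^esub> a k n \<theta> (a n p (coface n j) z)"
        using c zc Suc \<theta> by (intro diff) (auto intro: closed y_closed)
      also have "a k n \<theta> (a n p (coface n j) z) = a k p (compose {..k} (coface n j) \<theta>) z"
        by (rule comp[OF \<theta>(2) c zc])
      also have "\<dots> = y k (compose {..k} (coface n j) \<theta>)"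
        using z \<theta>(1,3) miss simplex_hom_compose[OF \<theta>(2) c] unfolding Q_def by blast
      also have "a k n \<theta> (y n (coface n j)) = y k (compose {..k} (coface n j) \<theta>)"
        using y_comp \<theta> c Suc by simp
      finally show ?thesis
        using y_closed[of k "compose {..k} (coface n j) \<theta>"] \<theta> c by (auto simp: G.minus_eq_zero_iff)
    qed
    have Q: "\<exists>z. Q j z" if "j \<le> p" for j
      using that
    proof (induction j)
      case 0 then show ?case by (auto simp: Q_def intro!: exI[of _ "\<zero>\<^bsub>G p\<^esub>"])
    next
      case (Suc j)
      then obtain z where z: "Q j z" by auto
      have zc: "z \<in> carrier (G p)" using z by (simp add: Q_def)
      have j: "j \<le> n" using Suc \<open>p = Suc n\<close> by simp
      have c: "coface n j \<in> simplex_hom n p" and s: "codegeneracy n j \<in> simplex_hom p n"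
        using \<open>p = Suc n\<close> j by auto
      define v where "v = y n (coface n j) \<ominus>\<^bsub>G n\<^esub> a n p (coface n j) z"
      have v: "v \<in> carrier (G n)"
        unfolding v_def using c zc \<open>p = Suc n\<close> by (auto intro!: G.minus_closed y_closed closed)
      define z' where "z' = z \<oplus>\<^bsub>G p\<^esub> a p n (codegeneracy n j) v"
      have eq: "a k p \<theta> z' = a k p \<theta> z \<oplus>\<^bsub>G k\<^esub> a k n (compose {..k} (codegeneracy n j) \<theta>) v"
        if "\<theta> \<in> simplex_hom k p" for k \<theta>
        unfolding z'_def using that zc closed[OF s v] comp[OF that s v] by (simp add: add)
      have "a k p \<theta> z' = y k \<theta>" if k: "k < p" "\<theta> \<in> simplex_hom k p" "i < Suc j" "\<forall>l\<le>k. \<theta> l \<noteq> i" for k \<theta> i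
      proof (cases "\<exists>i<j. \<forall>l\<le>k. \<theta> l \<noteq> i")
        case True
        then obtain i where i: "i < j" "\<forall>l\<le>k. \<theta> l \<noteq> i" by blast
        have "\<forall>l\<le>k. compose {..k} (codegeneracy n j) \<theta> l \<noteq> i"
          using i simplex_hom_le[OF k(2)] \<open>p = Suc n\<close> by (auto simp: compose_def codegeneracy_def)
        then have "a k n (compose {..k} (codegeneracy n j) \<theta>) v = \<zero>\<^bsub>G k\<^esub>"
          unfolding v_def using rest[OF z _ k(1) _ i(1)] k s Suc.prems by simp
        moreover have "a k p \<theta> z = y k \<theta>" using z k(1,2) i unfolding Q_def by blast
        ultimately show ?thesis using eq[OF k(2)] y_closed k by simp
      next
        case False
        then have "\<forall>l\<le>k. \<theta> l \<noteq> j" using k less_Suc_eq by metis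
        then obtain \<rho> where \<rho>: "\<rho> \<in> simplex_hom k n" "\<theta> = compose {..k} (coface n j) \<rho>"
            "\<And>i. i \<le> k \<Longrightarrow> \<rho> i = (if \<theta> i < j then \<theta> i else \<theta> i - 1)"
          using factor_coface[of \<theta> k n j] k j \<open>p = Suc n\<close> by (metis le_SucI)
        have "compose {..k} (codegeneracy n j) \<theta> = \<rho>"
        proof (rule simplex_hom_eqI[OF simplex_hom_compose[OF k(2) s] \<rho>(1)])
          fix l assume "l \<le> k"
          then show "compose {..k} (codegeneracy n j) \<theta> l = \<rho> l"
            using simplex_hom_le[OF k(2), of l] \<rho>(3)[of l] \<open>\<forall>l\<le>k. \<theta> l \<noteq> j\<close> \<open>p = Suc n\<close>
            by (fastforce simp: compose_def codegeneracy_def)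
        qed
        moreover have "a k n \<rho> v = y k \<theta> \<ominus>\<^bsub>G k\<^esub> a k p \<theta> z"
          unfolding v_def using \<rho> c zc k \<open>p = Suc n\<close>
          by (subst diff) (auto intro: closed y_closed simp: y_comp comp)
        ultimately have "a k p \<theta> z' = a k p \<theta> z \<oplus>\<^bsub>G k\<^esub> (y k \<theta> \<ominus>\<^bsub>G k\<^esub> a k p \<theta> z)"
          using eq[OF k(2)] by simp
        also have "\<dots> = y k \<theta>"
          using y_closed[OF k(1,2)] closed[OF k(2) zc] by (simp add: a_minus_def G.a_lcomm G.r_neg)
        finally show ?thesis .
      qed
      then have "Q (Suc j) z'"
        unfolding Q_def using zc closed[OF s v] by (auto simp: z'_def)
      then show ?case by blast
    qed
    then obtain z where z: "Q p z" by blast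
    have zc: "z \<in> carrier (G p)" using z by (simp add: Q_def)
    have c: "coface n j \<in> simplex_hom n p" for j using Suc by simp
    define v where "v = y n (coface n p) \<ominus>\<^bsub>G n\<^esub> a n p (coface n p) z"
    have v: "v \<in> carrier (G n)"
      unfolding v_def using c zc Suc by (auto intro!: G.minus_closed y_closed closed)
    have vanish: "a k n \<theta> v = \<zero>\<^bsub>G k\<^esub>"
      if \<theta>: "\<theta> \<in> simplex_hom k n" "i \<le> n" "\<And>l. l \<le> k \<Longrightarrow> \<theta> l \<noteq> i" for k \<theta> i
    proof -
      obtain n' where n: "n = Suc n'"
        using \<theta>(2) \<theta>(3)[of 0] simplex_hom_le[OF \<theta>(1), of 0] by (cases n) auto
      obtain \<rho> where \<rho>: "\<rho> \<in> simplex_hom k n'" "\<theta> = compose {..k} (coface n' i) \<rho>"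
        using factor_coface[of \<theta> k n' i] \<theta> n by metis
      have "\<forall>l\<le>n'. coface n' i l \<noteq> i" by (auto simp: coface_def)
      then have "a n' n (coface n' i) v = \<zero>\<^bsub>G n'\<^esub>"
        unfolding v_def using rest[OF z, of n' "coface n' i" i] \<theta>(2) Suc n by simp
      then show ?thesis using comp[OF \<rho>(1), of "coface n' i" n v] v n \<rho> zero by simp
    qed
    have "\<exists>f\<in>carrier (G (Suc n)). (\<forall>i\<le>n. a n (Suc n) (coface n i) f = \<zero>\<^bsub>G n\<^esub>) \<and>
         a n (Suc n) (coface n (Suc n)) f = v"
      by (rule fill[OF v]) (rule vanish)
    then obtain f where f: "f \<in> carrier (G p)" "\<forall>i\<le>n. a n p (coface n i) f = \<zero>\<^bsub>G n\<^esub>" "a n p (coface n p) f = v"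
      unfolding Suc by blast
    have "a k p \<theta> (z \<oplus>\<^bsub>G p\<^esub> f) = y k \<theta>" if k: "k < p" "\<theta> \<in> simplex_hom k p" for k \<theta>
    proof -
      have "\<exists>i\<le>p. \<forall>l\<le>k. \<theta> l \<noteq> i"
      proof (rule ccontr)
        assume "\<not> ?thesis"
        then have "{..p} \<subseteq> \<theta> ` {..k}" by (fastforce simp: image_iff)
        then have "card {..p} \<le> card {..k}" using surj_card_le by blast
        with k show False by simp
      qed
      then obtain i where i: "i \<le> p" "\<forall>l\<le>k. \<theta> l \<noteq> i" by blast
      then obtain \<rho> where \<rho>: "\<rho> \<in> simplex_hom k n" "\<theta> = compose {..k} (coface n i) \<rho>"
        using factor_coface[of \<theta> k n i] k Suc by metis
      have sum: "a k p \<theta> (z \<oplus>\<^bsub>G p\<^esub> f) = a k p \<theta> z \<oplus>\<^bsub>G k\<^esub> a k n \<rho> (a n p (coface n i) f)"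
        using add[OF k(2) zc f(1)] comp[OF \<rho>(1) c f(1), of i] \<rho>(2) by simp
      show ?thesis
      proof (cases "i = p")
        case False
        then have "i < p" "i \<le> n" using i(1) Suc by auto
        then have "a k p \<theta> z = y k \<theta>" using z k i(2) unfolding Q_def by blast
        then show ?thesis using sum f(2) zero[OF \<rho>(1)] y_closed[OF k] \<open>i \<le> n\<close> by simp
      next
        case True
        have "a k n \<rho> v = y k \<theta> \<ominus>\<^bsub>G k\<^esub> a k p \<theta> z"
          unfolding v_def using \<rho> c zc k Suc True
          by (subst diff) (auto intro: closed y_closed simp: y_comp comp)
        then have "a k p \<theta> (z \<oplus>\<^bsub>G p\<^esub> f) = a k p \<theta> z \<oplus>\<^bsub>G k\<^esub> (y k \<theta> \<ominus>\<^bsub>G k\<^esub> a k p \<theta> z)"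
          using sum f(3) True by simp
        also have "\<dots> = y k \<theta>"
          using y_closed[OF k] closed[OF k(2) zc] by (simp add: a_minus_def G.a_lcomm G.r_neg)
        finally show ?thesis .
      qed
    qed
    then show ?thesis using zc f by (intro bexI[of _ "z \<oplus>\<^bsub>G p\<^esub> f"]) auto
  qed
  then show "\<exists>z\<in>simp E p. \<forall>k<p. \<forall>\<theta>\<in>simplex_hom k p. act E k p \<theta> z = y k \<theta>" using E(1) by simp
qed

lemma fillableE:
  assumes "fillable E" "boundary_family E p y"
  obtains z where "z \<in> simp E p" "\<And>k \<theta>. k < p \<Longrightarrow> \<theta> \<in> simplex_hom k p \<Longrightarrow> act E k p \<theta> z = y k \<theta>"
  using assms unfolding fillable_def by blast

section \<open>Acyclic simplicial complexes\<close>

locale acyclic_simplicial_complex =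
  fixes G :: "nat \<Rightarrow> int \<Rightarrow> ('g, 'x) ring_scheme"
    and d :: "nat \<Rightarrow> int \<Rightarrow> 'g \<Rightarrow> 'g"
    and a :: "nat \<Rightarrow> nat \<Rightarrow> (nat \<Rightarrow> nat) \<Rightarrow> int \<Rightarrow> 'g \<Rightarrow> 'g"
    and bound :: int
  assumes group: "abelian_group (G p q)"
    and d_closed: "x \<in> carrier (G p q) \<Longrightarrow> d p q x \<in> carrier (G p (q + 1))"
    and d_add: "x \<in> carrier (G p q) \<Longrightarrow> y \<in> carrier (G p q) \<Longrightarrow>
      d p q (x \<oplus>\<^bsub>G p q\<^esub> y) = d p q x \<oplus>\<^bsub>G p (q + 1)\<^esub> d p q y"
    and d_d: "x \<in> carrier (G p q) \<Longrightarrow> d p (q + 1) (d p q x) = \<zero>\<^bsub>G p (q + 1 + 1)\<^esub>"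
    and a_simplicial: "simplicial_set \<lparr>simp = \<lambda>p. carrier (G p q), act = \<lambda>m n \<theta>. a m n \<theta> q\<rparr>"
    and a_add: "\<theta> \<in> simplex_hom m n \<Longrightarrow> x \<in> carrier (G n q) \<Longrightarrow> y \<in> carrier (G n q) \<Longrightarrow>
      a m n \<theta> q (x \<oplus>\<^bsub>G n q\<^esub> y) = a m n \<theta> q x \<oplus>\<^bsub>G m q\<^esub> a m n \<theta> q y"
    and a_d: "\<theta> \<in> simplex_hom m n \<Longrightarrow> x \<in> carrier (G n q) \<Longrightarrow>
      a m n \<theta> (q + 1) (d n q x) = d m q (a m n \<theta> q x)"
    and exact: "x \<in> carrier (G p (q + 1)) \<Longrightarrow> d p (q + 1) x = \<zero>\<^bsub>G p (q + 1 + 1)\<^esub> \<Longrightarrow>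
      \<exists>w\<in>carrier (G p q). d p q w = x"
    and bounded: "q < bound \<Longrightarrow> carrier (G p q) = {\<zero>\<^bsub>G p q\<^esub>}"
    and fill: "fillable \<lparr>simp = \<lambda>p. carrier (G p q), act = \<lambda>m n \<theta>. a m n \<theta> q\<rparr>"
begin

sublocale G: abelian_group "G p q" for p q by (rule group)

abbreviation chain_sset where
  "chain_sset q \<equiv> \<lparr>simp = \<lambda>p. carrier (G p q), act = \<lambda>m n \<theta>. a m n \<theta> q\<rparr>"

definition cocycle_sset where
  "cocycle_sset q = \<lparr>simp = \<lambda>p. {x \<in> carrier (G p q). d p q x = \<zero>\<^bsub>G p (q + 1)\<^esub>},
     act = \<lambda>m n \<theta>. a m n \<theta> q\<rparr>"

lemma a_closed: "\<theta> \<in> simplex_hom m n \<Longrightarrow> x \<in> carrier (G n q) \<Longrightarrow> a m n \<theta> q x \<in> carrier (G m q)"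
  using act_closed[OF a_simplicial[of q], of \<theta> m n x] by simp

lemma a_comp: "\<phi> \<in> simplex_hom k m \<Longrightarrow> \<theta> \<in> simplex_hom m n \<Longrightarrow> x \<in> carrier (G n q) \<Longrightarrow>
  a k m \<phi> q (a m n \<theta> q x) = a k n (compose {..k} \<theta> \<phi>) q x"
  using act_act[OF a_simplicial[of q], of \<phi> k m \<theta> n x] by simp

lemma a_zero: "\<theta> \<in> simplex_hom m n \<Longrightarrow> a m n \<theta> q \<zero>\<^bsub>G n q\<^esub> = \<zero>\<^bsub>G m q\<^esub>"
  using additive_zero[OF group group, of n q "a m n \<theta> q" m q] a_closed a_add by auto

lemma a_diff: "\<theta> \<in> simplex_hom m n \<Longrightarrow> x \<in> carrier (G n q) \<Longrightarrow> y \<in> carrier (G n q) \<Longrightarrow>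
  a m n \<theta> q (x \<ominus>\<^bsub>G n q\<^esub> y) = a m n \<theta> q x \<ominus>\<^bsub>G m q\<^esub> a m n \<theta> q y"
  using additive_minus[OF group group, of n q "a m n \<theta> q" m q y] a_closed a_add
  by (simp add: a_minus_def)

lemma d_zero: "d p q \<zero>\<^bsub>G p q\<^esub> = \<zero>\<^bsub>G p (q + 1)\<^esub>"
  using additive_zero[OF group group, of p q "d p q" p "q + 1"] d_closed d_add by auto

lemma d_diff: "x \<in> carrier (G p q) \<Longrightarrow> y \<in> carrier (G p q) \<Longrightarrow>
  d p q (x \<ominus>\<^bsub>G p q\<^esub> y) = d p q x \<ominus>\<^bsub>G p (q + 1)\<^esub> d p q y"
  using additive_minus[OF group group, of p q "d p q" p "q + 1" y] d_closed d_add
  by (simp add: a_minus_def)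

lemma cocycle_simplicial: "simplicial_set (cocycle_sset q)"
proof -
  have "d m q (a m n \<theta> q x) = \<zero>\<^bsub>G m (q + 1)\<^esub>"
    if "\<theta> \<in> simplex_hom m n" "x \<in> carrier (G n q)" "d n q x = \<zero>\<^bsub>G n (q + 1)\<^esub>" for m n \<theta> x
    using a_d[OF that(1,2)] that a_zero by simp
  then show ?thesis
    using a_simplicial[of q] unfolding simplicial_set_def cocycle_sset_def by (auto simp: Pi_iff)
qed

lemma natural_d: "natural_on UNIV (chain_sset q) (cocycle_sset (q + 1)) (\<lambda>n. d n q)"
  by (auto simp: natural_on_def cocycle_sset_def d_closed d_d a_d)

lemma trivial_fibration_d:
  assumes "fillable (cocycle_sset q)"
  shows "trivial_fibration (chain_sset q) (cocycle_sset (q + 1)) (\<lambda>n. d n q)"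
  unfolding trivial_fibration_def
proof (intro allI ballI impI)
  fix p y b
  assume b: "b \<in> simp (cocycle_sset (q + 1)) p"
    and y: "boundary_family (chain_sset q) p y"
    and yb: "\<forall>k<p. \<forall>\<theta>\<in>simplex_hom k p. d k q (y k \<theta>) = act (cocycle_sset (q + 1)) k p \<theta> b"
  obtain w where w: "w \<in> carrier (G p q)" "d p q w = b"
    using b exact[of b p q] by (auto simp: cocycle_sset_def)
  have y_closed: "y k \<theta> \<in> carrier (G k q)" if "k < p" "\<theta> \<in> simplex_hom k p" for k \<theta>
    using y that unfolding boundary_family_def by simp
  have "boundary_family (cocycle_sset q) p (\<lambda>k \<theta>. y k \<theta> \<ominus>\<^bsub>G k q\<^esub> a k p \<theta> q w)"
    unfolding boundary_family_def
  proof (intro conjI allI impI ballI)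
    fix k \<theta> assume k: "k < p" "\<theta> \<in> simplex_hom k p"
    have "d k q (y k \<theta>) = d k q (a k p \<theta> q w)"
      using yb k a_d[OF k(2) w(1)] w(2) by (simp add: cocycle_sset_def)
    then have "d k q (y k \<theta> \<ominus>\<^bsub>G k q\<^esub> a k p \<theta> q w) = \<zero>\<^bsub>G k (q + 1)\<^esub>"
      using y_closed[OF k] a_closed[OF k(2) w(1)] by (simp add: d_diff d_closed G.minus_eq_zero_iff)
    then show "y k \<theta> \<ominus>\<^bsub>G k q\<^esub> a k p \<theta> q w \<in> simp (cocycle_sset q) k"
      using y_closed[OF k] a_closed[OF k(2) w(1)] by (simp add: cocycle_sset_def)
  next
    fix j k \<phi> \<theta> assume k: "j < p" "k < p" "\<phi> \<in> simplex_hom j k" "\<theta> \<in> simplex_hom k p"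
    then show "act (cocycle_sset q) j k \<phi> (y k \<theta> \<ominus>\<^bsub>G k q\<^esub> a k p \<theta> q w)
        = y j (compose {..j} \<theta> \<phi>) \<ominus>\<^bsub>G j q\<^esub> a j p (compose {..j} \<theta> \<phi>) q w"
      using y y_closed[OF k(2,4)] a_closed[OF k(4) w(1)] a_comp[OF k(3,4) w(1)]
      by (simp add: cocycle_sset_def a_diff boundary_family_def)
  qed
  then obtain z where z: "z \<in> simp (cocycle_sset q) p"
    "\<And>k \<theta>. k < p \<Longrightarrow> \<theta> \<in> simplex_hom k p \<Longrightarrow>
      a k p \<theta> q z = y k \<theta> \<ominus>\<^bsub>G k q\<^esub> a k p \<theta> q w"
    by (rule fillableE[OF assms]) (simp add: cocycle_sset_def)
  then have zc: "z \<in> carrier (G p q)" "d p q z = \<zero>\<^bsub>G p (q + 1)\<^esub>" by (auto simp: cocycle_sset_def)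
  show "\<exists>z\<in>simp (chain_sset q) p. d p q z = b \<and>
      (\<forall>k<p. \<forall>\<theta>\<in>simplex_hom k p. act (chain_sset q) k p \<theta> z = y k \<theta>)"
  proof (intro bexI[of _ "z \<oplus>\<^bsub>G p q\<^esub> w"] conjI allI impI ballI)
    show "d p q (z \<oplus>\<^bsub>G p q\<^esub> w) = b" using zc w d_closed[OF w(1)] by (simp add: d_add)
    fix k \<theta> assume k: "k < p" "\<theta> \<in> simplex_hom k p"
    have "a k p \<theta> q (z \<oplus>\<^bsub>G p q\<^esub> w) = (y k \<theta> \<ominus>\<^bsub>G k q\<^esub> a k p \<theta> q w) \<oplus>\<^bsub>G k q\<^esub> a k p \<theta> q w"
      using k z(2) zc w by (simp add: a_add)
    also have "\<dots> = y k \<theta>"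
      using y_closed[OF k] a_closed[OF k(2) w(1)] by (simp add: a_minus_def G.a_assoc G.l_neg)
    finally show "act (chain_sset q) k p \<theta> (z \<oplus>\<^bsub>G p q\<^esub> w) = y k \<theta>" by simp
  qed (use zc w in auto)
qed

lemma fillable_cocycles: "fillable (cocycle_sset q)"
proof -
  have low: "fillable (cocycle_sset q)" if q: "q < bound" for q
    unfolding fillable_def
  proof (intro allI impI)
    fix p y assume y: "boundary_family (cocycle_sset q) p y"
    have "y k \<theta> = \<zero>\<^bsub>G k q\<^esub>" if "k < p" "\<theta> \<in> simplex_hom k p" for k \<theta>
      using y that bounded[OF q] by (auto simp: boundary_family_def cocycle_sset_def)
    then show "\<exists>z\<in>simp (cocycle_sset q) p. \<forall>k<p. \<forall>\<theta>\<in>simplex_hom k p. act (cocycle_sset q) k p \<theta> z = y k \<theta>"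
      by (intro bexI[of _ "\<zero>\<^bsub>G p q\<^esub>"]) (auto simp: cocycle_sset_def a_zero d_zero)
  qed
  have step: "fillable (cocycle_sset (q + 1))" if q: "fillable (cocycle_sset q)" for q
    unfolding fillable_def
  proof (intro allI impI)
    fix p y assume y: "boundary_family (cocycle_sset (q + 1)) p y"
    define X where "X = \<lparr>simp = \<lambda>k. simplex_hom k p, act = \<lambda>j k \<phi> \<theta>. compose {..j} \<theta> \<phi>\<rparr>"
    have X: "simplicial_set X"
      unfolding simplicial_set_def
    proof (intro conjI allI ballI)
      show "act X n n (\<lambda>j\<in>{..n}. j) \<theta> = \<theta>" if "\<theta> \<in> simp X n" for n \<theta>
        using that unfolding X_def
        by (auto simp: compose_def simplex_hom_def PiE_def extensional_def fun_eq_iff)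
      show "act X k m \<phi> (act X m n \<theta> x) = act X k n (compose {..k} \<theta> \<phi>) x"
        if "\<phi> \<in> simplex_hom k m" "\<theta> \<in> simplex_hom m n" "x \<in> simp X n" for k m n \<phi> \<theta> x
        using simplex_hom_le[OF that(1)] by (auto simp: X_def compose_def fun_eq_iff)
    qed (auto simp: X_def)
    have y': "natural_on {..<p} X (cocycle_sset (q + 1)) y"
      using y by (auto simp: natural_on_def boundary_family_def X_def)
    obtain w where w: "natural_on {..<p} X (chain_sset q) w"
      "\<And>k \<theta>. k \<in> {..<p} \<Longrightarrow> \<theta> \<in> simp X k \<Longrightarrow> d k q (w k \<theta>) = y k \<theta>"
    proof (rule trivial_fibration_lift[OF X a_simplicial cocycle_simplicial natural_d
          trivial_fibration_d[OF q] _ y'])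
      show "m \<in> {..<p}" if "n \<in> {..<p}" "m \<le> n" for m n using that by simp
    qed (rule that)
    have "boundary_family (chain_sset q) p w"
      using w(1) by (auto simp: natural_on_def boundary_family_def X_def)
    then obtain z where z: "z \<in> carrier (G p q)"
      "\<And>k \<theta>. k < p \<Longrightarrow> \<theta> \<in> simplex_hom k p \<Longrightarrow> a k p \<theta> q z = w k \<theta>"
      by (rule fillableE[OF fill]) simp
    show "\<exists>z\<in>simp (cocycle_sset (q + 1)) p.
        \<forall>k<p. \<forall>\<theta>\<in>simplex_hom k p. act (cocycle_sset (q + 1)) k p \<theta> z = y k \<theta>"
    proof (intro bexI[of _ "d p q z"] allI impI ballI)
      fix k \<theta> assume "k < p" "\<theta> \<in> simplex_hom k p"
      then show "act (cocycle_sset (q + 1)) k p \<theta> (d p q z) = y k \<theta>"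
        using z w(2) a_d by (simp add: cocycle_sset_def X_def)
    qed (use z in \<open>auto simp: cocycle_sset_def d_closed d_d\<close>)
  qed
  show ?thesis
  proof (cases "q < bound")
    case False
    then have "bound - 1 \<le> q" by simp
    then show ?thesis by (induction q rule: int_ge_induct) (auto intro: low step)
  qed (rule low)
qed

lemma lift_cocycle:
  assumes "simplicial_set X" "natural_on UNIV X (chain_sset (q + 1)) y"
    and "\<And>n x. x \<in> simp X n \<Longrightarrow> d n (q + 1) (y n x) = \<zero>\<^bsub>G n (q + 1 + 1)\<^esub>"
  obtains w where "natural_on UNIV X (chain_sset q) w" "\<And>n x. x \<in> simp X n \<Longrightarrow> d n q (w n x) = y n x"
proof -
  have y: "natural_on UNIV X (cocycle_sset (q + 1)) y"
    using assms(2,3) by (auto simp: natural_on_def cocycle_sset_def)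
  show thesis
    by (rule trivial_fibration_lift[OF assms(1) a_simplicial cocycle_simplicial natural_d
        trivial_fibration_d[OF fillable_cocycles] _ y]) (use that in auto)
qed

end

lemma tensor_cochain_mapsD:
  assumes "b \<in> tensor_cochain_maps R C D E"
  shows "x \<in> carrier (deg C p) \<Longrightarrow> b p q x \<in> linear_maps R (deg D q) (deg E (p + q))"
    "y \<in> carrier (deg D q) \<Longrightarrow> (\<lambda>x. b p q x y) \<in> linear_maps R (deg C p) (deg E (p + q))"
    "x \<in> carrier (deg C p) \<Longrightarrow> y \<in> carrier (deg D q) \<Longrightarrow>
       dif E (p + q) (b p q x y) =
         b (p + 1) q (dif C p x) y
           \<oplus>\<^bsub>deg E (p + q + 1)\<^esub> signed (deg E (p + q + 1)) p (b p (q + 1) x (dif D q y))"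
  using assms unfolding tensor_cochain_maps_def by auto

lemma tensor_cochain_mapsI:
  assumes "\<And>p q x. x \<in> carrier (deg C p) \<Longrightarrow> b p q x \<in> linear_maps R (deg D q) (deg E (p + q))"
    "\<And>p q y. y \<in> carrier (deg D q) \<Longrightarrow> (\<lambda>x. b p q x y) \<in> linear_maps R (deg C p) (deg E (p + q))"
    "\<And>p q x y. x \<in> carrier (deg C p) \<Longrightarrow> y \<in> carrier (deg D q) \<Longrightarrow>
       dif E (p + q) (b p q x y) =
         b (p + 1) q (dif C p x) y
           \<oplus>\<^bsub>deg E (p + q + 1)\<^esub> signed (deg E (p + q + 1)) p (b p (q + 1) x (dif D q y))"
  shows "b \<in> tensor_cochain_maps R C D E"
  using assms unfolding tensor_cochain_maps_def by auto

lemma cochain_mapsD: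
  assumes "f \<in> cochain_maps R C D"
  shows "f q \<in> linear_maps R (deg C q) (deg D q)"
    "x \<in> carrier (deg C q) \<Longrightarrow> f (q + 1) (dif C q x) = dif D q (f q x)"
  using assms unfolding cochain_maps_def by auto

lemma cochain_mapsI:
  assumes "\<And>q. f q \<in> linear_maps R (deg C q) (deg D q)"
    "\<And>q x. x \<in> carrier (deg C q) \<Longrightarrow> f (q + 1) (dif C q x) = dif D q (f q x)"
  shows "f \<in> cochain_maps R C D"
  using assms unfolding cochain_maps_def by auto

lemma dga_mapsD:
  assumes "f \<in> dga_maps R A B"
  shows "f \<in> cochain_maps R A B"
    "x \<in> carrier (deg A p) \<Longrightarrow> y \<in> carrier (deg A q) \<Longrightarrow>
       f (p + q) (dmul A p q x y) = dmul B p q (f p x) (f q y)"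
    "f 0 (dunit A) = dunit B"
  using assms unfolding dga_maps_def by auto

locale cocomplex =
  fixes R :: "('r, 'k) ring_scheme" and C :: "('r, 'm, 'l) cochains_scheme"
  assumes complex: "cochain_complex R C"
begin

lemma module_deg: "module R (deg C q)"
  using complex by (simp add: cochain_complex_def)

sublocale group: abelian_group "deg C q" for q
  by (rule module_abelian_group[OF module_deg])

sublocale mod: module R "deg C q" for q
  by (rule module_deg)

lemma d_linear: "dif C q \<in> linear_maps R (deg C q) (deg C (q + 1))"
  using complex by (simp add: cochain_complex_def)

lemmas d_closed = linear_mapsD(1)[OF d_linear]
  and d_add = linear_mapsD(2)[OF d_linear]
  and d_smult = linear_mapsD(3)[OF d_linear]
  and d_zero = linear_zero[OF module_deg module_deg d_linear]
  and d_minus = linear_minus[OF module_deg module_deg d_linear]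

lemma d_d: "x \<in> carrier (deg C q) \<Longrightarrow> dif C (q + 1) (dif C q x) = \<zero>\<^bsub>deg C (q + 1 + 1)\<^esub>"
  using complex by (simp add: cochain_complex_def add.assoc)

lemma d_closed': "x \<in> carrier (deg C (q - 1)) \<Longrightarrow> dif C (q - 1) x \<in> carrier (deg C q)"
  using d_closed[of x "q - 1"] by simp

end

locale dg_alg = cocomplex R D
  for R :: "('r, 'k) ring_scheme" and D :: "('r, 'a) dga" +
  assumes dg: "dg_algebra R D"
begin

lemma neg_deg: "q < 0 \<Longrightarrow> carrier (deg D q) = {\<zero>\<^bsub>deg D q\<^esub>}"
  using dg by (simp add: dg_algebra_def)

lemma mul_tensor: "dmul D \<in> tensor_cochain_maps R D D D"
  using dg by (simp add: dg_algebra_def)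

lemma one_closed: "dunit D \<in> carrier (deg D 0)"
  using dg by (simp add: dg_algebra_def)

lemma mul_assoc:
  "x \<in> carrier (deg D p) \<Longrightarrow> y \<in> carrier (deg D q) \<Longrightarrow> z \<in> carrier (deg D r) \<Longrightarrow>
    dmul D (p + q) r (dmul D p q x y) z = dmul D p (q + r) x (dmul D q r y z)"
  using dg by (simp add: dg_algebra_def)

lemma one_mul: "x \<in> carrier (deg D q) \<Longrightarrow> dmul D 0 q (dunit D) x = x"
  and mul_one: "x \<in> carrier (deg D q) \<Longrightarrow> dmul D q 0 x (dunit D) = x"
  using dg by (simp_all add: dg_algebra_def)

context
  fixes p q :: int and x assumes x: "x \<in> carrier (deg D p)"
begin

lemmas mul_right_linear = tensor_cochain_mapsD(1)[OF mul_tensor x, of q]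
lemmas mul_closed = linear_mapsD(1)[OF mul_right_linear]
  and mul_add_right = linear_mapsD(2)[OF mul_right_linear]
  and mul_smult_right = linear_mapsD(3)[OF mul_right_linear]
  and mul_zero_right = linear_zero[OF module_deg module_deg mul_right_linear]
  and mul_minus_right = linear_minus[OF module_deg module_deg mul_right_linear]
  and mul_signed_right = linear_signed[OF module_deg module_deg mul_right_linear]

end

context
  fixes p q :: int and y assumes y: "y \<in> carrier (deg D q)"
begin

lemmas mul_left_linear = tensor_cochain_mapsD(2)[OF mul_tensor y, of p]
lemmas mul_add_left = linear_mapsD(2)[OF mul_left_linear]
  and mul_smult_left = linear_mapsD(3)[OF mul_left_linear]
  and mul_zero_left = linear_zero[OF module_deg module_deg mul_left_linear]
  and mul_signed_left = linear_signed[OF module_deg module_deg mul_left_linear]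

end

lemma d_mul:
  "x \<in> carrier (deg D p) \<Longrightarrow> y \<in> carrier (deg D q) \<Longrightarrow>
    dif D (p + q) (dmul D p q x y) = dmul D (p + 1) q (dif D p x) y
      \<oplus>\<^bsub>deg D (p + q + 1)\<^esub> signed (deg D (p + q + 1)) p (dmul D p (q + 1) x (dif D q y))"
  using tensor_cochain_mapsD(3)[OF mul_tensor] .

lemma mul_closed': "x \<in> carrier (deg D p) \<Longrightarrow> y \<in> carrier (deg D q) \<Longrightarrow> p + q = r \<Longrightarrow>
    dmul D p q x y \<in> carrier (deg D r)"
  using mul_closed by blast

lemma d_one: "dif D 0 (dunit D) = \<zero>\<^bsub>deg D 1\<^esub>"
proof -
  let ?d = "dif D 0 (dunit D)"
  have d: "?d \<in> carrier (deg D 1)" using d_closed[OF one_closed] by simp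
  have "?d = ?d \<oplus>\<^bsub>deg D 1\<^esub> ?d"
    using d_mul[OF one_closed one_closed] one_mul[OF one_closed] mul_one[OF d] one_mul[OF d]
    by (simp add: signed_def)
  then show ?thesis using d by (metis group.add.l_cancel_one)
qed

end

lemma dg_algI: "dg_algebra R D \<Longrightarrow> dg_alg R D"
  by (simp add: dg_alg_def cocomplex_def dg_alg_axioms_def dg_algebra_def)

locale simplicial_dg_alg =
  fixes R :: "('r, 'k) ring_scheme" and A :: "('r, 'a) sdga"
  assumes sdga: "simplicial_dga R A"
begin

sublocale dga: dg_alg R "level A p" for p
  using sdga by (intro dg_algI) (simp add: simplicial_dga_def)

lemma sact_dga: "\<theta> \<in> simplex_hom m n \<Longrightarrow> sact A m n \<theta> \<in> dga_maps R (level A n) (level A m)"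
  using sdga by (simp add: simplicial_dga_def)

lemma sact_id: "x \<in> carrier (deg (level A n) q) \<Longrightarrow> sact A n n (\<lambda>j\<in>{..n}. j) q x = x"
  using sdga by (simp add: simplicial_dga_def)

lemma sact_sact:
  "\<phi> \<in> simplex_hom k m \<Longrightarrow> \<theta> \<in> simplex_hom m n \<Longrightarrow> x \<in> carrier (deg (level A n) q) \<Longrightarrow>
    sact A k m \<phi> q (sact A m n \<theta> q x) = sact A k n (compose {..k} \<theta> \<phi>) q x"
  using sdga by (simp add: simplicial_dga_def)

context
  fixes m n \<theta> assumes \<theta>: "\<theta> \<in> simplex_hom m n"
begin

lemmas sact_linear = cochain_mapsD(1)[OF dga_mapsD(1)[OF sact_dga[OF \<theta>]]]
lemmas sact_closed = linear_mapsD(1)[OF sact_linear]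
  and sact_add = linear_mapsD(2)[OF sact_linear]
  and sact_smult = linear_mapsD(3)[OF sact_linear]
  and sact_zero = linear_zero[OF dga.module_deg dga.module_deg sact_linear]
  and sact_minus = linear_minus[OF dga.module_deg dga.module_deg sact_linear]
  and sact_d = cochain_mapsD(2)[OF dga_mapsD(1)[OF sact_dga[OF \<theta>]]]
  and sact_mul = dga_mapsD(2)[OF sact_dga[OF \<theta>]]
  and sact_one = dga_mapsD(3)[OF sact_dga[OF \<theta>]]

end

lemma sset: "simplicial_set (sdga_sset A q)"
  unfolding simplicial_set_def sdga_sset_def
  by (auto simp: sact_closed sact_id sact_sact)

end

text \<open>A path from 1 to 0 in the simplicial ring \<open>A\<^sup>0\<close>; multiplication by it contracts every
  simplicial module over this ring.\<close>

definition unit_path :: "('r, 'a) sdga \<Rightarrow> 'a \<Rightarrow> bool" where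
  "unit_path A t \<longleftrightarrow> t \<in> carrier (deg (level A 1) 0) \<and>
     sact A 0 1 (\<lambda>j\<in>{..0}. 1) 0 t = \<zero>\<^bsub>deg (level A 0) 0\<^esub> \<and>
     sact A 0 1 (\<lambda>j\<in>{..0}. 0) 0 t = dunit (level A 0)"

lemma (in simplicial_dg_alg) unit_path_exists:
  assumes "homotopy_axiom A"
  shows "\<exists>t. unit_path A t"
proof -
  let ?X = "sdga_sset A 0"
  let ?v = "\<zero>\<^bsub>deg (level A 0) 0\<^esub>"
  let ?u = "dunit (level A 0)"
  have X: "simplicially_contractible ?X" using assms by (simp add: homotopy_axiom_def)
  have v: "?v \<in> simp ?X 0" and u: "?u \<in> simp ?X 0"
    by (simp_all add: sdga_sset_def dga.one_closed)
  have sph: "spheres ?X ?v 0 = simp ?X 0" by (simp add: spheres_def)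
  obtain S where S: "homotopy_set ?X ?v 0 = {S}"
    using X v unfolding simplicially_contractible_def is_singleton_def by blast
  have same: "sphere_homotopy ?X ?v 0 `` {x} = S" if "x \<in> simp ?X 0" for x
  proof -
    have "sphere_homotopy ?X ?v 0 `` {x} \<in> homotopy_set ?X ?v 0"
      unfolding homotopy_set_def by (rule quotientI) (use that sph in simp)
    then show ?thesis using S by simp
  qed
  have face: "face ?X 0 0 z = act ?X 0 1 (\<lambda>j\<in>{..0}. 1) z"
    "face ?X 0 (Suc 0) z = act ?X 0 1 (\<lambda>j\<in>{..0}. 0) z" for z
  proof -
    have "(\<lambda>j\<in>{..0::nat}. if j < 0 then j else Suc j) = (\<lambda>j\<in>{..0}. 1)"
      "(\<lambda>j\<in>{..0::nat}. if j < Suc 0 then j else Suc j) = (\<lambda>j\<in>{..0}. 0)"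
      by (auto simp: fun_eq_iff)
    then show "face ?X 0 0 z = act ?X 0 1 (\<lambda>j\<in>{..0}. 1) z"
      "face ?X 0 (Suc 0) z = act ?X 0 1 (\<lambda>j\<in>{..0}. 0) z" by (simp_all add: face_def)
  qed
  have const: "(\<lambda>j\<in>{..m::nat}. 0) \<in> simplex_hom m 0" "(\<lambda>j\<in>{..0::nat}. c) \<in> simplex_hom 0 1"
    if "c \<le> 1" for m c using that by (auto intro!: simplex_homI)
  have "(?u, ?u) \<in> sphere_homotopy ?X ?v 0"
  proof -
    define z where "z = act ?X 1 0 (\<lambda>j\<in>{..1}. 0) ?u"
    have z: "z \<in> simp ?X 1" unfolding z_def by (intro act_closed[OF sset _ u] const(1)[of 0]) simp
    have "act ?X 0 1 (\<lambda>j\<in>{..0}. c) z = ?u" if "c \<le> 1" for c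
    proof -
      have "act ?X 0 1 (\<lambda>j\<in>{..0}. c) z = act ?X 0 0 (compose {..0} (\<lambda>j\<in>{..1}. 0) (\<lambda>j\<in>{..0}. c)) ?u"
        unfolding z_def using that by (intro act_act[OF sset _ _ u] const) auto
      also have "compose {..0} (\<lambda>j\<in>{..1}. 0) (\<lambda>j\<in>{..0}. c) = (\<lambda>j\<in>{..0::nat}. j)"
        using that by (auto simp: compose_def fun_eq_iff)
      also have "act ?X 0 0 \<dots> ?u = ?u" by (rule act_id[OF sset u])
      finally show ?thesis .
    qed
    then show ?thesis using z u unfolding sphere_homotopy_def sph
      by (auto simp: face intro!: bexI[of _ z])
  qed
  then have "(?v, ?u) \<in> sphere_homotopy ?X ?v 0" using same[OF u] same[OF v] by blast
  then obtain z where z: "z \<in> simp ?X 1" "face ?X 0 0 z = ?v" "face ?X 0 (Suc 0) z = ?u"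
    unfolding sphere_homotopy_def by auto
  then have "unit_path A z" unfolding unit_path_def face by (simp add: sdga_sset_def)
  then show ?thesis by blast
qed

context simplicial_dg_alg
begin

context
  fixes t assumes t: "unit_path A t"
begin

text \<open>The pull-back of the path along the map to [1] with fibres \<open>{..<i}\<close> and \<open>{i..n}\<close>.\<close>

definition cut :: "nat \<Rightarrow> nat \<Rightarrow> 'a" where
  "cut n i = sact A n 1 (\<lambda>j\<in>{..n}. if i \<le> j then 1 else 0) 0 t"

lemma cut_hom: "(\<lambda>j\<in>{..n}. if i \<le> j then 1 else 0) \<in> simplex_hom n 1"
  by (rule simplex_homI) auto

lemma t_closed: "t \<in> carrier (deg (level A 1) 0)"
  using t by (simp add: unit_path_def)

lemma cut_closed: "cut n i \<in> carrier (deg (level A n) 0)"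
  unfolding cut_def by (rule sact_closed[OF cut_hom t_closed])

lemma sact_cut:
  assumes "\<theta> \<in> simplex_hom m n" "\<And>j. j \<le> m \<Longrightarrow> i \<le> \<theta> j \<longleftrightarrow> i' \<le> j"
  shows "sact A m n \<theta> 0 (cut n i) = cut m i'"
proof -
  have "compose {..m} (\<lambda>j\<in>{..n}. if i \<le> j then 1 else 0) \<theta> = (\<lambda>j\<in>{..m}. if i' \<le> j then 1 else 0)"
    using assms simplex_hom_le[OF assms(1)] by (auto simp: compose_def fun_eq_iff)
  then show ?thesis unfolding cut_def sact_sact[OF assms(1) cut_hom t_closed] by (rule arg_cong)
qed

lemma cut_const:
  assumes c: "c \<le> 1" and "\<And>j. j \<le> n \<Longrightarrow> (if i \<le> j then 1 else 0) = c"
  shows "cut n i = sact A n 0 (\<lambda>j\<in>{..n}. 0) 0 (sact A 0 1 (\<lambda>j\<in>{..0}. c) 0 t)"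
proof -
  have "compose {..n} (\<lambda>j\<in>{..0::nat}. c) (\<lambda>j\<in>{..n}. 0) = (\<lambda>j\<in>{..n}. if i \<le> j then 1 else 0)"
    using assms(2) by (auto simp: compose_def fun_eq_iff)
  then show ?thesis
    unfolding cut_def
    by (subst sact_sact[OF simplex_hom_const simplex_hom_const[OF c] t_closed]) simp_all
qed

lemma cut_0: "cut n 0 = \<zero>\<^bsub>deg (level A n) 0\<^esub>"
  using cut_const[of 1 n 0] t by (simp add: unit_path_def sact_zero)

lemma cut_Suc: "cut n (Suc n) = dunit (level A n)"
  using cut_const[of 0 n "Suc n"] t by (simp add: unit_path_def sact_one)

lemma fillable: "fillable (sdga_sset A q)"
proof (rule fillable_if_sphere_fillers[where G = "\<lambda>p. deg (level A p) q" and a = "\<lambda>m n \<theta>. sact A m n \<theta> q"])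
  fix n v
  assume v: "v \<in> carrier (deg (level A n) q)"
    and vanish: "\<And>k \<theta> i. \<theta> \<in> simplex_hom k n \<Longrightarrow> i \<le> n \<Longrightarrow> (\<And>l. l \<le> k \<Longrightarrow> \<theta> l \<noteq> i) \<Longrightarrow>
      sact A k n \<theta> q v = \<zero>\<^bsub>deg (level A k) q\<^esub>"
  let ?M = "\<lambda>n. deg (level A n) q"
  let ?\<delta> = "\<lambda>j. sact A n (Suc n) (coface n j) q"
  text \<open>The simplices of the prism, added up one after the other: a partial sum has only one
    face that need not vanish.\<close>
  have "\<exists>F\<in>carrier (?M (Suc n)). \<forall>j\<le>Suc n.
      ?\<delta> j F = (if j = i then dmul (level A n) 0 q (cut n i) v else \<zero>\<^bsub>?M n\<^esub>)"
    if "i \<le> Suc n" for i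
    using that
  proof (induction i)
    case 0
    then show ?case
      by (intro bexI[of _ "\<zero>\<^bsub>?M (Suc n)\<^esub>"])
        (auto simp: sact_zero[OF coface_hom] cut_0 dga.mul_zero_left[OF v])
  next
    case (Suc i)
    then obtain F where F: "F \<in> carrier (?M (Suc n))"
      "\<And>j. j \<le> Suc n \<Longrightarrow> ?\<delta> j F = (if j = i then dmul (level A n) 0 q (cut n i) v else \<zero>\<^bsub>?M n\<^esub>)"
      by auto
    have i: "i \<le> n" using Suc by simp
    have s: "codegeneracy n i \<in> simplex_hom (Suc n) n" using i by simp
    let ?sv = "sact A (Suc n) n (codegeneracy n i) q v"
    define h where "h = dmul (level A (Suc n)) 0 q (cut (Suc n) (Suc i)) ?sv"
    have sv: "?sv \<in> carrier (?M (Suc n))" using sact_closed[OF s v] .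
    have h: "h \<in> carrier (?M (Suc n))"
      unfolding h_def using dga.mul_closed[OF cut_closed sv] by simp
    have \<delta>h: "?\<delta> j h = (if j = i \<or> j = Suc i then dmul (level A n) 0 q (cut n j) v else \<zero>\<^bsub>?M n\<^esub>)"
      if j: "j \<le> Suc n" for j
    proof -
      have 1: "?\<delta> j h = dmul (level A n) 0 q (sact A n (Suc n) (coface n j) 0 (cut (Suc n) (Suc i)))
          (sact A n n (compose {..n} (codegeneracy n i) (coface n j)) q v)"
        unfolding h_def using sact_mul[OF coface_hom cut_closed sv]
          sact_sact[OF coface_hom s v] by simp
      show ?thesis
      proof (cases "j = i \<or> j = Suc i")
        case True
        have "compose {..n} (codegeneracy n i) (coface n j) = (\<lambda>j\<in>{..n}. j)"
          using True by (auto simp: compose_def codegeneracy_def coface_def fun_eq_iff)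
        moreover have "sact A n (Suc n) (coface n j) 0 (cut (Suc n) (Suc i)) = cut n j"
          by (rule sact_cut[OF coface_hom]) (use True in \<open>auto simp: coface_def\<close>)
        ultimately show ?thesis using 1 True sact_id[OF v] by simp
      next
        case False
        define i' where "i' = (if j < i then j else j - 1)"
        have "sact A n n (compose {..n} (codegeneracy n i) (coface n j)) q v = \<zero>\<^bsub>?M n\<^esub>"
        proof (rule vanish[of _ _ i'])
          show "i' \<le> n" using False j i by (auto simp: i'_def)
          fix l assume "l \<le> n"
          then show "compose {..n} (codegeneracy n i) (coface n j) l \<noteq> i'"
            using False by (auto simp: i'_def compose_def codegeneracy_def coface_def)
        qed (use s in auto)
        then show ?thesis
          using 1 False dga.mul_zero_right[OF sact_closed[OF coface_hom cut_closed]] by simp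
      qed
    qed
    show ?case
    proof (intro bexI[of _ "h \<ominus>\<^bsub>?M (Suc n)\<^esub> F"] allI impI)
      fix j assume j: "j \<le> Suc n"
      have c: "dmul (level A n) 0 q (cut n j) v \<in> carrier (?M n)"
        using dga.mul_closed[OF cut_closed v] by simp
      have "?\<delta> j (h \<ominus>\<^bsub>?M (Suc n)\<^esub> F) = ?\<delta> j h \<ominus>\<^bsub>?M n\<^esub> ?\<delta> j F"
        using h F(1) by (simp add: a_minus_def sact_add[OF coface_hom] sact_minus[OF coface_hom])
      then show "?\<delta> j (h \<ominus>\<^bsub>?M (Suc n)\<^esub> F)
          = (if j = Suc i then dmul (level A n) 0 q (cut n (Suc i)) v else \<zero>\<^bsub>?M n\<^esub>)"
        using \<delta>h[OF j] F(2)[OF j] c by (auto simp: a_minus_def dga.group.r_neg)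
    qed (use h F in auto)
  qed
  from this[of "Suc n"] obtain F where F: "F \<in> carrier (?M (Suc n))"
    "\<And>j. j \<le> Suc n \<Longrightarrow> ?\<delta> j F = (if j = Suc n then v else \<zero>\<^bsub>?M n\<^esub>)"
    by (auto simp: cut_Suc dga.one_mul[OF v])
  show "\<exists>f\<in>carrier (?M (Suc n)). (\<forall>i\<le>n. ?\<delta> i f = \<zero>\<^bsub>?M n\<^esub>) \<and> ?\<delta> (Suc n) f = v"
    using F by (intro bexI[of _ F]) auto
qed (use sset[of q] in \<open>simp_all add: sact_add dga.group.abelian_group_axioms sdga_sset_def\<close>)

end

end

section \<open>Quasi-isomorphisms\<close>

definition quis ::
  "('r, 'm, 'l) cochains_scheme \<Rightarrow> ('r, 'n, 'l2) cochains_scheme \<Rightarrow> (int \<Rightarrow> 'm \<Rightarrow> 'n) \<Rightarrow> bool" where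
  "quis C D f \<longleftrightarrow>
     (\<forall>q. \<forall>x\<in>cocycles C q. f q x \<in> coboundaries D q \<longrightarrow> x \<in> coboundaries C q) \<and>
     (\<forall>q. \<forall>z\<in>cocycles D q. \<exists>x\<in>cocycles C q. \<exists>b\<in>coboundaries D q. z = f q x \<oplus>\<^bsub>deg D q\<^esub> b)"

lemma quisD:
  assumes "quis C D f"
  shows "x \<in> cocycles C q \<Longrightarrow> f q x \<in> coboundaries D q \<Longrightarrow> x \<in> coboundaries C q"
    "z \<in> cocycles D q \<Longrightarrow> \<exists>x\<in>cocycles C q. \<exists>b\<in>coboundaries D q. z = f q x \<oplus>\<^bsub>deg D q\<^esub> b"
  using assms unfolding quis_def by blast+

lemma quisI:
  assumes "\<And>q x. x \<in> cocycles C q \<Longrightarrow> f q x \<in> coboundaries D q \<Longrightarrow> x \<in> coboundaries C q"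
    "\<And>q z. z \<in> cocycles D q \<Longrightarrow> \<exists>x\<in>cocycles C q. \<exists>b\<in>coboundaries D q. z = f q x \<oplus>\<^bsub>deg D q\<^esub> b"
  shows "quis C D f"
  using assms unfolding quis_def by blast

context cocomplex
begin

lemma cocycles_closed: "x \<in> cocycles C q \<Longrightarrow> x \<in> carrier (deg C q)"
  by (simp add: cocycles_def)

lemma cocycles_add: "x \<in> cocycles C q \<Longrightarrow> y \<in> cocycles C q \<Longrightarrow> x \<oplus>\<^bsub>deg C q\<^esub> y \<in> cocycles C q"
  by (simp add: cocycles_def d_add)

lemma cocycles_minus: "x \<in> cocycles C q \<Longrightarrow> \<ominus>\<^bsub>deg C q\<^esub> x \<in> cocycles C q"
  by (simp add: cocycles_def d_minus)

lemma coboundaries_cocycles: "coboundaries C q \<subseteq> cocycles C q"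
  using d_d[of _ "q - 1"] d_closed[of _ "q - 1"] by (auto simp: coboundaries_def cocycles_def)

lemma coboundaries_add:
  assumes "x \<in> coboundaries C q" "y \<in> coboundaries C q"
  shows "x \<oplus>\<^bsub>deg C q\<^esub> y \<in> coboundaries C q"
proof -
  obtain u v where "u \<in> carrier (deg C (q - 1))" "v \<in> carrier (deg C (q - 1))"
    "x = dif C (q - 1) u" "y = dif C (q - 1) v" using assms by (auto simp: coboundaries_def)
  then show ?thesis
    using d_add[of u "q - 1" v] by (auto simp: coboundaries_def intro!: image_eqI[of _ _ "u \<oplus>\<^bsub>deg C (q - 1)\<^esub> v"])
qed

lemma coboundaries_minus:
  assumes "x \<in> coboundaries C q"
  shows "\<ominus>\<^bsub>deg C q\<^esub> x \<in> coboundaries C q"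
proof -
  obtain u where "u \<in> carrier (deg C (q - 1))" "x = dif C (q - 1) u"
    using assms by (auto simp: coboundaries_def)
  then show ?thesis
    using d_minus[of u "q - 1"] by (auto simp: coboundaries_def intro!: image_eqI[of _ _ "\<ominus>\<^bsub>deg C (q - 1)\<^esub> u"])
qed

lemma coboundaries_zero: "\<zero>\<^bsub>deg C q\<^esub> \<in> coboundaries C q"
  using d_zero[of "q - 1"] unfolding coboundaries_def
  by (intro image_eqI[of _ _ "\<zero>\<^bsub>deg C (q - 1)\<^esub>"]) simp_all

lemma coboundaries_closed: "x \<in> coboundaries C q \<Longrightarrow> x \<in> carrier (deg C q)"
  using coboundaries_cocycles cocycles_closed by blast

lemma coset_eq_iff:
  assumes "x \<in> cocycles C q" "y \<in> cocycles C q"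
  shows "coboundaries C q +>\<^bsub>deg C q\<^esub> x = coboundaries C q +>\<^bsub>deg C q\<^esub> y \<longleftrightarrow>
    x \<ominus>\<^bsub>deg C q\<^esub> y \<in> coboundaries C q"
proof
  note c = cocycles_closed[OF assms(1)] cocycles_closed[OF assms(2)]
  have expand: "coboundaries C q +>\<^bsub>deg C q\<^esub> z = {b \<oplus>\<^bsub>deg C q\<^esub> z | b. b \<in> coboundaries C q}" for z
    by (auto simp: a_r_coset_def r_coset_def)
  {
    assume "coboundaries C q +>\<^bsub>deg C q\<^esub> x = coboundaries C q +>\<^bsub>deg C q\<^esub> y"
    moreover have "x \<in> coboundaries C q +>\<^bsub>deg C q\<^esub> x"
      unfolding expand using coboundaries_zero c by force
    ultimately obtain b where b: "b \<in> coboundaries C q" "x = b \<oplus>\<^bsub>deg C q\<^esub> y" unfolding expand by auto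
    then have "x \<ominus>\<^bsub>deg C q\<^esub> y = b"
      using c coboundaries_closed by (simp add: a_minus_def group.a_assoc group.r_neg)
    then show "x \<ominus>\<^bsub>deg C q\<^esub> y \<in> coboundaries C q" using b by simp
  }
  have half: "coboundaries C q +>\<^bsub>deg C q\<^esub> u \<subseteq> coboundaries C q +>\<^bsub>deg C q\<^esub> v"
    if "u \<ominus>\<^bsub>deg C q\<^esub> v \<in> coboundaries C q" "u \<in> carrier (deg C q)" "v \<in> carrier (deg C q)" for u v
  proof
    fix z assume "z \<in> coboundaries C q +>\<^bsub>deg C q\<^esub> u"
    then obtain b where b: "b \<in> coboundaries C q" "z = b \<oplus>\<^bsub>deg C q\<^esub> u" unfolding expand by auto
    have "z = (b \<oplus>\<^bsub>deg C q\<^esub> (u \<ominus>\<^bsub>deg C q\<^esub> v)) \<oplus>\<^bsub>deg C q\<^esub> v"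
      using b that coboundaries_closed by (simp add: a_minus_def group.a_assoc group.l_neg)
    then show "z \<in> coboundaries C q +>\<^bsub>deg C q\<^esub> v"
      unfolding expand using coboundaries_add[OF b(1) that(1)] by blast
  qed
  assume "x \<ominus>\<^bsub>deg C q\<^esub> y \<in> coboundaries C q"
  moreover from coboundaries_minus[OF this] have "y \<ominus>\<^bsub>deg C q\<^esub> x \<in> coboundaries C q"
    using c by (simp add: a_minus_def group.minus_add group.a_comm)
  ultimately show "coboundaries C q +>\<^bsub>deg C q\<^esub> x = coboundaries C q +>\<^bsub>deg C q\<^esub> y"
    using half c by blast
qed

lemma cohomology_carrier:
  "carrier (cohomology C q) = (\<lambda>x. coboundaries C q +>\<^bsub>deg C q\<^esub> x) ` cocycles C q"
  by (auto simp: cohomology_def A_FactGroup_def' A_RCOSETS_def' a_r_coset_def r_coset_def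
      FactGroup_def RCOSETS_def)

lemma cohomology_mult:
  assumes "x \<in> cocycles C q" "y \<in> cocycles C q"
  shows "(coboundaries C q +>\<^bsub>deg C q\<^esub> x) \<otimes>\<^bsub>cohomology C q\<^esub> (coboundaries C q +>\<^bsub>deg C q\<^esub> y)
    = coboundaries C q +>\<^bsub>deg C q\<^esub> (x \<oplus>\<^bsub>deg C q\<^esub> y)"
proof -
  have expand: "coboundaries C q +>\<^bsub>deg C q\<^esub> z = {b \<oplus>\<^bsub>deg C q\<^esub> z | b. b \<in> coboundaries C q}" for z
    by (auto simp: a_r_coset_def r_coset_def)
  have mult: "S \<otimes>\<^bsub>cohomology C q\<^esub> T = {s \<oplus>\<^bsub>deg C q\<^esub> t | s t. s \<in> S \<and> t \<in> T}" for S T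
    by (auto simp: cohomology_def A_FactGroup_def FactGroup_def set_mult_def)
  note c = cocycles_closed[OF assms(1)] cocycles_closed[OF assms(2)]
  show ?thesis
  proof (intro equalityI subsetI)
    fix z assume "z \<in> (coboundaries C q +>\<^bsub>deg C q\<^esub> x) \<otimes>\<^bsub>cohomology C q\<^esub> (coboundaries C q +>\<^bsub>deg C q\<^esub> y)"
    then obtain b b' where b: "b \<in> coboundaries C q" "b' \<in> coboundaries C q"
      "z = (b \<oplus>\<^bsub>deg C q\<^esub> x) \<oplus>\<^bsub>deg C q\<^esub> (b' \<oplus>\<^bsub>deg C q\<^esub> y)"
      unfolding mult expand by blast
    then have "z = (b \<oplus>\<^bsub>deg C q\<^esub> b') \<oplus>\<^bsub>deg C q\<^esub> (x \<oplus>\<^bsub>deg C q\<^esub> y)"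
      using c coboundaries_closed by (simp add: group.a_ac)
    then show "z \<in> coboundaries C q +>\<^bsub>deg C q\<^esub> (x \<oplus>\<^bsub>deg C q\<^esub> y)"
      unfolding expand using coboundaries_add[OF b(1,2)] by blast
  next
    fix z assume "z \<in> coboundaries C q +>\<^bsub>deg C q\<^esub> (x \<oplus>\<^bsub>deg C q\<^esub> y)"
    then obtain b where b: "b \<in> coboundaries C q" "z = b \<oplus>\<^bsub>deg C q\<^esub> (x \<oplus>\<^bsub>deg C q\<^esub> y)"
      unfolding expand by blast
    then have "z = (b \<oplus>\<^bsub>deg C q\<^esub> x) \<oplus>\<^bsub>deg C q\<^esub> (\<zero>\<^bsub>deg C q\<^esub> \<oplus>\<^bsub>deg C q\<^esub> y)"
      using c coboundaries_closed by (simp add: group.a_assoc)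
    then show "z \<in> (coboundaries C q +>\<^bsub>deg C q\<^esub> x) \<otimes>\<^bsub>cohomology C q\<^esub> (coboundaries C q +>\<^bsub>deg C q\<^esub> y)"
      unfolding mult expand using b coboundaries_zero by blast
  qed
qed

end

lemma cochain_maps_cocycles:
  assumes "cochain_complex R C" "cochain_complex R D" "f \<in> cochain_maps R C D" "x \<in> cocycles C q"
  shows "f q x \<in> cocycles D q"
proof -
  interpret C: cocomplex R C by unfold_locales fact
  interpret D: cocomplex R D by unfold_locales fact
  show ?thesis
    using assms(4) linear_mapsD(1)[OF cochain_mapsD(1)[OF assms(3)], of x q]
      cochain_mapsD(2)[OF assms(3), of x q]
      linear_zero[OF C.module_deg D.module_deg cochain_mapsD(1)[OF assms(3)]]
    by (auto simp: cocycles_def)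
qed

lemma cochain_maps_coboundaries:
  assumes "f \<in> cochain_maps R C D" "x \<in> coboundaries C q"
  shows "f q x \<in> coboundaries D q"
  using assms(2) linear_mapsD(1)[OF cochain_mapsD(1)[OF assms(1)], of _ "q - 1"]
    cochain_mapsD(2)[OF assms(1), of _ "q - 1"]
  by (auto simp: coboundaries_def)

lemma quasi_isomorphismI:
  assumes C: "cochain_complex R C" and D: "cochain_complex R D"
    and f: "f \<in> cochain_maps R C D" and q: "quis C D f"
  shows "quasi_isomorphism R C D f"
  unfolding quasi_isomorphism_def
proof (intro conjI f allI)
  interpret C: cocomplex R C by unfold_locales fact
  interpret D: cocomplex R D by unfold_locales fact
  fix q
  note fc = cochain_maps_cocycles[OF C D f]
  note f_add = linear_mapsD(2)[OF cochain_mapsD(1)[OF f]]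
  have f_diff: "f q (x \<ominus>\<^bsub>deg C q\<^esub> y) = f q x \<ominus>\<^bsub>deg D q\<^esub> f q y"
    if "x \<in> cocycles C q" "y \<in> cocycles C q" for x y
    using that linear_minus[OF C.module_deg D.module_deg cochain_mapsD(1)[OF f]]
    by (simp add: a_minus_def f_add C.cocycles_closed)
  have eq_iff: "coboundaries C q +>\<^bsub>deg C q\<^esub> x = coboundaries C q +>\<^bsub>deg C q\<^esub> y \<longleftrightarrow>
      coboundaries D q +>\<^bsub>deg D q\<^esub> f q x = coboundaries D q +>\<^bsub>deg D q\<^esub> f q y"
    if "x \<in> cocycles C q" "y \<in> cocycles C q" for x y
    using that C.coset_eq_iff[OF that] D.coset_eq_iff[OF fc fc, OF that] f_diff[OF that]
      quisD(1)[OF q, of "x \<ominus>\<^bsub>deg C q\<^esub> y" q] cochain_maps_coboundaries[OF f]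
      C.cocycles_add[OF that(1) C.cocycles_minus[OF that(2)]]
    by (metis a_minus_def)
  define \<phi> where "\<phi> S = coboundaries D q +>\<^bsub>deg D q\<^esub>
    f q (SOME x. x \<in> cocycles C q \<and> S = coboundaries C q +>\<^bsub>deg C q\<^esub> x)" for S
  have \<phi>: "\<phi> (coboundaries C q +>\<^bsub>deg C q\<^esub> x) = coboundaries D q +>\<^bsub>deg D q\<^esub> f q x"
    if "x \<in> cocycles C q" for x
  proof -
    let ?P = "\<lambda>y. y \<in> cocycles C q \<and> coboundaries C q +>\<^bsub>deg C q\<^esub> x = coboundaries C q +>\<^bsub>deg C q\<^esub> y"
    have "?P (SOME y. ?P y)" by (rule someI[of ?P x]) (use that in simp)
    then show ?thesis unfolding \<phi>_def using eq_iff[OF that, of "SOME y. ?P y"] by simp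
  qed
  have "\<phi> \<in> iso (cohomology C q) (cohomology D q)"
    unfolding iso_def
  proof (intro CollectI conjI homI)
    show "bij_betw \<phi> (carrier (cohomology C q)) (carrier (cohomology D q))"
      unfolding bij_betw_def
    proof
      show "inj_on \<phi> (carrier (cohomology C q))"
        unfolding C.cohomology_carrier by (rule inj_onI, elim imageE) (simp add: \<phi> eq_iff)
      show "\<phi> ` carrier (cohomology C q) = carrier (cohomology D q)"
        unfolding C.cohomology_carrier D.cohomology_carrier
      proof (intro equalityI subsetI)
        fix S assume "S \<in> (\<lambda>x. coboundaries D q +>\<^bsub>deg D q\<^esub> x) ` cocycles D q"
        then obtain z where z: "z \<in> cocycles D q" "S = coboundaries D q +>\<^bsub>deg D q\<^esub> z" by blast
        then obtain x b where x: "x \<in> cocycles C q" "b \<in> coboundaries D q" "z = f q x \<oplus>\<^bsub>deg D q\<^esub> b"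
          using quisD(2)[OF q] by blast
        have "z \<ominus>\<^bsub>deg D q\<^esub> f q x = b"
          using x D.coboundaries_closed[OF x(2)] D.cocycles_closed[OF fc[OF x(1)]]
          by (simp add: a_minus_def D.group.a_ac D.group.r_neg1 D.group.r_neg)
        then have "S = \<phi> (coboundaries C q +>\<^bsub>deg C q\<^esub> x)"
          using \<phi>[OF x(1)] D.coset_eq_iff[OF z(1) fc[OF x(1)]] x z by simp
        then show "S \<in> \<phi> ` (\<lambda>x. coboundaries C q +>\<^bsub>deg C q\<^esub> x) ` cocycles C q" using x by blast
      qed (use \<phi> fc in auto)
    qed
    fix S T assume "S \<in> carrier (cohomology C q)" "T \<in> carrier (cohomology C q)"
    then show "\<phi> (S \<otimes>\<^bsub>cohomology C q\<^esub> T) = \<phi> S \<otimes>\<^bsub>cohomology D q\<^esub> \<phi> T"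
      unfolding C.cohomology_carrier
      by (auto simp: C.cohomology_mult \<phi> D.cohomology_mult fc C.cocycles_add f_add C.cocycles_closed)
  qed (use \<phi> fc in \<open>auto simp: C.cohomology_carrier D.cohomology_carrier\<close>)
  with \<phi> show "\<exists>\<phi>\<in>iso (cohomology C q) (cohomology D q). \<forall>x\<in>cocycles C q.
      \<phi> (coboundaries C q +>\<^bsub>deg C q\<^esub> x) = coboundaries D q +>\<^bsub>deg D q\<^esub> f q x" by blast
qed

lemma quasi_isomorphism_comp:
  assumes C: "cochain_complex R C" and D: "cochain_complex R D"
    and f: "quasi_isomorphism R C D f" and g: "quasi_isomorphism R D E g"
    and gf: "(\<lambda>q x. g q (f q x)) \<in> cochain_maps R C E"
  shows "quasi_isomorphism R C E (\<lambda>q x. g q (f q x))"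
  unfolding quasi_isomorphism_def
proof (intro conjI gf allI)
  fix q
  obtain \<phi> where \<phi>: "\<phi> \<in> iso (cohomology C q) (cohomology D q)"
    "\<And>x. x \<in> cocycles C q \<Longrightarrow> \<phi> (coboundaries C q +>\<^bsub>deg C q\<^esub> x) = coboundaries D q +>\<^bsub>deg D q\<^esub> f q x"
    using f unfolding quasi_isomorphism_def by blast
  obtain \<psi> where \<psi>: "\<psi> \<in> iso (cohomology D q) (cohomology E q)"
    "\<And>x. x \<in> cocycles D q \<Longrightarrow> \<psi> (coboundaries D q +>\<^bsub>deg D q\<^esub> x) = coboundaries E q +>\<^bsub>deg E q\<^esub> g q x"
    using g unfolding quasi_isomorphism_def by blast
  have "\<psi> \<circ> \<phi> \<in> iso (cohomology C q) (cohomology E q)"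
    using \<phi>(1) \<psi>(1) bij_betw_trans by (fastforce simp: iso_def hom_def Pi_iff)
  moreover have "f q x \<in> cocycles D q" if "x \<in> cocycles C q" for x
    using cochain_maps_cocycles[OF C D _ that] f unfolding quasi_isomorphism_def by blast
  ultimately show "\<exists>\<phi>\<in>iso (cohomology C q) (cohomology E q). \<forall>x\<in>cocycles C q.
      \<phi> (coboundaries C q +>\<^bsub>deg C q\<^esub> x) = coboundaries E q +>\<^bsub>deg E q\<^esub> g q (f q x)"
    using \<phi>(2) \<psi>(2) by (intro bexI[of _ "\<psi> \<circ> \<phi>"]) auto
qed

lemma quis_comp:
  assumes "cochain_complex R C" "cochain_complex R D" "cochain_complex R E"
    and f: "f \<in> cochain_maps R C D" and g: "g \<in> cochain_maps R D E"
    and qf: "quis C D f" and qg: "quis D E g"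
  shows "quis C E (\<lambda>q x. g q (f q x))"
proof (rule quisI)
  interpret E: cocomplex R E by unfold_locales fact
  interpret D: cocomplex R D by unfold_locales fact
  fix q
  note fc = cochain_maps_cocycles[OF assms(1,2) f]
  show "x \<in> coboundaries C q" if "x \<in> cocycles C q" "g q (f q x) \<in> coboundaries E q" for x
    using quisD(1)[OF qf that(1) quisD(1)[OF qg fc[OF that(1)] that(2)]] .
  fix z assume "z \<in> cocycles E q"
  then obtain y b where y: "y \<in> cocycles D q" "b \<in> coboundaries E q" "z = g q y \<oplus>\<^bsub>deg E q\<^esub> b"
    using quisD(2)[OF qg] by blast
  then obtain x b' where x: "x \<in> cocycles C q" "b' \<in> coboundaries D q" "y = f q x \<oplus>\<^bsub>deg D q\<^esub> b'"
    using quisD(2)[OF qf] by blast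
  have gb: "g q b' \<in> coboundaries E q" by (rule cochain_maps_coboundaries[OF g x(2)])
  have c: "g q (f q x) \<in> carrier (deg E q)"
    using linear_mapsD(1)[OF cochain_mapsD(1)[OF g]] D.cocycles_closed[OF fc[OF x(1)]] by blast
  have "z = g q (f q x) \<oplus>\<^bsub>deg E q\<^esub> (g q b' \<oplus>\<^bsub>deg E q\<^esub> b)"
    using y(3) x c E.coboundaries_closed[OF gb] E.coboundaries_closed[OF y(2)]
      linear_mapsD(2)[OF cochain_mapsD(1)[OF g]] D.cocycles_closed[OF fc[OF x(1)]]
      D.coboundaries_closed[OF x(2)]
    by (simp add: E.group.a_assoc)
  then show "\<exists>x\<in>cocycles C q. \<exists>b\<in>coboundaries E q. z = g q (f q x) \<oplus>\<^bsub>deg E q\<^esub> b"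
    using x(1) E.coboundaries_add[OF gb y(2)] by blast
qed

lemma quis_cancel:
  assumes "cochain_complex R C" "cochain_complex R D" "cochain_complex R E"
    and f: "f \<in> cochain_maps R C D" and g: "g \<in> cochain_maps R D E"
    and qf: "quis C D f" and qgf: "quis C E (\<lambda>q x. g q (f q x))"
  shows "quis D E g"
proof (rule quisI)
  interpret E: cocomplex R E by unfold_locales fact
  interpret D: cocomplex R D by unfold_locales fact
  fix q
  note fc = cochain_maps_cocycles[OF assms(1,2) f]
  show "\<exists>y\<in>cocycles D q. \<exists>b\<in>coboundaries E q. z = g q y \<oplus>\<^bsub>deg E q\<^esub> b" if "z \<in> cocycles E q" for z
    using quisD(2)[OF qgf that] fc by blast
  fix y assume y: "y \<in> cocycles D q" "g q y \<in> coboundaries E q"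
  obtain x b where x: "x \<in> cocycles C q" "b \<in> coboundaries D q" "y = f q x \<oplus>\<^bsub>deg D q\<^esub> b"
    using quisD(2)[OF qf y(1)] by blast
  have gb: "g q b \<in> coboundaries E q" by (rule cochain_maps_coboundaries[OF g x(2)])
  have c: "g q (f q x) \<in> carrier (deg E q)"
    using linear_mapsD(1)[OF cochain_mapsD(1)[OF g]] D.cocycles_closed[OF fc[OF x(1)]] by blast
  have "g q y = g q (f q x) \<oplus>\<^bsub>deg E q\<^esub> g q b"
    using x linear_mapsD(2)[OF cochain_mapsD(1)[OF g]] D.cocycles_closed[OF fc[OF x(1)]]
      D.coboundaries_closed[OF x(2)] by simp
  then have "g q (f q x) = g q y \<oplus>\<^bsub>deg E q\<^esub> (\<ominus>\<^bsub>deg E q\<^esub> g q b)"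
    using c E.coboundaries_closed[OF gb] by (simp add: E.group.a_assoc E.group.r_neg)
  then have "g q (f q x) \<in> coboundaries E q"
    using E.coboundaries_add[OF y(2) E.coboundaries_minus[OF gb]] by simp
  then have "f q x \<in> coboundaries D q"
    using quisD(1)[OF qgf x(1)] cochain_maps_coboundaries[OF f] by blast
  then show "y \<in> coboundaries D q" using x D.coboundaries_add by blast
qed

lemma quis_cone:
  assumes "cochain_complex R C" "cochain_complex R D" "f \<in> cochain_maps R C D" "quis C D f"
    and x: "x \<in> carrier (deg C (q + 1 + 1))" "dif C (q + 1 + 1) x = \<zero>\<^bsub>deg C (q + 1 + 1 + 1)\<^esub>"
    and y: "y \<in> carrier (deg D (q + 1))" "f (q + 1 + 1) x = dif D (q + 1) y"
  obtains x' y' where "x' \<in> carrier (deg C (q + 1))" "y' \<in> carrier (deg D q)"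
    "dif C (q + 1) x' = x" "y = f (q + 1) x' \<oplus>\<^bsub>deg D (q + 1)\<^esub> dif D q y'"
proof -
  interpret C: cocomplex R C by unfold_locales fact
  interpret D: cocomplex R D by unfold_locales fact
  note f = cochain_mapsD[OF assms(3)]
  note f_closed = linear_mapsD(1)[OF f(1)] and f_add = linear_mapsD(2)[OF f(1)]
  have "x \<in> cocycles C (q + 1 + 1)" using x by (simp add: cocycles_def)
  moreover have "f (q + 1 + 1) x \<in> coboundaries D (q + 1 + 1)" 
    using imageI[OF y(1), of "dif D (q + 1)"] unfolding coboundaries_def y(2) add_diff_cancel_right' .
  ultimately have "x \<in> coboundaries C (q + 1 + 1)" using quisD(1)[OF assms(4)] by blast
  then obtain x1 where x1: "x1 \<in> carrier (deg C (q + 1))" "dif C (q + 1) x1 = x"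
    unfolding coboundaries_def add_diff_cancel_right' by blast
  have "dif D (q + 1) (y \<ominus>\<^bsub>deg D (q + 1)\<^esub> f (q + 1) x1) = \<zero>\<^bsub>deg D (q + 1 + 1)\<^esub>"
    using y f(2)[OF x1(1)] x1 f_closed[OF x1(1)] D.d_closed[OF y(1)]
    by (simp add: a_minus_def D.d_add D.d_minus D.group.r_neg)
  then have "y \<ominus>\<^bsub>deg D (q + 1)\<^esub> f (q + 1) x1 \<in> cocycles D (q + 1)"
    using y f_closed[OF x1(1)] by (simp add: cocycles_def)
  then obtain x2 b where x2: "x2 \<in> cocycles C (q + 1)" "b \<in> coboundaries D (q + 1)"
    "y \<ominus>\<^bsub>deg D (q + 1)\<^esub> f (q + 1) x1 = f (q + 1) x2 \<oplus>\<^bsub>deg D (q + 1)\<^esub> b"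
    using quisD(2)[OF assms(4)] by blast
  obtain y' where y': "y' \<in> carrier (deg D q)" "b = dif D q y'"
    using x2(2) by (auto simp: coboundaries_def)
  have x2c: "x2 \<in> carrier (deg C (q + 1))" "dif C (q + 1) x2 = \<zero>\<^bsub>deg C (q + 1 + 1)\<^esub>"
    using x2(1) by (auto simp: cocycles_def)
  show thesis
  proof (rule that[of "x1 \<oplus>\<^bsub>deg C (q + 1)\<^esub> x2" y'])
    show "dif C (q + 1) (x1 \<oplus>\<^bsub>deg C (q + 1)\<^esub> x2) = x" using x1 x2c x by (simp add: C.d_add)
    have "y = f (q + 1) x1 \<oplus>\<^bsub>deg D (q + 1)\<^esub> (y \<ominus>\<^bsub>deg D (q + 1)\<^esub> f (q + 1) x1)"
      using y(1) f_closed[OF x1(1)] by (simp add: a_minus_def D.group.a_lcomm D.group.r_neg)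
    also have "\<dots> = f (q + 1) (x1 \<oplus>\<^bsub>deg C (q + 1)\<^esub> x2) \<oplus>\<^bsub>deg D (q + 1)\<^esub> dif D q y'"
      using x2(3) y' x1 x2c f_closed D.d_closed[OF y'(1)] by (simp add: f_add D.group.a_assoc)
    finally show "y = f (q + 1) (x1 \<oplus>\<^bsub>deg C (q + 1)\<^esub> x2) \<oplus>\<^bsub>deg D (q + 1)\<^esub> dif D q y'" .
  qed (use x1 x2c y' in auto)
qed

section \<open>The functor of a simplicial dg algebra\<close>

lemma moduleI_jointly_injective:
  fixes N :: "('r, 'n) module" and M :: "'i \<Rightarrow> ('r, 'm) module"
  assumes R: "cring R" and M: "\<And>i. i \<in> I \<Longrightarrow> module R (M i)"
    and ev: "\<And>i x. i \<in> I \<Longrightarrow> x \<in> carrier N \<Longrightarrow> ev i x \<in> carrier (M i)"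
    and inj: "\<And>x y. x \<in> carrier N \<Longrightarrow> y \<in> carrier N \<Longrightarrow> (\<And>i. i \<in> I \<Longrightarrow> ev i x = ev i y) \<Longrightarrow> x = y"
    and zero: "\<zero>\<^bsub>N\<^esub> \<in> carrier N" "\<And>i. i \<in> I \<Longrightarrow> ev i \<zero>\<^bsub>N\<^esub> = \<zero>\<^bsub>M i\<^esub>"
    and add: "\<And>x y. x \<in> carrier N \<Longrightarrow> y \<in> carrier N \<Longrightarrow> x \<oplus>\<^bsub>N\<^esub> y \<in> carrier N"
      "\<And>i x y. i \<in> I \<Longrightarrow> x \<in> carrier N \<Longrightarrow> y \<in> carrier N \<Longrightarrow> ev i (x \<oplus>\<^bsub>N\<^esub> y) = ev i x \<oplus>\<^bsub>M i\<^esub> ev i y"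
    and smult: "\<And>r x. r \<in> carrier R \<Longrightarrow> x \<in> carrier N \<Longrightarrow> r \<odot>\<^bsub>N\<^esub> x \<in> carrier N"
      "\<And>i r x. i \<in> I \<Longrightarrow> r \<in> carrier R \<Longrightarrow> x \<in> carrier N \<Longrightarrow> ev i (r \<odot>\<^bsub>N\<^esub> x) = r \<odot>\<^bsub>M i\<^esub> ev i x"
  shows "module R N"
proof -
  interpret R: cring R by fact
  have grp: "abelian_group (M i)" if "i \<in> I" for i using M[OF that] by (simp add: module_def)
  have monoid: "abelian_monoid (M i)" if "i \<in> I" for i
    using grp[OF that] by (simp add: abelian_group_def)
  note simps = zero add smult ev abelian_monoid.a_assoc[OF monoid] abelian_monoid.a_comm[OF monoid]
    abelian_monoid.l_zero[OF monoid]
  have N: "abelian_group N"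
  proof (rule abelian_groupI)
    fix x assume x: "x \<in> carrier N"
    have "\<ominus>\<^bsub>R\<^esub> \<one>\<^bsub>R\<^esub> \<odot>\<^bsub>N\<^esub> x \<oplus>\<^bsub>N\<^esub> x = \<zero>\<^bsub>N\<^esub>"
    proof (rule inj)
      fix i assume i: "i \<in> I"
      interpret Mi: module R "M i" by (rule M[OF i])
      show "ev i (\<ominus>\<^bsub>R\<^esub> \<one>\<^bsub>R\<^esub> \<odot>\<^bsub>N\<^esub> x \<oplus>\<^bsub>N\<^esub> x) = ev i \<zero>\<^bsub>N\<^esub>"
        using x i by (simp add: simps Mi.smult_l_minus Mi.l_neg Mi.r_neg)
    qed (use x in \<open>auto simp: simps\<close>)
    then show "\<exists>y\<in>carrier N. y \<oplus>\<^bsub>N\<^esub> x = \<zero>\<^bsub>N\<^esub>" using x smult by blast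
  qed (use inj in \<open>auto simp: simps intro!: inj\<close>)
  show ?thesis
  proof (rule moduleI[OF R N])
    fix a b x assume "a \<in> carrier R" "b \<in> carrier R" "x \<in> carrier N"
    then show "(a \<oplus>\<^bsub>R\<^esub> b) \<odot>\<^bsub>N\<^esub> x = a \<odot>\<^bsub>N\<^esub> x \<oplus>\<^bsub>N\<^esub> b \<odot>\<^bsub>N\<^esub> x"
      by (intro inj) (auto simp: simps module.smult_l_distr[OF M])
  next
    fix a x y assume "a \<in> carrier R" "x \<in> carrier N" "y \<in> carrier N"
    then show "a \<odot>\<^bsub>N\<^esub> (x \<oplus>\<^bsub>N\<^esub> y) = a \<odot>\<^bsub>N\<^esub> x \<oplus>\<^bsub>N\<^esub> a \<odot>\<^bsub>N\<^esub> y"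
      by (intro inj) (auto simp: simps module.smult_r_distr[OF M])
  next
    fix a b x assume "a \<in> carrier R" "b \<in> carrier R" "x \<in> carrier N"
    then show "(a \<otimes>\<^bsub>R\<^esub> b) \<odot>\<^bsub>N\<^esub> x = a \<odot>\<^bsub>N\<^esub> (b \<odot>\<^bsub>N\<^esub> x)"
      by (intro inj) (auto simp: simps module.smult_assoc1[OF M])
  next
    fix x assume "x \<in> carrier N"
    then show "\<one>\<^bsub>R\<^esub> \<odot>\<^bsub>N\<^esub> x = x"
      by (intro inj) (auto simp: simps module.smult_one[OF M])
  qed (auto simp: simps)
qed

lemma simplicial_mapsD:
  assumes "f \<in> simplicial_maps X Y"
  shows "x \<in> simp X n \<Longrightarrow> f n x \<in> simp Y n" "x \<notin> simp X n \<Longrightarrow> f n x = undefined"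
    "\<theta> \<in> simplex_hom m n \<Longrightarrow> x \<in> simp X n \<Longrightarrow> f m (act X m n \<theta> x) = act Y m n \<theta> (f n x)"
  using assms unfolding simplicial_maps_def by (auto simp: PiE_iff extensional_def)

lemma simplicial_mapsI:
  assumes "\<And>n x. x \<in> simp X n \<Longrightarrow> f n x \<in> simp Y n" "\<And>n x. x \<notin> simp X n \<Longrightarrow> f n x = undefined"
    "\<And>m n \<theta> x. \<theta> \<in> simplex_hom m n \<Longrightarrow> x \<in> simp X n \<Longrightarrow> f m (act X m n \<theta> x) = act Y m n \<theta> (f n x)"
  shows "f \<in> simplicial_maps X Y"
  using assms unfolding simplicial_maps_def by (auto simp: PiE_iff extensional_def)

lemma simplicial_maps_eqI:
  assumes "f \<in> simplicial_maps X Y" "g \<in> simplicial_maps X Y" "\<And>n x. x \<in> simp X n \<Longrightarrow> f n x = g n x"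
  shows "f = g"
proof (intro ext)
  fix n x show "f n x = g n x"
    using assms(3)[of x n] simplicial_mapsD(2)[OF assms(1), of x n] simplicial_mapsD(2)[OF assms(2), of x n]
    by (cases "x \<in> simp X n") auto
qed

context
  fixes pr :: "'u \<times> 'u \<Rightarrow> 'u"
  assumes pr: "inj pr"
begin

lemma pfst_pr [simp]: "pfst pr (pr (x, y)) = x"
  and psnd_pr [simp]: "psnd pr (pr (x, y)) = y"
  using pr by (simp_all add: pfst_def psnd_def)

lemma pr_eq_iff [simp]: "pr a = pr b \<longleftrightarrow> a = b"
  using pr by (auto dest: injD)

lemma sset_prod_simp: "simp (sset_prod pr X Y) n = {pr (x, y) | x y. x \<in> simp X n \<and> y \<in> simp Y n}"
  by (auto simp: sset_prod_def)

lemma sset_prodE: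
  assumes "z \<in> simp (sset_prod pr X Y) n"
  obtains x y where "z = pr (x, y)" "x \<in> simp X n" "y \<in> simp Y n"
  using assms by (auto simp: sset_prod_simp)

lemma sset_prod_in: "x \<in> simp X n \<Longrightarrow> y \<in> simp Y n \<Longrightarrow> pr (x, y) \<in> simp (sset_prod pr X Y) n"
  by (auto simp: sset_prod_simp)

lemma sset_prod_act: "act (sset_prod pr X Y) m n \<theta> (pr (x, y)) = pr (act X m n \<theta> x, act Y m n \<theta> y)"
  by (simp add: sset_prod_def)

lemma simplicial_set_prod:
  assumes "simplicial_set X" "simplicial_set Y"
  shows "simplicial_set (sset_prod pr X Y)"
  unfolding simplicial_set_def
  using assms by (auto simp: sset_prod_simp sset_prod_act act_closed act_id act_act)

lemma sset_fst_map: "simplicial_set X \<Longrightarrow> simplicial_set Y \<Longrightarrow> sset_fst pr X Y \<in> simplicial_maps (sset_prod pr X Y) X"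
  by (rule simplicial_mapsI)
    (auto simp: sset_fst_def sset_prod_act act_closed sset_prod_in elim!: sset_prodE)

lemma sset_snd_map: "simplicial_set X \<Longrightarrow> simplicial_set Y \<Longrightarrow> sset_snd pr X Y \<in> simplicial_maps (sset_prod pr X Y) Y"
  by (rule simplicial_mapsI)
    (auto simp: sset_snd_def sset_prod_act act_closed sset_prod_in elim!: sset_prodE)

lemma sset_prod_map_map:
  assumes "simplicial_set X" "simplicial_set Y" "f \<in> simplicial_maps X X'" "g \<in> simplicial_maps Y Y'"
  shows "sset_prod_map pr X Y f g \<in> simplicial_maps (sset_prod pr X Y) (sset_prod pr X' Y')"
  by (rule simplicial_mapsI)
    (use assms in \<open>auto simp: sset_prod_map_def sset_prod_act act_closed sset_prod_in simplicial_mapsD elim!: sset_prodE\<close>)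

lemma sset_assoc_map:
  assumes "simplicial_set X" "simplicial_set Y" "simplicial_set Z"
  shows "sset_assoc pr X Y Z \<in> simplicial_maps (sset_prod pr (sset_prod pr X Y) Z) (sset_prod pr X (sset_prod pr Y Z))"
  by (rule simplicial_mapsI)
    (use assms in \<open>auto simp: sset_assoc_def sset_prod_act act_closed sset_prod_in elim!: sset_prodE\<close>)

end

lemma simplicial_set_pt: "simplicial_set sset_pt"
  by (auto simp: simplicial_set_def sset_pt_def)

lemma sset_comp_map:
  assumes "simplicial_set X" "f \<in> simplicial_maps X Y" "g \<in> simplicial_maps Y Z"
  shows "sset_comp X g f \<in> simplicial_maps X Z"
  by (rule simplicial_mapsI)
    (use assms in \<open>auto simp: sset_comp_def compose_def act_closed simplicial_mapsD\<close>)

lemma sset_id_map: "simplicial_set X \<Longrightarrow> sset_id X \<in> simplicial_maps X X"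
  by (rule simplicial_mapsI) (auto simp: sset_id_def act_closed)

context simplicial_dg_alg
begin

abbreviation M where "M n q \<equiv> deg (level A n) q"

lemma theory_carrier: "carrier (deg (theory_complex A X) q) = simplicial_maps X (sdga_sset A q)"
  by (simp add: theory_complex_def)

lemma theory_closed: "\<alpha> \<in> carrier (deg (theory_complex A X) q) \<Longrightarrow> x \<in> simp X n \<Longrightarrow> \<alpha> n x \<in> carrier (M n q)"
  using simplicial_mapsD(1)[of \<alpha> X "sdga_sset A q" x n] by (simp add: theory_carrier sdga_sset_def)

lemma theory_act:
  "\<alpha> \<in> carrier (deg (theory_complex A X) q) \<Longrightarrow> \<theta> \<in> simplex_hom m n \<Longrightarrow> x \<in> simp X n \<Longrightarrow>
    \<alpha> m (act X m n \<theta> x) = sact A m n \<theta> q (\<alpha> n x)"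
  using simplicial_mapsD(3)[of \<alpha> X "sdga_sset A q"] by (simp add: theory_carrier sdga_sset_def)

lemma theory_carrierI:
  assumes "\<And>n x. x \<in> simp X n \<Longrightarrow> \<alpha> n x \<in> carrier (M n q)" "\<And>n x. x \<notin> simp X n \<Longrightarrow> \<alpha> n x = undefined"
    "\<And>m n \<theta> x. \<theta> \<in> simplex_hom m n \<Longrightarrow> x \<in> simp X n \<Longrightarrow> \<alpha> m (act X m n \<theta> x) = sact A m n \<theta> q (\<alpha> n x)"
  shows "\<alpha> \<in> carrier (deg (theory_complex A X) q)"
  unfolding theory_carrier using assms by (intro simplicial_mapsI) (auto simp: sdga_sset_def)

lemma theory_eqI:
  assumes "\<alpha> \<in> carrier (deg (theory_complex A X) q)" "\<beta> \<in> carrier (deg (theory_complex A X) q)"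
    "\<And>n x. x \<in> simp X n \<Longrightarrow> \<alpha> n x = \<beta> n x"
  shows "\<alpha> = \<beta>"
  using assms simplicial_maps_eqI unfolding theory_carrier by blast

lemma theory_apply:
  assumes "x \<in> simp X n"
  shows "\<zero>\<^bsub>deg (theory_complex A X) q\<^esub> n x = \<zero>\<^bsub>M n q\<^esub>"
    "(\<alpha> \<oplus>\<^bsub>deg (theory_complex A X) q\<^esub> \<beta>) n x = \<alpha> n x \<oplus>\<^bsub>M n q\<^esub> \<beta> n x"
    "(r \<odot>\<^bsub>deg (theory_complex A X) q\<^esub> \<alpha>) n x = r \<odot>\<^bsub>M n q\<^esub> \<alpha> n x"
    "dif (theory_complex A X) q \<alpha> n x = dif (level A n) q (\<alpha> n x)"
  using assms by (simp_all add: theory_complex_def)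

context
  fixes X :: "'u sset" assumes X: "simplicial_set X"
begin

lemma theory_zero_closed: "\<zero>\<^bsub>deg (theory_complex A X) q\<^esub> \<in> carrier (deg (theory_complex A X) q)"
  by (rule theory_carrierI) (use X in \<open>auto simp: theory_complex_def sact_zero act_closed\<close>)

lemma theory_add_closed:
  assumes "\<alpha> \<in> carrier (deg (theory_complex A X) q)" "\<beta> \<in> carrier (deg (theory_complex A X) q)"
  shows "\<alpha> \<oplus>\<^bsub>deg (theory_complex A X) q\<^esub> \<beta> \<in> carrier (deg (theory_complex A X) q)"
proof (rule theory_carrierI)
  show "(\<alpha> \<oplus>\<^bsub>deg (theory_complex A X) q\<^esub> \<beta>) n x = undefined" if "x \<notin> simp X n" for n x
    using that by (simp add: theory_complex_def)
qed (use assms X in \<open>auto simp: theory_apply sact_add act_closed theory_closed theory_act\<close>)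

lemma theory_smult_closed:
  assumes "r \<in> carrier R" "\<alpha> \<in> carrier (deg (theory_complex A X) q)"
  shows "r \<odot>\<^bsub>deg (theory_complex A X) q\<^esub> \<alpha> \<in> carrier (deg (theory_complex A X) q)"
proof (rule theory_carrierI)
  show "(r \<odot>\<^bsub>deg (theory_complex A X) q\<^esub> \<alpha>) n x = undefined" if "x \<notin> simp X n" for n x
    using that by (simp add: theory_complex_def)
qed (use assms X in \<open>auto simp: theory_apply sact_smult act_closed theory_closed theory_act dga.mod.smult_closed\<close>)

lemma theory_dif_closed:
  assumes "\<alpha> \<in> carrier (deg (theory_complex A X) q)"
  shows "dif (theory_complex A X) q \<alpha> \<in> carrier (deg (theory_complex A X) (q + 1))"
proof (rule theory_carrierI)
  show "dif (theory_complex A X) q \<alpha> n x = undefined" if "x \<notin> simp X n" for n x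
    using that by (simp add: theory_complex_def)
qed (use assms X in \<open>auto simp: theory_apply act_closed theory_closed theory_act dga.d_closed sact_d\<close>)

lemma theory_module: "module R (deg (theory_complex A X) q)"
proof (rule moduleI_jointly_injective[where I = "{(n, x). x \<in> simp X n}" and
      M = "\<lambda>(n, x). M n q" and ev = "\<lambda>(n, x) \<alpha>. \<alpha> n x"])
  show "cring R" using dga.module_deg by (simp add: module_def)
  show "\<alpha> = \<beta>" if "\<alpha> \<in> carrier (deg (theory_complex A X) q)" "\<beta> \<in> carrier (deg (theory_complex A X) q)"
    "\<And>i. i \<in> {(n, x). x \<in> simp X n} \<Longrightarrow> (\<lambda>(n, x) \<alpha>. \<alpha> n x) i \<alpha> = (\<lambda>(n, x) \<alpha>. \<alpha> n x) i \<beta>" for \<alpha> \<beta>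
    using that(3) by (intro theory_eqI[OF that(1,2)]) fastforce
qed (auto simp: theory_zero_closed theory_add_closed theory_smult_closed theory_apply theory_closed dga.module_deg)

lemma theory_cochain_complex: "cochain_complex R (theory_complex A X)"
  unfolding cochain_complex_def
proof (intro conjI allI ballI theory_module)
  note closed = theory_zero_closed theory_add_closed theory_smult_closed theory_dif_closed
  show "dif (theory_complex A X) q \<in> linear_maps R (deg (theory_complex A X) q) (deg (theory_complex A X) (q + 1))" for q
  proof (rule linear_mapsI)
    fix \<alpha> \<beta> assume "\<alpha> \<in> carrier (deg (theory_complex A X) q)" "\<beta> \<in> carrier (deg (theory_complex A X) q)"
    then show "dif (theory_complex A X) q (\<alpha> \<oplus>\<^bsub>deg (theory_complex A X) q\<^esub> \<beta>) =
        dif (theory_complex A X) q \<alpha> \<oplus>\<^bsub>deg (theory_complex A X) (q + 1)\<^esub> dif (theory_complex A X) q \<beta>"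
      by (intro theory_eqI[of _ X "q + 1"]) (auto simp: closed theory_apply theory_closed dga.d_add)
  next
    fix r \<alpha> assume "r \<in> carrier R" "\<alpha> \<in> carrier (deg (theory_complex A X) q)"
    then show "dif (theory_complex A X) q (r \<odot>\<^bsub>deg (theory_complex A X) q\<^esub> \<alpha>) =
        r \<odot>\<^bsub>deg (theory_complex A X) (q + 1)\<^esub> dif (theory_complex A X) q \<alpha>"
      by (intro theory_eqI[of _ X "q + 1"]) (auto simp: closed theory_apply theory_closed dga.d_smult)
  qed (auto simp: closed)
  fix q \<alpha> assume \<alpha>: "\<alpha> \<in> carrier (deg (theory_complex A X) q)"
  have 2: "q + 2 = q + 1 + 1" by simp
  show "dif (theory_complex A X) (q + 1) (dif (theory_complex A X) q \<alpha>) = \<zero>\<^bsub>deg (theory_complex A X) (q + 2)\<^esub>"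
    unfolding 2 by (intro theory_eqI[of _ X "q + 1 + 1"])
      (use \<alpha> in \<open>simp_all only: closed theory_apply theory_closed dga.d_d\<close>)
qed

lemma theory_neg: "q < 0 \<Longrightarrow> carrier (deg (theory_complex A X) q) = {\<zero>\<^bsub>deg (theory_complex A X) q\<^esub>}"
proof -
  assume q: "q < 0"
  have "\<alpha> = \<zero>\<^bsub>deg (theory_complex A X) q\<^esub>" if "\<alpha> \<in> carrier (deg (theory_complex A X) q)" for \<alpha>
    using that theory_closed[OF that] dga.neg_deg[OF q]
    by (intro theory_eqI[of _ X q]) (auto simp: theory_zero_closed theory_apply)
  then show ?thesis using theory_zero_closed by blast
qed

lemma theory_bounded: "bounded_below (theory_complex A X)"
  unfolding bounded_below_def using theory_neg by blast

lemma theory_pullback: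
  "f \<in> simplicial_maps X Y \<Longrightarrow> \<alpha> \<in> carrier (deg (theory_complex A Y) q) \<Longrightarrow>
    sset_comp X \<alpha> f \<in> carrier (deg (theory_complex A X) q)"
  unfolding theory_carrier by (rule sset_comp_map[OF X])

end

lemma sset_comp_apply: "x \<in> simp X n \<Longrightarrow> sset_comp X \<alpha> f n x = \<alpha> n (f n x)"
  by (simp add: sset_comp_def compose_def)

lemma theory_signed_apply:
  assumes "simplicial_set X" "\<alpha> \<in> carrier (deg (theory_complex A X) q)" "x \<in> simp X n"
  shows "signed (deg (theory_complex A X) q) k \<alpha> n x = signed (M n q) k (\<alpha> n x)"
  using additive_minus[of "deg (theory_complex A X) q" "M n q" "\<lambda>\<alpha>. \<alpha> n x" \<alpha>]
    module_abelian_group[OF theory_module[OF assms(1), of q]] assms(2,3)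
  by (simp add: signed_def dga.group.abelian_group_axioms theory_closed theory_apply)

lemma theory_contravariant: "contravariant_functor R (cohomology_theory pr A)"
  unfolding contravariant_functor_def cohomology_theory_def mfunctor.simps
proof (intro conjI allI impI ballI)
  fix X Y :: "'u sset" and f assume X: "simplicial_set X" and Y: "simplicial_set Y" and f: "f \<in> simplicial_maps X Y"
  note closed = theory_add_closed theory_smult_closed theory_dif_closed theory_pullback[OF X f]
    simplicial_mapsD(1)[OF f]
  show "(\<lambda>q \<alpha>. sset_comp X \<alpha> f) \<in> cochain_maps R (theory_complex A Y) (theory_complex A X)"
  proof (intro cochain_mapsI linear_mapsI)
    fix q \<alpha> assume \<alpha>: "\<alpha> \<in> carrier (deg (theory_complex A Y) q)"
    show "sset_comp X (dif (theory_complex A Y) q \<alpha>) f = dif (theory_complex A X) q (sset_comp X \<alpha> f)"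
      by (rule theory_eqI[of _ X "q + 1"]) (use \<alpha> X Y in \<open>auto simp: closed sset_comp_apply theory_apply\<close>)
    show "sset_comp X (\<alpha> \<oplus>\<^bsub>deg (theory_complex A Y) q\<^esub> \<beta>) f =
        sset_comp X \<alpha> f \<oplus>\<^bsub>deg (theory_complex A X) q\<^esub> sset_comp X \<beta> f"
      if \<beta>: "\<beta> \<in> carrier (deg (theory_complex A Y) q)" for \<beta>
      by (rule theory_eqI[of _ X q]) (use \<alpha> \<beta> X Y in \<open>auto simp: closed sset_comp_apply theory_apply\<close>)
    show "sset_comp X (r \<odot>\<^bsub>deg (theory_complex A Y) q\<^esub> \<alpha>) f = r \<odot>\<^bsub>deg (theory_complex A X) q\<^esub> sset_comp X \<alpha> f"
      if r: "r \<in> carrier R" for r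
      by (rule theory_eqI[of _ X q]) (use \<alpha> r X Y in \<open>auto simp: closed sset_comp_apply theory_apply\<close>)
  qed (rule closed)
next
  fix X :: "'u sset" and q \<alpha> assume X: "simplicial_set X" and \<alpha>: "\<alpha> \<in> carrier (deg (theory_complex A X) q)"
  show "sset_comp X \<alpha> (sset_id X) = \<alpha>"
    by (rule theory_eqI[OF theory_pullback[OF X sset_id_map[OF X] \<alpha>] \<alpha>]) (simp add: sset_comp_apply sset_id_def)
next
  fix X Y Z :: "'u sset" and q f g \<alpha>
  assume X: "simplicial_set X" and Y: "simplicial_set Y" and f: "f \<in> simplicial_maps X Y"
    and g: "g \<in> simplicial_maps Y Z" and \<alpha>: "\<alpha> \<in> carrier (deg (theory_complex A Z) q)"
  show "sset_comp X \<alpha> (sset_comp X g f) = sset_comp X (sset_comp Y \<alpha> g) f"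
    by (rule theory_eqI[OF theory_pullback[OF X sset_comp_map[OF X f g] \<alpha>] theory_pullback[OF X f theory_pullback[OF Y g \<alpha>]]])
      (simp add: sset_comp_apply simplicial_mapsD(1)[OF f])
qed (auto simp: theory_cochain_complex theory_bounded)

lemma kappa_apply:
  assumes "inj pr" "x \<in> simp X n" "y \<in> simp Y n"
  shows "kappa (cohomology_theory pr A) X Y p q \<alpha> \<beta> n (pr (x, y)) = dmul (level A n) p q (\<alpha> n x) (\<beta> n y)"
  using assms
  by (simp add: cohomology_theory_def theory_cup_def sset_prod_in sset_comp_apply sset_fst_def sset_snd_def)

lemma kappa_outside:
  "z \<notin> simp (sset_prod pr X Y) n \<Longrightarrow> kappa (cohomology_theory pr A) X Y p q \<alpha> \<beta> n z = undefined"
  by (simp add: cohomology_theory_def theory_cup_def)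

lemma kappa_closed:
  assumes pr: "inj pr" and X: "simplicial_set X" and Y: "simplicial_set Y"
    and "\<alpha> \<in> carrier (deg (theory_complex A X) p)" "\<beta> \<in> carrier (deg (theory_complex A Y) q)"
  shows "kappa (cohomology_theory pr A) X Y p q \<alpha> \<beta> \<in> carrier (deg (theory_complex A (sset_prod pr X Y)) (p + q))"
proof (rule theory_carrierI)
  fix n z assume "z \<in> simp (sset_prod pr X Y) n"
  then obtain x y where z: "z = pr (x, y)" "x \<in> simp X n" "y \<in> simp Y n" by (rule sset_prodE[OF pr])
  then show "kappa (cohomology_theory pr A) X Y p q \<alpha> \<beta> n z \<in> carrier (M n (p + q))"
    using assms by (simp add: kappa_apply dga.mul_closed theory_closed)
  fix m \<theta> assume "\<theta> \<in> simplex_hom m n"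
  then show "kappa (cohomology_theory pr A) X Y p q \<alpha> \<beta> m (act (sset_prod pr X Y) m n \<theta> z)
      = sact A m n \<theta> (p + q) (kappa (cohomology_theory pr A) X Y p q \<alpha> \<beta> n z)"
    using assms z
    by (simp add: sset_prod_act kappa_apply act_closed theory_act[of _ X p] theory_act[of _ Y q] sact_mul theory_closed)
qed (rule kappa_outside)

lemma kappa_tensor:
  fixes pr :: "'u \<times> 'u \<Rightarrow> 'u"
  assumes pr: "inj pr" and X: "simplicial_set X" and Y: "simplicial_set Y"
  shows "kappa (cohomology_theory pr A) X Y
    \<in> tensor_cochain_maps R (theory_complex A X) (theory_complex A Y) (theory_complex A (sset_prod pr X Y))"
proof -
  note XY = simplicial_set_prod[OF pr X Y]
  note closed = kappa_closed[OF pr X Y] theory_add_closed theory_smult_closed theory_dif_closed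
    theory_closed dga.d_closed
  note calc = theory_apply kappa_apply[OF pr] theory_apply[OF sset_prod_in[OF pr]]
  show ?thesis
  proof (intro tensor_cochain_mapsI linear_mapsI)
    fix p q \<alpha> \<beta> assume \<alpha>: "\<alpha> \<in> carrier (deg (theory_complex A X) p)" and \<beta>: "\<beta> \<in> carrier (deg (theory_complex A Y) q)"
    show "kappa (cohomology_theory pr A) X Y p q \<alpha> \<beta> \<in> carrier (deg (theory_complex A (sset_prod pr X Y)) (p + q))"
      by (rule kappa_closed[OF pr X Y \<alpha> \<beta>])
    then show "kappa (cohomology_theory pr A) X Y p q \<alpha> \<beta> \<in> carrier (deg (theory_complex A (sset_prod pr X Y)) (p + q))" .
    show "kappa (cohomology_theory pr A) X Y p q \<alpha> (\<beta> \<oplus>\<^bsub>deg (theory_complex A Y) q\<^esub> \<gamma>) =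
        kappa (cohomology_theory pr A) X Y p q \<alpha> \<beta> \<oplus>\<^bsub>deg (theory_complex A (sset_prod pr X Y)) (p + q)\<^esub>
        kappa (cohomology_theory pr A) X Y p q \<alpha> \<gamma>"
      if \<gamma>: "\<gamma> \<in> carrier (deg (theory_complex A Y) q)" for \<gamma>
    proof (rule theory_eqI[of _ _ "p + q"])
      fix n z assume "z \<in> simp (sset_prod pr X Y) n"
      then obtain x y where "z = pr (x, y)" "x \<in> simp X n" "y \<in> simp Y n" by (rule sset_prodE[OF pr])
      then show "kappa (cohomology_theory pr A) X Y p q \<alpha> (\<beta> \<oplus>\<^bsub>deg (theory_complex A Y) q\<^esub> \<gamma>) n z =
        (kappa (cohomology_theory pr A) X Y p q \<alpha> \<beta> \<oplus>\<^bsub>deg (theory_complex A (sset_prod pr X Y)) (p + q)\<^esub>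
        kappa (cohomology_theory pr A) X Y p q \<alpha> \<gamma>) n z"
        using \<alpha> \<beta> \<gamma> by (simp add: calc closed dga.mul_add_right)
    qed (simp_all add: closed X Y XY \<alpha> \<beta> \<gamma>)
    show "kappa (cohomology_theory pr A) X Y p q \<alpha> (r \<odot>\<^bsub>deg (theory_complex A Y) q\<^esub> \<beta>) =
        r \<odot>\<^bsub>deg (theory_complex A (sset_prod pr X Y)) (p + q)\<^esub> kappa (cohomology_theory pr A) X Y p q \<alpha> \<beta>"
      if r: "r \<in> carrier R" for r
    proof (rule theory_eqI[of _ _ "p + q"])
      fix n z assume "z \<in> simp (sset_prod pr X Y) n"
      then obtain x y where "z = pr (x, y)" "x \<in> simp X n" "y \<in> simp Y n" by (rule sset_prodE[OF pr])
      then show "kappa (cohomology_theory pr A) X Y p q \<alpha> (r \<odot>\<^bsub>deg (theory_complex A Y) q\<^esub> \<beta>) n z =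
        (r \<odot>\<^bsub>deg (theory_complex A (sset_prod pr X Y)) (p + q)\<^esub> kappa (cohomology_theory pr A) X Y p q \<alpha> \<beta>) n z"
        using \<alpha> \<beta> r by (simp add: calc closed dga.mul_smult_right)
    qed (simp_all add: closed X Y XY \<alpha> \<beta> r)
    show "kappa (cohomology_theory pr A) X Y p q (\<alpha> \<oplus>\<^bsub>deg (theory_complex A X) p\<^esub> \<gamma>) \<beta> =
        kappa (cohomology_theory pr A) X Y p q \<alpha> \<beta> \<oplus>\<^bsub>deg (theory_complex A (sset_prod pr X Y)) (p + q)\<^esub>
        kappa (cohomology_theory pr A) X Y p q \<gamma> \<beta>"
      if \<gamma>: "\<gamma> \<in> carrier (deg (theory_complex A X) p)" for \<gamma>
    proof (rule theory_eqI[of _ _ "p + q"])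
      fix n z assume "z \<in> simp (sset_prod pr X Y) n"
      then obtain x y where "z = pr (x, y)" "x \<in> simp X n" "y \<in> simp Y n" by (rule sset_prodE[OF pr])
      then show "kappa (cohomology_theory pr A) X Y p q (\<alpha> \<oplus>\<^bsub>deg (theory_complex A X) p\<^esub> \<gamma>) \<beta> n z =
        (kappa (cohomology_theory pr A) X Y p q \<alpha> \<beta> \<oplus>\<^bsub>deg (theory_complex A (sset_prod pr X Y)) (p + q)\<^esub>
        kappa (cohomology_theory pr A) X Y p q \<gamma> \<beta>) n z"
        using \<alpha> \<beta> \<gamma> by (simp add: calc closed dga.mul_add_left)
    qed (simp_all add: closed X Y XY \<alpha> \<beta> \<gamma>)
    show "kappa (cohomology_theory pr A) X Y p q (r \<odot>\<^bsub>deg (theory_complex A X) p\<^esub> \<alpha>) \<beta> =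
        r \<odot>\<^bsub>deg (theory_complex A (sset_prod pr X Y)) (p + q)\<^esub> kappa (cohomology_theory pr A) X Y p q \<alpha> \<beta>"
      if r: "r \<in> carrier R" for r
    proof (rule theory_eqI[of _ _ "p + q"])
      fix n z assume "z \<in> simp (sset_prod pr X Y) n"
      then obtain x y where "z = pr (x, y)" "x \<in> simp X n" "y \<in> simp Y n" by (rule sset_prodE[OF pr])
      then show "kappa (cohomology_theory pr A) X Y p q (r \<odot>\<^bsub>deg (theory_complex A X) p\<^esub> \<alpha>) \<beta> n z =
        (r \<odot>\<^bsub>deg (theory_complex A (sset_prod pr X Y)) (p + q)\<^esub> kappa (cohomology_theory pr A) X Y p q \<alpha> \<beta>) n z"
        using \<alpha> \<beta> r by (simp add: calc closed dga.mul_smult_left)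
    qed (simp_all add: closed X Y XY \<alpha> \<beta> r)
    let ?d = "dif (theory_complex A (sset_prod pr X Y)) (p + q)"
    let ?l = "kappa (cohomology_theory pr A) X Y (p + 1) q (dif (theory_complex A X) p \<alpha>) \<beta>"
    let ?r = "kappa (cohomology_theory pr A) X Y p (q + 1) \<alpha> (dif (theory_complex A Y) q \<beta>)"
    let ?M = "deg (theory_complex A (sset_prod pr X Y)) (p + q + 1)"
    interpret T: abelian_group ?M by (rule module_abelian_group[OF theory_module[OF XY]])
    have deg: "p + 1 + q = p + q + 1" "p + (q + 1) = p + q + 1" by simp_all
    have l: "?l \<in> carrier ?M" and r: "?r \<in> carrier ?M"
      using closed(1)[OF theory_dif_closed[OF X \<alpha>] \<beta>] closed(1)[OF \<alpha> theory_dif_closed[OF Y \<beta>]]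
      unfolding deg by blast+
    show "?d (kappa (cohomology_theory pr A) X Y p q \<alpha> \<beta>) = ?l \<oplus>\<^bsub>?M\<^esub> signed ?M p ?r"
    proof (rule theory_eqI[of _ _ "p + q + 1"])
      fix n z assume "z \<in> simp (sset_prod pr X Y) n"
      then obtain x y where z: "z = pr (x, y)" "x \<in> simp X n" "y \<in> simp Y n" by (rule sset_prodE[OF pr])
      then show "?d (kappa (cohomology_theory pr A) X Y p q \<alpha> \<beta>) n z = (?l \<oplus>\<^bsub>?M\<^esub> signed ?M p ?r) n z"
        using \<alpha> \<beta> theory_signed_apply[OF XY r sset_prod_in[OF pr z(2,3)], of p]
        by (simp add: calc theory_closed dga.d_mul)
    qed (use l r closed(1)[OF \<alpha> \<beta>] XY in \<open>auto intro: closed\<close>)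
  qed
qed

lemma unit_map_closed: "s \<in> carrier R \<Longrightarrow> unit_map (level A n) q s \<in> carrier (M n q)"
  by (simp add: unit_map_def dga.mod.smult_closed dga.one_closed)

lemma theory_eta_closed:
  fixes pr :: "'u \<times> 'u \<Rightarrow> 'u"
  assumes "s \<in> carrier R"
  shows "eta (cohomology_theory pr A) q s \<in> carrier (deg (theory_complex A sset_pt) q)"
proof (rule theory_carrierI)
  fix m n \<theta> and x :: 'u
  assume "\<theta> \<in> simplex_hom m n" "x \<in> simp sset_pt n"
  then show "eta (cohomology_theory pr A) q s m (act sset_pt m n \<theta> x) =
      sact A m n \<theta> q (eta (cohomology_theory pr A) q s n x)"
    using assms
    by (simp add: cohomology_theory_def sset_pt_def unit_map_def sact_smult sact_zero sact_one dga.one_closed)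
qed (use assms in \<open>auto simp: cohomology_theory_def unit_map_closed\<close>)

lemma theory_lax_monoidal:
  fixes pr :: "'u \<times> 'u \<Rightarrow> 'u"
  assumes pr: "inj pr"
  shows "lax_monoidal_functor R pr (cohomology_theory pr A)"
proof -
  let ?F = "cohomology_theory pr A"
  have obj: "fobj ?F = theory_complex A" and map: "fmap ?F = (\<lambda>X Y f q \<alpha>. sset_comp X \<alpha> f)"
    by (simp_all add: cohomology_theory_def)
  have pt: "simplicial_set (sset_pt :: 'u sset)" by (rule simplicial_set_pt)
  show ?thesis
    unfolding lax_monoidal_functor_def obj map
  proof (intro conjI allI impI ballI theory_contravariant kappa_tensor pr)
    fix X X' Y Y' :: "'u sset" and p q f g \<alpha> \<beta>
    assume S: "simplicial_set X" "simplicial_set X'" "simplicial_set Y" "simplicial_set Y'"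
      and f: "f \<in> simplicial_maps X X'" and g: "g \<in> simplicial_maps Y Y'"
      and \<alpha>: "\<alpha> \<in> carrier (deg (theory_complex A X') p)" and \<beta>: "\<beta> \<in> carrier (deg (theory_complex A Y') q)"
    note fg = simplicial_mapsD(1)[OF f] simplicial_mapsD(1)[OF g]
    show "sset_comp (sset_prod pr X Y) (kappa ?F X' Y' p q \<alpha> \<beta>) (sset_prod_map pr X Y f g)
        = kappa ?F X Y p q (sset_comp X \<alpha> f) (sset_comp Y \<beta> g)"
    proof (rule theory_eqI[of _ _ "p + q"])
      fix n z assume z: "z \<in> simp (sset_prod pr X Y) n"
      then obtain x y where "z = pr (x, y)" "x \<in> simp X n" "y \<in> simp Y n" by (rule sset_prodE[OF pr])
      then show "sset_comp (sset_prod pr X Y) (kappa ?F X' Y' p q \<alpha> \<beta>) (sset_prod_map pr X Y f g) n z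
        = kappa ?F X Y p q (sset_comp X \<alpha> f) (sset_comp Y \<beta> g) n z"
        using z pr fg by (simp add: sset_comp_apply sset_prod_map_def kappa_apply)
    qed (use S f g \<alpha> \<beta> pr in \<open>auto intro!: theory_pullback simplicial_set_prod sset_prod_map_map kappa_closed\<close>)
  next
    have ap: "eta ?F q s n x = unit_map (level A n) q s" if "x \<in> simp sset_pt n" for q s n and x :: 'u
      using that by (simp add: cohomology_theory_def)
    show "eta ?F \<in> cochain_maps R (unit_complex R) (theory_complex A sset_pt)"
    proof (intro cochain_mapsI linear_mapsI)
      fix q s assume s: "s \<in> carrier (deg (unit_complex R) q)"
      have sR: "s \<in> carrier R" and s0: "q \<noteq> 0 \<Longrightarrow> s = \<zero>\<^bsub>R\<^esub>"
        using s dga.mod.R.zero_closed by (auto simp: unit_complex_def ring_module_def split: if_splits)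
      show "eta ?F q s \<in> carrier (deg (theory_complex A sset_pt) q)" by (rule theory_eta_closed[OF sR])
      show "eta ?F (q + 1) (dif (unit_complex R) q s) = dif (theory_complex A sset_pt) q (eta ?F q s)"
      proof (rule theory_eqI[of _ sset_pt "q + 1"])
        fix n and x :: 'u assume x: "x \<in> simp sset_pt n"
        show "eta ?F (q + 1) (dif (unit_complex R) q s) n x = dif (theory_complex A sset_pt) q (eta ?F q s) n x"
          using sR dga.d_one[of n] dga.d_zero
          by (simp add: ap x theory_apply unit_complex_def unit_map_def dga.one_closed dga.d_smult)
      qed (auto simp: theory_eta_closed sR theory_dif_closed[OF pt] unit_complex_def)
      show "eta ?F q (s \<oplus>\<^bsub>deg (unit_complex R) q\<^esub> s') =
          eta ?F q s \<oplus>\<^bsub>deg (theory_complex A sset_pt) q\<^esub> eta ?F q s'"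
        if "s' \<in> carrier (deg (unit_complex R) q)" for s'
      proof -
        have s': "s' \<in> carrier R" "q \<noteq> 0 \<Longrightarrow> s' = \<zero>\<^bsub>R\<^esub>"
          using that dga.mod.R.zero_closed by (auto simp: unit_complex_def ring_module_def split: if_splits)
        have plus: "s \<oplus>\<^bsub>deg (unit_complex R) q\<^esub> s' = s \<oplus>\<^bsub>R\<^esub> s'" by (simp add: unit_complex_def ring_module_def)
        show ?thesis
          unfolding plus
          by (rule theory_eqI[of _ sset_pt q])
            (use sR s' pt in \<open>auto simp: ap theory_apply theory_eta_closed theory_add_closed
              unit_map_def dga.one_closed dga.mod.smult_l_distr\<close>)
      qed
      show "eta ?F q (r \<odot>\<^bsub>deg (unit_complex R) q\<^esub> s) = r \<odot>\<^bsub>deg (theory_complex A sset_pt) q\<^esub> eta ?F q s"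
        if r: "r \<in> carrier R" for r
      proof -
        have times: "r \<odot>\<^bsub>deg (unit_complex R) q\<^esub> s = r \<otimes>\<^bsub>R\<^esub> s" by (simp add: unit_complex_def ring_module_def)
        show ?thesis
          unfolding times
          by (rule theory_eqI[of _ sset_pt q])
            (use sR r pt in \<open>auto simp: ap theory_apply theory_eta_closed theory_smult_closed
              unit_map_def dga.one_closed dga.mod.smult_assoc1 dga.mod.smult_r_null\<close>)
      qed
    qed
  next
    fix X Y Z :: "'u sset" and p q r \<alpha> \<beta> \<gamma>
    assume S: "simplicial_set X" "simplicial_set Y" "simplicial_set Z"
      and \<alpha>: "\<alpha> \<in> carrier (deg (theory_complex A X) p)" and \<beta>: "\<beta> \<in> carrier (deg (theory_complex A Y) q)"
      and \<gamma>: "\<gamma> \<in> carrier (deg (theory_complex A Z) r)"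
    note XY = simplicial_set_prod[OF pr S(1,2)] and YZ = simplicial_set_prod[OF pr S(2,3)]
    show "kappa ?F (sset_prod pr X Y) Z (p + q) r (kappa ?F X Y p q \<alpha> \<beta>) \<gamma> =
       sset_comp (sset_prod pr (sset_prod pr X Y) Z) (kappa ?F X (sset_prod pr Y Z) p (q + r) \<alpha> (kappa ?F Y Z q r \<beta> \<gamma>))
        (sset_assoc pr X Y Z)"
    proof (rule theory_eqI[of _ _ "p + q + r"])
      show "sset_comp (sset_prod pr (sset_prod pr X Y) Z) (kappa ?F X (sset_prod pr Y Z) p (q + r) \<alpha> (kappa ?F Y Z q r \<beta> \<gamma>))
          (sset_assoc pr X Y Z) \<in> carrier (deg (theory_complex A (sset_prod pr (sset_prod pr X Y) Z)) (p + q + r))"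
        unfolding add.assoc
        by (intro theory_pullback[OF simplicial_set_prod[OF pr XY S(3)] sset_assoc_map[OF pr S]]
            kappa_closed[OF pr S(1) YZ \<alpha>] kappa_closed[OF pr S(2,3) \<beta> \<gamma>])
      fix n z assume z: "z \<in> simp (sset_prod pr (sset_prod pr X Y) Z) n"
      then obtain w z' where w: "z = pr (w, z')" "w \<in> simp (sset_prod pr X Y) n" "z' \<in> simp Z n"
        by (rule sset_prodE[OF pr])
      then obtain x y where x: "w = pr (x, y)" "x \<in> simp X n" "y \<in> simp Y n" by (metis sset_prodE[OF pr])
      then show "kappa ?F (sset_prod pr X Y) Z (p + q) r (kappa ?F X Y p q \<alpha> \<beta>) \<gamma> n z =
         sset_comp (sset_prod pr (sset_prod pr X Y) Z) (kappa ?F X (sset_prod pr Y Z) p (q + r) \<alpha> (kappa ?F Y Z q r \<beta> \<gamma>))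
          (sset_assoc pr X Y Z) n z"
        using z w pr \<alpha> \<beta> \<gamma>
        by (simp add: kappa_apply sset_comp_apply sset_assoc_def sset_prod_in dga.mul_assoc theory_closed)
    qed (use S pr \<alpha> \<beta> \<gamma> in \<open>auto intro!: kappa_closed simplicial_set_prod\<close>)
  next
    fix X :: "'u sset" and q s \<alpha>
    assume X: "simplicial_set X" and s: "s \<in> carrier R" and \<alpha>: "\<alpha> \<in> carrier (deg (theory_complex A X) q)"
    let ?u = "undefined :: 'u"
    have ap: "eta ?F 0 s n ?u = s \<odot>\<^bsub>M n 0\<^esub> dunit (level A n)" for n
      by (simp add: cohomology_theory_def sset_pt_def unit_map_def)
    show "kappa ?F sset_pt X 0 q (eta ?F 0 s) \<alpha> =
        sset_comp (sset_prod pr sset_pt X) (s \<odot>\<^bsub>deg (theory_complex A X) q\<^esub> \<alpha>) (sset_snd pr sset_pt X)"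
    proof (rule theory_eqI[of _ _ q])
      show "kappa ?F sset_pt X 0 q (eta ?F 0 s) \<alpha> \<in> carrier (deg (theory_complex A (sset_prod pr sset_pt X)) q)"
        using kappa_closed[OF pr pt X theory_eta_closed[OF s, of pr 0] \<alpha>] by simp
      fix n z assume z: "z \<in> simp (sset_prod pr sset_pt X) n"
      then obtain x where x: "z = pr (?u, x)" "x \<in> simp X n"
        using sset_prodE[OF pr z] by (auto simp: sset_pt_def)
      then show "kappa ?F sset_pt X 0 q (eta ?F 0 s) \<alpha> n z =
          sset_comp (sset_prod pr sset_pt X) (s \<odot>\<^bsub>deg (theory_complex A X) q\<^esub> \<alpha>) (sset_snd pr sset_pt X) n z"
        using z pr s \<alpha> kappa_apply[OF pr, of ?u sset_pt n x X 0 q "eta ?F 0 s" \<alpha>]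
        by (simp add: sset_comp_apply sset_snd_def theory_apply ap sset_pt_def theory_closed dga.one_closed dga.one_mul dga.mul_smult_left[OF theory_closed[OF \<alpha>]])
    qed (use X s \<alpha> pr pt in \<open>auto intro!: theory_pullback simplicial_set_prod sset_snd_map theory_smult_closed\<close>)
    show "kappa ?F X sset_pt q 0 \<alpha> (eta ?F 0 s) =
        sset_comp (sset_prod pr X sset_pt) (s \<odot>\<^bsub>deg (theory_complex A X) q\<^esub> \<alpha>) (sset_fst pr X sset_pt)"
    proof (rule theory_eqI[of _ _ q])
      show "kappa ?F X sset_pt q 0 \<alpha> (eta ?F 0 s) \<in> carrier (deg (theory_complex A (sset_prod pr X sset_pt)) q)"
        using kappa_closed[OF pr X pt \<alpha> theory_eta_closed[OF s, of pr 0]] by simp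
      fix n z assume z: "z \<in> simp (sset_prod pr X sset_pt) n"
      then obtain x where x: "z = pr (x, ?u)" "x \<in> simp X n"
        using sset_prodE[OF pr z] by (auto simp: sset_pt_def)
      then show "kappa ?F X sset_pt q 0 \<alpha> (eta ?F 0 s) n z =
          sset_comp (sset_prod pr X sset_pt) (s \<odot>\<^bsub>deg (theory_complex A X) q\<^esub> \<alpha>) (sset_fst pr X sset_pt) n z"
        using z pr s \<alpha> kappa_apply[OF pr, of x X n ?u sset_pt q 0 \<alpha> "eta ?F 0 s"]
        by (simp add: sset_comp_apply sset_fst_def theory_apply ap sset_pt_def theory_closed dga.one_closed dga.mul_one dga.mul_smult_right[OF theory_closed[OF \<alpha>]])
    qed (use X s \<alpha> pr pt in \<open>auto intro!: theory_pullback simplicial_set_prod sset_fst_map theory_smult_closed\<close>)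
  qed
qed

end

definition product_group :: "('r, 'm) module \<Rightarrow> ('r, 'n) module \<Rightarrow> ('m \<times> 'n) ring" where
  "product_group M N = \<lparr>carrier = carrier M \<times> carrier N, mult = undefined, one = undefined,
     zero = (\<zero>\<^bsub>M\<^esub>, \<zero>\<^bsub>N\<^esub>), add = (\<lambda>x y. (fst x \<oplus>\<^bsub>M\<^esub> fst y, snd x \<oplus>\<^bsub>N\<^esub> snd y))\<rparr>"

lemma product_group_simps:
  "carrier (product_group M N) = carrier M \<times> carrier N"
  "\<zero>\<^bsub>product_group M N\<^esub> = (\<zero>\<^bsub>M\<^esub>, \<zero>\<^bsub>N\<^esub>)"
  "x \<oplus>\<^bsub>product_group M N\<^esub> y = (fst x \<oplus>\<^bsub>M\<^esub> fst y, snd x \<oplus>\<^bsub>N\<^esub> snd y)"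
  by (simp_all add: product_group_def)

lemma product_group:
  assumes "abelian_group M" "abelian_group N"
  shows "abelian_group (product_group M N)"
proof -
  interpret M: abelian_group M by fact
  interpret N: abelian_group N by fact
  show ?thesis
  proof (rule abelian_groupI)
    fix x assume "x \<in> carrier (product_group M N)"
    then show "\<exists>y\<in>carrier (product_group M N). y \<oplus>\<^bsub>product_group M N\<^esub> x = \<zero>\<^bsub>product_group M N\<^esub>"
      by (intro bexI[of _ "(\<ominus>\<^bsub>M\<^esub> fst x, \<ominus>\<^bsub>N\<^esub> snd x)"])
        (auto simp: product_group_simps M.l_neg N.l_neg)
  qed (auto simp: product_group_simps M.a_ac N.a_ac)
qed

definition theory_map ::
  "(nat \<Rightarrow> int \<Rightarrow> 'a \<Rightarrow> 'b) \<Rightarrow> 'u sset \<Rightarrow> int \<Rightarrow> (nat \<Rightarrow> 'u \<Rightarrow> 'a) \<Rightarrow> nat \<Rightarrow> 'u \<Rightarrow> 'b" where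
  "theory_map f X q \<alpha> = (\<lambda>n. \<lambda>x\<in>simp X n. f n q (\<alpha> n x))"

lemma theory_map_apply: "x \<in> simp X n \<Longrightarrow> theory_map f X q \<alpha> n x = f n q (\<alpha> n x)"
  by (simp add: theory_map_def)

locale sdga_map = A: simplicial_dg_alg R A + B: simplicial_dg_alg R B
  for R :: "('r, 'k) ring_scheme" and A :: "('r, 'a) sdga" and B :: "('r, 'b) sdga" +
  fixes f :: "nat \<Rightarrow> int \<Rightarrow> 'a \<Rightarrow> 'b"
  assumes f_dga: "f n \<in> dga_maps R (level A n) (level B n)"
    and f_sact: "\<theta> \<in> simplex_hom m n \<Longrightarrow> x \<in> carrier (deg (level A n) q) \<Longrightarrow>
      f m q (sact A m n \<theta> q x) = sact B m n \<theta> q (f n q x)"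
begin

lemmas f_cochain = dga_mapsD(1)[OF f_dga]
lemmas f_linear = cochain_mapsD(1)[OF f_cochain]
lemmas f_closed = linear_mapsD(1)[OF f_linear]
  and f_add = linear_mapsD(2)[OF f_linear]
  and f_smult = linear_mapsD(3)[OF f_linear]
  and f_zero = linear_zero[OF A.dga.module_deg B.dga.module_deg f_linear]
  and f_minus = linear_minus[OF A.dga.module_deg B.dga.module_deg f_linear]
  and f_d = cochain_mapsD(2)[OF f_cochain]
  and f_mul = dga_mapsD(2)[OF f_dga]
  and f_one = dga_mapsD(3)[OF f_dga]

lemma unit_path_map:
  assumes "unit_path A t"
  shows "unit_path B (f 1 0 t)"
proof -
  have h: "(\<lambda>j\<in>{..0}. c) \<in> simplex_hom 0 1" if "c \<le> 1" for c using that by (rule simplex_hom_const)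
  have t: "t \<in> carrier (deg (level A 1) 0)" using assms by (simp add: unit_path_def)
  show ?thesis
    using assms f_closed[OF t] f_sact[OF h t, of 0] f_sact[OF h t, of 1]
    by (simp add: unit_path_def f_zero f_one)
qed

lemma theory_map_closed:
  assumes "simplicial_set X" "\<alpha> \<in> carrier (deg (theory_complex A X) q)"
  shows "theory_map f X q \<alpha> \<in> carrier (deg (theory_complex B X) q)"
  by (rule B.theory_carrierI)
    (use assms in \<open>auto simp: theory_map_def f_closed A.theory_closed act_closed A.theory_act f_sact\<close>)

lemma theory_map_cochain:
  assumes X: "simplicial_set X"
  shows "theory_map f X \<in> cochain_maps R (theory_complex A X) (theory_complex B X)"
proof (intro cochain_mapsI linear_mapsI)
  note closed = theory_map_closed[OF X] A.theory_add_closed[OF X] A.theory_smult_closed[OF X]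
    A.theory_dif_closed[OF X] B.theory_add_closed[OF X] B.theory_smult_closed[OF X] B.theory_dif_closed[OF X]
  note calc = A.theory_apply B.theory_apply theory_map_apply A.theory_closed
  fix q \<alpha> assume \<alpha>: "\<alpha> \<in> carrier (deg (theory_complex A X) q)"
  show "theory_map f X q (\<alpha> \<oplus>\<^bsub>deg (theory_complex A X) q\<^esub> \<beta>) =
      theory_map f X q \<alpha> \<oplus>\<^bsub>deg (theory_complex B X) q\<^esub> theory_map f X q \<beta>"
    if "\<beta> \<in> carrier (deg (theory_complex A X) q)" for \<beta>
    by (rule B.theory_eqI[of _ X q]) (use that \<alpha> in \<open>auto simp: closed calc f_add\<close>)
  show "theory_map f X q (r \<odot>\<^bsub>deg (theory_complex A X) q\<^esub> \<alpha>) =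
      r \<odot>\<^bsub>deg (theory_complex B X) q\<^esub> theory_map f X q \<alpha>" if "r \<in> carrier R" for r
    by (rule B.theory_eqI[of _ X q]) (use that \<alpha> in \<open>auto simp: closed calc f_smult\<close>)
  show "theory_map f X (q + 1) (dif (theory_complex A X) q \<alpha>) =
      dif (theory_complex B X) q (theory_map f X q \<alpha>)"
    by (rule B.theory_eqI[of _ X "q + 1"]) (use \<alpha> in \<open>auto simp: closed calc f_d\<close>)
qed (rule theory_map_closed[OF X])

lemma theory_map_monoidal:
  fixes pr :: "'u \<times> 'u \<Rightarrow> 'u"
  assumes pr: "inj pr"
  shows "theory_map f \<in> monoidal_transformations R pr (cohomology_theory pr A) (cohomology_theory pr B)"
proof -
  have obj: "fobj (cohomology_theory pr A) = theory_complex A" "fobj (cohomology_theory pr B) = theory_complex B"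
    and map: "fmap (cohomology_theory pr A) = (\<lambda>X Y f q \<alpha>. sset_comp X \<alpha> f)"
      "fmap (cohomology_theory pr B) = (\<lambda>X Y f q \<alpha>. sset_comp X \<alpha> f)"
    by (simp_all add: cohomology_theory_def)
  show ?thesis
    unfolding monoidal_transformations_def obj map
  proof (intro CollectI conjI allI impI ballI theory_map_cochain)
    fix X Y :: "'u sset" and q g \<alpha>
    assume X: "simplicial_set X" and Y: "simplicial_set Y" and g: "g \<in> simplicial_maps X Y"
      and \<alpha>: "\<alpha> \<in> carrier (deg (theory_complex A Y) q)"
    show "theory_map f X q (sset_comp X \<alpha> g) = sset_comp X (theory_map f Y q \<alpha>) g"
      by (rule B.theory_eqI[OF theory_map_closed[OF X A.theory_pullback[OF X g \<alpha>]]
            B.theory_pullback[OF X g theory_map_closed[OF Y \<alpha>]]])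
        (simp add: theory_map_apply A.sset_comp_apply simplicial_mapsD(1)[OF g])
  next
    fix X Y :: "'u sset" and p q \<alpha> \<beta>
    assume X: "simplicial_set X" and Y: "simplicial_set Y"
      and \<alpha>: "\<alpha> \<in> carrier (deg (theory_complex A X) p)" and \<beta>: "\<beta> \<in> carrier (deg (theory_complex A Y) q)"
    show "theory_map f (sset_prod pr X Y) (p + q) (kappa (cohomology_theory pr A) X Y p q \<alpha> \<beta>) =
        kappa (cohomology_theory pr B) X Y p q (theory_map f X p \<alpha>) (theory_map f Y q \<beta>)"
    proof (rule B.theory_eqI[OF theory_map_closed[OF simplicial_set_prod[OF pr X Y] A.kappa_closed[OF pr X Y \<alpha> \<beta>]]
          B.kappa_closed[OF pr X Y theory_map_closed[OF X \<alpha>] theory_map_closed[OF Y \<beta>]]])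
      fix n z assume z: "z \<in> simp (sset_prod pr X Y) n"
      then obtain x y where "z = pr (x, y)" "x \<in> simp X n" "y \<in> simp Y n" by (rule sset_prodE[OF pr])
      then show "theory_map f (sset_prod pr X Y) (p + q) (kappa (cohomology_theory pr A) X Y p q \<alpha> \<beta>) n z =
          kappa (cohomology_theory pr B) X Y p q (theory_map f X p \<alpha>) (theory_map f Y q \<beta>) n z"
        using z \<alpha> \<beta> pr
        by (simp add: theory_map_apply A.kappa_apply B.kappa_apply f_mul A.theory_closed)
    qed
  next
    fix q s assume s: "s \<in> carrier (deg (unit_complex R) q)"
    have sR: "s \<in> carrier R"
      using s A.dga.mod.R.zero_closed by (auto simp: unit_complex_def ring_module_def split: if_splits)
    show "theory_map f sset_pt q (eta (cohomology_theory pr A) q s) = eta (cohomology_theory pr B) q s"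
      by (rule B.theory_eqI[OF theory_map_closed[OF simplicial_set_pt A.theory_eta_closed[OF sR]] B.theory_eta_closed[OF sR]])
        (use sR in \<open>simp add: theory_map_apply cohomology_theory_def unit_map_def f_smult f_one f_zero A.dga.one_closed\<close>)
  qed
qed

lemma cone_acyclic:
  assumes q: "\<And>n. quis (level A n) (level B n) (f n)" and t: "unit_path A t"
  shows "acyclic_simplicial_complex
    (\<lambda>n q. product_group (deg (level A n) (q + 1)) (deg (level B n) q))
    (\<lambda>n q x. (\<ominus>\<^bsub>deg (level A n) (q + 1 + 1)\<^esub> dif (level A n) (q + 1) (fst x),
       f n (q + 1) (fst x) \<oplus>\<^bsub>deg (level B n) (q + 1)\<^esub> dif (level B n) q (snd x)))
    (\<lambda>m n \<theta> q x. (sact A m n \<theta> (q + 1) (fst x), sact B m n \<theta> q (snd x))) (- 1)"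
    (is "acyclic_simplicial_complex ?G ?d ?a _")
proof -
  note [[simproc del: int_combine_numerals]]
  note simps = product_group_simps f_closed f_add A.dga.d_closed B.dga.d_closed A.dga.d_add B.dga.d_add
    A.dga.d_d B.dga.d_d A.dga.d_minus f_minus f_d
  have ac: "(x \<oplus>\<^bsub>deg (level B n) q\<^esub> y) \<oplus>\<^bsub>deg (level B n) q\<^esub> (z \<oplus>\<^bsub>deg (level B n) q\<^esub> w) =
      (x \<oplus>\<^bsub>deg (level B n) q\<^esub> z) \<oplus>\<^bsub>deg (level B n) q\<^esub> (y \<oplus>\<^bsub>deg (level B n) q\<^esub> w)"
    if "x \<in> carrier (deg (level B n) q)" "y \<in> carrier (deg (level B n) q)"
      "z \<in> carrier (deg (level B n) q)" "w \<in> carrier (deg (level B n) q)" for n q x y z w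
    using that by (simp add: B.dga.group.a_ac)
  show ?thesis
  proof (rule acyclic_simplicial_complex.intro)
    show "abelian_group (?G n q)" for n q
      by (intro product_group A.dga.group.abelian_group_axioms B.dga.group.abelian_group_axioms)
    show "?d n q x \<in> carrier (?G n (q + 1))" if "x \<in> carrier (?G n q)" for n q x
      using that by (auto simp: simps)
    show "?d n q (x \<oplus>\<^bsub>?G n q\<^esub> y) = ?d n q x \<oplus>\<^bsub>?G n (q + 1)\<^esub> ?d n q y"
      if "x \<in> carrier (?G n q)" "y \<in> carrier (?G n q)" for n q x y
      using that by (auto simp: simps A.dga.group.minus_add ac)
    show "?d n (q + 1) (?d n q x) = \<zero>\<^bsub>?G n (q + 1 + 1)\<^esub>" if xin: "x \<in> carrier (?G n q)" for n q x
    proof -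
      obtain y z where x: "x = (y, z)" and y: "y \<in> carrier (deg (level A n) (q + 1))"
        and z: "z \<in> carrier (deg (level B n) q)" using xin by (auto simp: product_group_simps)
      have fy: "f n (q + 1) y \<in> carrier (deg (level B n) (q + 1))" using f_closed[OF y] .
      show ?thesis
        unfolding x fst_conv snd_conv product_group_simps
          A.dga.d_minus[OF A.dga.d_closed[OF y]] A.dga.d_d[OF y] f_minus[OF A.dga.d_closed[OF y]] f_d[OF y]
          B.dga.d_add[OF fy B.dga.d_closed[OF z]] B.dga.d_d[OF z]
        using B.dga.d_closed[OF fy] by (simp add: B.dga.group.l_neg)
    qed
    show "?a m n \<theta> q (x \<oplus>\<^bsub>?G n q\<^esub> y) = ?a m n \<theta> q x \<oplus>\<^bsub>?G m q\<^esub> ?a m n \<theta> q y"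
      if "\<theta> \<in> simplex_hom m n" "x \<in> carrier (?G n q)" "y \<in> carrier (?G n q)" for m n \<theta> q x y
      using that by (auto simp: product_group_simps A.sact_add B.sact_add)
    show "?a m n \<theta> (q + 1) (?d n q x) = ?d m q (?a m n \<theta> q x)"
      if "\<theta> \<in> simplex_hom m n" "x \<in> carrier (?G n q)" for m n \<theta> q x
      using that by (auto simp: product_group_simps A.sact_minus B.sact_add A.dga.d_closed B.dga.d_closed
          f_closed A.sact_d B.sact_d f_sact)
    show S: "simplicial_set \<lparr>simp = \<lambda>p. carrier (?G p q), act = \<lambda>m n \<theta>. ?a m n \<theta> q\<rparr>" for q
      unfolding simplicial_set_def
      by (auto simp: product_group_simps A.sact_closed B.sact_closed A.sact_id B.sact_id A.sact_sact B.sact_sact)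
    show "\<exists>w\<in>carrier (?G n q). ?d n q w = x"
      if x: "x \<in> carrier (?G n (q + 1))" "?d n (q + 1) x = \<zero>\<^bsub>?G n (q + 1 + 1)\<^esub>" for n q x
    proof -
      obtain y z where xyz: "x = (y, z)" and y: "y \<in> carrier (deg (level A n) (q + 1 + 1))"
        and z: "z \<in> carrier (deg (level B n) (q + 1))" using x by (auto simp: product_group_simps)
      let ?y = "\<ominus>\<^bsub>deg (level A n) (q + 1 + 1)\<^esub> y"
      have dy: "dif (level A n) (q + 1 + 1) ?y = \<zero>\<^bsub>deg (level A n) (q + 1 + 1 + 1)\<^esub>"
        and fz: "f n (q + 1 + 1) y \<oplus>\<^bsub>deg (level B n) (q + 1 + 1)\<^esub> dif (level B n) (q + 1) z
            = \<zero>\<^bsub>deg (level B n) (q + 1 + 1)\<^esub>"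
        using x(2) unfolding xyz fst_conv snd_conv product_group_simps A.dga.d_minus[OF y] by blast+
      have "f n (q + 1 + 1) ?y = dif (level B n) (q + 1) z"
        unfolding f_minus[OF y]
        using fz f_closed[OF y] B.dga.d_closed[OF z] B.dga.group.minus_equality B.dga.group.a_comm
        by (metis B.dga.group.minus_minus)
      then obtain y' z' where y': "y' \<in> carrier (deg (level A n) (q + 1))" "z' \<in> carrier (deg (level B n) q)"
        "dif (level A n) (q + 1) y' = ?y" "z = f n (q + 1) y' \<oplus>\<^bsub>deg (level B n) (q + 1)\<^esub> dif (level B n) q z'"
        using quis_cone[OF A.dga.complex B.dga.complex f_cochain q _ dy z] y by blast
      then show ?thesis
        unfolding xyz using y by (intro bexI[of _ "(y', z')"]) (auto simp: product_group_simps)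
    qed
    show "carrier (?G n q) = {\<zero>\<^bsub>?G n q\<^esub>}" if "q < - 1" for n q
    proof -
      have "q + 1 < 0" "q < 0" using that by simp_all
      then show ?thesis unfolding product_group_simps A.dga.neg_deg[OF \<open>q + 1 < 0\<close>] B.dga.neg_deg[OF \<open>q < 0\<close>] by blast
    qed
    show "fillable \<lparr>simp = \<lambda>p. carrier (?G p q), act = \<lambda>m n \<theta>. ?a m n \<theta> q\<rparr>" for q
      unfolding fillable_def
    proof (intro allI impI)
      fix p y assume y: "boundary_family \<lparr>simp = \<lambda>p. carrier (?G p q), act = \<lambda>m n \<theta>. ?a m n \<theta> q\<rparr> p y"
      have yc: "y k \<theta> \<in> carrier (?G k q)" if "k < p" "\<theta> \<in> simplex_hom k p" for k \<theta>
        using y that unfolding boundary_family_def by simp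
      have ya: "y j (compose {..j} \<theta> \<phi>) = ?a j k \<phi> q (y k \<theta>)"
        if "j < p" "k < p" "\<phi> \<in> simplex_hom j k" "\<theta> \<in> simplex_hom k p" for j k \<phi> \<theta>
        using y that unfolding boundary_family_def by simp
      have 1: "boundary_family (sdga_sset A (q + 1)) p (\<lambda>k \<theta>. fst (y k \<theta>))"
        and 2: "boundary_family (sdga_sset B q) p (\<lambda>k \<theta>. snd (y k \<theta>))"
        using yc ya unfolding boundary_family_def sdga_sset_def by (auto simp: product_group_simps mem_Times_iff)
      obtain z where z: "z \<in> simp (sdga_sset A (q + 1)) p"
        "\<And>k \<theta>. k < p \<Longrightarrow> \<theta> \<in> simplex_hom k p \<Longrightarrow> act (sdga_sset A (q + 1)) k p \<theta> z = fst (y k \<theta>)"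
        by (rule fillableE[OF A.fillable[OF t] 1]) blast
      obtain w where w: "w \<in> simp (sdga_sset B q) p"
        "\<And>k \<theta>. k < p \<Longrightarrow> \<theta> \<in> simplex_hom k p \<Longrightarrow> act (sdga_sset B q) k p \<theta> w = snd (y k \<theta>)"
        by (rule fillableE[OF B.fillable[OF unit_path_map[OF t]] 2]) blast
      show "\<exists>z\<in>simp \<lparr>simp = \<lambda>p. carrier (?G p q), act = \<lambda>m n \<theta>. ?a m n \<theta> q\<rparr> p. \<forall>k<p. \<forall>\<theta>\<in>simplex_hom k p.
          act \<lparr>simp = \<lambda>p. carrier (?G p q), act = \<lambda>m n \<theta>. ?a m n \<theta> q\<rparr> k p \<theta> z = y k \<theta>"
        using z w by (intro bexI[of _ "(z, w)"]) (auto simp: sdga_sset_def product_group_simps)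
    qed
  qed
qed

lemma theory_map_lift:
  assumes q: "\<And>n. quis (level A n) (level B n) (f n)" and t: "unit_path A t"
    and X: "simplicial_set X"
    and \<alpha>: "\<alpha> \<in> carrier (deg (theory_complex A X) (q + 1 + 1))"
      "dif (theory_complex A X) (q + 1 + 1) \<alpha> = \<zero>\<^bsub>deg (theory_complex A X) (q + 1 + 1 + 1)\<^esub>"
    and \<beta>: "\<beta> \<in> carrier (deg (theory_complex B X) (q + 1))"
      "theory_map f X (q + 1 + 1) \<alpha> = dif (theory_complex B X) (q + 1) \<beta>"
  obtains \<alpha>' \<beta>' where "\<alpha>' \<in> carrier (deg (theory_complex A X) (q + 1))"
    "\<beta>' \<in> carrier (deg (theory_complex B X) q)" "dif (theory_complex A X) (q + 1) \<alpha>' = \<alpha>"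
    "\<beta> = theory_map f X (q + 1) \<alpha>' \<oplus>\<^bsub>deg (theory_complex B X) (q + 1)\<^esub> dif (theory_complex B X) q \<beta>'"
proof -
  interpret K: acyclic_simplicial_complex
    "\<lambda>n q. product_group (deg (level A n) (q + 1)) (deg (level B n) q)"
    "\<lambda>n q x. (\<ominus>\<^bsub>deg (level A n) (q + 1 + 1)\<^esub> dif (level A n) (q + 1) (fst x),
       f n (q + 1) (fst x) \<oplus>\<^bsub>deg (level B n) (q + 1)\<^esub> dif (level B n) q (snd x))"
    "\<lambda>m n \<theta> q x. (sact A m n \<theta> (q + 1) (fst x), sact B m n \<theta> q (snd x))" "- 1"
    by (rule cone_acyclic[OF q t])
  let ?y = "\<lambda>n x. (\<ominus>\<^bsub>deg (level A n) (q + 1 + 1)\<^esub> \<alpha> n x, \<beta> n x)"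
  have \<alpha>c: "\<alpha> n x \<in> carrier (deg (level A n) (q + 1 + 1))"
    and \<beta>c: "\<beta> n x \<in> carrier (deg (level B n) (q + 1))" if "x \<in> simp X n" for n x
    using A.theory_closed[OF \<alpha>(1) that] B.theory_closed[OF \<beta>(1) that] by auto
  have d\<alpha>: "dif (level A n) (q + 1 + 1) (\<alpha> n x) = \<zero>\<^bsub>deg (level A n) (q + 1 + 1 + 1)\<^esub>"
    and f\<alpha>: "f n (q + 1 + 1) (\<alpha> n x) = dif (level B n) (q + 1) (\<beta> n x)" if x: "x \<in> simp X n" for n x
    using arg_cong[OF \<alpha>(2), of "\<lambda>g. g n x"] arg_cong[OF \<beta>(2), of "\<lambda>g. g n x"]
    unfolding A.theory_apply[OF x] B.theory_apply[OF x] theory_map_apply[OF x] by auto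
  have nat: "natural_on UNIV X (K.chain_sset (q + 1)) ?y"
    unfolding natural_on_def
  proof (intro conjI ballI)
    fix n x assume "x \<in> simp X n"
    then show "?y n x \<in> simp (K.chain_sset (q + 1)) n"
      unfolding sset.simps product_group_simps using \<alpha>c \<beta>c A.dga.group.a_inv_closed by blast
  next
    fix m n \<theta> x assume \<theta>: "\<theta> \<in> simplex_hom m n" and x: "x \<in> simp X n"
    show "?y m (act X m n \<theta> x) = act (K.chain_sset (q + 1)) m n \<theta> (?y n x)"
      unfolding sset.simps fst_conv snd_conv A.theory_act[OF \<alpha>(1) \<theta> x] B.theory_act[OF \<beta>(1) \<theta> x]
        A.sact_minus[OF \<theta> \<alpha>c[OF x]] ..
  qed
  obtain w where w: "natural_on UNIV X (K.chain_sset q) w"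
    "\<And>n x. x \<in> simp X n \<Longrightarrow> (\<ominus>\<^bsub>deg (level A n) (q + 1 + 1)\<^esub> dif (level A n) (q + 1) (fst (w n x)),
       f n (q + 1) (fst (w n x)) \<oplus>\<^bsub>deg (level B n) (q + 1)\<^esub> dif (level B n) q (snd (w n x))) = ?y n x"
  proof (rule K.lift_cocycle[OF X nat])
    fix n x assume x: "x \<in> simp X n"
    show "(\<ominus>\<^bsub>deg (level A n) (q + 1 + 1 + 1)\<^esub> dif (level A n) (q + 1 + 1) (fst (?y n x)),
        f n (q + 1 + 1) (fst (?y n x)) \<oplus>\<^bsub>deg (level B n) (q + 1 + 1)\<^esub> dif (level B n) (q + 1) (snd (?y n x))) =
        \<zero>\<^bsub>product_group (deg (level A n) (q + 1 + 1 + 1)) (deg (level B n) (q + 1 + 1))\<^esub>"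
      unfolding fst_conv snd_conv product_group_simps A.dga.d_minus[OF \<alpha>c[OF x]] f_minus[OF \<alpha>c[OF x]] d\<alpha>[OF x] f\<alpha>[OF x]
      using B.dga.d_closed[OF \<beta>c[OF x]] by (simp add: B.dga.group.l_neg)
  qed (rule that)
  have wc: "fst (w n x) \<in> carrier (deg (level A n) (q + 1))" "snd (w n x) \<in> carrier (deg (level B n) q)"
    if "x \<in> simp X n" for n x
    using natural_onD(1)[OF w(1) UNIV_I that] by (auto simp: product_group_simps)
  have wn: "fst (w m (act X m n \<theta> x)) = sact A m n \<theta> (q + 1) (fst (w n x))"
      "snd (w m (act X m n \<theta> x)) = sact B m n \<theta> q (snd (w n x))"
    if "\<theta> \<in> simplex_hom m n" "x \<in> simp X n" for m n \<theta> x
    using natural_onD(2)[OF w(1) UNIV_I UNIV_I that] by auto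
  define \<alpha>' where "\<alpha>' = (\<lambda>n. \<lambda>x\<in>simp X n. fst (w n x))"
  define \<beta>' where "\<beta>' = (\<lambda>n. \<lambda>x\<in>simp X n. snd (w n x))"
  have \<alpha>': "\<alpha>' \<in> carrier (deg (theory_complex A X) (q + 1))"
    by (rule A.theory_carrierI) (auto simp: \<alpha>'_def wc wn act_closed[OF X])
  have \<beta>': "\<beta>' \<in> carrier (deg (theory_complex B X) q)"
    by (rule B.theory_carrierI) (auto simp: \<beta>'_def wc wn act_closed[OF X])
  show thesis
  proof (rule that[OF \<alpha>' \<beta>'])
    show "dif (theory_complex A X) (q + 1) \<alpha>' = \<alpha>"
    proof (rule A.theory_eqI[OF A.theory_dif_closed[OF X \<alpha>'] \<alpha>(1)])
      fix n x assume x: "x \<in> simp X n"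
      have "\<ominus>\<^bsub>deg (level A n) (q + 1 + 1)\<^esub> dif (level A n) (q + 1) (fst (w n x)) =
          \<ominus>\<^bsub>deg (level A n) (q + 1 + 1)\<^esub> \<alpha> n x" using w(2)[OF x] by blast
      then have "dif (level A n) (q + 1) (fst (w n x)) = \<alpha> n x"
        using A.dga.d_closed[OF wc(1)[OF x]] \<alpha>c[OF x] by (metis A.dga.group.minus_minus)
      then show "dif (theory_complex A X) (q + 1) \<alpha>' n x = \<alpha> n x"
        unfolding A.theory_apply[OF x] using x by (simp add: \<alpha>'_def)
    qed
    show "\<beta> = theory_map f X (q + 1) \<alpha>' \<oplus>\<^bsub>deg (theory_complex B X) (q + 1)\<^esub> dif (theory_complex B X) q \<beta>'"
    proof (rule B.theory_eqI[OF \<beta>(1) B.theory_add_closed[OF X theory_map_closed[OF X \<alpha>'] B.theory_dif_closed[OF X \<beta>']]])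
      fix n x assume x: "x \<in> simp X n"
      show "\<beta> n x = (theory_map f X (q + 1) \<alpha>' \<oplus>\<^bsub>deg (theory_complex B X) (q + 1)\<^esub> dif (theory_complex B X) q \<beta>') n x"
        unfolding B.theory_apply[OF x] theory_map_apply[OF x] using w(2)[OF x] x by (simp add: \<alpha>'_def \<beta>'_def)
    qed
  qed
qed

lemma theory_map_quis:
  assumes q: "\<And>n. quis (level A n) (level B n) (f n)" and t: "unit_path A t" and X: "simplicial_set X"
  shows "quis (theory_complex A X) (theory_complex B X) (theory_map f X)"
proof (rule quisI)
  interpret TA: cocomplex R "theory_complex A X" by unfold_locales (rule A.theory_cochain_complex[OF X])
  interpret TB: cocomplex R "theory_complex B X" by unfold_locales (rule B.theory_cochain_complex[OF X])
  fix p
  show "\<alpha> \<in> coboundaries (theory_complex A X) p"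
    if asm: "\<alpha> \<in> cocycles (theory_complex A X) p" "theory_map f X p \<alpha> \<in> coboundaries (theory_complex B X) p" for \<alpha>
  proof -
    define q where "q = p - 1 - 1"
    have p: "p = q + 1 + 1" "p - 1 = q + 1" by (simp_all add: q_def)
    obtain \<beta> where \<beta>: "\<beta> \<in> carrier (deg (theory_complex B X) (q + 1))"
      "theory_map f X (q + 1 + 1) \<alpha> = dif (theory_complex B X) (q + 1) \<beta>"
      using asm(2) unfolding coboundaries_def p(2) unfolding p(1) by blast
    have "\<alpha> \<in> carrier (deg (theory_complex A X) (q + 1 + 1))"
      "dif (theory_complex A X) (q + 1 + 1) \<alpha> = \<zero>\<^bsub>deg (theory_complex A X) (q + 1 + 1 + 1)\<^esub>"
      using asm(1) unfolding cocycles_def p(1) by blast+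
    from theory_map_lift[OF q t X this \<beta>] show ?thesis
      unfolding coboundaries_def p(2) unfolding p(1) by (metis imageI)
  qed
  show "\<exists>\<alpha>\<in>cocycles (theory_complex A X) p. \<exists>\<beta>'\<in>coboundaries (theory_complex B X) p.
      \<beta> = theory_map f X p \<alpha> \<oplus>\<^bsub>deg (theory_complex B X) p\<^esub> \<beta>'"
    if "\<beta> \<in> cocycles (theory_complex B X) p" for \<beta>
  proof -
    define q where "q = p - 1"
    have p: "p = q + 1" "p - 1 = q" by (simp_all add: q_def)
    have \<beta>: "\<beta> \<in> carrier (deg (theory_complex B X) (q + 1))"
      "dif (theory_complex B X) (q + 1) \<beta> = \<zero>\<^bsub>deg (theory_complex B X) (q + 1 + 1)\<^esub>"
      using that unfolding cocycles_def p(1) by blast+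
    let ?z = "\<zero>\<^bsub>deg (theory_complex A X) (q + 1 + 1)\<^esub>"
    have z: "?z \<in> carrier (deg (theory_complex A X) (q + 1 + 1))"
      "dif (theory_complex A X) (q + 1 + 1) ?z = \<zero>\<^bsub>deg (theory_complex A X) (q + 1 + 1 + 1)\<^esub>"
      "theory_map f X (q + 1 + 1) ?z = dif (theory_complex B X) (q + 1) \<beta>"
      using linear_zero[OF TA.module_deg TB.module_deg cochain_mapsD(1)[OF theory_map_cochain[OF X]], of "q + 1 + 1"] \<beta>(2)
      by (simp_all only: TA.d_zero TA.group.zero_closed)
    obtain \<alpha>' \<beta>' where *: "\<alpha>' \<in> carrier (deg (theory_complex A X) (q + 1))"
      "\<beta>' \<in> carrier (deg (theory_complex B X) q)" "dif (theory_complex A X) (q + 1) \<alpha>' = ?z"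
      "\<beta> = theory_map f X (q + 1) \<alpha>' \<oplus>\<^bsub>deg (theory_complex B X) (q + 1)\<^esub> dif (theory_complex B X) q \<beta>'"
      by (rule theory_map_lift[OF q t X z(1,2) \<beta>(1) z(3)])
    have "\<alpha>' \<in> cocycles (theory_complex A X) p" "dif (theory_complex B X) q \<beta>' \<in> coboundaries (theory_complex B X) p"
      using * unfolding cocycles_def coboundaries_def p(2) unfolding p(1) by blast+
    then show ?thesis using *(4) unfolding p(1) by blast
  qed
qed

lemma quasi_iso_step:
  fixes pr :: "'u \<times> 'u \<Rightarrow> 'u"
  assumes pr: "inj pr" and q: "\<And>n. quis (level A n) (level B n) (f n)" and t: "unit_path A t"
  shows "quasi_iso_step R pr (cohomology_theory pr A) (cohomology_theory pr B)"
  unfolding quasi_iso_step_def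
proof (intro conjI bexI[OF _ theory_map_monoidal[OF pr]] allI impI)
  fix X :: "'u sset" assume X: "simplicial_set X"
  have obj: "fobj (cohomology_theory pr A) = theory_complex A" "fobj (cohomology_theory pr B) = theory_complex B"
    by (simp_all add: cohomology_theory_def)
  show "quasi_isomorphism R (fobj (cohomology_theory pr A) X) (fobj (cohomology_theory pr B) X) (theory_map f X)"
    unfolding obj
    by (rule quasi_isomorphismI[OF A.theory_cochain_complex[OF X] B.theory_cochain_complex[OF X]
          theory_map_cochain[OF X] theory_map_quis[OF q t X]])
qed (rule A.theory_lax_monoidal[OF pr] B.theory_lax_monoidal[OF pr])+

end

section \<open>Cochains on lists of vertices\<close>

text \<open>A cochain of degree \<open>n\<close> with values in a graded module is a function \<open>c\<close> on lists of
  vertices with \<open>c xs\<close> of degree \<open>N - length xs\<close> for \<open>N = n + 1\<close>.  Writing \<open>L\<^sub>x c\<close> for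
  \<open>\<lambda>ys. c (x # ys)\<close>, the total differential satisfies \<open>L\<^sub>x \<circ> d = 1 - d \<circ> L\<^sub>x\<close>, and the
  Alexander--Whitney product has a similar recursion; all identities follow by induction on the
  list.  A value at the empty list has to be allowed because of the operators \<open>L\<^sub>x\<close>.\<close>

fun cobd :: "('r, 'a, 'l) cochains_scheme \<Rightarrow> int \<Rightarrow> ('v list \<Rightarrow> 'a) \<Rightarrow> 'v list \<Rightarrow> 'a" where
  "cobd D N c [] = \<ominus>\<^bsub>deg D (N + 1)\<^esub> dif D N (c [])"
| "cobd D N c (x # xs) = c xs \<ominus>\<^bsub>deg D (N - int (length xs))\<^esub> cobd D (N - 1) (\<lambda>ys. c (x # ys)) xs"

fun cup :: "('r, 'a) dga \<Rightarrow> int \<Rightarrow> int \<Rightarrow> ('v list \<Rightarrow> 'a) \<Rightarrow> ('v list \<Rightarrow> 'a) \<Rightarrow> 'v list \<Rightarrow> 'a" where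
  "cup D N m c c' [] = \<zero>\<^bsub>deg D (N + m)\<^esub>"
| "cup D N m c c' (x # xs) =
     signed (deg D (N + m - 1 - int (length xs))) ((N - 1) * int (length xs))
       (dmul D (N - 1) (m - int (length xs)) (c [x]) (c' (x # xs)))
     \<oplus>\<^bsub>deg D (N + m - 1 - int (length xs))\<^esub> cup D (N - 1) m (\<lambda>ys. c (x # ys)) c' xs"

definition graded :: "('r, 'a, 'l) cochains_scheme \<Rightarrow> int \<Rightarrow> ('v list \<Rightarrow> 'a) \<Rightarrow> 'v list \<Rightarrow> bool" where
  "graded D N c xs \<longleftrightarrow> (\<forall>ys. subseq ys xs \<longrightarrow> c ys \<in> carrier (deg D (N - int (length ys))))"

lemma subseq_tl [simp]: "subseq xs (x # xs)"
  by (simp add: list_emb_Cons)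

lemma gradedD: "graded D N c xs \<Longrightarrow> subseq ys xs \<Longrightarrow> c ys \<in> carrier (deg D (N - int (length ys)))"
  by (simp add: graded_def)

lemma graded_nil: "graded D N c xs \<Longrightarrow> c [] \<in> carrier (deg D N)"
  using gradedD[of D N c xs "[]"] by simp

lemma graded_tl: "graded D N c (x # xs) \<Longrightarrow> graded D N c xs"
  by (auto simp: graded_def intro: list_emb_Cons)

lemma graded_shift:
  assumes "graded D N c (x # xs)"
  shows "graded D (N - 1) (\<lambda>ys. c (x # ys)) xs"
  unfolding graded_def
proof (intro allI impI)
  fix ys assume "subseq ys xs"
  then have "c (x # ys) \<in> carrier (deg D (N - int (length (x # ys))))"
    using gradedD[OF assms, of "x # ys"] by simp
  then show "c (x # ys) \<in> carrier (deg D (N - 1 - int (length ys)))" by (simp add: diff_diff_eq)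
qed

lemma graded_subseq: "graded D N c xs \<Longrightarrow> subseq ys xs \<Longrightarrow> graded D N c ys"
  unfolding graded_def by (meson subseq_order.trans)

lemma cobd_cong:
  "(\<And>ys. subseq ys xs \<Longrightarrow> c ys = c' ys) \<Longrightarrow> cobd D N c xs = cobd D N c' xs"
proof (induction xs arbitrary: N c c')
  case (Cons x xs)
  have "cobd D (N - 1) (\<lambda>ys. c (x # ys)) xs = cobd D (N - 1) (\<lambda>ys. c' (x # ys)) xs"
    by (rule Cons.IH) (use Cons.prems in auto)
  then show ?case using Cons.prems[OF subseq_tl] by simp
qed simp

lemma cup_cong:
  "(\<And>ys. ys \<noteq> [] \<Longrightarrow> subseq ys xs \<Longrightarrow> c ys = d ys) \<Longrightarrow> (\<And>ys. ys \<noteq> [] \<Longrightarrow> subseq ys xs \<Longrightarrow> c' ys = d' ys) \<Longrightarrow>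
    cup D N m c c' xs = cup D N m d d' xs"
proof (induction xs arbitrary: N c d)
  case (Cons x xs)
  have "cup D (N - 1) m (\<lambda>ys. c (x # ys)) c' xs = cup D (N - 1) m (\<lambda>ys. d (x # ys)) d' xs"
    by (rule Cons.IH) (use Cons.prems in auto)
  then show ?case using Cons.prems(1)[of "[x]"] Cons.prems(2)[of "x # xs"] by simp
qed simp

lemma cobd_map_list: "cobd D N (\<lambda>ys. c (map h ys)) xs = cobd D N c (map h xs)"
proof (induction xs arbitrary: N c)
  case (Cons x xs)
  show ?case using Cons[of "N - 1" "\<lambda>ys. c (h x # ys)"] by simp
qed simp

lemma cup_map_list: "cup D N m (\<lambda>ys. c (map h ys)) (\<lambda>ys. c' (map h ys)) xs = cup D N m c c' (map h xs)"
proof (induction xs arbitrary: N c)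
  case (Cons x xs)
  show ?case using Cons[of "N - 1" "\<lambda>ys. c (h x # ys)"] by simp
qed simp

lemma (in abelian_group) signed_add:
  "x \<in> carrier G \<Longrightarrow> y \<in> carrier G \<Longrightarrow> signed G k (x \<oplus> y) = signed G k x \<oplus> signed G k y"
  by (simp add: signed_def minus_add)

lemma (in abelian_group) minus_zero: "x \<in> carrier G \<Longrightarrow> x \<ominus> \<zero> = x"
  by (simp add: a_minus_def)

lemma (in abelian_group) signed_zero: "signed G k \<zero> = \<zero>"
  by (simp add: signed_def)

lemma (in abelian_group) signed_signed: "x \<in> carrier G \<Longrightarrow> signed G j (signed G k x) = signed G (j + k) x"
  by (auto simp: signed_def)

lemma (in abelian_group) signed_minus: "x \<in> carrier G \<Longrightarrow> \<ominus> signed G k x = signed G (k + 1) x"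
  by (auto simp: signed_def)

lemma signed_cong: "even j = even k \<Longrightarrow> signed G j x = signed G k x"
  by (simp add: signed_def)

context cocomplex
begin

lemma cobd_closed: "graded C N c xs \<Longrightarrow> cobd C N c xs \<in> carrier (deg C (N + 1 - int (length xs)))"
proof (induction xs arbitrary: N c)
  case Nil
  then show ?case using d_closed[OF graded_nil[OF Nil]] by simp
next
  case (Cons x xs)
  have "c xs \<in> carrier (deg C (N - int (length xs)))" using gradedD[OF Cons.prems, of xs] by simp
  moreover have "cobd C (N - 1) (\<lambda>ys. c (x # ys)) xs \<in> carrier (deg C (N - int (length xs)))"
    using Cons.IH[OF graded_shift[OF Cons.prems]] by simp
  ultimately show ?case by simp
qed

lemma graded_cobd: "graded C N c xs \<Longrightarrow> graded C (N + 1) (cobd C N c) xs"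
  using cobd_closed[OF graded_subseq] by (metis graded_def)

lemma cobd_add:
  "graded C N c xs \<Longrightarrow> graded C N c' xs \<Longrightarrow>
    cobd C N (\<lambda>ys. c ys \<oplus>\<^bsub>deg C (N - int (length ys))\<^esub> c' ys) xs
      = cobd C N c xs \<oplus>\<^bsub>deg C (N + 1 - int (length xs))\<^esub> cobd C N c' xs"
proof (induction xs arbitrary: N c c')
  case Nil
  then show ?case
    using graded_nil[OF Nil(1)] graded_nil[OF Nil(2)] by (simp add: d_add d_closed group.minus_add)
next
  case (Cons x xs)
  let ?G = "deg C (N - int (length xs))"
  have c: "c xs \<in> carrier ?G" "c' xs \<in> carrier ?G"
    using gradedD[OF Cons.prems(1), of xs] gradedD[OF Cons.prems(2), of xs] by simp_all
  have b: "cobd C (N - 1) (\<lambda>ys. c (x # ys)) xs \<in> carrier ?G" "cobd C (N - 1) (\<lambda>ys. c' (x # ys)) xs \<in> carrier ?G"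
    using cobd_closed[OF graded_shift[OF Cons.prems(1)]] cobd_closed[OF graded_shift[OF Cons.prems(2)]] by simp_all
  have "cobd C (N - 1) (\<lambda>ys. c (x # ys) \<oplus>\<^bsub>deg C (N - int (length (x # ys)))\<^esub> c' (x # ys)) xs
      = cobd C (N - 1) (\<lambda>ys. c (x # ys)) xs \<oplus>\<^bsub>?G\<^esub> cobd C (N - 1) (\<lambda>ys. c' (x # ys)) xs"
    using Cons.IH[OF graded_shift[OF Cons.prems(1)] graded_shift[OF Cons.prems(2)]] by (simp add: diff_diff_eq)
  then show ?case using b c by (simp add: a_minus_def group.minus_add group.a_ac)
qed

end

lemma cobd_map:
  assumes C: "cochain_complex R C" and D: "cochain_complex R D" and f: "f \<in> cochain_maps R C D"
  shows "graded C N c xs \<Longrightarrow>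
    cobd D N (\<lambda>ys. f (N - int (length ys)) (c ys)) xs = f (N + 1 - int (length xs)) (cobd C N c xs)"
proof (induction xs arbitrary: N c)
  interpret C: cocomplex R C by unfold_locales fact
  interpret D: cocomplex R D by unfold_locales fact
  note f_minus = linear_minus[OF C.module_deg D.module_deg cochain_mapsD(1)[OF f]]
  {
    case Nil
    then show ?case
      using graded_nil[OF Nil] C.d_closed[OF graded_nil[OF Nil]] cochain_mapsD(2)[OF f, of "c []" N]
      by (simp add: f_minus)
  next
    case (Cons x xs)
    let ?q = "N - int (length xs)"
    have c: "c xs \<in> carrier (deg C ?q)" using gradedD[OF Cons.prems, of xs] by simp
    have b: "cobd C (N - 1) (\<lambda>ys. c (x # ys)) xs \<in> carrier (deg C ?q)"
      using C.cobd_closed[OF graded_shift[OF Cons.prems]] by simp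
    have "cobd D (N - 1) (\<lambda>ys. f (N - int (length (x # ys))) (c (x # ys))) xs
        = f ?q (cobd C (N - 1) (\<lambda>ys. c (x # ys)) xs)"
      using Cons.IH[OF graded_shift[OF Cons.prems]] by (simp add: diff_diff_eq)
    then show ?case
      using c b linear_mapsD(2)[OF cochain_mapsD(1)[OF f] c, of "\<ominus>\<^bsub>deg C ?q\<^esub> cobd C (N - 1) (\<lambda>ys. c (x # ys)) xs"]
      by (simp add: a_minus_def f_minus)
  }
qed

context cocomplex
begin

lemma smult_cochain:
  assumes "r \<in> carrier R"
  shows "(\<lambda>q x. r \<odot>\<^bsub>deg C q\<^esub> x) \<in> cochain_maps R C C"
  using assms
  by (intro cochain_mapsI linear_mapsI)
    (auto simp: mod.smult_closed mod.smult_r_distr d_smult mod.smult_assoc1[symmetric] mod.R.m_comm)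

lemmas cobd_smult = cobd_map[OF complex complex smult_cochain]

definition sign :: "int \<Rightarrow> 'r" where
  "sign k = (if even k then \<one>\<^bsub>R\<^esub> else \<ominus>\<^bsub>R\<^esub> \<one>\<^bsub>R\<^esub>)"

lemma sign_closed: "sign k \<in> carrier R"
  by (simp add: sign_def)

lemma signed_smult: "x \<in> carrier (deg C q) \<Longrightarrow> signed (deg C q) k x = sign k \<odot>\<^bsub>deg C q\<^esub> x"
  by (simp add: sign_def signed_def mod.smult_l_minus)

lemma cobd_signed:
  assumes c: "graded C N c xs"
  shows "cobd C N (\<lambda>ys. signed (deg C (N - int (length ys))) k (c ys)) xs
    = signed (deg C (N + 1 - int (length xs))) k (cobd C N c xs)"
proof -
  have "cobd C N (\<lambda>ys. signed (deg C (N - int (length ys))) k (c ys)) xs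
      = cobd C N (\<lambda>ys. sign k \<odot>\<^bsub>deg C (N - int (length ys))\<^esub> c ys) xs"
    by (rule cobd_cong) (simp add: signed_smult gradedD[OF c])
  then show ?thesis using cobd_smult[OF sign_closed c] signed_smult[OF cobd_closed[OF c]] by simp
qed

lemma graded_signed: "graded C N c xs \<Longrightarrow> graded C N (\<lambda>ys. signed (deg C (N - int (length ys))) (k ys) (c ys)) xs"
  by (simp add: graded_def)

lemma graded_add: "graded C N c xs \<Longrightarrow> graded C N c' xs \<Longrightarrow>
    graded C N (\<lambda>ys. c ys \<oplus>\<^bsub>deg C (N - int (length ys))\<^esub> c' ys) xs"
  by (simp add: graded_def)

lemma minus_signed: "\<ominus>\<^bsub>deg C q\<^esub> x = signed (deg C q) 1 x"
  by (simp add: signed_def)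

lemma cobd_diff:
  assumes "graded C N c xs" "graded C N c' xs"
  shows "cobd C N (\<lambda>ys. c ys \<ominus>\<^bsub>deg C (N - int (length ys))\<^esub> c' ys) xs
      = cobd C N c xs \<ominus>\<^bsub>deg C (N + 1 - int (length xs))\<^esub> cobd C N c' xs"
  unfolding a_minus_def minus_signed cobd_add[OF assms(1) graded_signed[OF assms(2)]] cobd_signed[OF assms(2)] ..

lemma cobd_cobd:
  "graded C N c xs \<Longrightarrow> cobd C (N + 1) (cobd C N c) xs = \<zero>\<^bsub>deg C (N + 2 - int (length xs))\<^esub>"
proof (induction xs arbitrary: N c)
  case Nil
  have "c [] \<in> carrier (deg C N)" using graded_nil[OF Nil] .
  then show ?case using d_d[of "c []" N] d_closed[of "c []" N] by (simp add: d_minus add.commute)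
next
  case (Cons x xs)
  note c = graded_tl[OF Cons.prems] and Lc = graded_shift[OF Cons.prems]
  have b: "graded C N (cobd C (N - 1) (\<lambda>ys. c (x # ys))) xs" using graded_cobd[OF Lc] by simp
  have z: "cobd C N (cobd C (N - 1) (\<lambda>ys. c (x # ys))) xs = \<zero>\<^bsub>deg C (N + 1 - int (length xs))\<^esub>"
  proof -
    have e: "N - 1 + 1 = N" "N - 1 + 2 = N + 1" by simp_all
    show ?thesis using Cons.IH[OF Lc] unfolding e .
  qed
  have deg_eq: "N + 2 - int (length (x # xs)) = N + 1 - int (length xs)" by simp
  have "cobd C (N + 1) (cobd C N c) (x # xs) = cobd C N c xs \<ominus>\<^bsub>deg C (N + 1 - int (length xs))\<^esub>
      cobd C N (\<lambda>ys. c ys \<ominus>\<^bsub>deg C (N - int (length ys))\<^esub> cobd C (N - 1) (\<lambda>zs. c (x # zs)) ys) xs" by simp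
  also have "\<dots> = \<zero>\<^bsub>deg C (N + 1 - int (length xs))\<^esub>"
    unfolding cobd_diff[OF c b] z using cobd_closed[OF c] by (simp add: group.minus_zero group.minus_eq_zero_iff)
  finally show ?case unfolding deg_eq .
qed

lemma graded_zero: "graded C N (\<lambda>ys. \<zero>\<^bsub>deg C (N - int (length ys))\<^esub>) xs"
  by (simp add: graded_def)

lemma cobd_zero: "cobd C N (\<lambda>ys. \<zero>\<^bsub>deg C (N - int (length ys))\<^esub>) xs = \<zero>\<^bsub>deg C (N + 1 - int (length xs))\<^esub>"
proof -
  have "cobd C N (\<lambda>ys. \<zero>\<^bsub>deg C (N - int (length ys))\<^esub>) xs
      = cobd C N (\<lambda>ys. \<zero>\<^bsub>R\<^esub> \<odot>\<^bsub>deg C (N - int (length ys))\<^esub> \<zero>\<^bsub>deg C (N - int (length ys))\<^esub>) xs"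
    by simp
  then show ?thesis
    using cobd_smult[OF mod.R.zero_closed graded_zero, of N xs] cobd_closed[OF graded_zero, of N xs] by simp
qed

lemma cobd_point:
  assumes "a \<in> carrier (deg C N)"
  shows "cobd C N (\<lambda>ys. if ys = [] then a else \<zero>\<^bsub>deg C (N - int (length ys))\<^esub>) (x # xs)
    = (if xs = [] then a else \<zero>\<^bsub>deg C (N - int (length xs))\<^esub>)"
proof -
  have "cobd C (N - 1) (\<lambda>ys. \<zero>\<^bsub>deg C (N - int (length (x # ys)))\<^esub>) xs = \<zero>\<^bsub>deg C (N - int (length xs))\<^esub>"
    using cobd_zero[of "N - 1" xs] by (simp add: diff_diff_eq)
  then show ?thesis using assms by (simp add: group.minus_zero)
qed

end

context dg_alg
begin

abbreviation M where "M q \<equiv> deg D q"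

lemma mul_add_left': "x \<in> carrier (M p) \<Longrightarrow> y \<in> carrier (M p) \<Longrightarrow> z \<in> carrier (M q) \<Longrightarrow> p + q = r \<Longrightarrow>
    dmul D p q (x \<oplus>\<^bsub>M p\<^esub> y) z = dmul D p q x z \<oplus>\<^bsub>M r\<^esub> dmul D p q y z"
  using mul_add_left by blast

lemma mul_add_right': "x \<in> carrier (M p) \<Longrightarrow> y \<in> carrier (M q) \<Longrightarrow> z \<in> carrier (M q) \<Longrightarrow> p + q = r \<Longrightarrow>
    dmul D p q x (y \<oplus>\<^bsub>M q\<^esub> z) = dmul D p q x y \<oplus>\<^bsub>M r\<^esub> dmul D p q x z"
  using mul_add_right by blast

lemma mul_smult_left': "s \<in> carrier R \<Longrightarrow> x \<in> carrier (M p) \<Longrightarrow> y \<in> carrier (M q) \<Longrightarrow> p + q = r \<Longrightarrow>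
    dmul D p q (s \<odot>\<^bsub>M p\<^esub> x) y = s \<odot>\<^bsub>M r\<^esub> dmul D p q x y"
  using mul_smult_left by blast

lemma mul_smult_right': "s \<in> carrier R \<Longrightarrow> x \<in> carrier (M p) \<Longrightarrow> y \<in> carrier (M q) \<Longrightarrow> p + q = r \<Longrightarrow>
    dmul D p q x (s \<odot>\<^bsub>M q\<^esub> y) = s \<odot>\<^bsub>M r\<^esub> dmul D p q x y"
  using mul_smult_right by blast

lemma mul_signed_left': "x \<in> carrier (M p) \<Longrightarrow> y \<in> carrier (M q) \<Longrightarrow> p + q = r \<Longrightarrow>
    dmul D p q (signed (M p) k x) y = signed (M r) k (dmul D p q x y)"
  using mul_signed_left by blast

lemma mul_signed_right': "x \<in> carrier (M p) \<Longrightarrow> y \<in> carrier (M q) \<Longrightarrow> p + q = r \<Longrightarrow>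
    dmul D p q x (signed (M q) k y) = signed (M r) k (dmul D p q x y)"
  using mul_signed_right by blast

lemma mul_minus_right': "x \<in> carrier (M p) \<Longrightarrow> y \<in> carrier (M q) \<Longrightarrow> p + q = r \<Longrightarrow>
    dmul D p q x (\<ominus>\<^bsub>M q\<^esub> y) = \<ominus>\<^bsub>M r\<^esub> dmul D p q x y"
  using mul_minus_right by blast

lemma mul_zero_left': "y \<in> carrier (M q) \<Longrightarrow> p + q = r \<Longrightarrow> dmul D p q \<zero>\<^bsub>M p\<^esub> y = \<zero>\<^bsub>M r\<^esub>"
  using mul_zero_left by blast

lemma mul_zero_right': "x \<in> carrier (M p) \<Longrightarrow> p + q = r \<Longrightarrow> dmul D p q x \<zero>\<^bsub>M q\<^esub> = \<zero>\<^bsub>M r\<^esub>"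
  using mul_zero_right by blast

lemma head_closed: "graded D N c (x # xs) \<Longrightarrow> c [x] \<in> carrier (M (N - 1))"
  using gradedD[of D N c "x # xs" "[x]"] by simp

lemma whole_closed: "graded D (m + 1) c (x # xs) \<Longrightarrow> c (x # xs) \<in> carrier (M (m - int (length xs)))"
  using gradedD[of D "m + 1" c "x # xs" "x # xs"] by simp

lemma term_closed: "graded D N c (x # xs) \<Longrightarrow> graded D (m + 1) c' (x # xs) \<Longrightarrow>
    dmul D (N - 1) (m - int (length xs)) (c [x]) (c' (x # xs)) \<in> carrier (M (N + m - 1 - int (length xs)))"
  by (rule mul_closed'[OF head_closed whole_closed]) auto

lemma cup_closed:
  "graded D N c xs \<Longrightarrow> graded D (m + 1) c' xs \<Longrightarrow> cup D N m c c' xs \<in> carrier (M (N + m - int (length xs)))"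
proof (induction xs arbitrary: N c)
  case (Cons x xs)
  have "N - 1 + m - int (length xs) = N + m - 1 - int (length xs)" by simp
  then have "cup D (N - 1) m (\<lambda>ys. c (x # ys)) c' xs \<in> carrier (M (N + m - 1 - int (length xs)))"
    using Cons.IH[OF graded_shift[OF Cons.prems(1)] graded_tl[OF Cons.prems(2)]] by metis
  moreover have "N + m - int (length (x # xs)) = N + m - 1 - int (length xs)" by simp
  ultimately show ?case using term_closed[OF Cons.prems] by (metis cup.simps(2) group.a_closed group.signed_closed)
qed simp

lemma graded_cup:
  "graded D N c xs \<Longrightarrow> graded D (m + 1) c' xs \<Longrightarrow> graded D (N + m) (cup D N m c c') xs"
  unfolding graded_def[of D "N + m"] using cup_closed graded_subseq by blast

text \<open>All values are taken in one module \<open>G\<close>, which hides the different expressions for its degree.\<close>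

lemma cup_Cons:
  assumes "graded D N c (x # xs)" "graded D (m + 1) c' (x # xs)" "G = M (N + m - 1 - int (length xs))"
  shows "cup D N m c c' (x # xs) = signed G ((N - 1) * int (length xs))
      (dmul D (N - 1) (m - int (length xs)) (c [x]) (c' (x # xs))) \<oplus>\<^bsub>G\<^esub> cup D (N - 1) m (\<lambda>ys. c (x # ys)) c' xs"
    "dmul D (N - 1) (m - int (length xs)) (c [x]) (c' (x # xs)) \<in> carrier G"
    "cup D (N - 1) m (\<lambda>ys. c (x # ys)) c' xs \<in> carrier G"
    "M (N + m - int (length (x # xs))) = G"
proof -
  have e: "N - 1 + m - int (length xs) = N + m - 1 - int (length xs)" by simp
  show "cup D (N - 1) m (\<lambda>ys. c (x # ys)) c' xs \<in> carrier G"
    using cup_closed[OF graded_shift[OF assms(1)] graded_tl[OF assms(2)]] unfolding e assms(3) .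
  show "M (N + m - int (length (x # xs))) = G" unfolding assms(3) by (simp add: algebra_simps)
qed (use term_closed[OF assms(1,2)] assms(3) in simp_all)

lemma cup_add_left:
  "graded D N c xs \<Longrightarrow> graded D N d xs \<Longrightarrow> graded D (m + 1) c' xs \<Longrightarrow>
    cup D N m (\<lambda>ys. c ys \<oplus>\<^bsub>M (N - int (length ys))\<^esub> d ys) c' xs
      = cup D N m c c' xs \<oplus>\<^bsub>M (N + m - int (length xs))\<^esub> cup D N m d c' xs"
proof (induction xs arbitrary: N c d)
  case (Cons x xs)
  define G where "G = M (N + m - 1 - int (length xs))"
  interpret G: abelian_group G unfolding G_def by (rule group.abelian_group_axioms)
  note p = Cons.prems
  note c = cup_Cons[OF p(1,3) G_def] and d = cup_Cons[OF p(2,3) G_def]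
    and s = cup_Cons[OF graded_add[OF p(1,2)] p(3) G_def]
  have e: "N - 1 + m - int (length xs) = N + m - 1 - int (length xs)"
    "N - int (length (x # ys)) = N - 1 - int (length ys)" "N - int (length [x]) = N - 1" for ys by simp_all
  have 1: "cup D (N - 1) m (\<lambda>ys. c (x # ys) \<oplus>\<^bsub>M (N - int (length (x # ys)))\<^esub> d (x # ys)) c' xs
      = cup D (N - 1) m (\<lambda>ys. c (x # ys)) c' xs \<oplus>\<^bsub>G\<^esub> cup D (N - 1) m (\<lambda>ys. d (x # ys)) c' xs"
    unfolding G_def e(1)[symmetric] e(2)
    by (rule Cons.IH[OF graded_shift[OF p(1)] graded_shift[OF p(2)] graded_tl[OF p(3)]])
  have 2: "dmul D (N - 1) (m - int (length xs)) (c [x] \<oplus>\<^bsub>M (N - int (length [x]))\<^esub> d [x]) (c' (x # xs))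
      = dmul D (N - 1) (m - int (length xs)) (c [x]) (c' (x # xs)) \<oplus>\<^bsub>G\<^esub>
        dmul D (N - 1) (m - int (length xs)) (d [x]) (c' (x # xs))"
    unfolding G_def e(3) by (rule mul_add_left'[OF head_closed[OF p(1)] head_closed[OF p(2)] whole_closed[OF p(3)]]) simp
  show ?case unfolding s(1) c(1) d(1) c(4) 1 2 using c(2,3) d(2,3) by (simp add: G.signed_add G.a_ac)
qed simp

lemma cup_add_right:
  "graded D N c xs \<Longrightarrow> graded D (m + 1) c' xs \<Longrightarrow> graded D (m + 1) d' xs \<Longrightarrow>
    cup D N m c (\<lambda>ys. c' ys \<oplus>\<^bsub>M (m + 1 - int (length ys))\<^esub> d' ys) xs
      = cup D N m c c' xs \<oplus>\<^bsub>M (N + m - int (length xs))\<^esub> cup D N m c d' xs"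
proof (induction xs arbitrary: N c)
  case (Cons x xs)
  define G where "G = M (N + m - 1 - int (length xs))"
  interpret G: abelian_group G unfolding G_def by (rule group.abelian_group_axioms)
  note p = Cons.prems
  note c = cup_Cons[OF p(1,2) G_def] and d = cup_Cons[OF p(1,3) G_def]
    and s = cup_Cons[OF p(1) graded_add[OF p(2,3)] G_def]
  have e: "N - 1 + m - int (length xs) = N + m - 1 - int (length xs)"
    "m + 1 - int (length (x # xs)) = m - int (length xs)" by simp_all
  have 1: "cup D (N - 1) m (\<lambda>ys. c (x # ys)) (\<lambda>ys. c' ys \<oplus>\<^bsub>M (m + 1 - int (length ys))\<^esub> d' ys) xs
      = cup D (N - 1) m (\<lambda>ys. c (x # ys)) c' xs \<oplus>\<^bsub>G\<^esub> cup D (N - 1) m (\<lambda>ys. c (x # ys)) d' xs"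
    unfolding G_def e(1)[symmetric] by (rule Cons.IH[OF graded_shift[OF p(1)] graded_tl[OF p(2)] graded_tl[OF p(3)]])
  have 2: "dmul D (N - 1) (m - int (length xs)) (c [x]) (c' (x # xs) \<oplus>\<^bsub>M (m + 1 - int (length (x # xs)))\<^esub> d' (x # xs))
      = dmul D (N - 1) (m - int (length xs)) (c [x]) (c' (x # xs)) \<oplus>\<^bsub>G\<^esub>
        dmul D (N - 1) (m - int (length xs)) (c [x]) (d' (x # xs))"
    unfolding G_def e(2) by (rule mul_add_right'[OF head_closed[OF p(1)] whole_closed[OF p(2)] whole_closed[OF p(3)]]) simp
  show ?case unfolding s(1) c(1) d(1) c(4) 1 2 using c(2,3) d(2,3) by (simp add: G.signed_add G.a_ac)
qed simp

lemma signed_smult_commute: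
  "s \<in> carrier R \<Longrightarrow> x \<in> carrier (M q) \<Longrightarrow> signed (M q) k (s \<odot>\<^bsub>M q\<^esub> x) = s \<odot>\<^bsub>M q\<^esub> signed (M q) k x"
  by (simp add: signed_def mod.smult_r_minus)

lemma graded_smult: "s \<in> carrier R \<Longrightarrow> graded D N c xs \<Longrightarrow>
    graded D N (\<lambda>ys. s \<odot>\<^bsub>M (N - int (length ys))\<^esub> c ys) xs"
  by (simp add: graded_def mod.smult_closed)

lemma cup_smult_left:
  assumes s: "s \<in> carrier R"
  shows "graded D N c xs \<Longrightarrow> graded D (m + 1) c' xs \<Longrightarrow>
    cup D N m (\<lambda>ys. s \<odot>\<^bsub>M (N - int (length ys))\<^esub> c ys) c' xs
      = s \<odot>\<^bsub>M (N + m - int (length xs))\<^esub> cup D N m c c' xs"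
proof (induction xs arbitrary: N c)
  case Nil
  then show ?case using s mod.smult_r_null by simp
next
  case (Cons x xs)
  define G where "G = M (N + m - 1 - int (length xs))"
  note p = Cons.prems
  note c = cup_Cons[OF p G_def] and s' = cup_Cons[OF graded_smult[OF s p(1)] p(2) G_def]
  have e: "N - 1 + m - int (length xs) = N + m - 1 - int (length xs)"
    "N - int (length (x # ys)) = N - 1 - int (length ys)" "N - int (length [x]) = N - 1" for ys by simp_all
  have 1: "cup D (N - 1) m (\<lambda>ys. s \<odot>\<^bsub>M (N - int (length (x # ys)))\<^esub> c (x # ys)) c' xs
      = s \<odot>\<^bsub>G\<^esub> cup D (N - 1) m (\<lambda>ys. c (x # ys)) c' xs"
    unfolding G_def e(1)[symmetric] e(2) by (rule Cons.IH[OF graded_shift[OF p(1)] graded_tl[OF p(2)]])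
  have 2: "dmul D (N - 1) (m - int (length xs)) (s \<odot>\<^bsub>M (N - int (length [x]))\<^esub> c [x]) (c' (x # xs))
      = s \<odot>\<^bsub>G\<^esub> dmul D (N - 1) (m - int (length xs)) (c [x]) (c' (x # xs))"
    unfolding G_def e(3) by (rule mul_smult_left'[OF s head_closed[OF p(1)] whole_closed[OF p(2)]]) simp
  show ?case unfolding s'(1) c(1) c(4) 1 2 using c(2,3) s unfolding G_def
    by (simp add: signed_smult_commute mod.smult_r_distr)
qed

lemma cup_smult_right:
  assumes s: "s \<in> carrier R"
  shows "graded D N c xs \<Longrightarrow> graded D (m + 1) c' xs \<Longrightarrow>
    cup D N m c (\<lambda>ys. s \<odot>\<^bsub>M (m + 1 - int (length ys))\<^esub> c' ys) xs
      = s \<odot>\<^bsub>M (N + m - int (length xs))\<^esub> cup D N m c c' xs"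
proof (induction xs arbitrary: N c)
  case Nil
  then show ?case using s mod.smult_r_null by simp
next
  case (Cons x xs)
  define G where "G = M (N + m - 1 - int (length xs))"
  note p = Cons.prems
  note c = cup_Cons[OF p G_def] and s' = cup_Cons[OF p(1) graded_smult[OF s p(2)] G_def]
  have e: "N - 1 + m - int (length xs) = N + m - 1 - int (length xs)"
    "m + 1 - int (length (x # xs)) = m - int (length xs)" by simp_all
  have 1: "cup D (N - 1) m (\<lambda>ys. c (x # ys)) (\<lambda>ys. s \<odot>\<^bsub>M (m + 1 - int (length ys))\<^esub> c' ys) xs
      = s \<odot>\<^bsub>G\<^esub> cup D (N - 1) m (\<lambda>ys. c (x # ys)) c' xs"
    unfolding G_def e(1)[symmetric] by (rule Cons.IH[OF graded_shift[OF p(1)] graded_tl[OF p(2)]])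
  have 2: "dmul D (N - 1) (m - int (length xs)) (c [x]) (s \<odot>\<^bsub>M (m + 1 - int (length (x # xs)))\<^esub> c' (x # xs))
      = s \<odot>\<^bsub>G\<^esub> dmul D (N - 1) (m - int (length xs)) (c [x]) (c' (x # xs))"
    unfolding G_def e(2) by (rule mul_smult_right'[OF s head_closed[OF p(1)] whole_closed[OF p(2)]]) simp
  show ?case unfolding s'(1) c(1) c(4) 1 2 using c(2,3) s unfolding G_def
    by (simp add: signed_smult_commute mod.smult_r_distr)
qed

lemma cup_signed_left:
  assumes "graded D N c xs" "graded D (m + 1) c' xs"
  shows "cup D N m (\<lambda>ys. signed (M (N - int (length ys))) k (c ys)) c' xs
      = signed (M (N + m - int (length xs))) k (cup D N m c c' xs)"
proof -
  have "cup D N m (\<lambda>ys. signed (M (N - int (length ys))) k (c ys)) c' xs =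
      cup D N m (\<lambda>ys. sign k \<odot>\<^bsub>M (N - int (length ys))\<^esub> c ys) c' xs"
    by (rule cup_cong) (simp_all add: signed_smult gradedD[OF assms(1)])
  then show ?thesis using cup_smult_left[OF sign_closed assms] signed_smult[OF cup_closed[OF assms]] by simp
qed

lemma cup_diff_left:
  assumes "graded D N c xs" "graded D N d xs" "graded D (m + 1) c' xs"
  shows "cup D N m (\<lambda>ys. c ys \<ominus>\<^bsub>M (N - int (length ys))\<^esub> d ys) c' xs
      = cup D N m c c' xs \<ominus>\<^bsub>M (N + m - int (length xs))\<^esub> cup D N m d c' xs"
  unfolding a_minus_def minus_signed
    cup_add_left[OF assms(1) graded_signed[OF assms(2)] assms(3)] cup_signed_left[OF assms(2,3)] ..

lemma graded_mul:
  assumes "a \<in> carrier (M n)" "graded D m h xs"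
  shows "graded D (n + m) (\<lambda>ys. dmul D n (m - int (length ys)) a (h ys)) xs"
  unfolding graded_def using mul_closed'[OF assms(1) gradedD[OF assms(2)]] by auto

lemma cup_zero_left:
  "(\<And>ys. ys \<noteq> [] \<Longrightarrow> subseq ys xs \<Longrightarrow> c ys = \<zero>\<^bsub>M (N - int (length ys))\<^esub>) \<Longrightarrow> graded D (m + 1) c' xs \<Longrightarrow>
    cup D N m c c' xs = \<zero>\<^bsub>M (N + m - int (length xs))\<^esub>"
proof (induction xs arbitrary: N c)
  case (Cons x xs)
  have e: "N - 1 + m - int (length xs) = N + m - 1 - int (length xs)"
    "N + m - int (length (x # xs)) = N + m - 1 - int (length xs)"
    "N - int (length (x # ys)) = N - 1 - int (length ys)" "N - int (length [x]) = N - 1" for ys by simp_all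
  have 1: "cup D (N - 1) m (\<lambda>ys. c (x # ys)) c' xs = \<zero>\<^bsub>M (N - 1 + m - int (length xs))\<^esub>"
  proof (rule Cons.IH)
    fix ys assume "ys \<noteq> []" "subseq ys xs"
    then show "c (x # ys) = \<zero>\<^bsub>M (N - 1 - int (length ys))\<^esub>" using Cons.prems(1)[of "x # ys"] unfolding e(3) by simp
  qed (rule graded_tl[OF Cons.prems(2)])
  have 2: "c [x] = \<zero>\<^bsub>M (N - 1)\<^esub>" using Cons.prems(1)[of "[x]"] unfolding e(4) by simp
  have 3: "dmul D (N - 1) (m - int (length xs)) \<zero>\<^bsub>M (N - 1)\<^esub> (c' (x # xs)) = \<zero>\<^bsub>M (N + m - 1 - int (length xs))\<^esub>"
    by (rule mul_zero_left'[OF whole_closed[OF Cons.prems(2)]]) simp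
  show ?case unfolding cup.simps 1 2 3 unfolding e by (simp add: group.signed_zero)
qed simp

text \<open>The shift \<open>L\<^sub>x\<close> of a product involves left multiplication by the value \<open>c [x]\<close>.\<close>

lemma cobd_mul:
  assumes a: "a \<in> carrier (M n)"
  shows "graded D m h zs \<Longrightarrow> G = M (n + m + 1 - int (length zs)) \<Longrightarrow>
    cobd D (n + m) (\<lambda>ys. signed (M (n + m - int (length ys))) (n * int (length ys)) (dmul D n (m - int (length ys)) a (h ys))) zs
    = signed G (n * (int (length zs) - 1)) (dmul D n (m + 1 - int (length zs)) a (cobd D m h zs)) \<oplus>\<^bsub>G\<^esub>
      signed G ((n + 1) * int (length zs) + 1) (dmul D (n + 1) (m - int (length zs)) (dif D n a) (h zs))"
proof (induction zs arbitrary: m h G)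
  case Nil
  have h: "h [] \<in> carrier (M m)" using graded_nil[OF Nil(1)] .
  have dh: "dmul D n (m + 1) a (dif D m (h [])) \<in> carrier (M (n + m + 1))"
    by (rule mul_closed'[OF a d_closed[OF h]]) simp
  have ah: "dmul D (n + 1) m (dif D n a) (h []) \<in> carrier (M (n + m + 1))"
    by (rule mul_closed'[OF d_closed[OF a] h]) simp
  have 1: "dmul D n (m + 1) a (\<ominus>\<^bsub>M (m + 1)\<^esub> dif D m (h [])) = \<ominus>\<^bsub>M (n + m + 1)\<^esub> dmul D n (m + 1) a (dif D m (h []))"
    by (rule mul_minus_right'[OF a d_closed[OF h]]) simp
  have G: "G = M (n + m + 1)" using Nil(2) by simp
  have "cobd D (n + m) (\<lambda>ys. signed (M (n + m - int (length ys))) (n * int (length ys)) (dmul D n (m - int (length ys)) a (h ys))) []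
     = \<ominus>\<^bsub>M (n + m + 1)\<^esub> dif D (n + m) (dmul D n m a (h []))" by (simp add: signed_def)
  also have "\<dots> = \<ominus>\<^bsub>M (n + m + 1)\<^esub> (dmul D (n + 1) m (dif D n a) (h []) \<oplus>\<^bsub>M (n + m + 1)\<^esub>
      signed (M (n + m + 1)) n (dmul D n (m + 1) a (dif D m (h []))))" unfolding d_mul[OF a h] ..
  also have "\<dots> = signed (M (n + m + 1)) (- n) (\<ominus>\<^bsub>M (n + m + 1)\<^esub> dmul D n (m + 1) a (dif D m (h []))) \<oplus>\<^bsub>M (n + m + 1)\<^esub>
      signed (M (n + m + 1)) 1 (dmul D (n + 1) m (dif D n a) (h []))"
    using dh ah by (auto simp: signed_def group.minus_add group.a_comm)
  finally show ?case using 1 G by simp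
next
  case (Cons y zs)
  let ?k = "int (length zs)"
  define H where "H = M (n + m - ?k)"
  interpret H: abelian_group H unfolding H_def by (rule group.abelian_group_axioms)
  have G: "G = H" using Cons.prems(2) by (simp add: H_def algebra_simps)
  note Lh = graded_shift[OF Cons.prems(1)]
  have hz: "h zs \<in> carrier (M (m - ?k))" using gradedD[OF Cons.prems(1) subseq_tl] .
  have hy: "h (y # zs) \<in> carrier (M (m - 1 - ?k))" using gradedD[OF Lh, of zs] by simp
  define b where "b = cobd D (m - 1) (\<lambda>ys. h (y # ys)) zs"
  have b: "b \<in> carrier (M (m - ?k))" using cobd_closed[OF Lh] by (simp add: b_def)
  define u where "u = dmul D n (m - ?k) a (h zs)"
  define v where "v = dmul D n (m - ?k) a b"
  define w where "w = dmul D (n + 1) (m - 1 - ?k) (dif D n a) (h (y # zs))"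
  have u: "u \<in> carrier H" unfolding u_def H_def by (rule mul_closed'[OF a hz]) simp
  have v: "v \<in> carrier H" unfolding v_def H_def by (rule mul_closed'[OF a b]) simp
  have w: "w \<in> carrier H" unfolding w_def H_def by (rule mul_closed'[OF d_closed[OF a] hy]) simp
  have e: "n + m - int (length (y # ys)) = n + (m - 1) - int (length ys)"
      "m - int (length (y # ys)) = m - 1 - int (length ys)"
      "n * int (length (y # ys)) = n + n * int (length ys)" "n + m - 1 = n + (m - 1)"
      "m - 1 + 1 - ?k = m - ?k" "n + (m - 1) + 1 - ?k = n + m - ?k"
      "m + 1 - int (length (y # zs)) = m - ?k" for ys
    by (simp_all add: algebra_simps)
  let ?g = "\<lambda>ys. signed (M (n + (m - 1) - int (length ys))) (n * int (length ys)) (dmul D n (m - 1 - int (length ys)) a (h (y # ys)))"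
  have g: "graded D (n + (m - 1)) ?g zs" by (rule graded_signed[OF graded_mul[OF a Lh]])
  have "cobd D (n + m - 1) (\<lambda>ys. signed (M (n + m - int (length (y # ys)))) (n * int (length (y # ys)))
        (dmul D n (m - int (length (y # ys))) a (h (y # ys)))) zs
      = cobd D (n + (m - 1)) (\<lambda>ys. signed (M (n + (m - 1) - int (length ys))) n (?g ys)) zs"
    unfolding e(4)
    by (rule cobd_cong)
      (unfold e(1,2,3), rule group.signed_signed[symmetric, OF gradedD[OF graded_mul[OF a Lh]]], assumption)
  also have "\<dots> = signed H n (cobd D (n + (m - 1)) ?g zs)"
    unfolding cobd_signed[OF g] e(6) H_def ..
  also have "cobd D (n + (m - 1)) ?g zs = signed H (n * (?k - 1)) v \<oplus>\<^bsub>H\<^esub> signed H ((n + 1) * ?k + 1) w"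
    unfolding v_def w_def b_def
    by (subst Cons.IH[OF Lh, of H]) (simp_all only: e H_def)
  finally have 1: "cobd D (n + m) (\<lambda>ys. signed (M (n + m - int (length ys))) (n * int (length ys)) (dmul D n (m - int (length ys)) a (h ys))) (y # zs)
     = signed H (n * ?k) u \<ominus>\<^bsub>H\<^esub> signed H n (signed H (n * (?k - 1)) v \<oplus>\<^bsub>H\<^esub> signed H ((n + 1) * ?k + 1) w)"
    by (simp add: H_def u_def)
  have 2: "dmul D n (m - ?k) a (cobd D m h (y # zs)) = u \<ominus>\<^bsub>H\<^esub> v"
    unfolding cobd.simps(2) a_minus_def u_def v_def b_def[symmetric]
    using mul_add_right'[OF a hz group.a_inv_closed[OF b], of "n + m - ?k"] mul_minus_right'[OF a b, of "n + m - ?k"]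
    by (simp add: H_def)
  show ?case
    unfolding 1 G e(7) 2 e(2) w_def[symmetric]
    using u v w by (cases "even n"; cases "even ?k")
      (simp_all add: signed_def a_minus_def H.minus_add H.a_ac)
qed

lemma cobd_cup:
  "graded D N c xs \<Longrightarrow> graded D (m + 1) c' xs \<Longrightarrow> c' [] = \<zero>\<^bsub>M (m + 1)\<^esub> \<Longrightarrow> G = M (N + m + 1 - int (length xs)) \<Longrightarrow>
    cobd D (N + m) (cup D N m c c') xs \<oplus>\<^bsub>G\<^esub>
      signed G (N * (int (length xs) - 1)) (dmul D N (m + 1 - int (length xs)) (c []) (c' xs))
    = cup D (N + 1) m (cobd D N c) c' xs \<oplus>\<^bsub>G\<^esub> signed G (N - 1) (cup D N (m + 1) c (cobd D (m + 1) c') xs)"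
proof (induction xs arbitrary: N c G)
  case Nil
  have G: "G = M (N + m + 1)" using Nil by simp
  have 1: "dmul D N (m + 1) (c []) \<zero>\<^bsub>M (m + 1)\<^esub> = \<zero>\<^bsub>M (N + m + 1)\<^esub>"
    by (rule mul_zero_right'[OF graded_nil[OF Nil(1)]]) simp
  have e: "N + 1 + m = N + m + 1" "N + (m + 1) = N + m + 1" "m + 1 - int (length []) = m + 1" by simp_all
  show ?case
    unfolding cobd.simps cup.simps Nil(3) e 1 d_zero G by (simp add: group.signed_zero)
next
  case (Cons x xs)
  let ?k = "int (length xs)"
  note p = Cons.prems
  have e: "N + m + 1 - int (length (x # xs)) = N + m - ?k" "N + 1 + m - 1 - ?k = N + m - ?k"
    "N + (m + 1) - 1 - ?k = N + m - ?k" "m + 1 - int (length (x # xs)) = m - ?k" "N + 1 - 1 = N"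
    "N - 1 + 1 = N" "N + m - 1 = N - 1 + m" "N - 1 + m + 1 = N + m" "int (length (x # xs)) - 1 = ?k"
    "N + 1 + m = N + m + 1"
    by simp_all
  define H where "H = M (N + m - ?k)"
  have G: "G = H" using p(4) unfolding H_def e(1) .
  interpret H: abelian_group H unfolding H_def by (rule group.abelian_group_axioms)
  note Lc = graded_shift[OF p(1)] and Lc' = graded_shift[OF p(2), unfolded add_diff_cancel_right']
  define a where "a = c [x]"
  have a: "a \<in> carrier (M (N - 1))" unfolding a_def by (rule head_closed[OF p(1)])
  have w': "c' (x # xs) \<in> carrier (M (m - ?k))" by (rule whole_closed[OF p(2)])
  have c'xs: "c' xs \<in> carrier (M (m + 1 - ?k))" using gradedD[OF p(2) subseq_tl] .
  have g': "graded D (m + 1 + 1) (cobd D (m + 1) c') (x # xs)" by (rule graded_cobd[OF p(2)])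
  have dc': "cobd D (m + 1) c' (x # xs) \<in> carrier (M (m + 1 - ?k))" using whole_closed[OF g'] .
  define P where "P = cup D N m c c' xs"
  define Q where "Q = cup D N m (cobd D (N - 1) (\<lambda>ys. c (x # ys))) c' xs"
  define S where "S = cup D (N - 1) (m + 1) (\<lambda>ys. c (x # ys)) (cobd D (m + 1) c') xs"
  define u where "u = dmul D (N - 1) (m + 1 - ?k) a (c' xs)"
  define v where "v = dmul D (N - 1) (m + 1 - ?k) a (cobd D (m + 1) c' (x # xs))"
  define w where "w = dmul D N (m - ?k) (dif D (N - 1) a) (c' (x # xs))"
  define z where "z = dmul D N (m - ?k) (c []) (c' (x # xs))"
  have Q': "graded D N (cobd D (N - 1) (\<lambda>ys. c (x # ys))) xs" using graded_cobd[OF Lc] unfolding e(6) .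
  have da: "dif D (N - 1) a \<in> carrier (M N)" using d_closed[OF a] unfolding e(6) .
  have P: "P \<in> carrier H" unfolding P_def H_def by (rule cup_closed[OF graded_tl[OF p(1)] graded_tl[OF p(2)]])
  have Q: "Q \<in> carrier H" unfolding Q_def H_def by (rule cup_closed[OF Q' graded_tl[OF p(2)]])
  have S: "S \<in> carrier H"
    unfolding S_def H_def using cup_closed[OF Lc graded_tl[OF g']] by (simp add: algebra_simps)
  have u: "u \<in> carrier H" unfolding u_def H_def by (rule mul_closed'[OF a c'xs]) simp
  have v: "v \<in> carrier H" unfolding v_def H_def by (rule mul_closed'[OF a dc']) simp
  have w: "w \<in> carrier H" unfolding w_def H_def by (rule mul_closed'[OF da w']) simp
  have z: "z \<in> carrier H" unfolding z_def H_def by (rule mul_closed'[OF graded_nil[OF p(1)] w']) simp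
  let ?g = "\<lambda>ys. signed (M (N - 1 + m - int (length ys))) ((N - 1) * int (length ys))
      (dmul D (N - 1) (m - int (length ys)) a (c' (x # ys)))"
  let ?C = "cup D (N - 1) m (\<lambda>ys. c (x # ys)) c'"
  have gg: "graded D (N - 1 + m) ?g xs" by (rule graded_signed[OF graded_mul[OF a Lc']])
  have gC: "graded D (N - 1 + m) ?C xs" by (rule graded_cup[OF Lc graded_tl[OF p(2)]])
  have L: "cup D N m c c' (x # ys) = ?g ys \<oplus>\<^bsub>M (N - 1 + m - int (length ys))\<^esub> ?C ys" for ys
    unfolding cup.simps a_def e(7) ..
  have split: "cobd D (m + 1) c' (x # xs) = c' xs \<ominus>\<^bsub>M (m + 1 - ?k)\<^esub> cobd D m (\<lambda>ys. c' (x # ys)) xs"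
    by simp
  have b: "cobd D m (\<lambda>ys. c' (x # ys)) xs \<in> carrier (M (m + 1 - ?k))" by (rule cobd_closed[OF Lc'])
  have b_eq: "cobd D m (\<lambda>ys. c' (x # ys)) xs = c' xs \<ominus>\<^bsub>M (m + 1 - ?k)\<^esub> cobd D (m + 1) c' (x # xs)"
    unfolding split using c'xs b by (simp add: a_minus_def group.minus_add group.a_assoc[symmetric] group.r_neg)
  have ab: "dmul D (N - 1) (m + 1 - ?k) a (cobd D m (\<lambda>ys. c' (x # ys)) xs) = u \<ominus>\<^bsub>H\<^esub> v"
    unfolding b_eq a_minus_def u_def v_def
    using mul_add_right'[OF a c'xs group.a_inv_closed[OF dc'], of "N + m - ?k"] mul_minus_right'[OF a dc', of "N + m - ?k"]
    by (simp add: H_def)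
  have 1: "cobd D (N - 1 + m) ?g xs = signed H ((N - 1) * (?k - 1)) (u \<ominus>\<^bsub>H\<^esub> v) \<oplus>\<^bsub>H\<^esub> signed H (N * ?k + 1) w"
    using cobd_mul[OF a Lc', of H] unfolding e(6) ab w_def[symmetric] e(8) H_def by blast
  have IH: "cobd D (N - 1 + m) ?C xs \<oplus>\<^bsub>H\<^esub> signed H ((N - 1) * (?k - 1)) u = Q \<oplus>\<^bsub>H\<^esub> signed H (N - 1 - 1) S"
    using Cons.IH[OF Lc graded_tl[OF p(2)] p(3), of H] unfolding e(6) e(8) H_def Q_def S_def u_def a_def by blast
  define X where "X = cobd D (N - 1 + m) ?C xs"
  have X: "X \<in> carrier H" unfolding X_def H_def using cobd_closed[OF gC] unfolding e(8) .
  have lhs: "cobd D (N + m) (cup D N m c c') (x # xs) = P \<ominus>\<^bsub>H\<^esub>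
      ((signed H ((N - 1) * (?k - 1)) (u \<ominus>\<^bsub>H\<^esub> v) \<oplus>\<^bsub>H\<^esub> signed H (N * ?k + 1) w) \<oplus>\<^bsub>H\<^esub> X)"
    unfolding cobd.simps(2) L e(7) cobd_add[OF gg gC] P_def[symmetric] 1 X_def[symmetric] e(8) H_def[symmetric] ..
  have head: "cobd D N c [x] = c [] \<oplus>\<^bsub>M N\<^esub> dif D (N - 1) a"
    using da graded_nil[OF p(1)] by (simp add: a_minus_def a_def)
  have 2: "dmul D N (m - ?k) (cobd D N c [x]) (c' (x # xs)) = z \<oplus>\<^bsub>H\<^esub> w"
    unfolding head z_def w_def H_def by (rule mul_add_left'[OF graded_nil[OF p(1)] da w']) simp
  have 3: "cup D N m (\<lambda>ys. cobd D N c (x # ys)) c' xs = P \<ominus>\<^bsub>H\<^esub> Q"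
    unfolding cobd.simps(2) cup_diff_left[OF graded_tl[OF p(1)] Q' graded_tl[OF p(2)]] P_def Q_def H_def ..
  have rhs1: "cup D (N + 1) m (cobd D N c) c' (x # xs) = signed H (N * ?k) (z \<oplus>\<^bsub>H\<^esub> w) \<oplus>\<^bsub>H\<^esub> (P \<ominus>\<^bsub>H\<^esub> Q)"
    unfolding cup.simps(2) e(5) 2 3 e(2) H_def[symmetric] ..
  have rhs2: "cup D N (m + 1) c (cobd D (m + 1) c') (x # xs) = signed H ((N - 1) * ?k) v \<oplus>\<^bsub>H\<^esub> S"
    unfolding cup.simps(2) e(3) H_def[symmetric] v_def a_def S_def ..
  define u' where "u' = signed H ((N - 1) * (?k - 1)) u"
  have u': "u' \<in> carrier H" unfolding u'_def using u by simp
  have X_eq: "X = (Q \<oplus>\<^bsub>H\<^esub> signed H (N - 1 - 1) S) \<ominus>\<^bsub>H\<^esub> u'"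
    using IH X u' unfolding X_def[symmetric] u'_def[symmetric]
    by (metis a_minus_def H.a_assoc H.a_inv_closed H.r_neg H.r_zero)
  have uv: "signed H ((N - 1) * (?k - 1)) (u \<ominus>\<^bsub>H\<^esub> v) = u' \<oplus>\<^bsub>H\<^esub> signed H ((N - 1) * (?k - 1) + 1) v"
    unfolding u'_def a_minus_def using u v by (auto simp: signed_def H.minus_add)
  let ?v = "signed H ((N - 1) * (?k - 1) + 1) v" and ?w = "signed H (N * ?k + 1) w" and ?S = "signed H (N - 1 - 1) S"
  have "P \<ominus>\<^bsub>H\<^esub> ((u' \<oplus>\<^bsub>H\<^esub> ?v) \<oplus>\<^bsub>H\<^esub> ?w \<oplus>\<^bsub>H\<^esub> ((Q \<oplus>\<^bsub>H\<^esub> ?S) \<ominus>\<^bsub>H\<^esub> u'))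
      = (P \<ominus>\<^bsub>H\<^esub> (?v \<oplus>\<^bsub>H\<^esub> ?w \<oplus>\<^bsub>H\<^esub> Q \<oplus>\<^bsub>H\<^esub> ?S)) \<oplus>\<^bsub>H\<^esub> (u' \<ominus>\<^bsub>H\<^esub> u')"
    using P Q S u' v w by (simp add: a_minus_def H.minus_add H.a_ac)
  also have "\<dots> = P \<ominus>\<^bsub>H\<^esub> (?v \<oplus>\<^bsub>H\<^esub> ?w \<oplus>\<^bsub>H\<^esub> Q \<oplus>\<^bsub>H\<^esub> ?S)"
    using P Q S u' v w by (simp add: H.minus_eq_zero_iff)
  finally have lhs': "cobd D (N + m) (cup D N m c c') (x # xs) = P \<ominus>\<^bsub>H\<^esub> (?v \<oplus>\<^bsub>H\<^esub> ?w \<oplus>\<^bsub>H\<^esub> Q \<oplus>\<^bsub>H\<^esub> ?S)"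
    unfolding lhs uv X_eq .
  show ?case
    unfolding G lhs' rhs1 rhs2 e(4) e(9) z_def[symmetric]
    using P Q S v w z by (cases "even N"; cases "even ?k")
      (simp_all add: signed_def a_minus_def H.minus_add H.a_ac)
qed

lemma cup_mul:
  assumes a: "a \<in> carrier (M n)"
  shows "graded D m h zs \<Longrightarrow> graded D (r + 1) c'' zs \<Longrightarrow>
    cup D (n + m) r (\<lambda>ys. signed (M (n + m - int (length ys))) (n * int (length ys)) (dmul D n (m - int (length ys)) a (h ys))) c'' zs
    = signed (M (n + m + r - int (length zs))) (n * int (length zs)) (dmul D n (m + r - int (length zs)) a (cup D m r h c'' zs))"
proof (induction zs arbitrary: m h)
  case Nil
  have "dmul D n (m + r) a \<zero>\<^bsub>M (m + r)\<^esub> = \<zero>\<^bsub>M (n + m + r)\<^esub>" by (rule mul_zero_right'[OF a]) simp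
  then show ?case by (simp add: group.signed_zero)
next
  case (Cons y zs)
  let ?k = "int (length zs)"
  note p = Cons.prems
  define H where "H = M (n + m + r - 1 - ?k)"
  interpret H: abelian_group H unfolding H_def by (rule group.abelian_group_axioms)
  note Lh = graded_shift[OF p(1)]
  have e: "n + m - int (length (y # ys)) = n + (m - 1) - int (length ys)"
      "m - int (length (y # ys)) = m - 1 - int (length ys)"
      "n * int (length (y # ys)) = n + n * int (length ys)" "n + m - 1 = n + (m - 1)"
      "n + (m - 1) + r - ?k = n + m + r - 1 - ?k" "m - 1 + r - ?k = m + r - 1 - ?k"
      "n + m + r - int (length (y # zs)) = n + m + r - 1 - ?k" "m + r - int (length (y # zs)) = m + r - 1 - ?k"
      "n + m - int (length [y]) = n + (m - 1)" "n * int (length [y]) = n" "m - int (length [y]) = m - 1" for ys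
    by (simp_all add: algebra_simps)
  have h: "h [y] \<in> carrier (M (m - 1))" by (rule head_closed[OF p(1)])
  have c: "c'' (y # zs) \<in> carrier (M (r - ?k))" by (rule whole_closed[OF p(2)])
  have ah: "dmul D n (m - 1) a (h [y]) \<in> carrier (M (n + (m - 1)))" by (rule mul_closed'[OF a h]) simp
  have hc: "dmul D (m - 1) (r - ?k) (h [y]) (c'' (y # zs)) \<in> carrier (M (m + r - 1 - ?k))"
    by (rule mul_closed'[OF h c]) simp
  define b where "b = cup D (m - 1) r (\<lambda>ys. h (y # ys)) c'' zs"
  have b: "b \<in> carrier (M (m + r - 1 - ?k))"
    using cup_closed[OF Lh graded_tl[OF p(2)]] unfolding b_def e(6) .
  define u where "u = dmul D n (m + r - 1 - ?k) a (dmul D (m - 1) (r - ?k) (h [y]) (c'' (y # zs)))"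
  define v where "v = dmul D n (m + r - 1 - ?k) a b"
  have u: "u \<in> carrier H" unfolding u_def H_def by (rule mul_closed'[OF a hc]) simp
  have v: "v \<in> carrier H" unfolding v_def H_def by (rule mul_closed'[OF a b]) simp
  let ?g = "\<lambda>ys. signed (M (n + (m - 1) - int (length ys))) (n * int (length ys)) (dmul D n (m - 1 - int (length ys)) a (h (y # ys)))"
  have g: "graded D (n + (m - 1)) ?g zs" by (rule graded_signed[OF graded_mul[OF a Lh]])
  have "cup D (n + m - 1) r (\<lambda>ys. signed (M (n + m - int (length (y # ys)))) (n * int (length (y # ys)))
        (dmul D n (m - int (length (y # ys))) a (h (y # ys)))) c'' zs
      = cup D (n + (m - 1)) r (\<lambda>ys. signed (M (n + (m - 1) - int (length ys))) n (?g ys)) c'' zs"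
    unfolding e(4)
    by (rule cup_cong)
      (unfold e(1,2,3), rule group.signed_signed[symmetric, OF gradedD[OF graded_mul[OF a Lh]]], assumption, rule refl)
  also have "\<dots> = signed H n (signed H (n * ?k) v)"
    unfolding cup_signed_left[OF g graded_tl[OF p(2)]] Cons.IH[OF Lh graded_tl[OF p(2)]]
    unfolding e H_def v_def b_def ..
  finally have 1: "cup D (n + m - 1) r (\<lambda>ys. signed (M (n + m - int (length (y # ys)))) (n * int (length (y # ys)))
        (dmul D n (m - int (length (y # ys))) a (h (y # ys)))) c'' zs = signed H n (signed H (n * ?k) v)" .
  have "dmul D (n + (m - 1)) (r - ?k) (signed (M (n + (m - 1))) n (dmul D n (m - 1) a (h [y]))) (c'' (y # zs))
     = signed H n (dmul D (n + (m - 1)) (r - ?k) (dmul D n (m - 1) a (h [y])) (c'' (y # zs)))"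
    unfolding H_def by (rule mul_signed_left'[OF ah c]) simp
  also have "dmul D (n + (m - 1)) (r - ?k) (dmul D n (m - 1) a (h [y])) (c'' (y # zs)) = u"
  proof -
    have "m - 1 + (r - ?k) = m + r - 1 - ?k" by simp
    then show ?thesis using mul_assoc[OF a h c] unfolding u_def by metis
  qed
  finally have 2: "dmul D (n + m - 1) (r - ?k) (signed (M (n + m - int (length [y]))) (n * int (length [y]))
      (dmul D n (m - int (length [y])) a (h [y]))) (c'' (y # zs)) = signed H n u"
    unfolding e(4,9,10,11) .
  have 3: "dmul D n (m + r - 1 - ?k) a (cup D m r h c'' (y # zs)) = signed H ((m - 1) * ?k) u \<oplus>\<^bsub>H\<^esub> v"
  proof -
    have "dmul D n (m + r - 1 - ?k) a (signed (M (m + r - 1 - ?k)) ((m - 1) * ?k) (dmul D (m - 1) (r - ?k) (h [y]) (c'' (y # zs)))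
        \<oplus>\<^bsub>M (m + r - 1 - ?k)\<^esub> b) = dmul D n (m + r - 1 - ?k) a (signed (M (m + r - 1 - ?k)) ((m - 1) * ?k)
          (dmul D (m - 1) (r - ?k) (h [y]) (c'' (y # zs)))) \<oplus>\<^bsub>H\<^esub> v"
      unfolding v_def H_def by (rule mul_add_right'[OF a group.signed_closed[OF hc] b]) simp
    also have "dmul D n (m + r - 1 - ?k) a (signed (M (m + r - 1 - ?k)) ((m - 1) * ?k)
          (dmul D (m - 1) (r - ?k) (h [y]) (c'' (y # zs)))) = signed H ((m - 1) * ?k) u"
      unfolding u_def H_def by (rule mul_signed_right'[OF a hc]) simp
    finally show ?thesis unfolding cup.simps(2) b_def .
  qed
  have H: "M (n + m + r - int (length (y # zs))) = H" unfolding e(7) H_def ..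
  have 4: "cup D (n + m) r (\<lambda>ys. signed (M (n + m - int (length ys))) (n * int (length ys)) (dmul D n (m - int (length ys)) a (h ys))) c'' (y # zs)
      = signed H ((n + m - 1) * ?k) (signed H n u) \<oplus>\<^bsub>H\<^esub> signed H n (signed H (n * ?k) v)"
    unfolding cup.simps(2)[of D "n + m"] 1 2 H_def ..
  have "even ((n + m - 1) * ?k + n) = even (n + n * ?k + (m - 1) * ?k)" by (simp add: algebra_simps)
  then show ?case
    unfolding H 4 e(3) e(8) 3 using u v signed_cong[of "(n + m - 1) * ?k + n" "n + n * ?k + (m - 1) * ?k" H u]
    by (simp add: H.signed_signed H.signed_add)
qed

lemma cup_assoc:
  "graded D N c xs \<Longrightarrow> graded D (m + 1) c' xs \<Longrightarrow> graded D (r + 1) c'' xs \<Longrightarrow>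
    cup D (N + m) r (cup D N m c c') c'' xs = cup D N (m + r) c (cup D (m + 1) r c' c'') xs"
proof (induction xs arbitrary: N c)
  case Nil
  then show ?case by (simp add: add.assoc)
next
  case (Cons x xs)
  let ?k = "int (length xs)"
  note p = Cons.prems
  note Lc = graded_shift[OF p(1)] and Lc' = graded_shift[OF p(2), unfolded add_diff_cancel_right']
  define H where "H = M (N + m + r - 1 - ?k)"
  interpret H: abelian_group H unfolding H_def by (rule group.abelian_group_axioms)
  have e: "N + m - 1 = N - 1 + m" "N - 1 + m + r - ?k = N + m + r - 1 - ?k" "N + (m + r) - 1 - ?k = N + m + r - 1 - ?k"
    "m + 1 + r - 1 - ?k = m + r - ?k" "m + 1 - 1 = m" "m - int (length []) = m" "N + m + r - 1 - ?k = N + m + r - 1 - ?k"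
    "N - 1 + m - int (length []) = N - 1 + m" "(N - 1) * int (length []) = 0" by simp_all
  define a where "a = c [x]"
  have a: "a \<in> carrier (M (N - 1))" unfolding a_def by (rule head_closed[OF p(1)])
  have b: "c' [x] \<in> carrier (M m)" using head_closed[OF p(2)] by simp
  have z: "c'' (x # xs) \<in> carrier (M (r - ?k))" by (rule whole_closed[OF p(3)])
  have ab: "dmul D (N - 1) m a (c' [x]) \<in> carrier (M (N - 1 + m))" by (rule mul_closed'[OF a b]) simp
  have bz: "dmul D m (r - ?k) (c' [x]) (c'' (x # xs)) \<in> carrier (M (m + r - ?k))" by (rule mul_closed'[OF b z]) simp
  define t where "t = cup D m r (\<lambda>ys. c' (x # ys)) c'' xs"
  have t: "t \<in> carrier (M (m + r - ?k))" unfolding t_def by (rule cup_closed[OF Lc' graded_tl[OF p(3)]])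
  define u where "u = dmul D (N - 1) (m + r - ?k) a (dmul D m (r - ?k) (c' [x]) (c'' (x # xs)))"
  define v where "v = dmul D (N - 1) (m + r - ?k) a t"
  define w where "w = cup D (N - 1) (m + r) (\<lambda>ys. c (x # ys)) (cup D (m + 1) r c' c'') xs"
  have u: "u \<in> carrier H" unfolding u_def H_def by (rule mul_closed'[OF a bz]) simp
  have v: "v \<in> carrier H" unfolding v_def H_def by (rule mul_closed'[OF a t]) simp
  have w: "w \<in> carrier H"
  proof -
    have "graded D (m + r + 1) (cup D (m + 1) r c' c'') xs"
      using graded_cup[OF graded_tl[OF p(2)] graded_tl[OF p(3)]] by (simp add: algebra_simps)
    from cup_closed[OF Lc this] show ?thesis unfolding w_def H_def by (simp add: algebra_simps)
  qed
  let ?g = "\<lambda>ys. signed (M (N - 1 + m - int (length ys))) ((N - 1) * int (length ys))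
      (dmul D (N - 1) (m - int (length ys)) a (c' (x # ys)))"
  let ?C = "cup D (N - 1) m (\<lambda>ys. c (x # ys)) c'"
  have gg: "graded D (N - 1 + m) ?g xs" by (rule graded_signed[OF graded_mul[OF a Lc']])
  have gC: "graded D (N - 1 + m) ?C xs" by (rule graded_cup[OF Lc graded_tl[OF p(2)]])
  have L: "cup D N m c c' (x # ys) = ?g ys \<oplus>\<^bsub>M (N - 1 + m - int (length ys))\<^esub> ?C ys" for ys
    unfolding cup.simps a_def e(1) ..
  have 1: "cup D (N + m - 1) r (\<lambda>ys. cup D N m c c' (x # ys)) c'' xs = signed H ((N - 1) * ?k) v \<oplus>\<^bsub>H\<^esub> w"
    unfolding L e(1) cup_add_left[OF gg gC graded_tl[OF p(3)]] cup_mul[OF a Lc' graded_tl[OF p(3)]]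
      Cons.IH[OF Lc graded_tl[OF p(2)] graded_tl[OF p(3)]]
    unfolding e(2) H_def v_def t_def w_def ..
  have "cup D N m c c' [x] = dmul D (N - 1) m a (c' [x])"
    using ab unfolding L by (simp add: signed_def)
  then have "dmul D (N + m - 1) (r - ?k) (cup D N m c c' [x]) (c'' (x # xs))
      = dmul D (N - 1 + m) (r - ?k) (dmul D (N - 1) m a (c' [x])) (c'' (x # xs))" by (simp add: algebra_simps)
  also have "\<dots> = u" unfolding u_def using mul_assoc[OF a b z] by (simp add: algebra_simps)
  finally have 2: "dmul D (N + m - 1) (r - ?k) (cup D N m c c' [x]) (c'' (x # xs)) = u" .
  have 3: "dmul D (N - 1) (m + r - ?k) a (cup D (m + 1) r c' c'' (x # xs)) = signed H (m * ?k) u \<oplus>\<^bsub>H\<^esub> v"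
  proof -
    have "dmul D (N - 1) (m + r - ?k) a (signed (M (m + r - ?k)) (m * ?k) (dmul D m (r - ?k) (c' [x]) (c'' (x # xs)))
        \<oplus>\<^bsub>M (m + r - ?k)\<^esub> t) = dmul D (N - 1) (m + r - ?k) a (signed (M (m + r - ?k)) (m * ?k)
          (dmul D m (r - ?k) (c' [x]) (c'' (x # xs)))) \<oplus>\<^bsub>H\<^esub> v"
      unfolding v_def H_def by (rule mul_add_right'[OF a group.signed_closed[OF bz] t]) simp
    also have "dmul D (N - 1) (m + r - ?k) a (signed (M (m + r - ?k)) (m * ?k)
          (dmul D m (r - ?k) (c' [x]) (c'' (x # xs)))) = signed H (m * ?k) u"
      unfolding u_def H_def by (rule mul_signed_right'[OF a bz]) simp
    finally show ?thesis unfolding cup.simps(2) e(4,5) t_def .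
  qed
  have 4: "cup D (N + m) r (cup D N m c c') c'' (x # xs) = signed H ((N + m - 1) * ?k) u \<oplus>\<^bsub>H\<^esub> (signed H ((N - 1) * ?k) v \<oplus>\<^bsub>H\<^esub> w)"
    unfolding cup.simps(2)[of D "N + m"] 1 2 H_def ..
  have 5: "cup D N (m + r) c (cup D (m + 1) r c' c'') (x # xs) =
      signed H ((N - 1) * ?k) (signed H (m * ?k) u \<oplus>\<^bsub>H\<^esub> v) \<oplus>\<^bsub>H\<^esub> w"
    unfolding cup.simps(2)[of D N "m + r"] a_def[symmetric] 3 w_def[symmetric] e(3) H_def ..
  have s: "(N - 1) * ?k + m * ?k = (N + m - 1) * ?k" by (simp add: algebra_simps)
  show ?case
    unfolding 4 5 using u v w by (simp add: H.signed_add H.signed_signed s H.a_assoc)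
qed

lemma cup_unit_left:
  assumes c: "graded D (m + 1) c xs" "xs \<noteq> []"
    and i: "\<And>x. i [x] = dunit D" "\<And>ys. length ys \<ge> 2 \<Longrightarrow> i ys = \<zero>\<^bsub>M (1 - int (length ys))\<^esub>"
  shows "cup D 1 m i c xs = c xs"
proof -
  obtain x zs where xs: "xs = x # zs" using c(2) by (cases xs) auto
  have 1: "cup D (1 - 1) m (\<lambda>ys. i (x # ys)) c zs = \<zero>\<^bsub>M (1 - 1 + m - int (length zs))\<^esub>"
  proof (rule cup_zero_left)
    fix ys :: "'b list" assume "ys \<noteq> []"
    then have "length (x # ys) \<ge> 2" by (cases ys) auto
    then show "i (x # ys) = \<zero>\<^bsub>M (1 - 1 - int (length ys))\<^esub>" using i(2)[of "x # ys"] by simp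
  qed (use graded_tl[of D "m + 1" c x zs] c(1) xs in simp)
  have "c xs \<in> carrier (M (m - int (length zs)))" using whole_closed[of m c x zs] c(1) unfolding xs by simp
  then show ?thesis using 1 unfolding xs by (simp add: i(1) one_mul signed_def)
qed

lemma cup_unit_right:
  assumes i: "\<And>x. i [x] = dunit D" "\<And>ys. length ys \<ge> 2 \<Longrightarrow> i ys = \<zero>\<^bsub>M (1 - int (length ys))\<^esub>"
  shows "graded D N c xs \<Longrightarrow> xs \<noteq> [] \<Longrightarrow> cup D N 0 c i xs = c xs"
proof (induction xs arbitrary: N c)
  case (Cons x zs)
  have h: "c [x] \<in> carrier (M (N - 1))" by (rule head_closed[OF Cons.prems(1)])
  show ?case
  proof (cases "zs = []")
    case True
    then show ?thesis using h i by (simp add: mul_one signed_def)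
  next
    case False
    have i0: "i (x # zs) = \<zero>\<^bsub>M (0 - int (length zs))\<^esub>" using i(2)[of "x # zs"] False by (cases zs) auto
    have "dmul D (N - 1) (0 - int (length zs)) (c [x]) \<zero>\<^bsub>M (0 - int (length zs))\<^esub> = \<zero>\<^bsub>M (N + 0 - 1 - int (length zs))\<^esub>"
      by (rule mul_zero_right'[OF h]) simp
    moreover have "cup D (N - 1) 0 (\<lambda>ys. c (x # ys)) i zs = c (x # zs)"
      by (rule Cons.IH[OF graded_shift[OF Cons.prems(1)] False])
    moreover have "c (x # zs) \<in> carrier (M (N + 0 - 1 - int (length zs)))"
      using gradedD[OF Cons.prems(1), of "x # zs"] by (simp add: algebra_simps)
    ultimately show ?thesis unfolding cup.simps(2) i0 by (simp only: group.signed_zero group.l_zero)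
  qed
qed simp

end

lemma cup_map:
  assumes D: "dg_algebra R D" and E: "dg_algebra R E" and f: "f \<in> dga_maps R D E"
  shows "graded D N c xs \<Longrightarrow> graded D (m + 1) c' xs \<Longrightarrow>
    cup E N m (\<lambda>ys. f (N - int (length ys)) (c ys)) (\<lambda>ys. f (m + 1 - int (length ys)) (c' ys)) xs
      = f (N + m - int (length xs)) (cup D N m c c' xs)"
proof (induction xs arbitrary: N c)
  interpret D: dg_alg R D by (rule dg_algI[OF D])
  interpret E: dg_alg R E by (rule dg_algI[OF E])
  note fl = cochain_mapsD(1)[OF dga_mapsD(1)[OF f]]
  {
    case Nil
    then show ?case using linear_zero[OF D.module_deg E.module_deg fl] by simp
  next
    case (Cons x xs)
    let ?k = "int (length xs)"
    let ?q = "N + m - 1 - ?k"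
    note c = D.cup_Cons[OF Cons.prems refl]
    have e: "N - int (length (x # ys)) = N - 1 - int (length ys)" "N - int (length [x]) = N - 1"
      "m + 1 - int (length (x # xs)) = m - ?k" "N - 1 + m - ?k = ?q" "N + m - int (length (x # xs)) = ?q"
      "N - 1 + (m - ?k) = ?q" for ys by simp_all
    have 1: "cup E (N - 1) m (\<lambda>ys. f (N - int (length (x # ys))) (c (x # ys))) (\<lambda>ys. f (m + 1 - int (length ys)) (c' ys)) xs
        = f ?q (cup D (N - 1) m (\<lambda>ys. c (x # ys)) c' xs)"
      using Cons.IH[OF graded_shift[OF Cons.prems(1)] graded_tl[OF Cons.prems(2)]] unfolding e .
    have 2: "dmul E (N - 1) (m - ?k) (f (N - 1) (c [x])) (f (m - ?k) (c' (x # xs)))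
        = f ?q (dmul D (N - 1) (m - ?k) (c [x]) (c' (x # xs)))"
      using dga_mapsD(2)[OF f D.head_closed[OF Cons.prems(1)] D.whole_closed[OF Cons.prems(2)]] unfolding e by simp
    show ?case
      unfolding cup.simps(2)[of E] e(2,3) 1 2 c(1) e(5)
      using linear_mapsD(2)[OF fl, of _ ?q] linear_signed[OF D.module_deg E.module_deg fl] c(2,3) by simp
  }
qed

section \<open>The algebra of cochains on lists\<close>

definition cochain_dga :: "('r, 'a) dga \<Rightarrow> 'v list set \<Rightarrow> ('r, 'v list \<Rightarrow> 'a) dga" where
  "cochain_dga D V =
     \<lparr> deg = (\<lambda>n.
         \<lparr> carrier = {c \<in> extensional V. c [] = \<zero>\<^bsub>deg D (n + 1)\<^esub> \<and>
             (\<forall>xs\<in>V. c xs \<in> carrier (deg D (n + 1 - int (length xs))))},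
           mult = undefined, one = undefined,
           zero = (\<lambda>xs\<in>V. \<zero>\<^bsub>deg D (n + 1 - int (length xs))\<^esub>),
           add = (\<lambda>c c'. \<lambda>xs\<in>V. c xs \<oplus>\<^bsub>deg D (n + 1 - int (length xs))\<^esub> c' xs),
           smult = (\<lambda>r c. \<lambda>xs\<in>V. r \<odot>\<^bsub>deg D (n + 1 - int (length xs))\<^esub> c xs) \<rparr>),
       dif = (\<lambda>n c. \<lambda>xs\<in>V. cobd D (n + 1) c xs),
       dmul = (\<lambda>n m c c'. \<lambda>xs\<in>V. cup D (n + 1) m c c' xs),
       dunit = (\<lambda>xs\<in>V. if length xs = 1 then dunit D else \<zero>\<^bsub>deg D (1 - int (length xs))\<^esub>) \<rparr>"

definition constant_cochain :: "('r, 'a) dga \<Rightarrow> 'v list set \<Rightarrow> int \<Rightarrow> 'a \<Rightarrow> 'v list \<Rightarrow> 'a" where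
  "constant_cochain D V n a = (\<lambda>xs\<in>V. if length xs = 1 then a else \<zero>\<^bsub>deg D (n + 1 - int (length xs))\<^esub>)"

definition map_cochain ::
  "'w list set \<Rightarrow> ('w \<Rightarrow> 'v) \<Rightarrow> (int \<Rightarrow> 'a \<Rightarrow> 'b) \<Rightarrow> int \<Rightarrow> ('v list \<Rightarrow> 'a) \<Rightarrow> 'w list \<Rightarrow> 'b" where
  "map_cochain W h f n c = (\<lambda>xs\<in>W. f (n + 1 - int (length xs)) (c (map h xs)))"

locale list_cochains = dg_alg R D
  for R :: "('r, 'k) ring_scheme" and D :: "('r, 'a) dga" +
  fixes V :: "'v list set"
  assumes nil: "[] \<in> V" and sub: "xs \<in> V \<Longrightarrow> subseq ys xs \<Longrightarrow> ys \<in> V"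
begin

abbreviation E where "E \<equiv> cochain_dga D V"

lemma E_carrier: "c \<in> carrier (deg E n) \<longleftrightarrow> c \<in> extensional V \<and> c [] = \<zero>\<^bsub>M (n + 1)\<^esub> \<and>
    (\<forall>xs\<in>V. c xs \<in> carrier (M (n + 1 - int (length xs))))"
  by (simp add: cochain_dga_def)

lemma E_carrierI:
  assumes "\<And>xs. xs \<in> V \<Longrightarrow> f xs \<in> carrier (M (n + 1 - int (length xs)))" "f [] = \<zero>\<^bsub>M (n + 1)\<^esub>"
  shows "(\<lambda>xs\<in>V. f xs) \<in> carrier (deg E n)"
  using assms nil by (simp add: E_carrier)

lemma E_closed: "c \<in> carrier (deg E n) \<Longrightarrow> xs \<in> V \<Longrightarrow> c xs \<in> carrier (M (n + 1 - int (length xs)))"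
  by (simp add: E_carrier)

lemma E_nil: "c \<in> carrier (deg E n) \<Longrightarrow> c [] = \<zero>\<^bsub>M (n + 1)\<^esub>"
  by (simp add: E_carrier)

lemma E_eqI:
  assumes "c \<in> carrier (deg E n)" "d \<in> carrier (deg E n)" "\<And>xs. xs \<in> V \<Longrightarrow> c xs = d xs"
  shows "c = d"
  using assms by (intro extensionalityI[of _ V]) (auto simp: E_carrier)

lemma E_graded: "c \<in> carrier (deg E n) \<Longrightarrow> xs \<in> V \<Longrightarrow> graded D (n + 1) c xs"
  unfolding graded_def using E_closed sub by blast

lemma E_apply:
  assumes "xs \<in> V"
  shows "\<zero>\<^bsub>deg E n\<^esub> xs = \<zero>\<^bsub>M (n + 1 - int (length xs))\<^esub>"
    "(c \<oplus>\<^bsub>deg E n\<^esub> c') xs = c xs \<oplus>\<^bsub>M (n + 1 - int (length xs))\<^esub> c' xs"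
    "(r \<odot>\<^bsub>deg E n\<^esub> c) xs = r \<odot>\<^bsub>M (n + 1 - int (length xs))\<^esub> c xs"
    "dif E n c xs = cobd D (n + 1) c xs"
    "dmul E n m c c' xs = cup D (n + 1) m c c' xs"
    "dunit E xs = (if length xs = 1 then dunit D else \<zero>\<^bsub>M (1 - int (length xs))\<^esub>)"
  using assms by (simp_all add: cochain_dga_def)

lemma E_zero_closed: "\<zero>\<^bsub>deg E n\<^esub> \<in> carrier (deg E n)"
  using nil by (simp add: cochain_dga_def)

lemma E_add_closed: "c \<in> carrier (deg E n) \<Longrightarrow> c' \<in> carrier (deg E n) \<Longrightarrow> c \<oplus>\<^bsub>deg E n\<^esub> c' \<in> carrier (deg E n)"
  using nil by (simp add: cochain_dga_def)

lemma E_smult_closed: "r \<in> carrier R \<Longrightarrow> c \<in> carrier (deg E n) \<Longrightarrow> r \<odot>\<^bsub>deg E n\<^esub> c \<in> carrier (deg E n)"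
  using nil mod.smult_r_null by (simp add: cochain_dga_def mod.smult_closed)

lemma E_dif_closed: "c \<in> carrier (deg E n) \<Longrightarrow> dif E n c \<in> carrier (deg E (n + 1))"
proof -
  assume c: "c \<in> carrier (deg E n)"
  have "(\<lambda>xs\<in>V. cobd D (n + 1) c xs) \<in> carrier (deg E (n + 1))"
  proof (rule E_carrierI)
    show "cobd D (n + 1) c [] = \<zero>\<^bsub>M (n + 1 + 1)\<^esub>"
      unfolding cobd.simps E_nil[OF c] d_zero by (simp add: group.signed_zero minus_signed)
  qed (rule cobd_closed[OF E_graded[OF c]])
  then show ?thesis by (simp add: cochain_dga_def)
qed

lemma E_mul_closed: "c \<in> carrier (deg E n) \<Longrightarrow> c' \<in> carrier (deg E m) \<Longrightarrow> dmul E n m c c' \<in> carrier (deg E (n + m))"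
proof -
  assume c: "c \<in> carrier (deg E n)" and c': "c' \<in> carrier (deg E m)"
  have e: "n + m + 1 = n + 1 + m" by simp
  have "(\<lambda>xs\<in>V. cup D (n + 1) m c c' xs) \<in> carrier (deg E (n + m))"
    by (rule E_carrierI; unfold e) (simp_all add: cup_closed[OF E_graded[OF c] E_graded[OF c']])
  then show ?thesis by (simp add: cochain_dga_def)
qed

lemma E_module: "module R (deg E n)"
proof (rule moduleI_jointly_injective[where I = V and M = "\<lambda>xs. M (n + 1 - int (length xs))" and ev = "\<lambda>xs c. c xs"])
  show "cring R" using module_deg by (simp add: module_def)
qed (auto simp: module_deg E_closed E_apply E_zero_closed E_add_closed E_smult_closed intro: E_eqI)

lemma E_complex: "cochain_complex R E"
  unfolding cochain_complex_def
proof (intro conjI allI ballI E_module linear_mapsI)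
  fix n c assume c: "c \<in> carrier (deg E n)"
  show "dif E n c \<in> carrier (deg E (n + 1))" by (rule E_dif_closed[OF c])
  show "dif E n (c \<oplus>\<^bsub>deg E n\<^esub> c') = dif E n c \<oplus>\<^bsub>deg E (n + 1)\<^esub> dif E n c'" if c': "c' \<in> carrier (deg E n)" for c'
  proof (rule E_eqI[of _ "n + 1"])
    fix xs assume xs: "xs \<in> V"
    have "cobd D (n + 1) (c \<oplus>\<^bsub>deg E n\<^esub> c') xs = cobd D (n + 1) (\<lambda>ys. c ys \<oplus>\<^bsub>M (n + 1 - int (length ys))\<^esub> c' ys) xs"
      by (rule cobd_cong) (simp add: E_apply sub[OF xs])
    then show "dif E n (c \<oplus>\<^bsub>deg E n\<^esub> c') xs = (dif E n c \<oplus>\<^bsub>deg E (n + 1)\<^esub> dif E n c') xs"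
      unfolding E_apply[OF xs] cobd_add[OF E_graded[OF c xs] E_graded[OF c' xs]] .
  qed (auto intro!: E_dif_closed E_add_closed c c')
  show "dif E n (r \<odot>\<^bsub>deg E n\<^esub> c) = r \<odot>\<^bsub>deg E (n + 1)\<^esub> dif E n c" if r: "r \<in> carrier R" for r
  proof (rule E_eqI[of _ "n + 1"])
    fix xs assume xs: "xs \<in> V"
    have "cobd D (n + 1) (r \<odot>\<^bsub>deg E n\<^esub> c) xs = cobd D (n + 1) (\<lambda>ys. r \<odot>\<^bsub>M (n + 1 - int (length ys))\<^esub> c ys) xs"
      by (rule cobd_cong) (simp add: E_apply sub[OF xs])
    then show "dif E n (r \<odot>\<^bsub>deg E n\<^esub> c) xs = (r \<odot>\<^bsub>deg E (n + 1)\<^esub> dif E n c) xs"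
      unfolding E_apply[OF xs] cobd_smult[OF r E_graded[OF c xs]] .
  qed (auto intro!: E_dif_closed E_smult_closed c r)
  have e: "n + 2 = n + 1 + 1" "n + 1 + 2 = n + 1 + 1 + 1" by simp_all
  show "dif E (n + 1) (dif E n c) = \<zero>\<^bsub>deg E (n + 2)\<^esub>"
    unfolding e
  proof (rule E_eqI[OF E_dif_closed[OF E_dif_closed[OF c]] E_zero_closed])
    fix xs assume xs: "xs \<in> V"
    have "cobd D (n + 1 + 1) (dif E n c) xs = cobd D (n + 1 + 1) (cobd D (n + 1) c) xs"
      by (rule cobd_cong) (simp add: E_apply sub[OF xs])
    then show "dif E (n + 1) (dif E n c) xs = \<zero>\<^bsub>deg E (n + 1 + 1)\<^esub> xs"
      unfolding E_apply[OF xs] using cobd_cobd[OF E_graded[OF c xs]] unfolding e by simp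
  qed
qed

lemma E_unit: "dunit E \<in> carrier (deg E 0)"
proof -
  have "(\<lambda>xs\<in>V. if length xs = 1 then dunit D else \<zero>\<^bsub>M (1 - int (length xs))\<^esub>) \<in> carrier (deg E 0)"
    by (rule E_carrierI) (auto simp: one_closed)
  then show ?thesis by (simp add: cochain_dga_def)
qed

lemma E_minus_apply:
  assumes "c \<in> carrier (deg E n)" "xs \<in> V"
  shows "signed (deg E n) k c xs = signed (M (n + 1 - int (length xs))) k (c xs)"
  using additive_minus[of "deg E n" "M (n + 1 - int (length xs))" "\<lambda>c. c xs" c] E_module assms
  by (simp add: signed_def module_abelian_group[OF E_module] group.abelian_group_axioms E_closed E_apply)

lemma E_tensor: "dmul E \<in> tensor_cochain_maps R E E E"
proof (intro tensor_cochain_mapsI linear_mapsI)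
  fix n m c c' assume c: "c \<in> carrier (deg E n)" and c': "c' \<in> carrier (deg E m)"
  have e: "n + m + 1 = n + 1 + m" "n + 1 - 1 = n" by simp_all
  show 1: "dmul E n m c c' \<in> carrier (deg E (n + m))" by (rule E_mul_closed[OF c c'])
  show "dmul E n m c c' \<in> carrier (deg E (n + m))" by (rule 1)
  show "dmul E n m (c \<oplus>\<^bsub>deg E n\<^esub> d) c' = dmul E n m c c' \<oplus>\<^bsub>deg E (n + m)\<^esub> dmul E n m d c'"
    if d: "d \<in> carrier (deg E n)" for d
  proof (rule E_eqI[of _ "n + m"])
    fix xs assume xs: "xs \<in> V"
    have "cup D (n + 1) m (c \<oplus>\<^bsub>deg E n\<^esub> d) c' xs = cup D (n + 1) m (\<lambda>ys. c ys \<oplus>\<^bsub>M (n + 1 - int (length ys))\<^esub> d ys) c' xs"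
      by (rule cup_cong) (simp_all add: E_apply sub[OF xs])
    then show "dmul E n m (c \<oplus>\<^bsub>deg E n\<^esub> d) c' xs = (dmul E n m c c' \<oplus>\<^bsub>deg E (n + m)\<^esub> dmul E n m d c') xs"
      unfolding E_apply[OF xs] cup_add_left[OF E_graded[OF c xs] E_graded[OF d xs] E_graded[OF c' xs]] e .
  qed (auto intro!: E_mul_closed E_add_closed c c' d)
  show "dmul E n m c (c' \<oplus>\<^bsub>deg E m\<^esub> d) = dmul E n m c c' \<oplus>\<^bsub>deg E (n + m)\<^esub> dmul E n m c d"
    if d: "d \<in> carrier (deg E m)" for d
  proof (rule E_eqI[of _ "n + m"])
    fix xs assume xs: "xs \<in> V"
    have "cup D (n + 1) m c (c' \<oplus>\<^bsub>deg E m\<^esub> d) xs = cup D (n + 1) m c (\<lambda>ys. c' ys \<oplus>\<^bsub>M (m + 1 - int (length ys))\<^esub> d ys) xs"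
      by (rule cup_cong) (simp_all add: E_apply sub[OF xs])
    then show "dmul E n m c (c' \<oplus>\<^bsub>deg E m\<^esub> d) xs = (dmul E n m c c' \<oplus>\<^bsub>deg E (n + m)\<^esub> dmul E n m c d) xs"
      unfolding E_apply[OF xs] cup_add_right[OF E_graded[OF c xs] E_graded[OF c' xs] E_graded[OF d xs]] e .
  qed (auto intro!: E_mul_closed E_add_closed c c' d)
  show "dmul E n m (r \<odot>\<^bsub>deg E n\<^esub> c) c' = r \<odot>\<^bsub>deg E (n + m)\<^esub> dmul E n m c c'" if r: "r \<in> carrier R" for r
  proof (rule E_eqI[of _ "n + m"])
    fix xs assume xs: "xs \<in> V"
    have "cup D (n + 1) m (r \<odot>\<^bsub>deg E n\<^esub> c) c' xs = cup D (n + 1) m (\<lambda>ys. r \<odot>\<^bsub>M (n + 1 - int (length ys))\<^esub> c ys) c' xs"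
      by (rule cup_cong) (simp_all add: E_apply sub[OF xs])
    then show "dmul E n m (r \<odot>\<^bsub>deg E n\<^esub> c) c' xs = (r \<odot>\<^bsub>deg E (n + m)\<^esub> dmul E n m c c') xs"
      unfolding E_apply[OF xs] cup_smult_left[OF r E_graded[OF c xs] E_graded[OF c' xs]] e .
  qed (auto intro!: E_mul_closed E_smult_closed c c' r)
  show "dmul E n m c (r \<odot>\<^bsub>deg E m\<^esub> c') = r \<odot>\<^bsub>deg E (n + m)\<^esub> dmul E n m c c'" if r: "r \<in> carrier R" for r
  proof (rule E_eqI[of _ "n + m"])
    fix xs assume xs: "xs \<in> V"
    have "cup D (n + 1) m c (r \<odot>\<^bsub>deg E m\<^esub> c') xs = cup D (n + 1) m c (\<lambda>ys. r \<odot>\<^bsub>M (m + 1 - int (length ys))\<^esub> c' ys) xs"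
      by (rule cup_cong) (simp_all add: E_apply sub[OF xs])
    then show "dmul E n m c (r \<odot>\<^bsub>deg E m\<^esub> c') xs = (r \<odot>\<^bsub>deg E (n + m)\<^esub> dmul E n m c c') xs"
      unfolding E_apply[OF xs] cup_smult_right[OF r E_graded[OF c xs] E_graded[OF c' xs]] e .
  qed (auto intro!: E_mul_closed E_smult_closed c c' r)
  interpret T: abelian_group "deg E (n + m + 1)" by (rule module_abelian_group[OF E_module])
  have l: "dmul E (n + 1) m (dif E n c) c' \<in> carrier (deg E (n + m + 1))"
    using E_mul_closed[OF E_dif_closed[OF c] c'] by (simp add: algebra_simps)
  have r: "dmul E n (m + 1) c (dif E m c') \<in> carrier (deg E (n + m + 1))"
    using E_mul_closed[OF c E_dif_closed[OF c']] by (simp add: algebra_simps)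
  show "dif E (n + m) (dmul E n m c c') = dmul E (n + 1) m (dif E n c) c' \<oplus>\<^bsub>deg E (n + m + 1)\<^esub>
      signed (deg E (n + m + 1)) n (dmul E n (m + 1) c (dif E m c'))"
  proof (rule E_eqI[of _ "n + m + 1"])
    fix xs assume xs: "xs \<in> V"
    let ?G = "M (n + 1 + m + 1 - int (length xs))"
    have 1: "cobd D (n + 1 + m) (dmul E n m c c') xs = cobd D (n + 1 + m) (cup D (n + 1) m c c') xs"
      by (rule cobd_cong) (simp add: E_apply sub[OF xs])
    have 2: "cup D (n + 1 + 1) m (dif E n c) c' xs = cup D (n + 1 + 1) m (cobd D (n + 1) c) c' xs"
      by (rule cup_cong) (simp_all add: E_apply sub[OF xs])
    have 3: "cup D (n + 1) (m + 1) c (dif E m c') xs = cup D (n + 1) (m + 1) c (cobd D (m + 1) c') xs"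
      by (rule cup_cong) (simp_all add: E_apply sub[OF xs])
    have "dmul D (n + 1) (m + 1 - int (length xs)) \<zero>\<^bsub>M (n + 1)\<^esub> (c' xs) = \<zero>\<^bsub>?G\<^esub>"
      by (rule mul_zero_left'[OF E_closed[OF c' xs]]) simp
    moreover have "cobd D (n + 1 + m) (cup D (n + 1) m c c') xs \<in> carrier ?G"
      by (rule cobd_closed[OF graded_cup[OF E_graded[OF c xs] E_graded[OF c' xs]]])
    ultimately have "cobd D (n + 1 + m) (cup D (n + 1) m c c') xs = cup D (n + 1 + 1) m (cobd D (n + 1) c) c' xs
        \<oplus>\<^bsub>?G\<^esub> signed ?G n (cup D (n + 1) (m + 1) c (cobd D (m + 1) c') xs)"
      using cobd_cup[OF E_graded[OF c xs] E_graded[OF c' xs] E_nil[OF c'] refl]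
      unfolding E_nil[OF c] e(2) by (simp add: group.signed_zero)
    then show "dif E (n + m) (dmul E n m c c') xs = (dmul E (n + 1) m (dif E n c) c' \<oplus>\<^bsub>deg E (n + m + 1)\<^esub>
        signed (deg E (n + m + 1)) n (dmul E n (m + 1) c (dif E m c'))) xs"
      unfolding E_apply(2)[OF xs] E_minus_apply[OF r xs]
      unfolding E_apply[OF xs] e 1 2 3 .
  qed (auto intro!: E_dif_closed 1 l r T.a_closed T.signed_closed)
qed

lemma E_dga: "dg_algebra R E"
  unfolding dg_algebra_def
proof (intro conjI allI ballI impI E_complex E_tensor E_unit)
  fix n :: int assume n: "n < 0"
  have "c = \<zero>\<^bsub>deg E n\<^esub>" if c: "c \<in> carrier (deg E n)" for c
  proof (rule E_eqI[OF c E_zero_closed])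
    fix xs assume xs: "xs \<in> V"
    show "c xs = \<zero>\<^bsub>deg E n\<^esub> xs"
    proof (cases xs)
      case Nil then show ?thesis using E_nil[OF c] E_apply(1)[OF nil] by simp
    next
      case (Cons x ys)
      then have "n + 1 - int (length xs) < 0" using n by simp
      then show ?thesis using E_closed[OF c xs] neg_deg unfolding E_apply[OF xs] by blast
    qed
  qed
  then show "carrier (deg E n) = {\<zero>\<^bsub>deg E n\<^esub>}" using E_zero_closed by blast
next
  fix n m r c c' c'' assume c: "c \<in> carrier (deg E n)" "c' \<in> carrier (deg E m)" "c'' \<in> carrier (deg E r)"
  show "dmul E (n + m) r (dmul E n m c c') c'' = dmul E n (m + r) c (dmul E m r c' c'')"
  proof (rule E_eqI[of _ "n + m + r"])
    show "dmul E n (m + r) c (dmul E m r c' c'') \<in> carrier (deg E (n + m + r))"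
      unfolding add.assoc by (intro E_mul_closed c)
    fix xs assume xs: "xs \<in> V"
    have e: "n + m + 1 = n + 1 + m" by simp
    have 1: "cup D (n + 1 + m) r (dmul E n m c c') c'' xs = cup D (n + 1 + m) r (cup D (n + 1) m c c') c'' xs"
      by (rule cup_cong) (simp_all add: E_apply sub[OF xs])
    have 2: "cup D (n + 1) (m + r) c (dmul E m r c' c'') xs = cup D (n + 1) (m + r) c (cup D (m + 1) r c' c'') xs"
      by (rule cup_cong) (simp_all add: E_apply sub[OF xs])
    show "dmul E (n + m) r (dmul E n m c c') c'' xs = dmul E n (m + r) c (dmul E m r c' c'') xs"
      unfolding E_apply[OF xs] e 1 2 by (rule cup_assoc[OF E_graded[OF c(1) xs] E_graded[OF c(2) xs] E_graded[OF c(3) xs]])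
  qed (intro E_mul_closed c)
next
  fix n c assume c: "c \<in> carrier (deg E n)"
  let ?i = "\<lambda>xs. if length xs = 1 then dunit D else \<zero>\<^bsub>M (1 - int (length xs))\<^esub>"
  show "dmul E 0 n (dunit E) c = c"
  proof (rule E_eqI[of _ n])
    show "dmul E 0 n (dunit E) c \<in> carrier (deg E n)" using E_mul_closed[OF E_unit c] by simp
    fix xs assume xs: "xs \<in> V"
    show "dmul E 0 n (dunit E) c xs = c xs"
    proof (cases "xs = []")
      case True
      then show ?thesis using E_apply(5)[OF nil, of 0 n] E_nil[OF c] by (simp add: add.commute)
    next
      case False
      have "cup D 1 n (dunit E) c xs = cup D 1 n ?i c xs"
        by (rule cup_cong) (simp_all add: E_apply sub[OF xs])
      also have "\<dots> = c xs" by (rule cup_unit_left[OF E_graded[OF c xs] False]) auto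
      finally show ?thesis unfolding E_apply[OF xs] by simp
    qed
  qed (rule c)
  show "dmul E n 0 c (dunit E) = c"
  proof (rule E_eqI[of _ n])
    show "dmul E n 0 c (dunit E) \<in> carrier (deg E n)" using E_mul_closed[OF c E_unit] by simp
    fix xs assume xs: "xs \<in> V"
    show "dmul E n 0 c (dunit E) xs = c xs"
    proof (cases "xs = []")
      case True
      then show ?thesis using E_apply(5)[OF nil, of n 0] E_nil[OF c] by simp
    next
      case False
      have "cup D (n + 1) 0 c (dunit E) xs = cup D (n + 1) 0 c ?i xs"
        by (rule cup_cong) (simp_all add: E_apply sub[OF xs])
      also have "\<dots> = c xs" by (rule cup_unit_right[OF _ _ E_graded[OF c xs] False]) auto
      finally show ?thesis unfolding E_apply[OF xs] .
    qed
  qed (rule c)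
qed

abbreviation \<iota> where "\<iota> \<equiv> constant_cochain D V"

lemma \<iota>_closed: "a \<in> carrier (M n) \<Longrightarrow> \<iota> n a \<in> carrier (deg E n)"
  unfolding constant_cochain_def by (rule E_carrierI) auto

lemma \<iota>_dif:
  assumes a: "a \<in> carrier (M n)"
  shows "\<iota> (n + 1) (dif D n a) = dif E n (\<iota> n a)"
proof (rule E_eqI[of _ "n + 1"])
  fix xs assume xs: "xs \<in> V"
  have z: "\<ominus>\<^bsub>M q\<^esub> \<zero>\<^bsub>M q\<^esub> = \<zero>\<^bsub>M q\<^esub>" for q by (simp add: minus_signed group.signed_zero)
  let ?i = "\<lambda>xs. if length xs = 1 then a else \<zero>\<^bsub>M (n + 1 - int (length xs))\<^esub>"
  have "cobd D (n + 1) (\<iota> n a) xs = cobd D (n + 1) ?i xs"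
    by (rule cobd_cong) (simp add: constant_cochain_def sub[OF xs])
  also have "\<dots> = \<iota> (n + 1) (dif D n a) xs"
  proof (cases xs)
    case Nil
    then show ?thesis using nil by (simp add: constant_cochain_def d_zero z)
  next
    case (Cons x ys)
    have p: "cobd D n (\<lambda>ys. ?i (x # ys)) ys = cobd D n (\<lambda>ys. if ys = [] then a else \<zero>\<^bsub>M (n - int (length ys))\<^esub>) ys"
      by (rule cobd_cong) auto
    show ?thesis
    proof (cases ys)
      case Nil
      then show ?thesis
        using Cons xs d_closed[OF a] by (simp add: constant_cochain_def a_minus_def)
    next
      case (Cons y zs)
      have "cobd D n (\<lambda>ys. ?i (x # ys)) ys = (if zs = [] then a else \<zero>\<^bsub>M (n - int (length zs))\<^esub>)"
        by (subst p, unfold Cons, rule cobd_point[OF a])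
      moreover have "length xs \<noteq> 1" "n + 1 + 1 - int (length xs) = n - int (length zs)"
        using \<open>xs = x # ys\<close> Cons by auto
      ultimately show ?thesis
        using \<open>xs = x # ys\<close> Cons xs a
        by (simp add: constant_cochain_def a_minus_def group.r_neg z)
    qed
  qed
  finally show "\<iota> (n + 1) (dif D n a) xs = dif E n (\<iota> n a) xs" unfolding E_apply[OF xs] ..
qed (intro E_dif_closed \<iota>_closed d_closed a)+

lemma \<iota>_dga: "\<iota> \<in> dga_maps R D E"
  unfolding dga_maps_def
proof (intro CollectI conjI allI ballI cochain_mapsI linear_mapsI)
  fix n a assume a: "a \<in> carrier (M n)"
  show "\<iota> n a \<in> carrier (deg E n)" by (rule \<iota>_closed[OF a])
  show "\<iota> n (a \<oplus>\<^bsub>M n\<^esub> b) = \<iota> n a \<oplus>\<^bsub>deg E n\<^esub> \<iota> n b" if b: "b \<in> carrier (M n)" for b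
    using a b by (intro E_eqI[of _ n] \<iota>_closed E_add_closed) (auto simp: E_apply, simp add: constant_cochain_def)
  show "\<iota> n (r \<odot>\<^bsub>M n\<^esub> a) = r \<odot>\<^bsub>deg E n\<^esub> \<iota> n a" if r: "r \<in> carrier R" for r
    using a r mod.smult_r_null
    by (intro E_eqI[of _ n] \<iota>_closed E_smult_closed mod.smult_closed) (auto simp: E_apply, simp add: constant_cochain_def)
  show "\<iota> (n + 1) (dif D n a) = dif E n (\<iota> n a)" by (rule \<iota>_dif[OF a])
next
  fix n m a b assume a: "a \<in> carrier (M n)" and b: "b \<in> carrier (M m)"
  show "\<iota> (n + m) (dmul D n m a b) = dmul E n m (\<iota> n a) (\<iota> m b)"
  proof (rule E_eqI[of _ "n + m"])
    fix xs assume xs: "xs \<in> V"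
    let ?i = "\<lambda>xs. if length xs = 1 then a else \<zero>\<^bsub>M (n + 1 - int (length xs))\<^esub>"
    let ?j = "\<lambda>xs. if length xs = 1 then b else \<zero>\<^bsub>M (m + 1 - int (length xs))\<^esub>"
    have "cup D (n + 1) m (\<iota> n a) (\<iota> m b) xs = cup D (n + 1) m ?i ?j xs"
      by (rule cup_cong) (simp_all add: constant_cochain_def sub[OF xs])
    also have "\<dots> = \<iota> (n + m) (dmul D n m a b) xs"
    proof (cases xs)
      case Nil
      then show ?thesis using nil by (simp add: constant_cochain_def algebra_simps)
    next
      case (Cons x ys)
      let ?G = "M (n + m - int (length ys))"
      have jg: "graded D (m + 1) ?j ys" using b by (auto simp: graded_def)
      have "cup D n m (\<lambda>ys. ?i (x # ys)) ?j ys = \<zero>\<^bsub>?G\<^esub>"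
        by (rule cup_zero_left[OF _ jg]) auto
      then have 1: "cup D (n + 1) m ?i ?j xs = signed ?G (n * int (length ys)) (dmul D n (m - int (length ys)) a (?j (x # ys))) \<oplus>\<^bsub>?G\<^esub> \<zero>\<^bsub>?G\<^esub>"
        unfolding Cons cup.simps(2) by (simp add: algebra_simps)
      show ?thesis
      proof (cases "ys = []")
        case True
        then show ?thesis using 1 Cons xs mul_closed[OF a b] by (simp add: constant_cochain_def signed_def)
      next
        case False
        have z: "dmul D n (m - int (length ys)) a \<zero>\<^bsub>M (m - int (length ys))\<^esub> = \<zero>\<^bsub>?G\<^esub>" by (rule mul_zero_right'[OF a]) simp
        have "cup D (n + 1) m ?i ?j xs = \<zero>\<^bsub>?G\<^esub>" using 1 False z by (simp add: group.signed_zero)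
        moreover have "\<iota> (n + m) (dmul D n m a b) xs = \<zero>\<^bsub>M (n + m + 1 - int (length xs))\<^esub>"
          unfolding constant_cochain_def using xs Cons False by simp
        moreover have "n + m + 1 - int (length xs) = n + m - int (length ys)" using Cons by simp
        ultimately show ?thesis by (simp only:)
      qed
    qed
    finally show "\<iota> (n + m) (dmul D n m a b) xs = dmul E n m (\<iota> n a) (\<iota> m b) xs" unfolding E_apply[OF xs] ..
  qed (intro E_mul_closed \<iota>_closed mul_closed a b)+
next
  show "\<iota> 0 (dunit D) = dunit E"
    by (rule E_eqI[OF \<iota>_closed[OF one_closed] E_unit]) (simp add: E_apply constant_cochain_def)
qed

text \<open>The cone with vertex \<open>v\<close> contracts the lists to \<open>v\<close>.\<close>

lemma \<iota>_quis:
  assumes cone: "\<And>xs. xs \<in> V \<Longrightarrow> v # xs \<in> V"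
  shows "quis D E \<iota>"
proof (rule quisI)
  fix n
  have v: "[v] \<in> V" using cone[OF nil] .
  have at_v: "dif E m c [v] = dif D m (c [v])" if c: "c \<in> carrier (deg E m)" for m c
  proof -
    have "c [v] \<in> carrier (M m)" using E_closed[OF c v] by simp
    then show ?thesis
      using d_closed[of "c [v]" m] E_nil[OF c] unfolding E_apply[OF v] by (simp add: a_minus_def)
  qed
  show "a \<in> coboundaries D n" if a: "a \<in> cocycles D n" "\<iota> n a \<in> coboundaries E n" for a
  proof -
    obtain c where c: "c \<in> carrier (deg E (n - 1))" "\<iota> n a = dif E (n - 1) c"
      using a(2) by (auto simp: coboundaries_def)
    have "a = dif D (n - 1) (c [v])"
      using arg_cong[OF c(2), of "\<lambda>c. c [v]"] at_v[OF c(1)] v by (simp add: constant_cochain_def)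
    moreover have "c [v] \<in> carrier (M (n - 1))" using E_closed[OF c(1) v] by simp
    ultimately show ?thesis by (simp add: coboundaries_def)
  qed
  fix c assume "c \<in> cocycles E n"
  then have c: "c \<in> carrier (deg E n)" and dc: "dif E n c = \<zero>\<^bsub>deg E (n + 1)\<^esub>" by (auto simp: cocycles_def)
  have cv: "c [v] \<in> carrier (M n)" using E_closed[OF c v] by simp
  have "dif D n (c [v]) = \<zero>\<^bsub>M (n + 1)\<^esub>" 
  proof -
    have e: "n + 1 + 1 - int (length [v]) = n + 1" by simp
    show ?thesis using at_v[OF c] unfolding dc E_apply[OF v] e by (rule sym)
  qed
  then have cocycle: "c [v] \<in> cocycles D n" using cv by (simp add: cocycles_def)
  define s where "s = (\<lambda>xs\<in>V. if xs = [] then \<zero>\<^bsub>M n\<^esub> else c (v # xs))"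
  have s: "s \<in> carrier (deg E (n - 1))"
    unfolding s_def
  proof (rule E_carrierI)
    fix xs assume xs: "xs \<in> V"
    show "(if xs = [] then \<zero>\<^bsub>M n\<^esub> else c (v # xs)) \<in> carrier (M (n - 1 + 1 - int (length xs)))"
      using E_closed[OF c cone[OF xs]] by simp
  qed simp
  have "c = \<iota> n (c [v]) \<oplus>\<^bsub>deg E n\<^esub> dif E (n - 1) s"
  proof (rule E_eqI[OF c])
    show "\<iota> n (c [v]) \<oplus>\<^bsub>deg E n\<^esub> dif E (n - 1) s \<in> carrier (deg E n)"
      using E_add_closed[OF \<iota>_closed[OF cv]] E_dif_closed[OF s] by simp
    fix xs assume xs: "xs \<in> V"
    show "c xs = (\<iota> n (c [v]) \<oplus>\<^bsub>deg E n\<^esub> dif E (n - 1) s) xs"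
    proof (cases xs)
      case Nil
      have "dif E (n - 1) s [] = \<zero>\<^bsub>M (n + 1)\<^esub>" using E_nil[OF E_dif_closed[OF s]] by simp
      then show ?thesis
        using E_apply(2)[OF nil] E_nil[OF c] E_nil[OF \<iota>_closed[OF cv]] Nil by simp
    next
      case (Cons x ys)
      let ?G = "M (n + 1 - int (length xs))"
      let ?p = "\<lambda>zs. if zs = [] then c [v] else \<zero>\<^bsub>M (n - int (length zs))\<^esub>"
      have p: "graded D n ?p xs" using cv by (simp add: graded_def)
      have L: "graded D n (\<lambda>zs. c (v # zs)) xs"
        using graded_shift[OF E_graded[OF c cone[OF xs]]] by simp
      have "cobd D n s xs = cobd D n (\<lambda>zs. c (v # zs) \<ominus>\<^bsub>M (n - int (length zs))\<^esub> ?p zs) xs"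
      proof (rule cobd_cong)
        fix zs assume zs: "subseq zs xs"
        have "c (v # zs) \<in> carrier (M (n - int (length zs)))" using gradedD[OF L zs] .
        then show "s zs = c (v # zs) \<ominus>\<^bsub>M (n - int (length zs))\<^esub> ?p zs"
          using cv sub[OF xs zs] by (auto simp: s_def group.minus_zero a_minus_def group.r_neg)
      qed
      also have "\<dots> = cobd D n (\<lambda>zs. c (v # zs)) xs \<ominus>\<^bsub>?G\<^esub> cobd D n ?p xs" by (rule cobd_diff[OF L p])
      also have "cobd D n ?p xs = \<iota> n (c [v]) xs"
        unfolding Cons cobd_point[OF cv] using xs Cons by (simp add: constant_cochain_def)
      also have "cobd D n (\<lambda>zs. c (v # zs)) xs = c xs"
      proof -
        have e: "n + 1 + 1 - int (length (v # xs)) = n + 1 - int (length xs)" "n + 1 - 1 = n" by simp_all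
        have "c xs \<ominus>\<^bsub>?G\<^esub> cobd D n (\<lambda>zs. c (v # zs)) xs = \<zero>\<^bsub>?G\<^esub>"
          using arg_cong[OF dc, of "\<lambda>c. c (v # xs)"] unfolding E_apply[OF cone[OF xs]] e cobd.simps(2) .
        moreover have "cobd D n (\<lambda>zs. c (v # zs)) xs \<in> carrier ?G" by (rule cobd_closed[OF L])
        ultimately show ?thesis using group.minus_eq_zero_iff[OF E_closed[OF c xs]] by simp
      qed
      finally have "dif E (n - 1) s xs = c xs \<ominus>\<^bsub>?G\<^esub> \<iota> n (c [v]) xs" unfolding E_apply[OF xs] by simp
      then show ?thesis
        unfolding E_apply[OF xs] using E_closed[OF c xs] E_closed[OF \<iota>_closed[OF cv] xs]
        by (simp add: a_minus_def group.a_lcomm group.r_neg)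
    qed
  qed
  moreover have "dif E (n - 1) s \<in> coboundaries E n" using s by (auto simp: coboundaries_def)
  ultimately show "\<exists>x\<in>cocycles D n. \<exists>b\<in>coboundaries E n. c = \<iota> n x \<oplus>\<^bsub>deg E n\<^esub> b" using cocycle by blast
qed

end

lemma map_cochain_dga:
  assumes D: "list_cochains R D V" and E: "list_cochains R E W" and f: "f \<in> dga_maps R D E"
    and h: "\<And>xs. xs \<in> W \<Longrightarrow> map h xs \<in> V"
  shows "map_cochain W h f \<in> dga_maps R (cochain_dga D V) (cochain_dga E W)"
proof -
  interpret D: list_cochains R D V by (rule D)
  interpret E: list_cochains R E W by (rule E)
  note fc = dga_mapsD(1)[OF f]
  note fl = cochain_mapsD(1)[OF fc]
  note f_zero = linear_zero[OF D.module_deg E.module_deg fl]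
  have closed: "map_cochain W h f n c \<in> carrier (deg E.E n)" if c: "c \<in> carrier (deg D.E n)" for n c
    unfolding map_cochain_def
  proof (rule E.E_carrierI)
    fix xs assume "xs \<in> W"
    then show "f (n + 1 - int (length xs)) (c (map h xs)) \<in> carrier (deg E (n + 1 - int (length xs)))"
      using linear_mapsD(1)[OF fl] D.E_closed[OF c h] by simp
  qed (simp add: D.E_nil[OF c] f_zero)
  have ap: "map_cochain W h f n c xs = f (n + 1 - int (length xs)) (c (map h xs))" if "xs \<in> W" for n c xs
    using that by (simp add: map_cochain_def)
  show ?thesis
    unfolding dga_maps_def
  proof (intro CollectI conjI allI ballI cochain_mapsI linear_mapsI)
    fix n c assume c: "c \<in> carrier (deg D.E n)"
    have ch: "c (map h xs) \<in> carrier (deg D (n + 1 - int (length xs)))" if "xs \<in> W" for xs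
      using D.E_closed[OF c h[OF that]] by simp
    show "map_cochain W h f n c \<in> carrier (deg E.E n)" by (rule closed[OF c])
    show "map_cochain W h f n (c \<oplus>\<^bsub>deg D.E n\<^esub> c') = map_cochain W h f n c \<oplus>\<^bsub>deg E.E n\<^esub> map_cochain W h f n c'"
      if c': "c' \<in> carrier (deg D.E n)" for c'
    proof (rule E.E_eqI[OF closed[OF D.E_add_closed[OF c c']] E.E_add_closed[OF closed[OF c] closed[OF c']]])
      fix xs assume xs: "xs \<in> W"
      have "c' (map h xs) \<in> carrier (deg D (n + 1 - int (length xs)))" using D.E_closed[OF c' h[OF xs]] by simp
      then show "map_cochain W h f n (c \<oplus>\<^bsub>deg D.E n\<^esub> c') xs = (map_cochain W h f n c \<oplus>\<^bsub>deg E.E n\<^esub> map_cochain W h f n c') xs"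
        unfolding E.E_apply[OF xs] ap[OF xs] D.E_apply[OF h[OF xs]] using linear_mapsD(2)[OF fl ch[OF xs]] by simp
    qed
    show "map_cochain W h f n (r \<odot>\<^bsub>deg D.E n\<^esub> c) = r \<odot>\<^bsub>deg E.E n\<^esub> map_cochain W h f n c" if r: "r \<in> carrier R" for r
    proof (rule E.E_eqI[OF closed[OF D.E_smult_closed[OF r c]] E.E_smult_closed[OF r closed[OF c]]])
      fix xs assume xs: "xs \<in> W"
      show "map_cochain W h f n (r \<odot>\<^bsub>deg D.E n\<^esub> c) xs = (r \<odot>\<^bsub>deg E.E n\<^esub> map_cochain W h f n c) xs"
        unfolding E.E_apply[OF xs] ap[OF xs] D.E_apply[OF h[OF xs]] using linear_mapsD(3)[OF fl r ch[OF xs]] by simp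
    qed
    show "map_cochain W h f (n + 1) (dif D.E n c) = dif E.E n (map_cochain W h f n c)"
    proof (rule E.E_eqI[OF closed[OF D.E_dif_closed[OF c]] E.E_dif_closed[OF closed[OF c]]])
      fix xs assume xs: "xs \<in> W"
      have g: "graded D (n + 1) (\<lambda>ys. c (map h ys)) xs"
        using D.E_closed[OF c h] E.sub[OF xs] by (simp add: graded_def)
      have "cobd E (n + 1) (map_cochain W h f n c) xs = cobd E (n + 1) (\<lambda>ys. f (n + 1 - int (length ys)) (c (map h ys))) xs"
        by (rule cobd_cong) (simp add: ap E.sub[OF xs])
      also have "\<dots> = f (n + 1 + 1 - int (length xs)) (cobd D (n + 1) c (map h xs))"
        unfolding cobd_map[OF D.complex E.complex fc g] cobd_map_list ..
      finally show "map_cochain W h f (n + 1) (dif D.E n c) xs = dif E.E n (map_cochain W h f n c) xs"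
        unfolding E.E_apply[OF xs] ap[OF xs] D.E_apply[OF h[OF xs]] ..
    qed
  next
    fix n m c c' assume c: "c \<in> carrier (deg D.E n)" and c': "c' \<in> carrier (deg D.E m)"
    show "map_cochain W h f (n + m) (dmul D.E n m c c') = dmul E.E n m (map_cochain W h f n c) (map_cochain W h f m c')"
    proof (rule E.E_eqI[OF closed[OF D.E_mul_closed[OF c c']] E.E_mul_closed[OF closed[OF c] closed[OF c']]])
      fix xs assume xs: "xs \<in> W"
      have e: "n + m + 1 = n + 1 + m" by simp
      have g: "graded D (n + 1) (\<lambda>ys. c (map h ys)) xs" "graded D (m + 1) (\<lambda>ys. c' (map h ys)) xs"
        using D.E_closed[OF c h] D.E_closed[OF c' h] E.sub[OF xs] by (simp_all add: graded_def)
      have "cup E (n + 1) m (map_cochain W h f n c) (map_cochain W h f m c') xs =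
          cup E (n + 1) m (\<lambda>ys. f (n + 1 - int (length ys)) (c (map h ys))) (\<lambda>ys. f (m + 1 - int (length ys)) (c' (map h ys))) xs"
        by (rule cup_cong) (simp_all add: ap E.sub[OF xs])
      also have "\<dots> = f (n + 1 + m - int (length xs)) (cup D (n + 1) m c c' (map h xs))"
        unfolding cup_map[OF D.dg E.dg f g] cup_map_list ..
      finally show "map_cochain W h f (n + m) (dmul D.E n m c c') xs = dmul E.E n m (map_cochain W h f n c) (map_cochain W h f m c') xs"
        unfolding E.E_apply[OF xs] ap[OF xs] D.E_apply[OF h[OF xs]] e ..
    qed
  next
    show "map_cochain W h f 0 (dunit D.E) = dunit E.E"
      by (rule E.E_eqI[OF closed[OF D.E_unit] E.E_unit])
        (simp add: ap E.E_apply D.E_apply h dga_mapsD(3)[OF f] f_zero)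
  qed
qed

section \<open>The simplicial algebra of cochains on the standard simplices\<close>

text \<open>A simplex of the standard simplex of dimension \<open>p\<close> is given by the sorted list of its vertices.\<close>

definition vertex_lists :: "nat \<Rightarrow> nat list set" where
  "vertex_lists p = {xs. sorted xs \<and> set xs \<subseteq> {..p}}"

definition cochain_sdga :: "('r, 'a) sdga \<Rightarrow> ('r, nat list \<Rightarrow> 'a) sdga" where
  "cochain_sdga A =
     \<lparr> level = (\<lambda>p. cochain_dga (level A p) (vertex_lists p)),
       sact = (\<lambda>m n \<theta>. map_cochain (vertex_lists m) \<theta> (sact A m n \<theta>)) \<rparr>"

definition constant_sdga :: "('r, 'k) ring_scheme \<Rightarrow> ('r, 'r) sdga" where
  "constant_sdga R =
     \<lparr> level = (\<lambda>p. \<lparr> deg = deg (unit_complex R), dif = dif (unit_complex R),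
         dmul = (\<lambda>p q. mult R), dunit = \<one>\<^bsub>R\<^esub> \<rparr>),
       sact = (\<lambda>m n \<theta> q x. x) \<rparr>"

lemma subseq_set: "subseq ys xs \<Longrightarrow> set ys \<subseteq> set xs"
  by (induction rule: list_emb.induct) auto

lemma sorted_subseq: "subseq ys xs \<Longrightarrow> sorted xs \<Longrightarrow> sorted (ys :: 'a :: linorder list)"
proof (induction rule: list_emb.induct)
  case (list_emb_Cons2 x y xs ys)
  then show ?case using subseq_set[OF list_emb_Cons2(2)] by auto
qed simp_all

lemma vertex_lists_subseq: "xs \<in> vertex_lists p \<Longrightarrow> subseq ys xs \<Longrightarrow> ys \<in> vertex_lists p"
  using sorted_subseq subseq_set unfolding vertex_lists_def by blast

lemma vertex_lists_map:
  assumes "\<theta> \<in> simplex_hom m n" "xs \<in> vertex_lists m"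
  shows "map \<theta> xs \<in> vertex_lists n"
proof -
  have "sorted (map \<theta> xs)"
    unfolding sorted_map
  proof (rule sorted_wrt_mono_rel[of xs "(\<le>)"])
    show "\<theta> x \<le> \<theta> y" if "x \<in> set xs" "y \<in> set xs" "x \<le> y" for x y
      using that assms(2) by (intro simplex_hom_mono[OF assms(1)]) (auto simp: vertex_lists_def)
  qed (use assms(2) in \<open>simp add: vertex_lists_def\<close>)
  moreover have "set xs \<subseteq> {..m}" using assms(2) by (simp add: vertex_lists_def)
  then have "set (map \<theta> xs) \<subseteq> {..n}" by (auto intro: simplex_hom_le[OF assms(1)])
  ultimately show ?thesis unfolding vertex_lists_def by blast
qed

lemma list_cochains_vertex:
  assumes "dg_algebra R D"
  shows "list_cochains R D (vertex_lists p)"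
proof (intro list_cochains.intro dg_algI assms list_cochains_axioms.intro)
  show "[] \<in> vertex_lists p" by (simp add: vertex_lists_def)
  show "ys \<in> vertex_lists p" if "xs \<in> vertex_lists p" "subseq ys xs" for xs ys
    using that by (rule vertex_lists_subseq)
qed

lemma map_compose_vertices:
  "xs \<in> vertex_lists k \<Longrightarrow> map (compose {..k} \<theta> \<phi>) xs = map \<theta> (map \<phi> xs)"
  by (auto simp: vertex_lists_def compose_def)

context simplicial_dg_alg
begin

sublocale L: list_cochains R "level A p" "vertex_lists p" for p
  by (rule list_cochains_vertex[OF dga.dg])

lemma cochain_sdga: "simplicial_dga R (cochain_sdga A)"
  unfolding simplicial_dga_def cochain_sdga_def sdga.simps
proof (intro conjI allI ballI L.E_dga)
  fix m n \<theta> assume "\<theta> \<in> simplex_hom m n"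
  then show "map_cochain (vertex_lists m) \<theta> (sact A m n \<theta>) \<in> dga_maps R (L.E n) (L.E m)"
    by (intro map_cochain_dga L.list_cochains_axioms sact_dga vertex_lists_map)
next
  fix n q c assume c: "c \<in> carrier (deg (L.E n) q)"
  have "map (\<lambda>j\<in>{..n}. j) xs = xs" if "xs \<in> vertex_lists n" for xs
    using that by (intro map_idI) (auto simp: vertex_lists_def)
  then have "map_cochain (vertex_lists n) (\<lambda>j\<in>{..n}. j) (sact A n n (\<lambda>j\<in>{..n}. j)) q c xs = c xs"
    if "xs \<in> vertex_lists n" for xs
    using that L.E_closed[OF c that] by (simp add: map_cochain_def sact_id)
  moreover have "map_cochain (vertex_lists n) (\<lambda>j\<in>{..n}. j) (sact A n n (\<lambda>j\<in>{..n}. j)) q c \<in> extensional (vertex_lists n)"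
    by (simp add: map_cochain_def)
  ultimately show "map_cochain (vertex_lists n) (\<lambda>j\<in>{..n}. j) (sact A n n (\<lambda>j\<in>{..n}. j)) q c = c"
    using c by (intro extensionalityI[of _ "vertex_lists n"]) (auto simp: L.E_carrier)
next
  fix k m n q \<phi> \<theta> c
  assume \<phi>: "\<phi> \<in> simplex_hom k m" and \<theta>: "\<theta> \<in> simplex_hom m n" and c: "c \<in> carrier (deg (L.E n) q)"
  show "map_cochain (vertex_lists k) \<phi> (sact A k m \<phi>) q (map_cochain (vertex_lists m) \<theta> (sact A m n \<theta>) q c) =
      map_cochain (vertex_lists k) (compose {..k} \<theta> \<phi>) (sact A k n (compose {..k} \<theta> \<phi>)) q c"
    unfolding map_cochain_def
  proof (rule restrict_ext)
    fix xs assume xs: "xs \<in> vertex_lists k"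
    note V = vertex_lists_map[OF \<phi> xs]
    have "c (map \<theta> (map \<phi> xs)) \<in> carrier (M n (q + 1 - int (length xs)))"
      using L.E_closed[OF c vertex_lists_map[OF \<theta> V]] by simp
    from sact_sact[OF \<phi> \<theta> this]
    show "sact A k m \<phi> (q + 1 - int (length xs)) ((\<lambda>xs\<in>vertex_lists m. sact A m n \<theta> (q + 1 - int (length xs)) (c (map \<theta> xs))) (map \<phi> xs))
        = sact A k n (compose {..k} \<theta> \<phi>) (q + 1 - int (length xs)) (c (map (compose {..k} \<theta> \<phi>) xs))"
      unfolding map_compose_vertices[OF xs] using V by simp
  qed
qed

lemma constant_sdga_map: "sdga_map R A (cochain_sdga A) (\<lambda>n. constant_cochain (level A n) (vertex_lists n))"
proof -
  interpret C: simplicial_dg_alg R "cochain_sdga A" by unfold_locales (rule cochain_sdga)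
  show ?thesis
  proof
    show "constant_cochain (level A n) (vertex_lists n) \<in> dga_maps R (level A n) (level (cochain_sdga A) n)" for n
      using L.\<iota>_dga by (simp add: cochain_sdga_def)
    fix \<theta> m n x q assume \<theta>: "\<theta> \<in> simplex_hom m n" and x: "x \<in> carrier (M n q)"
    show "constant_cochain (level A m) (vertex_lists m) q (sact A m n \<theta> q x) =
        sact (cochain_sdga A) m n \<theta> q (constant_cochain (level A n) (vertex_lists n) q x)"
      unfolding constant_cochain_def cochain_sdga_def map_cochain_def sdga.simps
      by (rule restrict_ext) (use vertex_lists_map[OF \<theta>] in \<open>auto simp: sact_zero[OF \<theta>]\<close>)
  qed
qed

lemma constant_quis: "quis (level A p) (level (cochain_sdga A) p) (constant_cochain (level A p) (vertex_lists p))"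
  using L.\<iota>_quis[of p 0] by (simp add: cochain_sdga_def vertex_lists_def)

end

context sdga_map
begin

lemma cochain_map: "sdga_map R (cochain_sdga A) (cochain_sdga B) (\<lambda>n. map_cochain (vertex_lists n) id (f n))"
proof -
  interpret CA: simplicial_dg_alg R "cochain_sdga A" by unfold_locales (rule A.cochain_sdga)
  interpret CB: simplicial_dg_alg R "cochain_sdga B" by unfold_locales (rule B.cochain_sdga)
  show ?thesis
  proof
    show "map_cochain (vertex_lists n) id (f n) \<in> dga_maps R (level (cochain_sdga A) n) (level (cochain_sdga B) n)" for n
      using map_cochain_dga[OF A.L.list_cochains_axioms[of n] B.L.list_cochains_axioms[of n] f_dga[of n], of id] by (simp add: cochain_sdga_def)
    fix \<theta> m n c q assume \<theta>: "\<theta> \<in> simplex_hom m n" and c: "c \<in> carrier (deg (level (cochain_sdga A) n) q)"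
    show "map_cochain (vertex_lists m) id (f m) q (sact (cochain_sdga A) m n \<theta> q c) =
        sact (cochain_sdga B) m n \<theta> q (map_cochain (vertex_lists n) id (f n) q c)"
      unfolding cochain_sdga_def map_cochain_def sdga.simps
    proof (rule restrict_ext)
      fix xs assume xs: "xs \<in> vertex_lists m"
      note V = vertex_lists_map[OF \<theta> xs]
      have "c (map \<theta> xs) \<in> carrier (deg (level A n) (q + 1 - int (length xs)))"
        using A.L.E_closed[of c n q "map \<theta> xs"] c V by (simp add: cochain_sdga_def)
      from f_sact[OF \<theta> this]
      show "f m (q + 1 - int (length xs)) ((\<lambda>xs\<in>vertex_lists m. sact A m n \<theta> (q + 1 - int (length xs)) (c (map \<theta> xs))) (map id xs))
          = sact B m n \<theta> (q + 1 - int (length xs)) ((\<lambda>xs\<in>vertex_lists n. f n (q + 1 - int (length xs)) (c (map id xs))) (map \<theta> xs))"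
        using xs V by simp
    qed
  qed
qed

lemma cochain_map_quis:
  assumes "\<And>n. quis (level A n) (level B n) (f n)"
  shows "quis (level (cochain_sdga A) n) (level (cochain_sdga B) n) (map_cochain (vertex_lists n) id (f n))"
proof -
  interpret IA: sdga_map R A "cochain_sdga A" "\<lambda>n. constant_cochain (level A n) (vertex_lists n)" by (rule A.constant_sdga_map)
  interpret IB: sdga_map R B "cochain_sdga B" "\<lambda>n. constant_cochain (level B n) (vertex_lists n)" by (rule B.constant_sdga_map)
  interpret C: sdga_map R "cochain_sdga A" "cochain_sdga B" "\<lambda>n. map_cochain (vertex_lists n) id (f n)" by (rule cochain_map)
  have square: "(\<lambda>q x. map_cochain (vertex_lists n) id (f n) q (constant_cochain (level A n) (vertex_lists n) q x))
      = (\<lambda>q x. constant_cochain (level B n) (vertex_lists n) q (f n q x))"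
    by (auto simp: fun_eq_iff map_cochain_def constant_cochain_def f_zero)
  have "quis (level A n) (level (cochain_sdga B) n) (\<lambda>q x. constant_cochain (level B n) (vertex_lists n) q (f n q x))"
    by (rule quis_comp[OF A.dga.complex B.dga.complex IB.B.dga.complex f_cochain IB.f_cochain assms B.constant_quis])
  then show ?thesis
    by (intro quis_cancel[OF A.dga.complex IA.B.dga.complex IB.B.dga.complex IA.f_cochain C.f_cochain A.constant_quis])
      (simp add: square)
qed

end

section \<open>The constant simplicial algebra\<close>

lemma homotopy_equivalence_quis:
  assumes C: "cochain_complex R C" and D: "cochain_complex R D" and e: "homotopy_equivalence R C D f"
  shows "quis C D f"
proof -
  interpret C: cocomplex R C by unfold_locales fact
  interpret D: cocomplex R D by unfold_locales fact
  obtain g h k where f: "f \<in> cochain_maps R C D" and g: "g \<in> cochain_maps R D C"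
    and h: "\<And>q. h q \<in> linear_maps R (deg C q) (deg C (q - 1))"
    and k: "\<And>q. k q \<in> linear_maps R (deg D q) (deg D (q - 1))"
    and gf: "\<And>q x. x \<in> carrier (deg C q) \<Longrightarrow>
      g q (f q x) \<ominus>\<^bsub>deg C q\<^esub> x = dif C (q - 1) (h q x) \<oplus>\<^bsub>deg C q\<^esub> h (q + 1) (dif C q x)"
    and fg: "\<And>q y. y \<in> carrier (deg D q) \<Longrightarrow>
      f q (g q y) \<ominus>\<^bsub>deg D q\<^esub> y = dif D (q - 1) (k q y) \<oplus>\<^bsub>deg D q\<^esub> k (q + 1) (dif D q y)"
    using e unfolding homotopy_equivalence_def by blast
  have hz: "h (q + 1) \<zero>\<^bsub>deg C (q + 1)\<^esub> = \<zero>\<^bsub>deg C q\<^esub>" for q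
    using linear_zero[OF C.module_deg C.module_deg h[of "q + 1"]] by simp
  have kz: "k (q + 1) \<zero>\<^bsub>deg D (q + 1)\<^esub> = \<zero>\<^bsub>deg D q\<^esub>" for q
    using linear_zero[OF D.module_deg D.module_deg k[of "q + 1"]] by simp
  show ?thesis
  proof (rule quisI)
    fix q x assume x: "x \<in> cocycles C q" and fx: "f q x \<in> coboundaries D q"
    then have xc: "x \<in> carrier (deg C q)" and dx: "dif C q x = \<zero>\<^bsub>deg C (q + 1)\<^esub>" by (auto simp: cocycles_def)
    have dh: "dif C (q - 1) (h q x) \<in> coboundaries C q"
      using linear_mapsD(1)[OF h xc] by (simp add: coboundaries_def)
    have gfx: "g q (f q x) \<in> coboundaries C q" by (rule cochain_maps_coboundaries[OF g fx])
    have "g q (f q x) \<ominus>\<^bsub>deg C q\<^esub> x = dif C (q - 1) (h q x)"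
      using gf[OF xc] C.coboundaries_closed[OF dh] unfolding dx hz by simp
    then have "x = g q (f q x) \<oplus>\<^bsub>deg C q\<^esub> \<ominus>\<^bsub>deg C q\<^esub> dif C (q - 1) (h q x)"
      using xc C.coboundaries_closed[OF gfx]
      by (metis (no_types, opaque_lifting) a_minus_def C.group.minus_add C.group.minus_minus C.group.a_inv_closed C.group.r_neg2)
    then show "x \<in> coboundaries C q" using C.coboundaries_add[OF gfx C.coboundaries_minus[OF dh]] by simp
  next
    fix q y assume y: "y \<in> cocycles D q"
    then have yc: "y \<in> carrier (deg D q)" and dy: "dif D q y = \<zero>\<^bsub>deg D (q + 1)\<^esub>" by (auto simp: cocycles_def)
    have dk: "dif D (q - 1) (k q y) \<in> coboundaries D q"
      using linear_mapsD(1)[OF k yc] by (simp add: coboundaries_def)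
    have gy: "g q y \<in> cocycles C q" by (rule cochain_maps_cocycles[OF D C g y])
    have fgy: "f q (g q y) \<in> carrier (deg D q)"
      using cochain_maps_cocycles[OF C D f gy] by (rule D.cocycles_closed)
    have "f q (g q y) \<ominus>\<^bsub>deg D q\<^esub> y = dif D (q - 1) (k q y)"
      using fg[OF yc] D.coboundaries_closed[OF dk] unfolding dy kz by simp
    then have "y = f q (g q y) \<oplus>\<^bsub>deg D q\<^esub> \<ominus>\<^bsub>deg D q\<^esub> dif D (q - 1) (k q y)"
      using yc fgy
      by (metis (no_types, opaque_lifting) a_minus_def D.group.minus_add D.group.minus_minus D.group.a_inv_closed D.group.r_neg2)
    then show "\<exists>x\<in>cocycles C q. \<exists>b\<in>coboundaries D q. y = f q x \<oplus>\<^bsub>deg D q\<^esub> b"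
      using gy D.coboundaries_minus[OF dk] by blast
  qed
qed

lemma unit_complex_simps:
  "\<zero>\<^bsub>deg (unit_complex R) q\<^esub> = \<zero>\<^bsub>R\<^esub>" "x \<oplus>\<^bsub>deg (unit_complex R) q\<^esub> y = x \<oplus>\<^bsub>R\<^esub> y"
  "r \<odot>\<^bsub>deg (unit_complex R) q\<^esub> x = r \<otimes>\<^bsub>R\<^esub> x" "dif (unit_complex R) q x = \<zero>\<^bsub>R\<^esub>"
  "carrier (deg (unit_complex R) q) = (if q = 0 then carrier R else {\<zero>\<^bsub>R\<^esub>})"
  by (simp_all add: unit_complex_def ring_module_def)

lemma ring_module_module: "cring R \<Longrightarrow> module R (ring_module R)"
proof -
  assume "cring R"
  then interpret cring R .
  have "abelian_group (ring_module R)"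
  proof (rule abelian_groupI)
    fix x assume "x \<in> carrier (ring_module R)"
    then show "\<exists>y\<in>carrier (ring_module R). y \<oplus>\<^bsub>ring_module R\<^esub> x = \<zero>\<^bsub>ring_module R\<^esub>"
      by (intro bexI[of _ "\<ominus>\<^bsub>R\<^esub> x"]) (auto simp: ring_module_def l_neg)
  qed (auto simp: ring_module_def a_ac)
  then show ?thesis
    by (intro moduleI) (auto simp: ring_module_def l_distr r_distr m_assoc \<open>cring R\<close>)
qed

lemma unit_complex_module: "cring R \<Longrightarrow> module R (deg (unit_complex R) q)"
proof -
  assume R: "cring R"
  then interpret cring R .
  show ?thesis
    by (rule moduleI_jointly_injective[where I = "{()}" and M = "\<lambda>_. ring_module R" and ev = "\<lambda>_ x. x"])
      (auto simp: R ring_module_module[OF R, unfolded ring_module_def] unit_complex_simps ring_module_def split: if_splits)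
qed

context cring
begin

lemma unit_carrier: "x \<in> carrier (deg (unit_complex R) q) \<Longrightarrow> x \<in> carrier R"
  by (auto simp: unit_complex_simps split: if_splits)

lemma unit_signed: "x \<in> carrier (deg (unit_complex R) q) \<Longrightarrow> signed (deg (unit_complex R) q) k x = signed R k x"
  using additive_minus[OF module_abelian_group[OF unit_complex_module[OF is_cring, of q]] abelian_group_axioms,
      where f = "\<lambda>x. x" and x = x] unit_carrier by (auto simp: signed_def unit_complex_simps)

lemma constant_dga: "dg_algebra R (level (constant_sdga R) p)"
proof -
  let ?D = "level (constant_sdga R) p"
  have D: "deg ?D = deg (unit_complex R)" "dif ?D = dif (unit_complex R)" "dmul ?D p q = mult R" "dunit ?D = \<one>" for p q
    by (simp_all add: constant_sdga_def)
  have complex: "cochain_complex R ?D"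
    unfolding cochain_complex_def D
    by (intro conjI allI ballI unit_complex_module is_cring linear_mapsI) (auto simp: unit_complex_simps)
  have mul: "x \<otimes> y \<in> carrier (deg (unit_complex R) (p + q))"
    if "x \<in> carrier (deg (unit_complex R) p)" "y \<in> carrier (deg (unit_complex R) q)" for p q x y
    using that by (auto simp: unit_complex_simps split: if_splits)
  have "dmul ?D \<in> tensor_cochain_maps R ?D ?D ?D"
  proof (intro tensor_cochain_mapsI linear_mapsI; unfold D)
    fix p q x y assume "x \<in> carrier (deg (unit_complex R) p)" "y \<in> carrier (deg (unit_complex R) q)"
    note xy = this unit_carrier[OF this(1)] unit_carrier[OF this(2)]
    show 1: "x \<otimes> y \<in> carrier (deg (unit_complex R) (p + q))" by (rule mul[OF xy(1,2)])
    show "x \<otimes> y \<in> carrier (deg (unit_complex R) (p + q))" by (rule 1)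
    show "x \<otimes> (y \<oplus>\<^bsub>deg (unit_complex R) q\<^esub> z) = x \<otimes> y \<oplus>\<^bsub>deg (unit_complex R) (p + q)\<^esub> x \<otimes> z"
      if "z \<in> carrier (deg (unit_complex R) q)" for z
      using xy unit_carrier[OF that] by (simp add: unit_complex_simps r_distr)
    show "(x \<oplus>\<^bsub>deg (unit_complex R) p\<^esub> z) \<otimes> y = x \<otimes> y \<oplus>\<^bsub>deg (unit_complex R) (p + q)\<^esub> z \<otimes> y"
      if "z \<in> carrier (deg (unit_complex R) p)" for z
      using xy unit_carrier[OF that] by (simp add: unit_complex_simps l_distr)
    show "x \<otimes> (r \<odot>\<^bsub>deg (unit_complex R) q\<^esub> y) = r \<odot>\<^bsub>deg (unit_complex R) (p + q)\<^esub> (x \<otimes> y)"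
      if "r \<in> carrier R" for r
      using xy that by (simp add: unit_complex_simps m_lcomm)
    show "(r \<odot>\<^bsub>deg (unit_complex R) p\<^esub> x) \<otimes> y = r \<odot>\<^bsub>deg (unit_complex R) (p + q)\<^esub> (x \<otimes> y)"
      if "r \<in> carrier R" for r
      using xy that by (simp add: unit_complex_simps m_assoc)
    have "\<zero> \<in> carrier (deg (unit_complex R) (p + q + 1))" by (simp add: unit_complex_simps)
    from unit_signed[OF this, of p]
    show "dif (unit_complex R) (p + q) (x \<otimes> y) = dif (unit_complex R) p x \<otimes> y \<oplus>\<^bsub>deg (unit_complex R) (p + q + 1)\<^esub>
        signed (deg (unit_complex R) (p + q + 1)) p (x \<otimes> dif (unit_complex R) q y)"
      using xy by (simp add: unit_complex_simps signed_zero)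
  qed
  then show ?thesis
    unfolding dg_algebra_def
    using complex unit_carrier by (auto simp: D unit_complex_simps m_assoc split: if_splits)
qed

lemma constant_sdga: "simplicial_dga R (constant_sdga R)"
proof -
  have "sact (constant_sdga R) m n \<theta> \<in> dga_maps R (level (constant_sdga R) n) (level (constant_sdga R) m)" for m n \<theta>
    by (auto simp: constant_sdga_def dga_maps_def intro!: cochain_mapsI linear_mapsI)
  then show ?thesis
    unfolding simplicial_dga_def using constant_dga by (auto simp: constant_sdga_def)
qed

lemma constant_unit_path:
  "unit_path (cochain_sdga (constant_sdga R)) (\<lambda>xs\<in>vertex_lists 1. if xs = [0] then \<one> else \<zero>)"
proof -
  interpret S: simplicial_dg_alg R "constant_sdga R" by unfold_locales (rule constant_sdga)
  let ?D = "\<lambda>p. level (constant_sdga R) p"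
  have D: "deg (?D p) = deg (unit_complex R)" "dunit (?D p) = \<one>" for p
    by (simp_all add: constant_sdga_def)
  have L: "level (cochain_sdga (constant_sdga R)) p = S.L.E p" for p
    by (simp add: cochain_sdga_def)
  have a: "sact (cochain_sdga (constant_sdga R)) 0 1 \<theta> 0 c = (\<lambda>xs\<in>vertex_lists 0. c (map \<theta> xs))" for \<theta> c
    by (simp add: cochain_sdga_def map_cochain_def constant_sdga_def)
  have V0: "xs = replicate (length xs) 0" if "xs \<in> vertex_lists 0" for xs
    using that by (intro replicate_eqI[symmetric, THEN sym]) (auto simp: vertex_lists_def)
  have V1: "map (\<lambda>j\<in>{0}. c) xs = replicate (length xs) c" if "xs \<in> vertex_lists 0" for xs and c :: nat
    by (subst V0[OF that]) simp
  have V2: "replicate n c \<in> vertex_lists 1" if "c \<le> 1" for n c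
    using that by (auto simp: vertex_lists_def)
  have r: "replicate n c = [0] \<longleftrightarrow> n = 1 \<and> c = 0" for n and c :: nat
    by (cases n) (auto simp: replicate_empty)
  show ?thesis
    unfolding unit_path_def a
  proof (intro conjI)
    show "(\<lambda>xs\<in>vertex_lists 1. if xs = [0] then \<one> else \<zero>) \<in> carrier (deg (level (cochain_sdga (constant_sdga R)) 1) 0)"
      unfolding L by (rule S.L.E_carrierI) (auto simp: D unit_complex_simps)
    show "(\<lambda>xs\<in>vertex_lists 0. (\<lambda>xs\<in>vertex_lists 1. if xs = [0] then \<one> else \<zero>) (map (\<lambda>j\<in>{..0}. 1) xs))
        = \<zero>\<^bsub>deg (level (cochain_sdga (constant_sdga R)) 0) 0\<^esub>"
    proof (rule S.L.E_eqI[of _ 0 0, folded L])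
      show "(\<lambda>xs\<in>vertex_lists 0. (\<lambda>xs\<in>vertex_lists 1. if xs = [0] then \<one> else \<zero>) (map (\<lambda>j\<in>{..0}. 1) xs))
          \<in> carrier (deg (level (cochain_sdga (constant_sdga R)) 0) 0)"
        unfolding L by (rule S.L.E_carrierI) (use V2[of 1] in \<open>auto simp: D unit_complex_simps V1 r S.L.nil\<close>)
    qed (use V2[of 1] in \<open>auto simp: L S.L.E_zero_closed S.L.E_apply D unit_complex_simps V1 r\<close>)
    show "(\<lambda>xs\<in>vertex_lists 0. (\<lambda>xs\<in>vertex_lists 1. if xs = [0] then \<one> else \<zero>) (map (\<lambda>j\<in>{..0}. 0) xs))
        = dunit (level (cochain_sdga (constant_sdga R)) 0)"
    proof (rule S.L.E_eqI[of _ 0 0, folded L])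
      show "(\<lambda>xs\<in>vertex_lists 0. (\<lambda>xs\<in>vertex_lists 1. if xs = [0] then \<one> else \<zero>) (map (\<lambda>j\<in>{..0}. 0) xs))
          \<in> carrier (deg (level (cochain_sdga (constant_sdga R)) 0) 0)"
        unfolding L by (rule S.L.E_carrierI) (use V2[of 0] in \<open>auto simp: D unit_complex_simps V1 r S.L.nil\<close>)
    qed (use V2[of 0] in \<open>auto simp: L S.L.E_unit S.L.E_apply D unit_complex_simps V1 r\<close>)
  qed
qed

end

context simplicial_dg_alg
begin

lemma unit_sdga_map: "sdga_map R (constant_sdga R) A (\<lambda>n. unit_map (level A n))"
proof -
  have R: "cring R" using dga.module_deg by (simp add: module_def)
  interpret S: simplicial_dg_alg R "constant_sdga R" by unfold_locales (rule cring.constant_sdga[OF R])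
  have D: "deg (level (constant_sdga R) p) = deg (unit_complex R)" "dif (level (constant_sdga R) p) = dif (unit_complex R)"
    "dmul (level (constant_sdga R) p) i j = mult R" "dunit (level (constant_sdga R) p) = \<one>\<^bsub>R\<^esub>"
    "sact (constant_sdga R) m n \<theta> q x = x" for p i j m n \<theta> q x
    by (simp_all add: constant_sdga_def)
  note simps = D unit_complex_simps unit_map_def dga.one_closed
  show ?thesis
  proof
    fix n
    show "unit_map (level A n) \<in> dga_maps R (level (constant_sdga R) n) (level A n)"
      unfolding dga_maps_def
    proof (intro CollectI conjI allI ballI cochain_mapsI linear_mapsI)
      fix q x assume x: "x \<in> carrier (deg (level (constant_sdga R) n) q)"
      have xR: "x \<in> carrier R" using cring.unit_carrier[OF R] x by (simp add: D)
      show "unit_map (level A n) q x \<in> carrier (M n q)" by (rule unit_map_closed[OF xR])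
      show "unit_map (level A n) q (x \<oplus>\<^bsub>deg (level (constant_sdga R) n) q\<^esub> y) = unit_map (level A n) q x \<oplus>\<^bsub>M n q\<^esub> unit_map (level A n) q y"
        if y: "y \<in> carrier (deg (level (constant_sdga R) n) q)" for y
        using x y by (auto simp: simps dga.mod.smult_l_distr)
      show "unit_map (level A n) q (r \<odot>\<^bsub>deg (level (constant_sdga R) n) q\<^esub> x) = r \<odot>\<^bsub>M n q\<^esub> unit_map (level A n) q x"
        if r: "r \<in> carrier R" for r
        using x r dga.mod.smult_r_null by (auto simp: simps dga.mod.smult_assoc1)
      show "unit_map (level A n) (q + 1) (dif (level (constant_sdga R) n) q x) = dif (level A n) q (unit_map (level A n) q x)"
        using xR dga.d_smult[OF xR dga.one_closed, of n] dga.d_one dga.d_zero dga.mod.smult_r_null by (auto simp: simps)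
      fix p y assume y: "y \<in> carrier (deg (level (constant_sdga R) n) p)"
      show "unit_map (level A n) (q + p) (dmul (level (constant_sdga R) n) q p x y) =
          dmul (level A n) q p (unit_map (level A n) q x) (unit_map (level A n) p y)"
      proof (cases "q = 0 \<and> p = 0")
        case True
        then have "x \<in> carrier R" "y \<in> carrier R" using x y by (auto simp: simps)
        moreover from this have "x \<odot>\<^bsub>M n 0\<^esub> (y \<odot>\<^bsub>M n 0\<^esub> dunit (level A n)) = y \<odot>\<^bsub>M n 0\<^esub> (x \<odot>\<^bsub>M n 0\<^esub> dunit (level A n))"
          by (simp add: dga.mod.smult_assoc1[symmetric] dga.one_closed dga.mod.R.m_comm)
        ultimately show ?thesis
          using True by (simp add: simps dga.mod.smult_assoc1 dga.one_mul dga.mod.smult_closed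
            dga.mul_smult_left dga.mul_smult_right)
      next
        case False
        have yR: "y \<in> carrier R" using cring.unit_carrier[OF R] y by (simp add: D)
        have "x \<otimes>\<^bsub>R\<^esub> y = \<zero>\<^bsub>R\<^esub>" using False x y by (auto simp: simps split: if_splits)
        moreover have "unit_map (level A n) (q + p) \<zero>\<^bsub>R\<^esub> = \<zero>\<^bsub>M n (q + p)\<^esub>"
          by (simp add: unit_map_def dga.one_closed)
        moreover have "unit_map (level A n) q x = \<zero>\<^bsub>M n q\<^esub> \<or> unit_map (level A n) p y = \<zero>\<^bsub>M n p\<^esub>"
          using False by (auto simp: unit_map_def)
        ultimately show ?thesis
          using dga.mul_zero_left[OF unit_map_closed[OF yR]] dga.mul_zero_right[OF unit_map_closed[OF xR]]
          by (auto simp: D)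
      qed
    qed (simp add: simps)
  qed (auto simp: unit_map_def D sact_zero sact_smult sact_one dga.one_closed dest: cring.unit_carrier[OF R])
qed

lemma unit_quis:
  assumes "homology_axiom R A"
  shows "quis (level (constant_sdga R) n) (level A n) (unit_map (level A n))"
proof -
  interpret U: sdga_map R "constant_sdga R" A "\<lambda>n. unit_map (level A n)" by (rule unit_sdga_map)
  have "homotopy_equivalence R (unit_complex R) (level A n) (unit_map (level A n))"
    using assms by (simp add: homology_axiom_def)
  then have "homotopy_equivalence R (level (constant_sdga R) n) (level A n) (unit_map (level A n))"
    by (simp add: homotopy_equivalence_def cochain_maps_def constant_sdga_def)
  then show ?thesis by (rule homotopy_equivalence_quis[OF U.A.dga.complex dga.complex])
qed

end

section \<open>Isomorphisms of monoidal functors\<close>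

lemma monoidal_transformationsD:
  assumes "T \<in> monoidal_transformations R pr F G"
  shows "simplicial_set X \<Longrightarrow> T X \<in> cochain_maps R (fobj F X) (fobj G X)"
    "simplicial_set X \<Longrightarrow> simplicial_set Y \<Longrightarrow> f \<in> simplicial_maps X Y \<Longrightarrow> a \<in> carrier (deg (fobj F Y) q) \<Longrightarrow>
      T X q (fmap F X Y f q a) = fmap G X Y f q (T Y q a)"
    "simplicial_set X \<Longrightarrow> simplicial_set Y \<Longrightarrow> a \<in> carrier (deg (fobj F X) p) \<Longrightarrow> b \<in> carrier (deg (fobj F Y) q) \<Longrightarrow>
      T (sset_prod pr X Y) (p + q) (kappa F X Y p q a b) = kappa G X Y p q (T X p a) (T Y q b)"
    "s \<in> carrier (deg (unit_complex R) q) \<Longrightarrow> T sset_pt q (eta F q s) = eta G q s"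
  using assms unfolding monoidal_transformations_def by blast+

lemma monoidal_transformationsI:
  assumes "\<And>X. simplicial_set X \<Longrightarrow> T X \<in> cochain_maps R (fobj F X) (fobj G X)"
    "\<And>X Y f a q. simplicial_set X \<Longrightarrow> simplicial_set Y \<Longrightarrow> f \<in> simplicial_maps X Y \<Longrightarrow> a \<in> carrier (deg (fobj F Y) q) \<Longrightarrow>
      T X q (fmap F X Y f q a) = fmap G X Y f q (T Y q a)"
    "\<And>X Y a b p q. simplicial_set X \<Longrightarrow> simplicial_set Y \<Longrightarrow> a \<in> carrier (deg (fobj F X) p) \<Longrightarrow> b \<in> carrier (deg (fobj F Y) q) \<Longrightarrow>
      T (sset_prod pr X Y) (p + q) (kappa F X Y p q a b) = kappa G X Y p q (T X p a) (T Y q b)"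
    "\<And>s q. s \<in> carrier (deg (unit_complex R) q) \<Longrightarrow> T sset_pt q (eta F q s) = eta G q s"
  shows "T \<in> monoidal_transformations R pr F G"
  using assms unfolding monoidal_transformations_def by blast

context
  fixes R :: "('r, 'k) ring_scheme" and pr :: "'u \<times> 'u \<Rightarrow> 'u" and F :: "('r, 'u, 'm) mfunctor"
  assumes lax: "lax_monoidal_functor R pr F"
begin

lemma lax_contravariant: "contravariant_functor R F"
  and lax_kappa: "simplicial_set X \<Longrightarrow> simplicial_set Y \<Longrightarrow>
    kappa F X Y \<in> tensor_cochain_maps R (fobj F X) (fobj F Y) (fobj F (sset_prod pr X Y))"
  and lax_eta: "eta F \<in> cochain_maps R (unit_complex R) (fobj F sset_pt)"
  using lax by (simp_all add: lax_monoidal_functor_def)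

lemma lax_complex: "simplicial_set X \<Longrightarrow> cochain_complex R (fobj F X)"
  and lax_bounded: "simplicial_set X \<Longrightarrow> bounded_below (fobj F X)"
  using lax_contravariant by (simp_all add: contravariant_functor_def)

lemma lax_map: "simplicial_set X \<Longrightarrow> simplicial_set Y \<Longrightarrow> f \<in> simplicial_maps X Y \<Longrightarrow>
    fmap F X Y f \<in> cochain_maps R (fobj F Y) (fobj F X)"
  using lax_contravariant unfolding contravariant_functor_def by blast

lemma lax_map_id: "simplicial_set X \<Longrightarrow> a \<in> carrier (deg (fobj F X) q) \<Longrightarrow> fmap F X X (sset_id X) q a = a"
  using lax_contravariant unfolding contravariant_functor_def by blast

lemma lax_map_comp: "simplicial_set X \<Longrightarrow> simplicial_set Y \<Longrightarrow> simplicial_set Z \<Longrightarrow>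
    f \<in> simplicial_maps X Y \<Longrightarrow> g \<in> simplicial_maps Y Z \<Longrightarrow> a \<in> carrier (deg (fobj F Z) q) \<Longrightarrow>
    fmap F X Z (sset_comp X g f) q a = fmap F X Y f q (fmap F Y Z g q a)"
  using lax_contravariant unfolding contravariant_functor_def by blast

lemma lax_kappa_natural:
  "simplicial_set X \<Longrightarrow> simplicial_set X' \<Longrightarrow> simplicial_set Y \<Longrightarrow> simplicial_set Y' \<Longrightarrow>
    f \<in> simplicial_maps X X' \<Longrightarrow> g \<in> simplicial_maps Y Y' \<Longrightarrow>
    a \<in> carrier (deg (fobj F X') p) \<Longrightarrow> b \<in> carrier (deg (fobj F Y') q) \<Longrightarrow>
    fmap F (sset_prod pr X Y) (sset_prod pr X' Y') (sset_prod_map pr X Y f g) (p + q) (kappa F X' Y' p q a b)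
      = kappa F X Y p q (fmap F X X' f p a) (fmap F Y Y' g q b)"
  by (rule lax[unfolded lax_monoidal_functor_def, THEN conjunct2, THEN conjunct2, THEN conjunct1, rule_format])

lemma lax_kappa_assoc:
  "simplicial_set X \<Longrightarrow> simplicial_set Y \<Longrightarrow> simplicial_set Z \<Longrightarrow>
    a \<in> carrier (deg (fobj F X) p) \<Longrightarrow> b \<in> carrier (deg (fobj F Y) q) \<Longrightarrow> c \<in> carrier (deg (fobj F Z) r) \<Longrightarrow>
    kappa F (sset_prod pr X Y) Z (p + q) r (kappa F X Y p q a b) c
      = fmap F (sset_prod pr (sset_prod pr X Y) Z) (sset_prod pr X (sset_prod pr Y Z))
          (sset_assoc pr X Y Z) (p + q + r) (kappa F X (sset_prod pr Y Z) p (q + r) a (kappa F Y Z q r b c))"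
  by (rule lax[unfolded lax_monoidal_functor_def, THEN conjunct2, THEN conjunct2, THEN conjunct2, THEN conjunct2, THEN conjunct1, rule_format])

lemma lax_kappa_unit:
  "simplicial_set X \<Longrightarrow> s \<in> carrier R \<Longrightarrow> a \<in> carrier (deg (fobj F X) q) \<Longrightarrow>
    kappa F sset_pt X 0 q (eta F 0 s) a
      = fmap F (sset_prod pr sset_pt X) X (sset_snd pr sset_pt X) q (s \<odot>\<^bsub>deg (fobj F X) q\<^esub> a)"
  "simplicial_set X \<Longrightarrow> s \<in> carrier R \<Longrightarrow> a \<in> carrier (deg (fobj F X) q) \<Longrightarrow>
    kappa F X sset_pt q 0 a (eta F 0 s)
      = fmap F (sset_prod pr X sset_pt) X (sset_fst pr X sset_pt) q (s \<odot>\<^bsub>deg (fobj F X) q\<^esub> a)"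
  using lax[unfolded lax_monoidal_functor_def, THEN conjunct2, THEN conjunct2, THEN conjunct2, THEN conjunct2, THEN conjunct2, rule_format] by simp_all

lemma lax_map_closed: "simplicial_set X \<Longrightarrow> simplicial_set Y \<Longrightarrow> f \<in> simplicial_maps X Y \<Longrightarrow>
    a \<in> carrier (deg (fobj F Y) q) \<Longrightarrow> fmap F X Y f q a \<in> carrier (deg (fobj F X) q)"
  using linear_mapsD(1)[OF cochain_mapsD(1)[OF lax_map]] by blast

lemma lax_kappa_closed: "simplicial_set X \<Longrightarrow> simplicial_set Y \<Longrightarrow> a \<in> carrier (deg (fobj F X) p) \<Longrightarrow>
    b \<in> carrier (deg (fobj F Y) q) \<Longrightarrow> kappa F X Y p q a b \<in> carrier (deg (fobj F (sset_prod pr X Y)) (p + q))"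
  using linear_mapsD(1)[OF tensor_cochain_mapsD(1)[OF lax_kappa]] by blast

lemma lax_eta_closed: "s \<in> carrier (deg (unit_complex R) q) \<Longrightarrow> eta F q s \<in> carrier (deg (fobj F sset_pt) q)"
  using linear_mapsD(1)[OF cochain_mapsD(1)[OF lax_eta]] by blast

end

lemma quasi_iso_step_trans:
  fixes pr :: "'u \<times> 'u \<Rightarrow> 'u"
  assumes pr: "inj pr" and FG: "quasi_iso_step R pr F G" and GH: "quasi_iso_step R pr G H"
  shows "quasi_iso_step R pr F H"
proof -
  obtain S where S: "S \<in> monoidal_transformations R pr F G"
    "\<And>X. simplicial_set X \<Longrightarrow> quasi_isomorphism R (fobj F X) (fobj G X) (S X)"
    and F: "lax_monoidal_functor R pr F" and G: "lax_monoidal_functor R pr G"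
    using FG unfolding quasi_iso_step_def by blast
  obtain T where T: "T \<in> monoidal_transformations R pr G H"
    "\<And>X. simplicial_set X \<Longrightarrow> quasi_isomorphism R (fobj G X) (fobj H X) (T X)"
    and H: "lax_monoidal_functor R pr H"
    using GH unfolding quasi_iso_step_def by blast
  note S' = monoidal_transformationsD[OF S(1)] and T' = monoidal_transformationsD[OF T(1)]
  have closed: "S X q a \<in> carrier (deg (fobj G X) q)" if "simplicial_set X" "a \<in> carrier (deg (fobj F X) q)" for X q a
    using linear_mapsD(1)[OF cochain_mapsD(1)[OF S'(1)]] that by blast
  define U where "U X q a = T X q (S X q a)" for X q a
  have chain: "U X \<in> cochain_maps R (fobj F X) (fobj H X)" if X: "simplicial_set X" for X
    unfolding U_def
    by (intro cochain_mapsI linear_mapsI)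
      (simp_all add: closed[OF X] linear_mapsD[OF cochain_mapsD(1)[OF S'(1)[OF X]]] cochain_mapsD(2)[OF S'(1)[OF X]]
        linear_mapsD[OF cochain_mapsD(1)[OF T'(1)[OF X]]] cochain_mapsD(2)[OF T'(1)[OF X]])
  have "U \<in> monoidal_transformations R pr F H"
    by (rule monoidal_transformationsI)
      (auto simp: U_def[abs_def] chain[unfolded U_def[abs_def]] S' T' closed lax_eta_closed[OF F])
  moreover have "quasi_isomorphism R (fobj F X) (fobj H X) (U X)" if X: "simplicial_set X" for X
    using quasi_isomorphism_comp[OF lax_complex[OF F X] lax_complex[OF G X] S(2)[OF X] T(2)[OF X]] chain[OF X]
    unfolding U_def[abs_def] .
  ultimately show ?thesis using F H unfolding quasi_iso_step_def by blast
qed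

definition functor_iso ::
  "('r, 'k) ring_scheme \<Rightarrow> ('u \<times> 'u \<Rightarrow> 'u) \<Rightarrow> ('r, 'u, 'm) mfunctor \<Rightarrow> ('r, 'u, 'n) mfunctor
     \<Rightarrow> ('u sset \<Rightarrow> int \<Rightarrow> 'm \<Rightarrow> 'n) \<Rightarrow> bool" where
  "functor_iso R pr F G T \<longleftrightarrow> T \<in> monoidal_transformations R pr F G \<and>
     (\<forall>X q. simplicial_set X \<longrightarrow>
        bij_betw (T X q) (carrier (deg (fobj F X) q)) (carrier (deg (fobj G X) q)) \<and>
        T X q \<zero>\<^bsub>deg (fobj F X) q\<^esub> = \<zero>\<^bsub>deg (fobj G X) q\<^esub>)"

lemma quis_bijective:
  assumes C: "cochain_complex R C" and D: "cochain_complex R D" and f: "f \<in> cochain_maps R C D"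
    and bij: "\<And>q. bij_betw (f q) (carrier (deg C q)) (carrier (deg D q))"
  shows "quis C D f"
proof -
  interpret C: cocomplex R C by unfold_locales fact
  interpret D: cocomplex R D by unfold_locales fact
  note inj = inj_onD[OF bij_betw_imp_inj_on[OF bij]]
  have surj: "\<exists>x\<in>carrier (deg C q). y = f q x" if "y \<in> carrier (deg D q)" for q y
    using that bij_betw_imp_surj_on[OF bij[of q]] by blast
  show ?thesis
  proof (rule quisI)
    fix q x assume x: "x \<in> cocycles C q" and "f q x \<in> coboundaries D q"
    then obtain y where y: "y \<in> carrier (deg D (q - 1))" "f q x = dif D (q - 1) y" by (auto simp: coboundaries_def)
    obtain x' where x': "x' \<in> carrier (deg C (q - 1))" "y = f (q - 1) x'" using surj[OF y(1)] by blast
    have "f q x = f q (dif C (q - 1) x')" using y(2) x' cochain_mapsD(2)[OF f x'(1)] by simp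
    then have "x = dif C (q - 1) x'"
      by (rule inj) (use C.cocycles_closed[OF x] C.d_closed'[OF x'(1)] in auto)
    then show "x \<in> coboundaries C q" using x' by (auto simp: coboundaries_def)
  next
    fix q z assume z: "z \<in> cocycles D q"
    then obtain x where x: "x \<in> carrier (deg C q)" "z = f q x" using surj D.cocycles_closed by blast
    have "f (q + 1) (dif C q x) = f (q + 1) \<zero>\<^bsub>deg C (q + 1)\<^esub>"
      using z cochain_mapsD(2)[OF f x(1)] x linear_zero[OF C.module_deg D.module_deg cochain_mapsD(1)[OF f]]
      by (simp add: cocycles_def)
    then have "dif C q x = \<zero>\<^bsub>deg C (q + 1)\<^esub>" by (rule inj) (use C.d_closed[OF x(1)] in auto)
    then have "x \<in> cocycles C q" using x by (simp add: cocycles_def)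
    moreover have "z = f q x \<oplus>\<^bsub>deg D q\<^esub> \<zero>\<^bsub>deg D q\<^esub>" using x D.cocycles_closed[OF z] by simp
    ultimately show "\<exists>x\<in>cocycles C q. \<exists>b\<in>coboundaries D q. z = f q x \<oplus>\<^bsub>deg D q\<^esub> b"
      using D.coboundaries_zero by blast
  qed
qed

context
  fixes R :: "('r, 'k) ring_scheme" and pr :: "'u \<times> 'u \<Rightarrow> 'u" and F :: "('r, 'u, 'm) mfunctor"
    and G :: "('r, 'u, 'n) mfunctor" and T
  assumes pr: "inj pr" and F: "lax_monoidal_functor R pr F" and iso: "functor_iso R pr F G T"
begin

lemma iso_T: "T \<in> monoidal_transformations R pr F G"
  using iso by (simp add: functor_iso_def)

lemmas T_chain = monoidal_transformationsD(1)[OF iso_T]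
  and T_map = monoidal_transformationsD(2)[OF iso_T]
  and T_kappa = monoidal_transformationsD(3)[OF iso_T]
  and T_eta = monoidal_transformationsD(4)[OF iso_T]

lemma T_bij: "simplicial_set X \<Longrightarrow> bij_betw (T X q) (carrier (deg (fobj F X) q)) (carrier (deg (fobj G X) q))"
  and T_zero: "simplicial_set X \<Longrightarrow> T X q \<zero>\<^bsub>deg (fobj F X) q\<^esub> = \<zero>\<^bsub>deg (fobj G X) q\<^esub>"
  using iso by (simp_all add: functor_iso_def)

lemma T_linear: "simplicial_set X \<Longrightarrow> T X q \<in> linear_maps R (deg (fobj F X) q) (deg (fobj G X) q)"
  using cochain_mapsD(1)[OF T_chain] .

lemmas T_closed = linear_mapsD(1)[OF T_linear]
  and T_add = linear_mapsD(2)[OF T_linear]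
  and T_smult = linear_mapsD(3)[OF T_linear]
  and T_d = cochain_mapsD(2)[OF T_chain]

lemma T_surj: "simplicial_set X \<Longrightarrow> b \<in> carrier (deg (fobj G X) q) \<Longrightarrow> \<exists>a\<in>carrier (deg (fobj F X) q). b = T X q a"
  using bij_betw_imp_surj_on[OF T_bij] by blast

lemma F_module: "simplicial_set X \<Longrightarrow> module R (deg (fobj F X) q)"
  using cocomplex.module_deg[OF cocomplex.intro[OF lax_complex[OF F]]] .

lemma F_d_closed: "simplicial_set X \<Longrightarrow> a \<in> carrier (deg (fobj F X) q) \<Longrightarrow> dif (fobj F X) q a \<in> carrier (deg (fobj F X) (q + 1))"
  using cocomplex.d_closed[OF cocomplex.intro[OF lax_complex[OF F]]] .

lemma F_add_closed: "simplicial_set X \<Longrightarrow> a \<in> carrier (deg (fobj F X) q) \<Longrightarrow> b \<in> carrier (deg (fobj F X) q) \<Longrightarrow>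
    a \<oplus>\<^bsub>deg (fobj F X) q\<^esub> b \<in> carrier (deg (fobj F X) q)"
  using abelian_monoid.a_closed[OF abelian_group.axioms(1)[OF module_abelian_group[OF F_module]]] .

lemma F_smult_closed: "simplicial_set X \<Longrightarrow> r \<in> carrier R \<Longrightarrow> a \<in> carrier (deg (fobj F X) q) \<Longrightarrow>
    r \<odot>\<^bsub>deg (fobj F X) q\<^esub> a \<in> carrier (deg (fobj F X) q)"
  using module.smult_closed[OF F_module] .

lemma G_module:
  assumes X: "simplicial_set X"
  shows "module R (deg (fobj G X) q)"
proof -
  define u where "u = inv_into (carrier (deg (fobj F X) q)) (T X q)"
  have u: "u (T X q a) = a" if "a \<in> carrier (deg (fobj F X) q)" for a
    unfolding u_def using that by (rule inv_into_f_f[OF bij_betw_imp_inj_on[OF T_bij[OF X]]])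
  show ?thesis
  proof (rule moduleI_jointly_injective[where I = "{()}" and M = "\<lambda>_. deg (fobj F X) q" and ev = "\<lambda>_. u"])
    show "cring R" using F_module[OF X] by (simp add: module_def)
    show "\<zero>\<^bsub>deg (fobj G X) q\<^esub> \<in> carrier (deg (fobj G X) q)" "u \<zero>\<^bsub>deg (fobj G X) q\<^esub> = \<zero>\<^bsub>deg (fobj F X) q\<^esub>"
      using T_closed[OF X abelian_monoid.zero_closed[OF abelian_group.axioms(1)[OF module_abelian_group[OF F_module[OF X]]]]]
        u abelian_monoid.zero_closed[OF abelian_group.axioms(1)[OF module_abelian_group[OF F_module[OF X]]]]
      unfolding T_zero[OF X, symmetric] by auto
  next
    fix x y assume "x \<in> carrier (deg (fobj G X) q)" "y \<in> carrier (deg (fobj G X) q)"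
    then obtain a b where ab: "a \<in> carrier (deg (fobj F X) q)" "b \<in> carrier (deg (fobj F X) q)" "x = T X q a" "y = T X q b"
      using T_surj[OF X] by metis
    note s = T_add[OF X ab(1,2), symmetric] F_add_closed[OF X ab(1,2)] u
    show "x \<oplus>\<^bsub>deg (fobj G X) q\<^esub> y \<in> carrier (deg (fobj G X) q)" unfolding ab(3,4) using s T_closed[OF X] by simp
    show "u (x \<oplus>\<^bsub>deg (fobj G X) q\<^esub> y) = u x \<oplus>\<^bsub>deg (fobj F X) q\<^esub> u y" unfolding ab(3,4) using s ab by simp
    show "x = y" if "\<And>i :: unit. i \<in> {()} \<Longrightarrow> u x = u y" using that u ab by auto
    show "u x \<in> carrier (deg (fobj F X) q)" using u ab by simp
  next
    fix r x assume r: "r \<in> carrier R" and "x \<in> carrier (deg (fobj G X) q)"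
    then obtain a where a: "a \<in> carrier (deg (fobj F X) q)" "x = T X q a" using T_surj[OF X] by metis
    note s = T_smult[OF X r a(1), symmetric] F_smult_closed[OF X r a(1)] u
    show "r \<odot>\<^bsub>deg (fobj G X) q\<^esub> x \<in> carrier (deg (fobj G X) q)" unfolding a(2) using s T_closed[OF X] by simp
    show "u (r \<odot>\<^bsub>deg (fobj G X) q\<^esub> x) = r \<odot>\<^bsub>deg (fobj F X) q\<^esub> u x" unfolding a(2) using s a by simp
  qed (use F_module[OF X] in auto)
qed

lemma G_complex:
  assumes X: "simplicial_set X"
  shows "cochain_complex R (fobj G X)"
  unfolding cochain_complex_def
proof (intro conjI allI ballI G_module X linear_mapsI)
  fix q x assume "x \<in> carrier (deg (fobj G X) q)"
  then obtain a where a: "a \<in> carrier (deg (fobj F X) q)" "x = T X q a" using T_surj[OF X] by metis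
  show "dif (fobj G X) q x \<in> carrier (deg (fobj G X) (q + 1))"
    unfolding a(2) T_d[OF X a(1), symmetric] using T_closed[OF X F_d_closed[OF X a(1)]] .
  show "dif (fobj G X) q (r \<odot>\<^bsub>deg (fobj G X) q\<^esub> x) = r \<odot>\<^bsub>deg (fobj G X) (q + 1)\<^esub> dif (fobj G X) q x" if r: "r \<in> carrier R" for r
    unfolding a(2) T_d[OF X a(1), symmetric] T_smult[OF X r a(1), symmetric] T_smult[OF X r F_d_closed[OF X a(1)], symmetric]
      T_d[OF X F_smult_closed[OF X r a(1)], symmetric]
    using cocomplex.d_smult[OF cocomplex.intro[OF lax_complex[OF F X]] r a(1)] by simp
  show "dif (fobj G X) q (x \<oplus>\<^bsub>deg (fobj G X) q\<^esub> y) = dif (fobj G X) q x \<oplus>\<^bsub>deg (fobj G X) (q + 1)\<^esub> dif (fobj G X) q y"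
    if y: "y \<in> carrier (deg (fobj G X) q)" for y
  proof -
    obtain b where b: "b \<in> carrier (deg (fobj F X) q)" "y = T X q b" using T_surj[OF X y] by metis
    show ?thesis
      unfolding a(2) b(2) T_d[OF X a(1), symmetric] T_d[OF X b(1), symmetric] T_add[OF X a(1) b(1), symmetric]
        T_add[OF X F_d_closed[OF X a(1)] F_d_closed[OF X b(1)], symmetric] T_d[OF X F_add_closed[OF X a(1) b(1)], symmetric]
      using cocomplex.d_add[OF cocomplex.intro[OF lax_complex[OF F X]] a(1) b(1)] by simp
  qed
  have "dif (fobj F X) (q + 1) (dif (fobj F X) q a) = \<zero>\<^bsub>deg (fobj F X) (q + 1 + 1)\<^esub>"
    by (rule cocomplex.d_d[OF cocomplex.intro[OF lax_complex[OF F X]] a(1)])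
  then have "dif (fobj G X) (q + 1) (dif (fobj G X) q x) = \<zero>\<^bsub>deg (fobj G X) (q + 1 + 1)\<^esub>"
    unfolding a(2) T_d[OF X a(1), symmetric] T_d[OF X F_d_closed[OF X a(1)], symmetric] using T_zero[OF X] by simp
  then show "dif (fobj G X) (q + 1) (dif (fobj G X) q x) = \<zero>\<^bsub>deg (fobj G X) (q + 2)\<^esub>" by (simp add: add.assoc)
qed

lemma T_signed: "simplicial_set X \<Longrightarrow> a \<in> carrier (deg (fobj F X) q) \<Longrightarrow>
    T X q (signed (deg (fobj F X) q) k a) = signed (deg (fobj G X) q) k (T X q a)"
  using linear_signed[OF F_module G_module T_linear] by blast

lemma iso_lax: "lax_monoidal_functor R pr G"
proof -
  have pt: "simplicial_set (sset_pt :: 'u sset)" by (rule simplicial_set_pt)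
  note prod = simplicial_set_prod[OF pr]
  note Fmap = lax_map_closed[OF F] and Fk = lax_kappa_closed[OF F]
  have R0: "s \<in> carrier (deg (unit_complex R) 0)" if "s \<in> carrier R" for s
    using that by (simp add: unit_complex_simps)
  have chain: "fmap G X Y f \<in> cochain_maps R (fobj G Y) (fobj G X)"
    if X: "simplicial_set X" and Y: "simplicial_set Y" and f: "f \<in> simplicial_maps X Y" for X Y f
  proof (intro cochain_mapsI linear_mapsI)
    note m = cochain_mapsD[OF lax_map[OF F X Y f]]
    fix q x assume "x \<in> carrier (deg (fobj G Y) q)"
    then obtain a where a: "a \<in> carrier (deg (fobj F Y) q)" "x = T Y q a" using T_surj[OF Y] by metis
    show "fmap G X Y f q x \<in> carrier (deg (fobj G X) q)"
      unfolding a(2) T_map[OF X Y f a(1), symmetric] by (rule T_closed[OF X Fmap[OF X Y f a(1)]])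
    show "fmap G X Y f q (r \<odot>\<^bsub>deg (fobj G Y) q\<^esub> x) = r \<odot>\<^bsub>deg (fobj G X) q\<^esub> fmap G X Y f q x" if r: "r \<in> carrier R" for r
      unfolding a(2) T_smult[OF Y r a(1), symmetric] T_map[OF X Y f F_smult_closed[OF Y r a(1)], symmetric]
        T_map[OF X Y f a(1), symmetric] T_smult[OF X r Fmap[OF X Y f a(1)], symmetric]
      using linear_mapsD(3)[OF m(1) r a(1)] by simp
    show "fmap G X Y f q (x \<oplus>\<^bsub>deg (fobj G Y) q\<^esub> y) = fmap G X Y f q x \<oplus>\<^bsub>deg (fobj G X) q\<^esub> fmap G X Y f q y"
      if y: "y \<in> carrier (deg (fobj G Y) q)" for y
    proof -
      obtain b where b: "b \<in> carrier (deg (fobj F Y) q)" "y = T Y q b" using T_surj[OF Y y] by metis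
      show ?thesis
        unfolding a(2) b(2) T_add[OF Y a(1) b(1), symmetric] T_map[OF X Y f F_add_closed[OF Y a(1) b(1)], symmetric]
          T_map[OF X Y f a(1), symmetric] T_map[OF X Y f b(1), symmetric]
          T_add[OF X Fmap[OF X Y f a(1)] Fmap[OF X Y f b(1)], symmetric]
        using linear_mapsD(2)[OF m(1) a(1) b(1)] by simp
    qed
    show "fmap G X Y f (q + 1) (dif (fobj G Y) q x) = dif (fobj G X) q (fmap G X Y f q x)"
      unfolding a(2) T_d[OF Y a(1), symmetric] T_map[OF X Y f F_d_closed[OF Y a(1)], symmetric]
        T_map[OF X Y f a(1), symmetric] T_d[OF X Fmap[OF X Y f a(1)], symmetric] m(2)[OF a(1)] ..
  qed
  have contra: "contravariant_functor R G"
    unfolding contravariant_functor_def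
  proof (intro conjI allI impI ballI G_complex chain)
    fix X :: "'u sset" assume X: "simplicial_set X"
    obtain N where N: "\<forall>q<N. carrier (deg (fobj F X) q) = {\<zero>\<^bsub>deg (fobj F X) q\<^esub>}"
      using lax_bounded[OF F X] unfolding bounded_below_def by blast
    have "carrier (deg (fobj G X) q) = {\<zero>\<^bsub>deg (fobj G X) q\<^esub>}" if "q < N" for q
      using bij_betw_imp_surj_on[OF T_bij[OF X, of q]] N that T_zero[OF X, of q] by auto
    then show "bounded_below (fobj G X)" unfolding bounded_below_def by blast
    fix q x assume "x \<in> carrier (deg (fobj G X) q)"
    then obtain a where a: "a \<in> carrier (deg (fobj F X) q)" "x = T X q a" using T_surj[OF X] by metis
    show "fmap G X X (sset_id X) q x = x"
      unfolding a(2) T_map[OF X X sset_id_map[OF X] a(1), symmetric] lax_map_id[OF F X a(1)] ..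
  next
    fix X Y Z :: "'u sset" and q f g x
    assume X: "simplicial_set X" and Y: "simplicial_set Y" and Z: "simplicial_set Z"
      and f: "f \<in> simplicial_maps X Y" and g: "g \<in> simplicial_maps Y Z" and "x \<in> carrier (deg (fobj G Z) q)"
    then obtain a where a: "a \<in> carrier (deg (fobj F Z) q)" "x = T Z q a" using T_surj[OF Z] by metis
    show "fmap G X Z (sset_comp X g f) q x = fmap G X Y f q (fmap G Y Z g q x)"
      unfolding a(2) T_map[OF X Z sset_comp_map[OF X f g] a(1), symmetric] T_map[OF Y Z g a(1), symmetric]
        T_map[OF X Y f Fmap[OF Y Z g a(1)], symmetric] lax_map_comp[OF F X Y Z f g a(1)] ..
  qed
  show ?thesis
    unfolding lax_monoidal_functor_def
  proof (intro conjI allI impI ballI contra)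
    fix X Y :: "'u sset" assume X: "simplicial_set X" and Y: "simplicial_set Y"
    note XY = prod[OF X Y]
    note k = tensor_cochain_mapsD[OF lax_kappa[OF F X Y]]
    show "kappa G X Y \<in> tensor_cochain_maps R (fobj G X) (fobj G Y) (fobj G (sset_prod pr X Y))"
    proof (intro tensor_cochain_mapsI linear_mapsI)
      fix p q x y assume x: "x \<in> carrier (deg (fobj G X) p)" and y: "y \<in> carrier (deg (fobj G Y) q)"
      obtain a where a: "a \<in> carrier (deg (fobj F X) p)" "x = T X p a" using T_surj[OF X x] by metis
      obtain b where b: "b \<in> carrier (deg (fobj F Y) q)" "y = T Y q b" using T_surj[OF Y y] by metis
      note kab = Fk[OF X Y a(1) b(1)]
      note Tk = T_kappa[OF X Y, symmetric]
      show 1: "kappa G X Y p q x y \<in> carrier (deg (fobj G (sset_prod pr X Y)) (p + q))"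
        unfolding a(2) b(2) Tk[OF a(1) b(1)] by (rule T_closed[OF XY kab])
      show "kappa G X Y p q x y \<in> carrier (deg (fobj G (sset_prod pr X Y)) (p + q))" by (rule 1)
      show "kappa G X Y p q x (r \<odot>\<^bsub>deg (fobj G Y) q\<^esub> y) = r \<odot>\<^bsub>deg (fobj G (sset_prod pr X Y)) (p + q)\<^esub> kappa G X Y p q x y"
        if r: "r \<in> carrier R" for r
        unfolding a(2) b(2) T_smult[OF Y r b(1), symmetric] Tk[OF a(1) b(1)] Tk[OF a(1) F_smult_closed[OF Y r b(1)]]
          T_smult[OF XY r kab, symmetric] linear_mapsD(3)[OF k(1)[OF a(1)] r b(1)] ..
      show "kappa G X Y p q (r \<odot>\<^bsub>deg (fobj G X) p\<^esub> x) y = r \<odot>\<^bsub>deg (fobj G (sset_prod pr X Y)) (p + q)\<^esub> kappa G X Y p q x y"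
        if r: "r \<in> carrier R" for r
        unfolding a(2) b(2) T_smult[OF X r a(1), symmetric] Tk[OF a(1) b(1)] Tk[OF F_smult_closed[OF X r a(1)] b(1)]
          T_smult[OF XY r kab, symmetric] linear_mapsD(3)[OF k(2)[OF b(1)] r a(1)] ..
      show "kappa G X Y p q x (y \<oplus>\<^bsub>deg (fobj G Y) q\<^esub> z) =
          kappa G X Y p q x y \<oplus>\<^bsub>deg (fobj G (sset_prod pr X Y)) (p + q)\<^esub> kappa G X Y p q x z"
        if z: "z \<in> carrier (deg (fobj G Y) q)" for z
      proof -
        obtain c where c: "c \<in> carrier (deg (fobj F Y) q)" "z = T Y q c" using T_surj[OF Y z] by metis
        show ?thesis
          unfolding a(2) b(2) c(2) T_add[OF Y b(1) c(1), symmetric] Tk[OF a(1) b(1)] Tk[OF a(1) c(1)]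
            Tk[OF a(1) F_add_closed[OF Y b(1) c(1)]] T_add[OF XY kab Fk[OF X Y a(1) c(1)], symmetric]
            linear_mapsD(2)[OF k(1)[OF a(1)] b(1) c(1)] ..
      qed
      show "kappa G X Y p q (x \<oplus>\<^bsub>deg (fobj G X) p\<^esub> z) y =
          kappa G X Y p q x y \<oplus>\<^bsub>deg (fobj G (sset_prod pr X Y)) (p + q)\<^esub> kappa G X Y p q z y"
        if z: "z \<in> carrier (deg (fobj G X) p)" for z
      proof -
        obtain c where c: "c \<in> carrier (deg (fobj F X) p)" "z = T X p c" using T_surj[OF X z] by metis
        show ?thesis
          unfolding a(2) b(2) c(2) T_add[OF X a(1) c(1), symmetric] Tk[OF a(1) b(1)] Tk[OF c(1) b(1)]
            Tk[OF F_add_closed[OF X a(1) c(1)] b(1)] T_add[OF XY kab Fk[OF X Y c(1) b(1)], symmetric]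
            linear_mapsD(2)[OF k(2)[OF b(1)] a(1) c(1)] ..
      qed
      note da = F_d_closed[OF X a(1)] and db = F_d_closed[OF Y b(1)]
      have e: "p + 1 + q = p + q + 1" "p + (q + 1) = p + q + 1" by simp_all
      let ?l = "kappa F X Y (p + 1) q (dif (fobj F X) p a) b" and ?r = "kappa F X Y p (q + 1) a (dif (fobj F Y) q b)"
      have l: "?l \<in> carrier (deg (fobj F (sset_prod pr X Y)) (p + q + 1))"
        and r: "?r \<in> carrier (deg (fobj F (sset_prod pr X Y)) (p + q + 1))"
        using Fk[OF X Y da b(1)] Fk[OF X Y a(1) db] unfolding e .
      have s: "signed (deg (fobj F (sset_prod pr X Y)) (p + q + 1)) p ?r \<in> carrier (deg (fobj F (sset_prod pr X Y)) (p + q + 1))"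
        by (rule abelian_group.signed_closed[OF module_abelian_group[OF F_module[OF XY]] r])
      have "dif (fobj G (sset_prod pr X Y)) (p + q) (kappa G X Y p q x y)
          = T (sset_prod pr X Y) (p + q + 1) (dif (fobj F (sset_prod pr X Y)) (p + q) (kappa F X Y p q a b))"
        unfolding a(2) b(2) Tk[OF a(1) b(1)] T_d[OF XY kab] ..
      also have "\<dots> = T (sset_prod pr X Y) (p + q + 1) ?l \<oplus>\<^bsub>deg (fobj G (sset_prod pr X Y)) (p + q + 1)\<^esub>
          signed (deg (fobj G (sset_prod pr X Y)) (p + q + 1)) p (T (sset_prod pr X Y) (p + q + 1) ?r)"
        unfolding k(3)[OF a(1) b(1)] T_add[OF XY l s] T_signed[OF XY r] ..
      also have "T (sset_prod pr X Y) (p + q + 1) ?l = kappa G X Y (p + 1) q (dif (fobj G X) p x) y"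
        using T_kappa[OF X Y da b(1)] unfolding a(2) b(2) T_d[OF X a(1)] e .
      also have "T (sset_prod pr X Y) (p + q + 1) ?r = kappa G X Y p (q + 1) x (dif (fobj G Y) q y)"
        using T_kappa[OF X Y a(1) db] unfolding a(2) b(2) T_d[OF Y b(1)] e .
      finally show "dif (fobj G (sset_prod pr X Y)) (p + q) (kappa G X Y p q x y) =
          kappa G X Y (p + 1) q (dif (fobj G X) p x) y \<oplus>\<^bsub>deg (fobj G (sset_prod pr X Y)) (p + q + 1)\<^esub>
          signed (deg (fobj G (sset_prod pr X Y)) (p + q + 1)) p (kappa G X Y p (q + 1) x (dif (fobj G Y) q y))" .
    qed
  next
    fix X X' Y Y' :: "'u sset" and p q f g x y
    assume X: "simplicial_set X" and X': "simplicial_set X'" and Y: "simplicial_set Y" and Y': "simplicial_set Y'"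
      and f: "f \<in> simplicial_maps X X'" and g: "g \<in> simplicial_maps Y Y'"
      and x: "x \<in> carrier (deg (fobj G X') p)" and y: "y \<in> carrier (deg (fobj G Y') q)"
    obtain a where a: "a \<in> carrier (deg (fobj F X') p)" "x = T X' p a" using T_surj[OF X' x] by metis
    obtain b where b: "b \<in> carrier (deg (fobj F Y') q)" "y = T Y' q b" using T_surj[OF Y' y] by metis
    show "fmap G (sset_prod pr X Y) (sset_prod pr X' Y') (sset_prod_map pr X Y f g) (p + q) (kappa G X' Y' p q x y)
        = kappa G X Y p q (fmap G X X' f p x) (fmap G Y Y' g q y)"
      unfolding a(2) b(2) T_kappa[OF X' Y' a(1) b(1), symmetric]
        T_map[OF prod[OF X Y] prod[OF X' Y'] sset_prod_map_map[OF pr X Y f g] Fk[OF X' Y' a(1) b(1)], symmetric]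
        T_map[OF X X' f a(1), symmetric] T_map[OF Y Y' g b(1), symmetric]
        T_kappa[OF X Y Fmap[OF X X' f a(1)] Fmap[OF Y Y' g b(1)], symmetric]
        lax_kappa_natural[OF F X X' Y Y' f g a(1) b(1)] ..
  next
    note m = cochain_mapsD[OF lax_eta[OF F]]
    show "eta G \<in> cochain_maps R (unit_complex R) (fobj G sset_pt)"
    proof (intro cochain_mapsI linear_mapsI)
      have cr: "cring R" using F_module[OF pt] by (simp add: module_def)
      fix q s assume s: "s \<in> carrier (deg (unit_complex R) q)"
      note es = lax_eta_closed[OF F s]
      show "eta G q s \<in> carrier (deg (fobj G sset_pt) q)"
        unfolding T_eta[OF s, symmetric] by (rule T_closed[OF pt es])
      show "eta G q (s \<oplus>\<^bsub>deg (unit_complex R) q\<^esub> t) = eta G q s \<oplus>\<^bsub>deg (fobj G sset_pt) q\<^esub> eta G q t"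
        if t: "t \<in> carrier (deg (unit_complex R) q)" for t
      proof -
        have st: "s \<oplus>\<^bsub>deg (unit_complex R) q\<^esub> t \<in> carrier (deg (unit_complex R) q)"
          using abelian_monoid.a_closed[OF abelian_group.axioms(1)[OF module_abelian_group[OF unit_complex_module[OF cr]]] s t] .
        show ?thesis
          unfolding T_eta[OF s, symmetric] T_eta[OF t, symmetric] T_eta[OF st, symmetric]
            T_add[OF pt es lax_eta_closed[OF F t], symmetric] linear_mapsD(2)[OF m(1) s t] ..
      qed
      show "eta G q (r \<odot>\<^bsub>deg (unit_complex R) q\<^esub> s) = r \<odot>\<^bsub>deg (fobj G sset_pt) q\<^esub> eta G q s" if r: "r \<in> carrier R" for r
      proof -
        have rs: "r \<odot>\<^bsub>deg (unit_complex R) q\<^esub> s \<in> carrier (deg (unit_complex R) q)"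
          using module.smult_closed[OF unit_complex_module[OF cr] r s] .
        show ?thesis
          unfolding T_eta[OF s, symmetric] T_eta[OF rs, symmetric]
            T_smult[OF pt r es, symmetric] linear_mapsD(3)[OF m(1) r s] ..
      qed
      have ds: "dif (unit_complex R) q s \<in> carrier (deg (unit_complex R) (q + 1))"
        using cring.cring_simprules(2)[OF cr] by (simp add: unit_complex_simps)
      show "eta G (q + 1) (dif (unit_complex R) q s) = dif (fobj G sset_pt) q (eta G q s)"
        unfolding T_eta[OF s, symmetric] T_eta[OF ds, symmetric] T_d[OF pt es, symmetric] m(2)[OF s] ..
    qed
  next
    fix X Y Z :: "'u sset" and p q r x y z
    assume X: "simplicial_set X" and Y: "simplicial_set Y" and Z: "simplicial_set Z"
      and x: "x \<in> carrier (deg (fobj G X) p)" and y: "y \<in> carrier (deg (fobj G Y) q)" and z: "z \<in> carrier (deg (fobj G Z) r)"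
    obtain a where a: "a \<in> carrier (deg (fobj F X) p)" "x = T X p a" using T_surj[OF X x] by metis
    obtain b where b: "b \<in> carrier (deg (fobj F Y) q)" "y = T Y q b" using T_surj[OF Y y] by metis
    obtain c where c: "c \<in> carrier (deg (fobj F Z) r)" "z = T Z r c" using T_surj[OF Z z] by metis
    note XY = prod[OF X Y] and YZ = prod[OF Y Z]
    note big = Fk[OF X YZ a(1) Fk[OF Y Z b(1) c(1)], unfolded add.assoc[symmetric]]
    have "kappa G X (sset_prod pr Y Z) p (q + r) (T X p a) (kappa G Y Z q r (T Y q b) (T Z r c)) =
        T (sset_prod pr X (sset_prod pr Y Z)) (p + q + r) (kappa F X (sset_prod pr Y Z) p (q + r) a (kappa F Y Z q r b c))"
      unfolding T_kappa[OF Y Z b(1) c(1), symmetric] T_kappa[OF X YZ a(1) Fk[OF Y Z b(1) c(1)], symmetric] add.assoc ..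
    then show "kappa G (sset_prod pr X Y) Z (p + q) r (kappa G X Y p q x y) z =
       fmap G (sset_prod pr (sset_prod pr X Y) Z) (sset_prod pr X (sset_prod pr Y Z)) (sset_assoc pr X Y Z) (p + q + r)
        (kappa G X (sset_prod pr Y Z) p (q + r) x (kappa G Y Z q r y z))"
      unfolding a(2) b(2) c(2) T_kappa[OF X Y a(1) b(1), symmetric]
        T_kappa[OF XY Z Fk[OF X Y a(1) b(1)] c(1), symmetric] lax_kappa_assoc[OF F X Y Z a(1) b(1) c(1)]
        T_map[OF prod[OF XY Z] prod[OF X YZ] sset_assoc_map[OF pr X Y Z] big] by simp
  next
    fix X :: "'u sset" and q s x
    assume X: "simplicial_set X" and s: "s \<in> carrier R" and x: "x \<in> carrier (deg (fobj G X) q)"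
    obtain a where a: "a \<in> carrier (deg (fobj F X) q)" "x = T X q a" using T_surj[OF X x] by metis
    note es = lax_eta_closed[OF F R0[OF s]]
    note sa = F_smult_closed[OF X s a(1)]
    show "kappa G sset_pt X 0 q (eta G 0 s) x =
        fmap G (sset_prod pr sset_pt X) X (sset_snd pr sset_pt X) q (s \<odot>\<^bsub>deg (fobj G X) q\<^esub> x)"
      using T_kappa[OF pt X es a(1)] lax_kappa_unit(1)[OF F X s a(1)] T_map[OF prod[OF pt X] X sset_snd_map[OF pr pt X] sa]
      unfolding a(2) T_eta[OF R0[OF s]] T_smult[OF X s a(1)] by simp
    show "kappa G X sset_pt q 0 x (eta G 0 s) =
        fmap G (sset_prod pr X sset_pt) X (sset_fst pr X sset_pt) q (s \<odot>\<^bsub>deg (fobj G X) q\<^esub> x)"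
      using T_kappa[OF X pt a(1) es] lax_kappa_unit(2)[OF F X s a(1)] T_map[OF prod[OF X pt] X sset_fst_map[OF pr X pt] sa]
      unfolding a(2) T_eta[OF R0[OF s]] T_smult[OF X s a(1)] by simp
  qed
qed

lemma iso_quasi_iso_step: "quasi_iso_step R pr F G"
  unfolding quasi_iso_step_def
proof (intro conjI F iso_lax bexI[OF _ iso_T] allI impI)
  fix X :: "'u sset" assume X: "simplicial_set X"
  show "quasi_isomorphism R (fobj F X) (fobj G X) (T X)"
    by (rule quasi_isomorphismI[OF lax_complex[OF F X] G_complex[OF X] T_chain[OF X]
          quis_bijective[OF lax_complex[OF F X] G_complex[OF X] T_chain[OF X] T_bij[OF X]]])
qed

lemma iso_inverse: "functor_iso R pr G F (\<lambda>X q. inv_into (carrier (deg (fobj F X) q)) (T X q))"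
proof -
  let ?u = "\<lambda>X q. inv_into (carrier (deg (fobj F X) q)) (T X q)"
  have pt: "simplicial_set (sset_pt :: 'u sset)" by (rule simplicial_set_pt)
  note prod = simplicial_set_prod[OF pr]
  have u: "?u X q (T X q a) = a" if "simplicial_set X" "a \<in> carrier (deg (fobj F X) q)" for X q a
    using inv_into_f_f[OF bij_betw_imp_inj_on[OF T_bij[OF that(1)]] that(2)] .
  have zero: "\<zero>\<^bsub>deg (fobj F X) q\<^esub> \<in> carrier (deg (fobj F X) q)" if "simplicial_set X" for X q
    using abelian_monoid.zero_closed[OF abelian_group.axioms(1)[OF module_abelian_group[OF F_module[OF that]]]] .
  show ?thesis
    unfolding functor_iso_def
  proof (intro conjI monoidal_transformationsI allI impI)
    fix X :: "'u sset" assume X: "simplicial_set X"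
    show "?u X \<in> cochain_maps R (fobj G X) (fobj F X)"
    proof (intro cochain_mapsI linear_mapsI)
      fix q x assume "x \<in> carrier (deg (fobj G X) q)"
      then obtain a where a: "a \<in> carrier (deg (fobj F X) q)" "x = T X q a" using T_surj[OF X] by metis
      show "?u X q x \<in> carrier (deg (fobj F X) q)" using u[OF X a(1)] a by simp
      show "?u X q (r \<odot>\<^bsub>deg (fobj G X) q\<^esub> x) = r \<odot>\<^bsub>deg (fobj F X) q\<^esub> ?u X q x" if r: "r \<in> carrier R" for r
        unfolding a(2) T_smult[OF X r a(1), symmetric] using u[OF X] a(1) F_smult_closed[OF X r a(1)] by simp
      show "?u X (q + 1) (dif (fobj G X) q x) = dif (fobj F X) q (?u X q x)"
        unfolding a(2) T_d[OF X a(1), symmetric] using u[OF X] a(1) F_d_closed[OF X a(1)] by simp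
      show "?u X q (x \<oplus>\<^bsub>deg (fobj G X) q\<^esub> y) = ?u X q x \<oplus>\<^bsub>deg (fobj F X) q\<^esub> ?u X q y"
        if y: "y \<in> carrier (deg (fobj G X) q)" for y
      proof -
        obtain b where b: "b \<in> carrier (deg (fobj F X) q)" "y = T X q b" using T_surj[OF X y] by metis
        show ?thesis
          unfolding a(2) b(2) T_add[OF X a(1) b(1), symmetric] using u[OF X] a(1) b(1) F_add_closed[OF X a(1) b(1)] by simp
      qed
    qed
  next
    fix X Y :: "'u sset" and f x q
    assume X: "simplicial_set X" and Y: "simplicial_set Y" and f: "f \<in> simplicial_maps X Y" and x: "x \<in> carrier (deg (fobj G Y) q)"
    obtain a where a: "a \<in> carrier (deg (fobj F Y) q)" "x = T Y q a" using T_surj[OF Y x] by metis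
    show "?u X q (fmap G X Y f q x) = fmap F X Y f q (?u Y q x)"
      unfolding a(2) T_map[OF X Y f a(1), symmetric] u[OF Y a(1)] by (rule u[OF X lax_map_closed[OF F X Y f a(1)]])
  next
    fix X Y :: "'u sset" and x y p q
    assume X: "simplicial_set X" and Y: "simplicial_set Y" and x: "x \<in> carrier (deg (fobj G X) p)" and y: "y \<in> carrier (deg (fobj G Y) q)"
    obtain a where a: "a \<in> carrier (deg (fobj F X) p)" "x = T X p a" using T_surj[OF X x] by metis
    obtain b where b: "b \<in> carrier (deg (fobj F Y) q)" "y = T Y q b" using T_surj[OF Y y] by metis
    show "?u (sset_prod pr X Y) (p + q) (kappa G X Y p q x y) = kappa F X Y p q (?u X p x) (?u Y q y)"
      unfolding a(2) b(2) T_kappa[OF X Y a(1) b(1), symmetric] u[OF X a(1)] u[OF Y b(1)]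
      by (rule u[OF prod[OF X Y] lax_kappa_closed[OF F X Y a(1) b(1)]])
  next
    fix s q assume s: "s \<in> carrier (deg (unit_complex R) q)"
    show "?u sset_pt q (eta G q s) = eta F q s"
      unfolding T_eta[OF s, symmetric] by (rule u[OF pt lax_eta_closed[OF F s]])
  next
    fix X :: "'u sset" and q assume X: "simplicial_set X"
    show "bij_betw (?u X q) (carrier (deg (fobj G X) q)) (carrier (deg (fobj F X) q))"
      by (rule bij_betw_inv_into[OF T_bij[OF X]])
    show "?u X q \<zero>\<^bsub>deg (fobj G X) q\<^esub> = \<zero>\<^bsub>deg (fobj F X) q\<^esub>"
      unfolding T_zero[OF X, symmetric] by (rule u[OF X zero[OF X]])
  qed
qed

end

definition transport_functor ::
  "('u \<times> 'u \<Rightarrow> 'u) \<Rightarrow> ('r, 'u, 'm) mfunctor \<Rightarrow> ('u sset \<Rightarrow> int \<Rightarrow> 'm \<Rightarrow> 'n) \<Rightarrow> ('r, 'u, 'n) mfunctor" where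
  "transport_functor pr F e =
     (let u = (\<lambda>X q. inv_into (carrier (deg (fobj F X) q)) (e X q)) in
     \<lparr> fobj = (\<lambda>X.
         \<lparr> deg = (\<lambda>q.
             \<lparr> carrier = e X q ` carrier (deg (fobj F X) q), mult = undefined, one = undefined,
               zero = e X q \<zero>\<^bsub>deg (fobj F X) q\<^esub>,
               add = (\<lambda>a b. e X q (u X q a \<oplus>\<^bsub>deg (fobj F X) q\<^esub> u X q b)),
               smult = (\<lambda>r a. e X q (r \<odot>\<^bsub>deg (fobj F X) q\<^esub> u X q a)) \<rparr>),
           dif = (\<lambda>q a. e X (q + 1) (dif (fobj F X) q (u X q a))) \<rparr>),
       fmap = (\<lambda>X Y f q a. e X q (fmap F X Y f q (u Y q a))),
       kappa = (\<lambda>X Y p q a b. e (sset_prod pr X Y) (p + q) (kappa F X Y p q (u X p a) (u Y q b))),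
       eta = (\<lambda>q s. e sset_pt q (eta F q s)) \<rparr>)"

lemma transport_functor_iso:
  assumes inj: "\<And>X q. simplicial_set X \<Longrightarrow> inj_on (e X q) (carrier (deg (fobj F X) q))"
  shows "functor_iso R pr F (transport_functor pr F e) e"
  unfolding functor_iso_def
proof (intro conjI monoidal_transformationsI cochain_mapsI linear_mapsI allI impI)
qed (auto simp: transport_functor_def Let_def inv_into_f_f[OF inj] bij_betw_def inj)

section \<open>Encoding of the intermediate functors\<close>

text \<open>A cochain of degree \<open>q\<close> vanishes on lists of more than \<open>q + 1\<close> vertices, because its values there
  have negative degree; hence finitely many values determine it.\<close>

definition short_vertex_lists :: "nat \<Rightarrow> int \<Rightarrow> nat list list" where
  "short_vertex_lists n q = (SOME l. set l = {xs \<in> vertex_lists n. int (length xs) \<le> q + 1})"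

lemma set_short_vertex_lists: "set (short_vertex_lists n q) = {xs \<in> vertex_lists n. int (length xs) \<le> q + 1}"
proof -
  have "{xs \<in> vertex_lists n. int (length xs) \<le> q + 1} \<subseteq> {xs. set xs \<subseteq> {..n} \<and> length xs \<le> nat (q + 1)}"
    by (auto simp: vertex_lists_def)
  then have "finite {xs \<in> vertex_lists n. int (length xs) \<le> q + 1}"
    by (rule finite_subset) (simp add: finite_lists_length_le)
  then show ?thesis unfolding short_vertex_lists_def by (rule someI_ex[OF finite_list])
qed

definition encode :: "('e \<Rightarrow> 'f) \<Rightarrow> 'u sset \<Rightarrow> int \<Rightarrow> (nat \<Rightarrow> 'u \<Rightarrow> nat list \<Rightarrow> 'e) \<Rightarrow> nat \<Rightarrow> 'u \<Rightarrow> 'f list" where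
  "encode f X q \<alpha> = (\<lambda>n. \<lambda>x\<in>simp X n. map (\<lambda>xs. f (\<alpha> n x xs)) (short_vertex_lists n q))"

context simplicial_dg_alg
begin

interpretation C: simplicial_dg_alg R "cochain_sdga A"
  by unfold_locales (rule cochain_sdga)

lemma cochain_theory_value:
  assumes "\<alpha> \<in> carrier (deg (theory_complex (cochain_sdga A) X) q)" "x \<in> simp X n"
  shows "\<alpha> n x \<in> carrier (deg (L.E n) q)"
  using C.theory_closed[OF assms] by (simp add: cochain_sdga_def)

lemma inj_encode:
  assumes f: "\<And>n q. inj_on f (carrier (M n q))"
  shows "inj_on (encode f X q) (carrier (deg (theory_complex (cochain_sdga A) X) q))"
proof (rule inj_onI)
  fix \<alpha> \<beta> assume \<alpha>: "\<alpha> \<in> carrier (deg (theory_complex (cochain_sdga A) X) q)"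
    and \<beta>: "\<beta> \<in> carrier (deg (theory_complex (cochain_sdga A) X) q)" and eq: "encode f X q \<alpha> = encode f X q \<beta>"
  show "\<alpha> = \<beta>"
  proof (rule C.theory_eqI[OF \<alpha> \<beta>])
    fix n x assume x: "x \<in> simp X n"
    note \<alpha>x = cochain_theory_value[OF \<alpha> x] and \<beta>x = cochain_theory_value[OF \<beta> x]
    show "\<alpha> n x = \<beta> n x"
    proof (rule L.E_eqI[OF \<alpha>x \<beta>x])
      fix xs assume xs: "xs \<in> vertex_lists n"
      note c = L.E_closed[OF \<alpha>x xs] L.E_closed[OF \<beta>x xs]
      show "\<alpha> n x xs = \<beta> n x xs"
      proof (cases "int (length xs) \<le> q + 1")
        case True
        have "map (\<lambda>xs. f (\<alpha> n x xs)) (short_vertex_lists n q) = map (\<lambda>xs. f (\<beta> n x xs)) (short_vertex_lists n q)"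
          using fun_cong[OF fun_cong[OF eq, of n], of x] x by (simp add: encode_def)
        then have "f (\<alpha> n x xs) = f (\<beta> n x xs)" using True xs set_short_vertex_lists by auto
        then show ?thesis using inj_onD[OF f _ c] by blast
      next
        case False
        then have "q + 1 - int (length xs) < 0" by simp
        then show ?thesis using c dga.neg_deg by auto
      qed
    qed
  qed
qed

lemma transported_cochains:
  fixes pr :: "'u \<times> 'u \<Rightarrow> 'u"
  assumes pr: "inj pr" and f: "\<And>n q. inj_on f (carrier (M n q))"
  shows "quasi_iso_step R pr (cohomology_theory pr (cochain_sdga A))
      (transport_functor pr (cohomology_theory pr (cochain_sdga A)) (encode f))" (is "quasi_iso_step R pr ?F ?G")
    and "quasi_iso_step R pr (transport_functor pr (cohomology_theory pr (cochain_sdga A)) (encode f))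
      (cohomology_theory pr (cochain_sdga A))"
proof -
  have F: "lax_monoidal_functor R pr ?F" by (rule C.theory_lax_monoidal[OF pr])
  have iso: "functor_iso R pr ?F ?G (encode f)"
    by (rule transport_functor_iso) (simp add: cohomology_theory_def inj_encode[OF f])
  show "quasi_iso_step R pr ?F ?G" by (rule iso_quasi_iso_step[OF pr F iso])
  show "quasi_iso_step R pr ?G ?F"
    by (rule iso_quasi_iso_step[OF pr iso_lax[OF pr F iso] iso_inverse[OF pr F iso]])
qed

lemma inj_unit:
  assumes "homology_axiom R A"
  shows "inj_on (\<lambda>r. r \<odot>\<^bsub>M 0 0\<^esub> dunit (level A 0)) (carrier R)"
proof (rule inj_onI)
  fix r s assume rs: "r \<in> carrier R" "s \<in> carrier R"
    and eq: "r \<odot>\<^bsub>M 0 0\<^esub> dunit (level A 0) = s \<odot>\<^bsub>M 0 0\<^esub> dunit (level A 0)"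
  interpret U: sdga_map R "constant_sdga R" A "\<lambda>n. unit_map (level A n)" by (rule unit_sdga_map)
  let ?x = "r \<ominus>\<^bsub>R\<^esub> s"
  have D: "deg (level (constant_sdga R) 0) = deg (unit_complex R)" "dif (level (constant_sdga R) 0) = dif (unit_complex R)"
    by (simp_all add: constant_sdga_def)
  have "?x \<in> cocycles (level (constant_sdga R) 0) 0"
    using rs dga.mod.R.minus_closed by (simp add: cocycles_def D unit_complex_simps)
  moreover have "unit_map (level A 0) 0 ?x \<in> coboundaries (level A 0) 0"
  proof -
    have "unit_map (level A 0) 0 ?x = \<zero>\<^bsub>M 0 0\<^esub>"
      unfolding unit_map_def a_minus_def
      using rs eq dga.one_closed by (simp add: dga.mod.smult_l_distr dga.mod.smult_l_minus dga.group.r_neg dga.mod.smult_closed)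
    then show ?thesis using dga.coboundaries_zero by simp
  qed
  ultimately have "?x \<in> coboundaries (level (constant_sdga R) 0) 0"
    using quisD(1)[OF unit_quis[OF assms]] by blast
  then have "?x = \<zero>\<^bsub>R\<^esub>" by (auto simp: coboundaries_def D unit_complex_simps)
  then show "r = s" using rs dga.mod.R.minus_eq_zero_iff by blast
qed

end

section \<open>Singular cochains\<close>

lemma (in abelian_group) finsum_minus:
  "finite A \<Longrightarrow> f \<in> A \<rightarrow> carrier G \<Longrightarrow> (\<Oplus>i\<in>A. \<ominus> f i) = \<ominus> (\<Oplus>i\<in>A. f i)"
proof (induction rule: finite_induct)
  case (insert x F)
  then have "f x \<in> carrier G" "f \<in> F \<rightarrow> carrier G" "(\<lambda>i. \<ominus> f i) \<in> F \<rightarrow> carrier G" by auto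
  then show ?case using insert by (simp add: minus_add)
qed (simp, subst eq_commute, simp)

definition singular_map :: "'u sset \<Rightarrow> int \<Rightarrow> (nat \<Rightarrow> 'u \<Rightarrow> nat list \<Rightarrow> 'r) \<Rightarrow> 'u \<Rightarrow> 'r" where
  "singular_map X q \<alpha> = (\<lambda>x\<in>simp_int X q. \<alpha> (nat q) x [0..<Suc (nat q)])"

lemma upt_vertex_lists: "[0..<Suc n] \<in> vertex_lists n"
  by (auto simp: vertex_lists_def simp del: upt_Suc)

lemma map_coface_upt:
  assumes "i \<le> Suc n"
  shows "map (coface n i) [0..<Suc n] = take i [0..<Suc (Suc n)] @ drop (Suc i) [0..<Suc (Suc n)]"
  using assms by (intro nth_equalityI) (auto simp: coface_def nth_append simp del: upt_Suc)

context cring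
begin

abbreviation S where "S \<equiv> constant_sdga R"

interpretation S: simplicial_dg_alg R S
  by unfold_locales (rule constant_sdga)

interpretation C: simplicial_dg_alg R "cochain_sdga S"
  by unfold_locales (rule S.cochain_sdga)

abbreviation K where "K \<equiv> theory_complex (cochain_sdga S)"

lemma S_simps:
  "deg (level S p) = deg (unit_complex R)" "dif (level S p) q x = \<zero>" "dmul (level S p) i j x y = x \<otimes> y"
  "dunit (level S p) = \<one>" "sact S m n \<theta> q x = x"
  by (simp_all add: constant_sdga_def unit_complex_def)

lemma unit_minus: "x \<in> carrier R \<Longrightarrow> \<ominus>\<^bsub>deg (unit_complex R) 0\<^esub> x = \<ominus> x"
  using unit_signed[of x 0 1] by (simp add: signed_def unit_complex_simps)

lemma constant_cobd:
  "(\<And>i. i < length xs \<Longrightarrow> c (take i xs @ drop (Suc i) xs) \<in> carrier R) \<Longrightarrow> N = int (length xs) - 1 \<Longrightarrow>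
    cobd (level S p) N c xs = (\<Oplus>i\<in>{..<length xs}. signed R (int i) (c (take i xs @ drop (Suc i) xs)))"
proof (induction xs arbitrary: N c)
  case Nil
  then show ?case using unit_minus[of \<zero>] by (simp add: S_simps minus_equality)
next
  case (Cons x xs)
  let ?t = "\<lambda>i. c (x # take i xs @ drop (Suc i) xs)"
  have t: "?t i \<in> carrier R" if "i < length xs" for i using Cons.prems(1)[of "Suc i"] that by simp
  have c: "c xs \<in> carrier R" using Cons.prems(1)[of 0] by simp
  have IH: "cobd (level S p) (N - 1) (\<lambda>ys. c (x # ys)) xs = (\<Oplus>i\<in>{..<length xs}. signed R (int i) (?t i))"
    by (rule Cons.IH) (use t Cons.prems(2) in auto)
  have cl: "(\<lambda>i. signed R (int i) (?t i)) \<in> {..<length xs} \<rightarrow> carrier R" using t by auto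
  have N: "N - int (length xs) = 0" using Cons.prems(2) by simp
  have "cobd (level S p) N c (x # xs) = c xs \<oplus> (\<ominus> (\<Oplus>i\<in>{..<length xs}. signed R (int i) (?t i)))"
    unfolding cobd.simps(2) IH N S_simps a_minus_def unit_minus[OF finsum_closed[OF cl]] unit_complex_simps ..
  also have "\<ominus> (\<Oplus>i\<in>{..<length xs}. signed R (int i) (?t i)) = (\<Oplus>i\<in>{..<length xs}. \<ominus> signed R (int i) (?t i))"
    using finsum_minus[OF _ cl] by simp
  also have "\<dots> = (\<Oplus>i\<in>{..<length xs}. signed R (int (Suc i)) (c (take (Suc i) (x # xs) @ drop (Suc (Suc i)) (x # xs))))"
    by (rule finsum_cong') (use t in \<open>auto simp: signed_minus add.commute\<close>)
  also have "\<dots> = (\<Oplus>i\<in>Suc ` {..<length xs}. signed R (int i) (c (take i (x # xs) @ drop (Suc i) (x # xs))))"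
    by (rule finsum_reindex[symmetric]) (use t in auto)
  also have "c xs \<oplus> \<dots> = (\<Oplus>i\<in>insert 0 (Suc ` {..<length xs}). signed R (int i) (c (take i (x # xs) @ drop (Suc i) (x # xs))))"
    by (subst finsum_insert) (use t c in \<open>auto simp: signed_def\<close>)
  also have "insert 0 (Suc ` {..<length xs}) = {..<length (x # xs)}" by (simp add: lessThan_Suc_eq_insert_0)
  finally show ?case .
qed

lemma constant_cup:
  "graded (level S n) (int p + 1) c xs \<Longrightarrow> graded (level S n) (int q + 1) c' xs \<Longrightarrow> length xs = Suc (p + q) \<Longrightarrow>
    cup (level S n) (int p + 1) (int q) c c' xs = c (take (Suc p) xs) \<otimes> c' (drop p xs)"
proof (induction p arbitrary: c xs)
  case 0
  then obtain x zs where xs: "xs = x # zs" by (cases xs) auto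
  note c = 0(1)[unfolded xs] and c' = 0(2)[unfolded xs]
  have c0: "c [x] \<in> carrier R" and c'0: "c' (x # zs) \<in> carrier R"
    using unit_carrier S.dga.head_closed[OF c] S.dga.whole_closed[OF c'] unfolding S_simps by blast+
  have "cup (level S n) (1 - 1) (int q) (\<lambda>ys. c (x # ys)) c' zs = \<zero>\<^bsub>deg (level S n) (1 - 1 + int q - int (length zs))\<^esub>"
  proof (rule S.dga.cup_zero_left[OF _ graded_tl[OF c']])
    fix ys assume ys: "ys \<noteq> []" "subseq ys zs"
    have "c (x # ys) \<in> carrier (deg (level S n) (1 - 1 - int (length ys)))"
      using gradedD[OF graded_shift[OF c] ys(2)] by simp
    then show "c (x # ys) = \<zero>\<^bsub>deg (level S n) (1 - 1 - int (length ys))\<^esub>"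
      using ys(1) by (auto simp: S_simps unit_complex_simps split: if_splits)
  qed
  then show ?case using c0 c'0 unit_signed[of "c [x] \<otimes> c' (x # zs)" 0 0]
    by (simp add: xs S_simps unit_complex_simps signed_def)
next
  case (Suc p)
  then obtain x zs where xs: "xs = x # zs" by (cases xs) auto
  note c = Suc.prems(1)[unfolded xs] and c' = Suc.prems(2)[unfolded xs]
  have e: "int (Suc p) + 1 - 1 = int p + 1" by simp
  have c'0: "c' (x # zs) \<in> carrier R"
    using unit_carrier S.dga.whole_closed[OF c'] unfolding S_simps by blast
  have "c [x] \<in> carrier (deg (level S n) (int p + 1))" using S.dga.head_closed[OF c] unfolding e .
  then have c0: "c [x] = \<zero>" by (auto simp: S_simps unit_complex_simps split: if_splits)
  have IH: "cup (level S n) (int p + 1) (int q) (\<lambda>ys. c (x # ys)) c' zs = c (x # take (Suc p) zs) \<otimes> c' (drop p zs)"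
    using Suc.IH[OF graded_shift[OF c, unfolded e] graded_tl[OF c']] Suc.prems(3) xs by simp
  have k1: "c (x # take (Suc p) zs) \<in> carrier R"
    using gradedD[OF c, of "x # take (Suc p) zs"] unit_carrier[of "c (x # take (Suc p) zs)"] sublist_imp_subseq[OF prefix_imp_sublist[OF take_is_prefix]]
    by (auto simp: S_simps)
  have k2: "c' (drop p zs) \<in> carrier R"
    using gradedD[OF graded_tl[OF c'], of "drop p zs"] unit_carrier[of "c' (drop p zs)"] sublist_imp_subseq[OF suffix_imp_sublist[OF suffix_drop]]
    by (auto simp: S_simps)
  show ?case
    unfolding xs cup.simps(2) e IH c0
    using k1 k2 c'0 by (simp add: S_simps unit_complex_simps unit_signed signed_zero)
qed

context
  fixes X :: "'u sset" assumes X: "simplicial_set X"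
begin

lemma K_value: "\<alpha> \<in> carrier (deg (K X) q) \<Longrightarrow> x \<in> simp X n \<Longrightarrow> \<alpha> n x \<in> carrier (deg (S.L.E n) q)"
  by (rule S.cochain_theory_value)

lemma K_closed:
  assumes "\<alpha> \<in> carrier (deg (K X) q)" "x \<in> simp X n" "xs \<in> vertex_lists n"
  shows "\<alpha> n x xs \<in> carrier R"
  using S.L.E_closed[OF K_value[OF assms(1,2)] assms(3)] unit_carrier by (auto simp: S_simps)

lemma K_zero:
  assumes "\<alpha> \<in> carrier (deg (K X) q)" "x \<in> simp X n" "xs \<in> vertex_lists n" "int (length xs) \<noteq> q + 1"
  shows "\<alpha> n x xs = \<zero>"
  using S.L.E_closed[OF K_value[OF assms(1,2)] assms(3)] assms(4) by (auto simp: S_simps unit_complex_simps)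

lemma K_act:
  assumes "\<alpha> \<in> carrier (deg (K X) q)" "x \<in> simp X n" "\<theta> \<in> simplex_hom k n" "xs \<in> vertex_lists k"
  shows "\<alpha> k (act X k n \<theta> x) xs = \<alpha> n x (map \<theta> xs)"
  using C.theory_act[OF assms(1,3,2)] assms(4) by (simp add: cochain_sdga_def map_cochain_def S_simps)

lemma K_neg: "q < 0 \<Longrightarrow> \<alpha> \<in> carrier (deg (K X) q) \<Longrightarrow> \<alpha> = \<zero>\<^bsub>deg (K X) q\<^esub>"
  using C.theory_neg[OF X] by blast

lemma K_apply:
  assumes "x \<in> simp X n" "xs \<in> vertex_lists n"
  shows "\<zero>\<^bsub>deg (K X) q\<^esub> n x xs = \<zero>" "(\<alpha> \<oplus>\<^bsub>deg (K X) q\<^esub> \<beta>) n x xs = \<alpha> n x xs \<oplus> \<beta> n x xs"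
    "(r \<odot>\<^bsub>deg (K X) q\<^esub> \<alpha>) n x xs = r \<otimes> \<alpha> n x xs" "dif (K X) q \<alpha> n x xs = cobd (level S n) (q + 1) (\<alpha> n x) xs"
  using S.L.E_apply[OF assms(2)] C.theory_apply[OF assms(1)]
  by (simp_all add: cochain_sdga_def S_simps unit_complex_simps)

definition list_simplex :: "nat list \<Rightarrow> nat \<Rightarrow> nat" where
  "list_simplex xs = (\<lambda>i\<in>{..<length xs}. xs ! i)"

lemma list_simplex_hom:
  assumes "xs \<in> vertex_lists n" "length xs = Suc k"
  shows "list_simplex xs \<in> simplex_hom k n"
proof (rule simplex_homI)
  show "list_simplex xs i \<le> n" if "i \<le> k" for i
  proof -
    have "xs ! i \<in> set xs" using that assms by simp
    then have "xs ! i \<le> n" using assms(1) unfolding vertex_lists_def by blast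
    then show ?thesis using that assms(2) by (simp add: list_simplex_def)
  qed
  show "list_simplex xs i \<le> list_simplex xs j" if "i \<le> j" "j \<le> k" for i j
    using assms that by (auto simp: list_simplex_def vertex_lists_def intro: sorted_nth_mono)
qed (use assms in \<open>auto simp: list_simplex_def\<close>)

lemma map_list_simplex: "length xs = Suc k \<Longrightarrow> map (list_simplex xs) [0..<Suc k] = xs"
  by (intro nth_equalityI) (auto simp: list_simplex_def simp del: upt_Suc)

lemma list_simplex_map:
  assumes "xs \<in> vertex_lists m" "length xs = Suc k" "\<theta> \<in> simplex_hom m n"
  shows "list_simplex (map \<theta> xs) = compose {..k} \<theta> (list_simplex xs)"
  using assms(2) by (auto simp: list_simplex_def compose_def fun_eq_iff)

lemma singular_map_bij:
  "bij_betw (singular_map X q) (carrier (deg (K X) q)) (carrier (deg (singular_complex R X) q))"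
proof (cases "q < 0")
  case True
  have "carrier (deg (singular_complex R X) q) = {\<lambda>_. undefined}"
    using True by (simp add: singular_complex_def simp_int_def)
  moreover have "singular_map X q \<alpha> = (\<lambda>_. undefined)" for \<alpha> :: "nat \<Rightarrow> 'u \<Rightarrow> nat list \<Rightarrow> 'a"
    using True by (simp add: singular_map_def simp_int_def restrict_def)
  ultimately show ?thesis unfolding C.theory_neg[OF X True] by (simp add: bij_betw_def)
next
  case False
  define k where "k = nat q"
  have q: "q = int k" using False by (simp add: k_def)
  have carrier: "carrier (deg (singular_complex R X) q) = simp X k \<rightarrow>\<^sub>E carrier R"
    by (simp add: singular_complex_def simp_int_def q)
  have map: "singular_map X q \<alpha> = (\<lambda>x\<in>simp X k. \<alpha> k x [0..<Suc k])" for \<alpha> :: "nat \<Rightarrow> 'u \<Rightarrow> nat list \<Rightarrow> 'a"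
    by (simp add: singular_map_def simp_int_def q)
  show ?thesis
    unfolding bij_betw_def
  proof (intro conjI inj_onI equalityI subsetI)
    fix \<alpha> \<beta> assume \<alpha>: "\<alpha> \<in> carrier (deg (K X) q)" and \<beta>: "\<beta> \<in> carrier (deg (K X) q)"
      and eq: "singular_map X q \<alpha> = singular_map X q \<beta>"
    show "\<alpha> = \<beta>"
    proof (rule C.theory_eqI[OF \<alpha> \<beta>])
      fix n x assume x: "x \<in> simp X n"
      show "\<alpha> n x = \<beta> n x"
      proof (rule S.L.E_eqI[OF K_value[OF \<alpha> x] K_value[OF \<beta> x]])
        fix xs assume xs: "xs \<in> vertex_lists n"
        show "\<alpha> n x xs = \<beta> n x xs"
        proof (cases "length xs = Suc k")
          case True
          note h = list_simplex_hom[OF xs True]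
          have "\<gamma> n x xs = singular_map X q \<gamma> (act X k n (list_simplex xs) x)" if "\<gamma> \<in> carrier (deg (K X) q)" for \<gamma>
            using K_act[OF that x h upt_vertex_lists] map_list_simplex[OF True] act_closed[OF X h x]
            by (simp add: map del: upt_Suc)
          from this[OF \<alpha>] this[OF \<beta>] show ?thesis unfolding eq by simp
        next
          case False
          then show ?thesis using K_zero[OF \<alpha> x xs] K_zero[OF \<beta> x xs] by (simp add: q)
        qed
      qed
    qed
  next
    fix b assume "b \<in> singular_map X q ` carrier (deg (K X) q)"
    then show "b \<in> carrier (deg (singular_complex R X) q)"
      unfolding carrier using K_closed[OF _ _ upt_vertex_lists] by (auto simp: map simp del: upt_Suc)
  next
    fix b assume "b \<in> carrier (deg (singular_complex R X) q)"
    then have b: "b \<in> simp X k \<rightarrow>\<^sub>E carrier R" unfolding carrier .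
    define \<alpha> where "\<alpha> = (\<lambda>n. \<lambda>x\<in>simp X n. \<lambda>xs\<in>vertex_lists n.
      if length xs = Suc k then b (act X k n (list_simplex xs) x) else \<zero>)"
    have \<alpha>: "\<alpha> \<in> carrier (deg (K X) q)"
    proof (rule C.theory_carrierI)
      fix n x assume x: "x \<in> simp X n"
      have "b (act X k n (list_simplex xs) x) \<in> carrier R" if "xs \<in> vertex_lists n" "length xs = Suc k" for xs
        using b act_closed[OF X list_simplex_hom[OF that] x] by auto
      then show "\<alpha> n x \<in> carrier (deg (level (cochain_sdga S) n) q)"
        using x unfolding \<alpha>_def cochain_sdga_def sdga.simps
        by (simp, intro S.L.E_carrierI) (auto simp: S_simps unit_complex_simps q)
      fix m \<theta> assume \<theta>: "\<theta> \<in> simplex_hom m n"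
      show "\<alpha> m (act X m n \<theta> x) = sact (cochain_sdga S) m n \<theta> q (\<alpha> n x)"
      proof (rule extensionalityI[of _ "vertex_lists m"])
        fix xs assume xs: "xs \<in> vertex_lists m"
        show "\<alpha> m (act X m n \<theta> x) xs = sact (cochain_sdga S) m n \<theta> q (\<alpha> n x) xs"
        proof (cases "length xs = Suc k")
          case True
          then show ?thesis
            using x xs act_closed[OF X \<theta> x] vertex_lists_map[OF \<theta> xs]
              act_act[OF X list_simplex_hom[OF xs True] \<theta> x] list_simplex_map[OF xs True \<theta>]
            by (simp add: \<alpha>_def cochain_sdga_def map_cochain_def S_simps)
        next
          case False
          then show ?thesis
            using x xs act_closed[OF X \<theta> x] vertex_lists_map[OF \<theta> xs]
            by (simp add: \<alpha>_def cochain_sdga_def map_cochain_def S_simps)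
        qed
      qed (use act_closed[OF X \<theta> x] in \<open>auto simp: \<alpha>_def cochain_sdga_def map_cochain_def\<close>)
    qed (simp add: \<alpha>_def)
    have "b = singular_map X q \<alpha>"
    proof (rule extensionalityI[of _ "simp X k"])
      fix x assume x: "x \<in> simp X k"
      have "list_simplex [0..<Suc k] = (\<lambda>j\<in>{..k}. j)"
        by (auto simp: list_simplex_def fun_eq_iff simp del: upt_Suc)
      then show "b x = singular_map X q \<alpha> x"
        using x upt_vertex_lists[of k] act_id[OF X x] by (simp add: map \<alpha>_def del: upt_Suc)
    qed (use b in \<open>auto simp: map PiE_iff\<close>)
    then show "b \<in> singular_map X q ` carrier (deg (K X) q)" using \<alpha> by blast
  qed
qed

lemma singular_map_dif:
  assumes \<alpha>: "\<alpha> \<in> carrier (deg (K X) q)"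
  shows "singular_map X (q + 1) (dif (K X) q \<alpha>) = dif (singular_complex R X) q (singular_map X q \<alpha>)"
proof (rule extensionalityI[of _ "simp_int X (q + 1)"])
  fix x assume x: "x \<in> simp_int X (q + 1)"
  then have q1: "0 \<le> q + 1" by (auto simp: simp_int_def split: if_splits)
  show "singular_map X (q + 1) (dif (K X) q \<alpha>) x = dif (singular_complex R X) q (singular_map X q \<alpha>) x"
  proof (cases "q < 0")
    case True
    then have q: "q = -1" using q1 by simp
    interpret K: cocomplex R "K X" by unfold_locales (rule C.theory_cochain_complex[OF X])
    have "dif (K X) q \<alpha> = \<zero>\<^bsub>deg (K X) (q + 1)\<^esub>" using K_neg[OF True \<alpha>] K.d_zero by simp
    then show ?thesis
      using x True upt_vertex_lists[of 0] K_apply(1)[of x 0 "[0..<Suc 0]" 0]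
      by (simp add: singular_map_def singular_complex_def simp_int_def q del: upt_Suc)
  next
    case False
    define k where "k = nat q"
    have q: "q = int k" "nat (q + 1) = Suc k" using False by (auto simp: k_def)
    have xk: "x \<in> simp X (Suc k)" using x q by (simp add: simp_int_def split: if_splits)
    let ?u = "[0..<Suc (Suc k)]"
    have faces: "\<alpha> k (face X k i x) [0..<Suc k] = \<alpha> (Suc k) x (take i ?u @ drop (Suc i) ?u)" if "i \<le> Suc k" for i
      unfolding face_eq K_act[OF \<alpha> xk coface_hom upt_vertex_lists] map_coface_upt[OF that] ..
    have face_in: "face X k i x \<in> simp X k" for i unfolding face_eq by (rule act_closed[OF X coface_hom xk])
    have cl: "\<alpha> k (face X k i x) [0..<Suc k] \<in> carrier R" for i
      by (rule K_closed[OF \<alpha> face_in upt_vertex_lists])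
    have "singular_map X (q + 1) (dif (K X) q \<alpha>) x = cobd (level S (Suc k)) (q + 1) (\<alpha> (Suc k) x) ?u"
      using x xk upt_vertex_lists[of "Suc k"] by (simp add: singular_map_def q(2) K_apply del: upt_Suc)
    also have "\<dots> = (\<Oplus>i\<in>{..<length ?u}. signed R (int i) (\<alpha> (Suc k) x (take i ?u @ drop (Suc i) ?u)))"
      by (rule constant_cobd) (use cl faces in \<open>auto simp: q less_Suc_eq_le simp del: upt_Suc\<close>, metis)
    also have "\<dots> = (\<Oplus>i\<in>{..Suc k}. signed R (int i) (\<alpha> k (face X k i x) [0..<Suc k]))"
      by (rule finsum_cong') (use cl faces in \<open>auto simp del: upt_Suc\<close>)
    also have "\<dots> = (\<Oplus>i\<in>{..Suc k}. signed R (int i) (singular_map X q \<alpha> (face X k i x)))"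
      using face_in by (simp add: singular_map_def simp_int_def q del: upt_Suc)
    finally show ?thesis using x False by (simp add: singular_complex_def q del: upt_Suc)
  qed
qed (auto simp: singular_map_def singular_complex_def)

lemma singular_map_chain: "singular_map X \<in> cochain_maps R (K X) (singular_complex R X)"
proof (intro cochain_mapsI linear_mapsI singular_map_dif)
  fix q \<alpha> assume \<alpha>: "\<alpha> \<in> carrier (deg (K X) q)"
  show "singular_map X q \<alpha> \<in> carrier (deg (singular_complex R X) q)"
    using \<alpha> bij_betw_imp_surj_on[OF singular_map_bij] by blast
  show "singular_map X q (\<alpha> \<oplus>\<^bsub>deg (K X) q\<^esub> \<beta>) = singular_map X q \<alpha> \<oplus>\<^bsub>deg (singular_complex R X) q\<^esub> singular_map X q \<beta>"
    if "\<beta> \<in> carrier (deg (K X) q)" for \<beta>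
    using upt_vertex_lists[of "nat q"]
    by (auto simp: singular_map_def singular_complex_def simp_int_def K_apply fun_eq_iff simp del: upt_Suc)
  show "singular_map X q (r \<odot>\<^bsub>deg (K X) q\<^esub> \<alpha>) = r \<odot>\<^bsub>deg (singular_complex R X) q\<^esub> singular_map X q \<alpha>"
    if "r \<in> carrier R" for r
    using upt_vertex_lists[of "nat q"]
    by (auto simp: singular_map_def singular_complex_def simp_int_def K_apply fun_eq_iff simp del: upt_Suc)
qed

lemma singular_map_zero: "singular_map X q \<zero>\<^bsub>deg (K X) q\<^esub> = \<zero>\<^bsub>deg (singular_complex R X) q\<^esub>"
  using upt_vertex_lists[of "nat q"]
  by (auto simp: singular_map_def singular_complex_def simp_int_def K_apply fun_eq_iff simp del: upt_Suc)

end

lemma singular_map_kappa: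
  fixes pr :: "'u \<times> 'u \<Rightarrow> 'u"
  assumes pr: "inj pr" and X: "simplicial_set X" and Y: "simplicial_set Y"
    and \<alpha>: "\<alpha> \<in> carrier (deg (K X) p)" and \<beta>: "\<beta> \<in> carrier (deg (K Y) q)"
  shows "singular_map (sset_prod pr X Y) (p + q) (kappa (cohomology_theory pr (cochain_sdga S)) X Y p q \<alpha> \<beta>)
    = kappa (singular_cochains R pr) X Y p q (singular_map X p \<alpha>) (singular_map Y q \<beta>)"
proof -
  let ?XY = "sset_prod pr X Y"
  note XY = simplicial_set_prod[OF pr X Y]
  let ?k = "kappa (cohomology_theory pr (cochain_sdga S)) X Y p q \<alpha> \<beta>"
  have kappa: "kappa (singular_cochains R pr) X Y p q a b =
      singular_cup R ?XY p q (singular_pullback ?XY (sset_fst pr X Y) p a) (singular_pullback ?XY (sset_snd pr X Y) q b)" for a b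
    by (simp add: singular_cochains_def)
  show ?thesis
    unfolding kappa
  proof (rule extensionalityI[of _ "simp_int ?XY (p + q)"])
    fix z assume zi: "z \<in> simp_int ?XY (p + q)"
    then have pq: "0 \<le> p + q" and z: "z \<in> simp ?XY (nat (p + q))" by (auto simp: simp_int_def split: if_splits)
    then obtain x y where xy: "z = pr (x, y)" "x \<in> simp X (nat (p + q))" "y \<in> simp Y (nat (p + q))"
      using sset_prodE[OF pr] by metis
    show "singular_map ?XY (p + q) ?k z =
        singular_cup R ?XY p q (singular_pullback ?XY (sset_fst pr X Y) p (singular_map X p \<alpha>))
          (singular_pullback ?XY (sset_snd pr X Y) q (singular_map Y q \<beta>)) z"
    proof (cases "p < 0 \<or> q < 0")
      case True
      interpret KX: cocomplex R "K X" by unfold_locales (rule C.theory_cochain_complex[OF X])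
      interpret KY: cocomplex R "K Y" by unfold_locales (rule C.theory_cochain_complex[OF Y])
      interpret KXY: cocomplex R "K ?XY" by unfold_locales (rule C.theory_cochain_complex[OF XY])
      note t = tensor_cochain_mapsD[OF C.kappa_tensor[OF pr X Y]]
      have "?k = \<zero>\<^bsub>deg (K ?XY) (p + q)\<^esub>"
      proof (cases "p < 0")
        case True
        show ?thesis
          using linear_zero[OF KX.module_deg KXY.module_deg t(2)[OF \<beta>]] K_neg[OF X True \<alpha>] by simp
      next
        case False
        with \<open>p < 0 \<or> q < 0\<close> have "q < 0" by simp
        then show ?thesis
          using linear_zero[OF KY.module_deg KXY.module_deg t(1)[OF \<alpha>]] K_neg[OF Y _ \<beta>] by simp
      qed
      then show ?thesis
        using True zi z upt_vertex_lists[of "nat (p + q)"]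
        by (auto simp: singular_map_def singular_cup_def K_apply[OF XY] simp del: upt_Suc)
    next
      case False
      define i j where "i = nat p" and "j = nat q"
      have ij: "p = int i" "q = int j" "nat (p + q) = i + j" using False by (auto simp: i_def j_def)
      let ?u = "[0..<Suc (i + j)]"
      have x: "x \<in> simp X (i + j)" and y: "y \<in> simp Y (i + j)" using xy ij by simp_all
      have f: "(\<lambda>l\<in>{..i}. l) \<in> simplex_hom i (i + j)" and b: "(\<lambda>l\<in>{..j}. i + l) \<in> simplex_hom j (i + j)"
        by (rule simplex_homI; auto)+
      have mf: "map (\<lambda>l\<in>{..i}. l) [0..<Suc i] = take (Suc i) ?u"
        by (intro nth_equalityI) (auto simp del: upt_Suc)
      have mb: "map (\<lambda>l\<in>{..j}. i + l) [0..<Suc j] = drop i ?u"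
        by (intro nth_equalityI) (auto simp del: upt_Suc)
      have fx: "act X i (i + j) (\<lambda>l\<in>{..i}. l) x \<in> simp X i" by (rule act_closed[OF X f x])
      have by': "act Y j (i + j) (\<lambda>l\<in>{..j}. i + l) y \<in> simp Y j" by (rule act_closed[OF Y b y])
      have "singular_map ?XY (p + q) ?k z = ?k (i + j) z ?u"
        using zi by (simp add: singular_map_def ij(3) del: upt_Suc)
      also have "\<dots> = dmul (level (cochain_sdga S) (i + j)) p q (\<alpha> (i + j) x) (\<beta> (i + j) y) ?u"
        unfolding xy(1) C.kappa_apply[OF pr x y] ..
      also have "\<dots> = cup (level S (i + j)) (p + 1) q (\<alpha> (i + j) x) (\<beta> (i + j) y) ?u"
        using S.L.E_apply(5)[OF upt_vertex_lists] by (simp add: cochain_sdga_def del: upt_Suc)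
      also have "\<dots> = \<alpha> (i + j) x (take (Suc i) ?u) \<otimes> \<beta> (i + j) y (drop i ?u)"
        unfolding ij(1,2)
        by (rule constant_cup[OF S.L.E_graded[OF K_value[OF X \<alpha> x] upt_vertex_lists, unfolded ij(1)]
              S.L.E_graded[OF K_value[OF Y \<beta> y] upt_vertex_lists, unfolded ij(2)]]) simp
      also have "\<alpha> (i + j) x (take (Suc i) ?u) = singular_map X p \<alpha> (act X i (i + j) (\<lambda>l\<in>{..i}. l) x)"
        unfolding mf[symmetric] K_act[OF X \<alpha> x f upt_vertex_lists, symmetric]
        using fx by (simp add: singular_map_def simp_int_def ij del: upt_Suc)
      also have "\<beta> (i + j) y (drop i ?u) = singular_map Y q \<beta> (act Y j (i + j) (\<lambda>l\<in>{..j}. i + l) y)"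
        unfolding mb[symmetric] K_act[OF Y \<beta> y b upt_vertex_lists, symmetric]
        using by' by (simp add: singular_map_def simp_int_def ij del: upt_Suc)
      also have "singular_map X p \<alpha> (act X i (i + j) (\<lambda>l\<in>{..i}. l) x) \<otimes> singular_map Y q \<beta> (act Y j (i + j) (\<lambda>l\<in>{..j}. i + l) y) =
          singular_cup R ?XY p q (singular_pullback ?XY (sset_fst pr X Y) p (singular_map X p \<alpha>))
            (singular_pullback ?XY (sset_snd pr X Y) q (singular_map Y q \<beta>)) z"
        using zi fx by' ij
        by (simp add: singular_cup_def singular_pullback_def simp_int_def xy(1) sset_prod_act[OF pr]
            sset_prod_in[OF pr] sset_fst_def sset_snd_def act_closed[OF X b x] act_closed[OF Y f y] pfst_pr[OF pr] psnd_pr[OF pr])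
      finally show ?thesis .
    qed
  qed (auto simp: singular_map_def singular_cup_def)
qed

lemma singular_iso:
  fixes pr :: "'u \<times> 'u \<Rightarrow> 'u"
  assumes pr: "inj pr"
  shows "functor_iso R pr (cohomology_theory pr (cochain_sdga S)) (singular_cochains R pr) singular_map"
proof -
  have obj: "fobj (cohomology_theory pr (cochain_sdga S)) = K" "fobj (singular_cochains R pr) = singular_complex R"
    by (simp_all add: cohomology_theory_def singular_cochains_def)
  show ?thesis
    unfolding functor_iso_def obj
  proof (intro conjI monoidal_transformationsI allI impI; (unfold obj)?)
    fix X Y :: "'u sset" and f \<alpha> q
    assume X: "simplicial_set X" and Y: "simplicial_set Y" and f: "f \<in> simplicial_maps X Y" and \<alpha>: "\<alpha> \<in> carrier (deg (K Y) q)"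
    show "singular_map X q (fmap (cohomology_theory pr (cochain_sdga S)) X Y f q \<alpha>) =
        fmap (singular_cochains R pr) X Y f q (singular_map Y q \<alpha>)"
      using simplicial_mapsD(1)[OF f]
      by (auto simp: cohomology_theory_def singular_cochains_def singular_map_def singular_pullback_def
          simp_int_def sset_comp_def compose_def fun_eq_iff simp del: upt_Suc)
  next
    fix s q assume s: "s \<in> carrier (deg (unit_complex R) q)"
    have sR: "s \<in> carrier R" by (rule unit_carrier[OF s])
    have L: "level (cochain_sdga S) n = S.L.E n" for n by (simp add: cochain_sdga_def)
    have "eta (cohomology_theory pr (cochain_sdga S)) q s (nat q) x [0..<Suc (nat q)] = eta (singular_cochains R pr) q s x"
      if x: "x \<in> simp_int sset_pt q" for x :: 'u
    proof -
      have "x \<in> simp sset_pt (nat q)" "0 \<le> q" using x by (auto simp: simp_int_def split: if_splits)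
      then have "eta (cohomology_theory pr (cochain_sdga S)) q s (nat q) x [0..<Suc (nat q)] =
          unit_map (S.L.E (nat q)) q s [0..<Suc (nat q)]"
        by (simp add: cohomology_theory_def L del: upt_Suc)
      also have "\<dots> = (if q = 0 then s else \<zero>)"
        using sR upt_vertex_lists[of "nat q"]
        by (auto simp: unit_map_def S.L.E_apply S_simps unit_complex_simps simp del: upt_Suc)
      finally show ?thesis using x by (simp add: singular_cochains_def)
    qed
    then show "singular_map sset_pt q (eta (cohomology_theory pr (cochain_sdga S)) q s) = eta (singular_cochains R pr) q s"
      by (auto simp: singular_map_def singular_cochains_def fun_eq_iff simp del: upt_Suc)
  qed (rule singular_map_chain singular_map_kappa[OF pr] singular_map_bij singular_map_zero; assumption)+
qed

lemma singular_step:
  assumes pr: "inj pr"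
  shows "quasi_iso_step R pr (cohomology_theory pr (cochain_sdga S)) (singular_cochains R pr)"
  by (rule iso_quasi_iso_step[OF pr C.theory_lax_monoidal[OF pr] singular_iso[OF pr]])

end

context simplicial_dg_alg
begin

lemma cring: "cring R"
  using dga.module_deg by (simp add: module_def)

lemma cochain_theory_step:
  fixes pr :: "'u \<times> 'u \<Rightarrow> 'u"
  assumes pr: "inj pr" and "homotopy_axiom A"
  shows "quasi_iso_step R pr (cohomology_theory pr A) (cohomology_theory pr (cochain_sdga A))"
proof -
  obtain t where "unit_path A t" using unit_path_exists assms(2) by blast
  then show ?thesis by (rule sdga_map.quasi_iso_step[OF constant_sdga_map pr constant_quis])
qed

lemma constant_cochain_theory_step:
  fixes pr :: "'u \<times> 'u \<Rightarrow> 'u"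
  assumes pr: "inj pr" and "homology_axiom R A"
  shows "quasi_iso_step R pr (cohomology_theory pr (cochain_sdga (constant_sdga R)))
    (cohomology_theory pr (cochain_sdga A))"
  by (rule sdga_map.quasi_iso_step[OF sdga_map.cochain_map[OF unit_sdga_map] pr
        sdga_map.cochain_map_quis[OF unit_sdga_map unit_quis[OF assms(2)]] cring.constant_unit_path[OF cring]])

end

theorem theorem9p1p2:
  fixes R :: "('r, 'k) ring_scheme"
    and A :: "('r, 'a) sdga" and B :: "('r, 'b) sdga"
    and pr :: "'u \<times> 'u \<Rightarrow> 'u"
  assumes "inj pr"
    and "simplicial_dga R A" and "simplicial_dga R B"
    and "homology_axiom R A" and "homology_axiom R B"
    and "homotopy_axiom A" and "homotopy_axiom B"
    and "freeness_axiom R A" and "freeness_axiom R B"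
  shows "weakly_quasi_isomorphic TYPE(('u, 'a, 'b) tensor_theory) R pr
           (cohomology_theory pr A) (cohomology_theory pr B) \<and>
         weakly_quasi_isomorphic TYPE(('u, 'a, 'r simplex_cochain) tensor_theory) R pr
           (cohomology_theory pr A) (singular_cochains R pr)"
proof -
  note pr = assms(1)
  interpret A: simplicial_dg_alg R A by unfold_locales fact
  interpret B: simplicial_dg_alg R B by unfold_locales fact
  interpret S: simplicial_dg_alg R "constant_sdga R" by unfold_locales (rule cring.constant_sdga[OF A.cring])
  let ?CA = "cohomology_theory pr (cochain_sdga A)" and ?CB = "cohomology_theory pr (cochain_sdga B)"
    and ?CS = "cohomology_theory pr (cochain_sdga (constant_sdga R))"
  note trans = quasi_iso_step_trans[OF pr]
  define unit where "unit r = r \<odot>\<^bsub>deg (level A 0) 0\<^esub> dunit (level A 0)" for r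
  have unit: "inj_on (\<lambda>r. (0 :: int, unit r, undefined :: 'c)) (carrier (deg (level (constant_sdga R) n) q))" for n q
  proof (rule inj_onI)
    fix r s assume "r \<in> carrier (deg (level (constant_sdga R) n) q)" "s \<in> carrier (deg (level (constant_sdga R) n) q)"
    then have "r \<in> carrier R" "s \<in> carrier R" using cring.unit_carrier[OF A.cring] by (auto simp: constant_sdga_def)
    moreover assume "(0 :: int, unit r, undefined :: 'c) = (0, unit s, undefined)"
    ultimately show "r = s" using inj_onD[OF A.inj_unit[OF assms(4)], of r s] by (simp add: unit_def)
  qed
  have left: "inj_on (\<lambda>a. (0 :: int, a, undefined :: 'c)) (carrier (deg (level A n) q))" for n q by (auto intro: inj_onI)
  have right: "inj_on (\<lambda>b. (0 :: int, undefined :: 'a, b)) (carrier (deg (level B n) q))" for n q by (auto intro: inj_onI)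
  have "weakly_quasi_isomorphic TYPE(('u, 'a, 'b) tensor_theory) R pr (cohomology_theory pr A) (cohomology_theory pr B)"
  proof -
    let ?HS = "transport_functor pr ?CS (encode (\<lambda>r. (0 :: int, unit r, undefined :: 'b)))"
    let ?HA = "transport_functor pr ?CA (encode (\<lambda>a. (0 :: int, a, undefined :: 'b)))"
    let ?HB = "transport_functor pr ?CB (encode (\<lambda>b. (0 :: int, undefined :: 'a, b)))"
    have "quasi_iso_step R pr ?HS ?HA"
      by (rule trans[OF trans[OF S.transported_cochains(2)[OF pr unit]
              A.constant_cochain_theory_step[OF pr assms(4)]] A.transported_cochains(1)[OF pr left]])
    moreover have "quasi_iso_step R pr ?HS ?HB"
      by (rule trans[OF trans[OF S.transported_cochains(2)[OF pr unit]
              B.constant_cochain_theory_step[OF pr assms(5)]] B.transported_cochains(1)[OF pr right]])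
    ultimately have "equivclp (quasi_iso_step R pr) ?HA ?HB"
      by (blast intro: equivclp_trans equivclp_sym r_into_equivclp)
    moreover have "quasi_iso_linked R pr (cohomology_theory pr A) ?HA"
      unfolding quasi_iso_linked_def
      by (rule disjI1[OF trans[OF A.cochain_theory_step[OF pr assms(6)] A.transported_cochains(1)[OF pr left]]])
    moreover have "quasi_iso_linked R pr ?HB (cohomology_theory pr B)"
      unfolding quasi_iso_linked_def
      by (rule disjI2[OF trans[OF B.cochain_theory_step[OF pr assms(7)] B.transported_cochains(1)[OF pr right]]])
    ultimately show ?thesis unfolding weakly_quasi_isomorphic_def by blast
  qed
  moreover have "weakly_quasi_isomorphic TYPE(('u, 'a, 'r simplex_cochain) tensor_theory) R pr
      (cohomology_theory pr A) (singular_cochains R pr)"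
  proof -
    let ?HS = "transport_functor pr ?CS (encode (\<lambda>r. (0 :: int, unit r, undefined :: 'r simplex_cochain)))"
    let ?HA = "transport_functor pr ?CA (encode (\<lambda>a. (0 :: int, a, undefined :: 'r simplex_cochain)))"
    have "quasi_iso_step R pr ?HS ?HA"
      by (rule trans[OF trans[OF S.transported_cochains(2)[OF pr unit]
              A.constant_cochain_theory_step[OF pr assms(4)]] A.transported_cochains(1)[OF pr left]])
    then have "equivclp (quasi_iso_step R pr) ?HA ?HS"
      by (blast intro: equivclp_sym r_into_equivclp)
    moreover have "quasi_iso_linked R pr (cohomology_theory pr A) ?HA"
      unfolding quasi_iso_linked_def
      by (rule disjI1[OF trans[OF A.cochain_theory_step[OF pr assms(6)] A.transported_cochains(1)[OF pr left]]])
    moreover have "quasi_iso_linked R pr ?HS (singular_cochains R pr)"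
      unfolding quasi_iso_linked_def
      by (rule disjI1[OF trans[OF S.transported_cochains(2)[OF pr unit] cring.singular_step[OF A.cring pr]]])
    ultimately show ?thesis unfolding weakly_quasi_isomorphic_def by blast
  qed
  ultimately show ?thesis by blast
qed

end
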